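(* Let $\mu$ be a Borel measure on $\mathbb{R}$ with $\int_{\mathbb{R}}(1+|t|)^{-1}d\mu(t)<\infty$, $A=M_t$ on $L^2(\mu)$, $\varphi\equiv\mathbf 1$, $\alpha\in\mathbb{R}\setminus\{0\}$, $A_\alpha=A+\alpha(\,\cdot\,,\varphi)\varphi$, and let $\mu$ and $\mu_\alpha$ be the spectral measures (with respect to $\varphi$) of $A$ and $A_\alpha$, respectively. For $\varepsilon>0$ let $$T_\varepsilon f(s)=\int_{\mathbb{R}}\frac{f(t)}{s-t+i\varepsilon}\,d\mu(t).$$ Then the operators $T_\varepsilon:L^2(\mu)\to L^2(\mu_\alpha)$ are uniformly bounded: $\|T_\varepsilon\|_{L^2(\mu)\to L^2(\mu_\alpha)}\le 2|\alpha|^{-1}$ for all $\varepsilon>0$. Moreover, the weak limit $T$ of $T_\varepsilon$ (in the weak operator topology) exists as $\varepsilon\to0^+$, and the spectral representation $V_\alpha:L^2(\mu)\to L^2(\mu_\alpha)$ of $A_\alpha$ has the alternative representation $$V_\alpha f(s)=f(s)\bigl(\mathbf 1-\alpha\,T\mathbf 1\bigr)(s)+\alpha\,Tf(s)$$ for all $f\in L^2(\mu)$. Finally, for any compactly supported $C^1$ function $f$ on $\mathbb{R}$, $$\lim_{\varepsilon\to0^+}(T_\varepsilon f)(s)=Tf(s)\qquad\mu_\alpha\text{-a.e.}$$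
   Context: All $L^2$ spaces are complex, with $(f,g)_{L^2(\mu)}=\int f\overline g\,d\mu$. $A=M_t$ is multiplication by the independent variable in $L^2(\mu)$ with maximal domain. The condition $\int(1+|t|)^{-1}d\mu<\infty$ means that $\varphi\equiv\mathbf 1\in\mathcal H_{-1}(A)=L^2((1+|t|)^{-1}d\mu)$; $\varphi$ need not lie in $L^2(\mu)$. For $z\in\mathbb{C}\setminus\mathbb{R}$ put $F(z)=((A-z)^{-1}\varphi,\varphi)=\int\frac{d\mu(t)}{t-z}$. $A_\alpha=A+\alpha(\cdot,\varphi)\varphi$ denotes the self-adjoint operator on $L^2(\mu)$ whose resolvent is $$(A_\alpha-\lambda)^{-1}f=(A-\lambda)^{-1}f-\frac{\alpha\,\int\frac{f(t)}{t-\lambda}d\mu(t)}{1+\alpha F(\lambda)}\cdot\frac{1}{t-\lambda},\qquad f\in L^2(\mu),\ \lambda\in\mathbb{C}\setminus\mathbb{R}$$ (the usual rank one perturbation if $\varphi\in L^2(\mu)$). The formula is also used for $f=\varphi$, giving $(A_\alpha-\lambda)^{-1}\varphi=(1+\alpha F(\lambda))^{-1}(t-\lambda)^{-1}$; $\varphi$ is cyclic for $A_\alpha$. $\mu_\alpha$ is the unique Borel measure with $\int\frac{d\mu_\alpha(s)}{s-\lambda}=((A_\alpha-\lambda)^{-1}\varphi,\varphi)$ for all $\lambda\in\mathbb{C}\setminus\mathbb{R}$. The spectral representation $V_\alpha:L^2(\mu)\to L^2(\mu_\alpha)$ is the unitary operator with $V_\alpha A_\alpha=M_sV_\alpha$ ($M_s$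 being multiplication by $s$ in $L^2(\mu_\alpha)$) under which $\varphi$ is represented by $\mathbf 1$, i.e. $V_\alpha(A_\alpha-\lambda)^{-1}\varphi=(s-\lambda)^{-1}$ for all $\lambda\in\mathbb{C}\setminus\mathbb{R}$. Meaning of $T\mathbf 1$: if $\mathbf 1\notin L^2(\mu)$, the function $T\mathbf 1$ is defined by duality, $\int T\mathbf 1\,\overline f\,d\mu_\alpha=\int\overline{T^*f}\,d\mu$ for all compactly supported $f\in L^2(\mu_\alpha)$ (it coincides $\mu_\alpha$-a.e. with $-F(x+i0^+)$, $F(x+i0^+)=\lim_{\varepsilon\to0^+}F(x+i\varepsilon)$). In the product $f(s)(\mathbf 1-\alpha T\mathbf 1)(s)$ the value is read as $0$ wherever $\mathbf 1-\alpha T\mathbf 1$ vanishes, independently of the representative of $f\in L^2(\mu)$. *)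

theory Defs
  imports "HOL-Analysis.Analysis"
begin

text \<open>
  Complex \<open>L\<^sup>2\<close> spaces are handled through representatives: an element of \<open>L\<^sup>2(M)\<close> is a
  square-integrable function, and equality in \<open>L\<^sup>2(M)\<close> is equality almost everywhere. Operators act on
  representatives and are required to respect equality almost everywhere. Their values outside
  \<open>L2 M\<close> carry no meaning.
\<close>

definition L2 :: "real measure \<Rightarrow> (real \<Rightarrow> complex) set" where
  "L2 M = {f \<in> borel_measurable M. integrable M (\<lambda>x. (cmod (f x))\<^sup>2)}"

definition L2_inner :: "real measure \<Rightarrow> (real \<Rightarrow> complex) \<Rightarrow> (real \<Rightarrow> complex) \<Rightarrow> complex" where
  "L2_inner M f g = (\<integral>x. f x * cnj (g x) \<partial>M)"

definition L2_norm :: "real measure \<Rightarrow> (real \<Rightarrow> complex) \<Rightarrow> real" where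
  "L2_norm M f = sqrt (\<integral>x. (cmod (f x))\<^sup>2 \<partial>M)"

definition L2_linear ::
  "real measure \<Rightarrow> real measure \<Rightarrow> ((real \<Rightarrow> complex) \<Rightarrow> (real \<Rightarrow> complex)) \<Rightarrow> bool" where
  "L2_linear M N U \<longleftrightarrow>
     (\<forall>f\<in>L2 M. U f \<in> L2 N) \<and>
     (\<forall>f\<in>L2 M. \<forall>g\<in>L2 M. (AE x in M. f x = g x) \<longrightarrow> (AE y in N. U f y = U g y)) \<and>
     (\<forall>f\<in>L2 M. \<forall>g\<in>L2 M. AE y in N. U (\<lambda>x. f x + g x) y = U f y + U g y) \<and>
     (\<forall>c. \<forall>f\<in>L2 M. AE y in N. U (\<lambda>x. c * f x) y = c * U f y)"

definition L2_opnorm ::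
  "real measure \<Rightarrow> real measure \<Rightarrow> ((real \<Rightarrow> complex) \<Rightarrow> (real \<Rightarrow> complex)) \<Rightarrow> ennreal" where
  "L2_opnorm M N U = (SUP f\<in>{f \<in> L2 M. L2_norm M f \<le> 1}. ennreal (L2_norm N (U f)))"

definition L2_bounded_operator ::
  "real measure \<Rightarrow> real measure \<Rightarrow> ((real \<Rightarrow> complex) \<Rightarrow> (real \<Rightarrow> complex)) \<Rightarrow> bool" where
  "L2_bounded_operator M N U \<longleftrightarrow> L2_linear M N U \<and> L2_opnorm M N U < \<infinity>"

definition L2_adjoint ::
  "real measure \<Rightarrow> real measure \<Rightarrow> ((real \<Rightarrow> complex) \<Rightarrow> (real \<Rightarrow> complex)) \<Rightarrow>
   ((real \<Rightarrow> complex) \<Rightarrow> (real \<Rightarrow> complex)) \<Rightarrow> bool" where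
  "L2_adjoint M N U W \<longleftrightarrow>
     L2_bounded_operator N M W \<and>
     (\<forall>f\<in>L2 M. \<forall>g\<in>L2 N. L2_inner N (U f) g = L2_inner M f (W g))"

definition L2_unitary ::
  "real measure \<Rightarrow> real measure \<Rightarrow> ((real \<Rightarrow> complex) \<Rightarrow> (real \<Rightarrow> complex)) \<Rightarrow> bool" where
  "L2_unitary M N V \<longleftrightarrow>
     L2_linear M N V \<and>
     (\<forall>f\<in>L2 M. \<forall>g\<in>L2 M. L2_inner N (V f) (V g) = L2_inner M f g) \<and>
     (\<forall>h\<in>L2 N. \<exists>f\<in>L2 M. AE y in N. V f y = h y)"

definition L2_weak_operator_limit ::
  "real measure \<Rightarrow> real measure \<Rightarrow> ('i \<Rightarrow> (real \<Rightarrow> complex) \<Rightarrow> (real \<Rightarrow> complex)) \<Rightarrow>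
   ((real \<Rightarrow> complex) \<Rightarrow> (real \<Rightarrow> complex)) \<Rightarrow> 'i filter \<Rightarrow> bool" where
  "L2_weak_operator_limit M N U T F \<longleftrightarrow>
     L2_bounded_operator M N T \<and>
     (\<forall>f\<in>L2 M. \<forall>g\<in>L2 N. ((\<lambda>i. L2_inner N (U i f) g) \<longlongrightarrow> L2_inner N (T f) g) F)"

text \<open>Unbounded operators in \<open>L\<^sup>2(M)\<close> are given by their graphs.\<close>

type_synonym graph = "((real \<Rightarrow> complex) \<times> (real \<Rightarrow> complex)) set"

definition mult_graph :: "real measure \<Rightarrow> graph" where
  "mult_graph M = {(f, g). f \<in> L2 M \<and> g \<in> L2 M \<and> (AE t in M. g t = complex_of_real t * f t)}"

definition graph_adjoint :: "real measure \<Rightarrow> graph \<Rightarrow> graph" where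
  "graph_adjoint M G =
     {(h, k). h \<in> L2 M \<and> k \<in> L2 M \<and> (\<forall>(f, g)\<in>G. L2_inner M g h = L2_inner M f k)}"

definition densely_defined :: "real measure \<Rightarrow> graph \<Rightarrow> bool" where
  "densely_defined M G \<longleftrightarrow>
     (\<forall>f\<in>L2 M. \<forall>e>0. \<exists>(u, v)\<in>G. L2_norm M (\<lambda>t. f t - u t) < e)"

text \<open>
  An adjoint graph is a subspace of \<open>L2 M \<times> L2 M\<close> closed under equality almost everywhere. Hence
  \<open>G = graph_adjoint M G\<close> makes \<open>G\<close> such a subspace, and density of the domain makes it
  single-valued up to null sets, so the graph of a linear operator.
\<close>

definition self_adjoint :: "real measure \<Rightarrow> graph \<Rightarrow> bool" where
  "self_adjoint M G \<longleftrightarrow> densely_defined M G \<and> G = graph_adjoint M G"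

text \<open>\<open>R = (G - z)\<^sup>-\<^sup>1\<close>, everywhere defined and bounded.\<close>

definition is_resolvent ::
  "real measure \<Rightarrow> graph \<Rightarrow> complex \<Rightarrow> ((real \<Rightarrow> complex) \<Rightarrow> (real \<Rightarrow> complex)) \<Rightarrow> bool" where
  "is_resolvent M G z R \<longleftrightarrow>
     L2_bounded_operator M M R \<and>
     (\<forall>u\<in>L2 M. \<forall>v\<in>L2 M.
        (u, v) \<in> G \<longleftrightarrow> (AE t in M. u t = R (\<lambda>x. v x - z * u x) t))"

definition borel_transform :: "real measure \<Rightarrow> complex \<Rightarrow> complex" where
  "borel_transform \<mu> z = (\<integral>t. 1 / (complex_of_real t - z) \<partial>\<mu>)"

text \<open>
  The first summand is \<open>(A - z)\<^sup>-\<^sup>1 f\<close> for \<open>A = M\<^sub>t\<close>. The formula is also applied to the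
  constant function \<open>1\<close>, which need not belong to \<open>L2 \<mu>\<close>.
\<close>

definition rank_one_resolvent ::
  "real measure \<Rightarrow> real \<Rightarrow> complex \<Rightarrow> (real \<Rightarrow> complex) \<Rightarrow> (real \<Rightarrow> complex)" where
  "rank_one_resolvent \<mu> \<alpha> z f = (\<lambda>t.
     f t / (complex_of_real t - z)
     - (complex_of_real \<alpha> * (\<integral>x. f x / (complex_of_real x - z) \<partial>\<mu>)
          / (1 + complex_of_real \<alpha> * borel_transform \<mu> z))
       * (1 / (complex_of_real t - z)))"

definition is_rank_one_perturbation :: "real measure \<Rightarrow> real \<Rightarrow> graph \<Rightarrow> bool" where
  "is_rank_one_perturbation \<mu> \<alpha> G \<longleftrightarrow>
     self_adjoint \<mu> G \<and>
     (\<forall>z. z \<notin> \<real> \<longrightarrow> is_resolvent \<mu> G z (rank_one_resolvent \<mu> \<alpha> z))"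

text \<open>
  Integrability is demanded separately because the Bochner integral of a non-integrable function
  is \<open>0\<close>.
\<close>

definition is_spectral_measure :: "real measure \<Rightarrow> real \<Rightarrow> real measure \<Rightarrow> bool" where
  "is_spectral_measure \<mu> \<alpha> \<nu> \<longleftrightarrow>
     sets \<nu> = sets borel \<and>
     (\<forall>z. z \<notin> \<real> \<longrightarrow>
        integrable \<nu> (\<lambda>s. 1 / (complex_of_real s - z)) \<and>
        (\<integral>s. 1 / (complex_of_real s - z) \<partial>\<nu>)
          = L2_inner \<mu> (rank_one_resolvent \<mu> \<alpha> z (\<lambda>_. 1)) (\<lambda>_. 1))"

text \<open>
  The second conjunct is the operator identity \<open>V G = M\<^sub>s V\<close>, including equality of the domains.
\<close>

definition is_spectral_representation ::
  "real measure \<Rightarrow> real \<Rightarrow> graph \<Rightarrow> real measure \<Rightarrow>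
   ((real \<Rightarrow> complex) \<Rightarrow> (real \<Rightarrow> complex)) \<Rightarrow> bool" where
  "is_spectral_representation \<mu> \<alpha> G \<nu> V \<longleftrightarrow>
     L2_unitary \<mu> \<nu> V \<and>
     (\<forall>f\<in>L2 \<mu>. \<forall>g\<in>L2 \<mu>. (f, g) \<in> G \<longleftrightarrow> (V f, V g) \<in> mult_graph \<nu>) \<and>
     (\<forall>z. z \<notin> \<real> \<longrightarrow>
        (AE s in \<nu>. V (rank_one_resolvent \<mu> \<alpha> z (\<lambda>_. 1)) s
                     = 1 / (complex_of_real s - z)))"

definition T_eps :: "real measure \<Rightarrow> real \<Rightarrow> (real \<Rightarrow> complex) \<Rightarrow> (real \<Rightarrow> complex)" where
  "T_eps \<mu> \<epsilon> f = (\<lambda>s. \<integral>t. f t / (complex_of_real s - complex_of_real t + \<i> * complex_of_real \<epsilon>) \<partial>\<mu>)"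

definition compactly_supported :: "(real \<Rightarrow> complex) \<Rightarrow> bool" where
  "compactly_supported f \<longleftrightarrow> compact (closure {x. f x \<noteq> 0})"

text \<open>
  \<open>h\<close> represents \<open>T 1\<close>. If \<open>1\<close> is not in \<open>L2 \<mu>\<close>, this is meant by duality, with \<open>W\<close> the adjoint of
  \<open>T\<close>; both integrals are required to converge.
\<close>

definition represents_T_one ::
  "real measure \<Rightarrow> real measure \<Rightarrow> ((real \<Rightarrow> complex) \<Rightarrow> (real \<Rightarrow> complex)) \<Rightarrow>
   (real \<Rightarrow> complex) \<Rightarrow> bool" where
  "represents_T_one \<mu> \<nu> T h \<longleftrightarrow>
     h \<in> borel_measurable \<nu> \<and>
     (if (\<lambda>_. 1) \<in> L2 \<mu> then AE s in \<nu>. h s = T (\<lambda>_. 1) s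
      else \<exists>W. L2_adjoint \<mu> \<nu> T W \<and>
             (\<forall>f\<in>L2 \<nu>. compactly_supported f \<longrightarrow>
                integrable \<nu> (\<lambda>s. h s * cnj (f s)) \<and>
                integrable \<mu> (\<lambda>t. cnj (W f t)) \<and>
                (\<integral>s. h s * cnj (f s) \<partial>\<nu>) = (\<integral>t. cnj (W f t) \<partial>\<mu>)))"

end

theory Submission
  imports Defs
begin

text \<open>
  Write \<open>F(z) = \<integral> d\<mu>(t) / (t - z)\<close> and \<open>\<nu>\<close> for the spectral measure of the perturbed operator, so that the
  Borel transform of \<open>\<nu>\<close> is \<open>G = F / (1 + \<alpha> F)\<close>.

  \<^emph>\<open>The bound.\<close> The resolvent formula and \<open>V A\<^sub>\<alpha> = M\<^sub>s V\<close> say that the commutator of \<open>V\<close> with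
  multiplication by the variable has rank one: \<open>M\<^sub>s V - V M\<^sub>t = \<alpha> (\<cdot>, 1) 1\<close> (lemmas \<open>V_div\<close>,
  \<open>V_times_t\<close>). Conjugation with the unitary groups therefore changes \<open>V\<close> by an explicit integral
  operator (\<open>V_exp\<close>):
  \<open>e\<^sup>i\<^sup>a\<^sup>s V (e\<^sup>-\<^sup>i\<^sup>a\<^sup>t f) = V f + \<alpha> \<integral> (e\<^sup>i\<^sup>a\<^sup>(\<^sup>s\<^sup>-\<^sup>t\<^sup>) - 1) / (s - t) f(t) d\<mu>(t)\<close>.
  The average of this over \<open>a\<close> with the exponential law of rate \<open>\<epsilon>\<close> turns the kernel into
  \<open>-1 / (s - t + i\<epsilon>)\<close>. Hence \<open>V - \<alpha> T\<^sub>\<epsilon>\<close> is an average of isometries, thus a contraction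
  (\<open>smoothed_contraction\<close>), and \<open>\<alpha> T\<^sub>\<epsilon>\<close> has norm at most \<open>2\<close>.

  \<^emph>\<open>Boundary values of\<close> \<open>F\<close>. On a horizontal line \<open>Im F\<close> and \<open>Im G\<close> are Poisson integrals of \<open>\<mu>\<close> and
  \<open>\<nu>\<close>. The quotient of two Poisson integrals converges \<open>\<nu>\<close>-almost everywhere to the density of the first
  measure with respect to \<open>\<nu>\<close> (\<open>poisson_ratio_converges\<close>, from a maximal inequality). Since
  \<open>Im F / Im G = |1 + \<alpha> F|\<^sup>2\<close>, the modulus of \<open>1 + \<alpha> F\<close> converges; with Lebesgue measure in place of
  \<open>\<mu>\<close>, so does \<open>1 / Im G\<close>. These two limits and continuity force convergence of \<open>F(s + i\<epsilon>)\<close>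
  itself (\<open>boundary_values\<close>). Its limit \<open>-h\<close> satisfies \<open>|1 - \<alpha> h|\<^sup>2 d\<nu> = d\<mu>\<close> on a set of full
  \<open>\<nu>\<close>-measure. So \<open>f \<mapsto> f (1 - \<alpha> h)\<close> is a contraction from \<open>L\<^sup>2(\<mu>)\<close> to \<open>L\<^sup>2(\<nu>)\<close> that does not depend on
  the representative of \<open>f\<close>.

  \<^emph>\<open>The weak limit\<close> is \<open>T f = (V f - f (1 - \<alpha> h)) / \<alpha>\<close> (called \<open>T0\<close> below). For \<open>f = 1 / (t - z)\<close> the
  convergence \<open>T\<^sub>\<epsilon> f \<rightarrow> T f\<close> holds almost everywhere and is just the convergence of \<open>F\<close>. The property
  survives multiplication by \<open>1 / (t - z)\<close>, so by Stone-Weierstrass it holds on a dense set. Almost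
  everywhere convergence with bounded norms is weak convergence, and the uniform bound carries
  weak convergence to all of \<open>L\<^sup>2(\<mu>)\<close> (\<open>T0_weak_limit\<close>).

  \<^emph>\<open>The representation of\<close> \<open>V\<close> is the definition of \<open>T0\<close>, once \<open>h\<close> is identified with \<open>T 1\<close>. If
  \<open>1\<close> is not square-integrable, it is replaced by cutoffs: \<open>T\<close> maps them to functions close to \<open>h\<close> on
  bounded sets, and the adjoint of \<open>T\<close> sends compactly supported functions to integrable ones
  (\<open>duality_for_h\<close>). Finally, for \<open>f\<close> of class \<open>C\<^sup>1\<close>,
  \<open>T\<^sub>\<epsilon> f(s) = f(s) T\<^sub>\<epsilon> 1(s) - \<integral> (f(s) - f(t)) / (s - t + i\<epsilon>) d\<mu>(t)\<close>, where the integrand is dominated, so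
  the pointwise limit exists wherever that of \<open>F\<close> does.
\<close>

section \<open>Square-integrable functions\<close>

lemma borel_measurable_cnj [measurable (raw)]:
  "f \<in> borel_measurable M \<Longrightarrow> (\<lambda>x. cnj (f x)) \<in> borel_measurable M"
  using measurable_compose[of f M borel cnj borel] borel_measurable_continuous_onI[OF continuous_on_cnj[OF continuous_on_id]]
  by simp

lemma L2_I:
  assumes "f \<in> borel_measurable M" "integrable M (\<lambda>x. (cmod (f x))\<^sup>2)"
  shows "f \<in> L2 M"
  using assms by (simp add: L2_def)

lemma L2_measurable [measurable_dest]: "f \<in> L2 M \<Longrightarrow> f \<in> borel_measurable M"
  by (simp add: L2_def)

lemma L2_square_integrable: "f \<in> L2 M \<Longrightarrow> integrable M (\<lambda>x. (cmod (f x))\<^sup>2)"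
  by (simp add: L2_def)

lemma L2_dominated:
  assumes f: "f \<in> L2 M" and g: "g \<in> borel_measurable M" and le: "AE x in M. cmod (g x) \<le> c * cmod (f x)"
  shows "g \<in> L2 M"
proof (rule L2_I[OF g])
  show "integrable M (\<lambda>x. (cmod (g x))\<^sup>2)"
  proof (rule Bochner_Integration.integrable_bound)
    show "integrable M (\<lambda>x. c\<^sup>2 * (cmod (f x))\<^sup>2)" using L2_square_integrable[OF f] by simp
    show "AE x in M. norm ((cmod (g x))\<^sup>2) \<le> norm (c\<^sup>2 * (cmod (f x))\<^sup>2)"
      using le
    proof eventually_elim
      case (elim x)
      then have "(cmod (g x))\<^sup>2 \<le> (c * cmod (f x))\<^sup>2" by (rule power_mono) simp
      then show ?case by (simp add: power_mult_distrib)
    qed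
  qed (use g in measurable)
qed

lemma L2_zero [simp]: "(\<lambda>_. 0) \<in> L2 M"
  by (simp add: L2_def)

lemma L2_scale: "f \<in> L2 M \<Longrightarrow> (\<lambda>x. c * f x) \<in> L2 M"
  by (rule L2_dominated[of f _ _ "cmod c"]) (auto simp: norm_mult L2_measurable)

lemma L2_cnj: "f \<in> L2 M \<Longrightarrow> (\<lambda>x. cnj (f x)) \<in> L2 M"
  by (rule L2_dominated[of f _ _ 1]) (auto simp: L2_measurable)

lemma L2_add:
  assumes f: "f \<in> L2 M" and g: "g \<in> L2 M"
  shows "(\<lambda>x. f x + g x) \<in> L2 M"
proof (rule L2_I)
  have [measurable]: "f \<in> borel_measurable M" "g \<in> borel_measurable M"
    using f g by (auto simp: L2_measurable)
  show "(\<lambda>x. f x + g x) \<in> borel_measurable M" by measurable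
  show "integrable M (\<lambda>x. (cmod (f x + g x))\<^sup>2)"
  proof (rule Bochner_Integration.integrable_bound)
    show "integrable M (\<lambda>x. 2 * (cmod (f x))\<^sup>2 + 2 * (cmod (g x))\<^sup>2)"
      using L2_square_integrable[OF f] L2_square_integrable[OF g] by simp
    have "(cmod (f x + g x))\<^sup>2 \<le> 2 * (cmod (f x))\<^sup>2 + 2 * (cmod (g x))\<^sup>2" for x
    proof -
      have "(cmod (f x + g x))\<^sup>2 \<le> (cmod (f x) + cmod (g x))\<^sup>2"
        by (intro power_mono norm_triangle_ineq) auto
      also have "\<dots> \<le> 2 * (cmod (f x))\<^sup>2 + 2 * (cmod (g x))\<^sup>2"
        using sum_squares_bound[of "cmod (f x)" "cmod (g x)"] by (simp add: power2_sum)
      finally show ?thesis .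
    qed
    then show "AE x in M. norm ((cmod (f x + g x))\<^sup>2) \<le> norm (2 * (cmod (f x))\<^sup>2 + 2 * (cmod (g x))\<^sup>2)"
      by auto
  qed measurable
qed

lemma L2_diff: "f \<in> L2 M \<Longrightarrow> g \<in> L2 M \<Longrightarrow> (\<lambda>x. f x - g x) \<in> L2 M"
  using L2_add[of f M "\<lambda>x. (-1) * g x"] L2_scale[of g M "-1"] by simp

lemma L2_times_indicator:
  assumes "f \<in> L2 M" "A \<in> sets M"
  shows "(\<lambda>x. indicator A x * f x) \<in> L2 M"
  by (rule L2_dominated[OF assms(1), of _ 1]) (use assms in \<open>auto simp: L2_measurable split: split_indicator\<close>)

lemma L2_norm_nonneg [simp]: "0 \<le> L2_norm M f"
  by (simp add: L2_norm_def)

lemma L2_norm_square: "(L2_norm M f)\<^sup>2 = (\<integral>x. (cmod (f x))\<^sup>2 \<partial>M)"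
  by (simp add: L2_norm_def)

lemma L2_norm_cong_AE:
  assumes "f \<in> borel_measurable M" "g \<in> borel_measurable M" "AE x in M. f x = g x"
  shows "L2_norm M f = L2_norm M g"
  unfolding L2_norm_def
  by (intro arg_cong[where f=sqrt] integral_cong_AE) (use assms in auto)

lemma L2_inner_cong_AE:
  assumes "f \<in> borel_measurable M" "f' \<in> borel_measurable M" "g \<in> borel_measurable M" "g' \<in> borel_measurable M"
   and "AE x in M. f x = f' x" "AE x in M. g x = g' x"
  shows "L2_inner M f g = L2_inner M f' g'"
  unfolding L2_inner_def by (intro integral_cong_AE) (use assms in \<open>auto elim: eventually_elim2\<close>)

lemma L2_norm_scale: "L2_norm M (\<lambda>x. c * f x) = cmod c * L2_norm M f"
  by (simp add: L2_norm_def norm_mult power_mult_distrib real_sqrt_mult)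

lemma nn_integral_L2:
  assumes "f \<in> L2 M"
  shows "(\<integral>\<^sup>+x. ennreal ((cmod (f x))\<^sup>2) \<partial>M) = ennreal ((L2_norm M f)\<^sup>2)"
  using nn_integral_eq_integral[OF L2_square_integrable[OF assms]] by (simp add: L2_norm_square)

lemma L2_nn_integral_le:
  assumes [measurable]: "f \<in> borel_measurable M"
    and le: "(\<integral>\<^sup>+x. ennreal ((cmod (f x))\<^sup>2) \<partial>M) \<le> ennreal (C\<^sup>2)" and C: "0 \<le> C"
  shows "f \<in> L2 M" "L2_norm M f \<le> C"
proof -
  show L: "f \<in> L2 M"
    by (rule L2_I, measurable, rule integrableI_nonneg) (use le in \<open>auto simp: top.not_eq_extremum intro: le_less_trans\<close>)
  have "ennreal ((L2_norm M f)\<^sup>2) \<le> ennreal (C\<^sup>2)" using le nn_integral_L2[OF L] by simp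
  then have "(L2_norm M f)\<^sup>2 \<le> C\<^sup>2" by simp
  then show "L2_norm M f \<le> C" using C power2_le_imp_le by blast
qed

lemma L2_mult_integrable_norm:
  assumes f: "f \<in> L2 M" and g: "g \<in> L2 M"
  shows "integrable M (\<lambda>x. cmod (f x) * cmod (g x))"
proof (rule Bochner_Integration.integrable_bound)
  show "integrable M (\<lambda>x. (cmod (f x))\<^sup>2 + (cmod (g x))\<^sup>2)"
    using L2_square_integrable[OF f] L2_square_integrable[OF g] by simp
  have "cmod (f x) * cmod (g x) \<le> (cmod (f x))\<^sup>2 + (cmod (g x))\<^sup>2" for x
  proof -
    have "0 \<le> cmod (f x) * cmod (g x)" by simp
    then show ?thesis using sum_squares_bound[of "cmod (f x)" "cmod (g x)"] by linarith
  qed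
  then show "AE x in M. norm (cmod (f x) * cmod (g x)) \<le> norm ((cmod (f x))\<^sup>2 + (cmod (g x))\<^sup>2)"
    by auto
qed (use f g in \<open>auto simp: L2_measurable\<close>)

lemma L2_mult_integrable:
  assumes f: "f \<in> L2 M" and g: "g \<in> L2 M"
  shows "integrable M (\<lambda>x. f x * g x)"
  by (rule Bochner_Integration.integrable_bound[OF L2_mult_integrable_norm[OF f g]])
    (use f g in \<open>auto simp: L2_measurable norm_mult\<close>)

lemma L2_inner_integrable:
  assumes f: "f \<in> L2 M" and g: "g \<in> L2 M"
  shows "integrable M (\<lambda>x. f x * cnj (g x))"
  by (rule L2_mult_integrable[OF f L2_cnj[OF g]])

lemma L2_Cauchy_Schwarz_norm:
  assumes f: "f \<in> L2 M" and g: "g \<in> L2 M"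
  shows "(\<integral>x. cmod (f x) * cmod (g x) \<partial>M) \<le> L2_norm M f * L2_norm M g"
proof -
  have [measurable]: "f \<in> borel_measurable M" "g \<in> borel_measurable M"
    using f g by (auto simp: L2_measurable)
  define I where "I = (\<integral>x. cmod (f x) * cmod (g x) \<partial>M)"
  have I0: "0 \<le> I" unfolding I_def by simp
  have "(\<integral>\<^sup>+x. ennreal (cmod (f x)) * ennreal (cmod (g x)) \<partial>M)\<^sup>2
      \<le> (\<integral>\<^sup>+x. (ennreal (cmod (f x)))\<^sup>2 \<partial>M) * (\<integral>\<^sup>+x. (ennreal (cmod (g x)))\<^sup>2 \<partial>M)"
    by (rule Cauchy_Schwarz_nn_integral) auto
  moreover have "(\<integral>\<^sup>+x. ennreal (cmod (f x)) * ennreal (cmod (g x)) \<partial>M) = ennreal I"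
    using nn_integral_eq_integral[OF L2_mult_integrable_norm[OF f g]] by (simp add: I_def ennreal_mult')
  ultimately have "ennreal (I\<^sup>2) \<le> ennreal ((L2_norm M f * L2_norm M g)\<^sup>2)"
    using nn_integral_L2[OF f] nn_integral_L2[OF g] I0
    by (simp add: ennreal_power ennreal_mult power_mult_distrib)
  then have "I\<^sup>2 \<le> (L2_norm M f * L2_norm M g)\<^sup>2" by (simp)
  then show ?thesis unfolding I_def[symmetric] by (rule power2_le_imp_le) simp
qed

lemma L2_Cauchy_Schwarz:
  assumes f: "f \<in> L2 M" and g: "g \<in> L2 M"
  shows "cmod (L2_inner M f g) \<le> L2_norm M f * L2_norm M g"
proof -
  have "cmod (L2_inner M f g) \<le> (\<integral>x. cmod (f x * cnj (g x)) \<partial>M)"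
    unfolding L2_inner_def by (rule integral_norm_bound)
  also have "\<dots> \<le> L2_norm M f * L2_norm M g"
    using L2_Cauchy_Schwarz_norm[OF f g] by (simp add: norm_mult)
  finally show ?thesis .
qed

lemma L2_inner_add_left:
  assumes "f \<in> L2 M" "g \<in> L2 M" "k \<in> L2 M"
  shows "L2_inner M (\<lambda>x. f x + g x) k = L2_inner M f k + L2_inner M g k"
  unfolding L2_inner_def by (simp add: distrib_right L2_inner_integrable assms)

lemma L2_inner_diff_left:
  assumes "f \<in> L2 M" "g \<in> L2 M" "k \<in> L2 M"
  shows "L2_inner M (\<lambda>x. f x - g x) k = L2_inner M f k - L2_inner M g k"
  unfolding L2_inner_def by (simp add: left_diff_distrib L2_inner_integrable assms)

lemma L2_inner_diff_right:
  assumes "f \<in> L2 M" "g \<in> L2 M" "k \<in> L2 M"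
  shows "L2_inner M k (\<lambda>x. f x - g x) = L2_inner M k f - L2_inner M k g"
  unfolding L2_inner_def by (simp add: right_diff_distrib L2_inner_integrable assms)

lemma L2_inner_scale_left: "L2_inner M (\<lambda>x. c * f x) g = c * L2_inner M f g"
  unfolding L2_inner_def by (simp add: mult.assoc)

lemma L2_inner_scale_right: "L2_inner M f (\<lambda>x. c * g x) = cnj c * L2_inner M f g"
  unfolding L2_inner_def by (simp add: mult.left_commute)

lemma L2_inner_commute: "L2_inner M g f = cnj (L2_inner M f g)"
  unfolding L2_inner_def using Bochner_Integration.integral_cnj[of M "\<lambda>x. f x * cnj (g x)"] by (simp add: mult.commute)

lemma L2_inner_self: "L2_inner M f f = complex_of_real ((L2_norm M f)\<^sup>2)"
  unfolding L2_norm_square L2_inner_def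
  by (subst integral_complex_of_real[symmetric]) (simp add: complex_norm_square[symmetric])

lemma L2_norm_triangle:
  assumes f: "f \<in> L2 M" and g: "g \<in> L2 M"
  shows "L2_norm M (\<lambda>x. f x + g x) \<le> L2_norm M f + L2_norm M g"
proof (rule power2_le_imp_le)
  let ?a = "L2_norm M f" and ?b = "L2_norm M g"
  have "(L2_norm M (\<lambda>x. f x + g x))\<^sup>2 \<le> (\<integral>x. (cmod (f x))\<^sup>2 + 2 * (cmod (f x) * cmod (g x)) + (cmod (g x))\<^sup>2 \<partial>M)"
    unfolding L2_norm_square
  proof (rule integral_mono)
    show "integrable M (\<lambda>x. (cmod (f x + g x))\<^sup>2)" using L2_square_integrable[OF L2_add[OF f g]] .
    show "integrable M (\<lambda>x. (cmod (f x))\<^sup>2 + 2 * (cmod (f x) * cmod (g x)) + (cmod (g x))\<^sup>2)"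
      using L2_square_integrable[OF f] L2_square_integrable[OF g] L2_mult_integrable_norm[OF f g] by simp
    fix x
    have "(cmod (f x + g x))\<^sup>2 \<le> (cmod (f x) + cmod (g x))\<^sup>2"
      by (intro power_mono norm_triangle_ineq) auto
    then show "(cmod (f x + g x))\<^sup>2 \<le> (cmod (f x))\<^sup>2 + 2 * (cmod (f x) * cmod (g x)) + (cmod (g x))\<^sup>2"
      by (simp add: power2_sum)
  qed
  also have "\<dots> = ?a\<^sup>2 + 2 * (\<integral>x. cmod (f x) * cmod (g x) \<partial>M) + ?b\<^sup>2"
    using L2_square_integrable[OF f] L2_square_integrable[OF g] L2_mult_integrable_norm[OF f g]
    by (simp add: L2_norm_square)
  also have "\<dots> \<le> (?a + ?b)\<^sup>2"
    using L2_Cauchy_Schwarz_norm[OF f g] by (simp add: power2_sum)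
  finally show "(L2_norm M (\<lambda>x. f x + g x))\<^sup>2 \<le> (?a + ?b)\<^sup>2" .
qed simp

lemma L2_norm_triangle_diff:
  assumes f: "f \<in> L2 M" and g: "g \<in> L2 M"
  shows "L2_norm M (\<lambda>x. f x - g x) \<le> L2_norm M f + L2_norm M g"
  using L2_norm_triangle[OF f L2_scale[OF g, of "-1"]] L2_norm_scale[of M "-1" g] by simp

lemma L2_norm_0_AE:
  assumes f: "f \<in> L2 M" and 0: "L2_norm M f = 0"
  shows "AE x in M. f x = 0"
proof -
  have "(\<integral>x. (cmod (f x))\<^sup>2 \<partial>M) = 0" using 0 L2_norm_square[of M f] by simp
  then have "AE x in M. (cmod (f x))\<^sup>2 = 0"
    by (subst (asm) integral_nonneg_eq_0_iff_AE[OF L2_square_integrable[OF f]]) auto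
  then show ?thesis by simp
qed

lemma L2_eq_AE_if_inner_eq:
  assumes f: "f \<in> L2 M" and g: "g \<in> L2 M"
    and eq: "\<And>k. k \<in> L2 M \<Longrightarrow> L2_inner M f k = L2_inner M g k"
  shows "AE x in M. f x = g x"
proof -
  let ?d = "\<lambda>x. f x - g x"
  have d: "?d \<in> L2 M" by (rule L2_diff[OF f g])
  have "L2_inner M ?d ?d = 0" using L2_inner_diff_left[OF f g d] eq[OF d] by simp
  then have "L2_norm M ?d = 0" by (simp add: L2_inner_self)
  from L2_norm_0_AE[OF d this] show ?thesis by simp
qed

text \<open>
  Dominated convergence applied to \<open>|u\<^sub>n - f|\<^sup>2 \<le> 4 |w|\<^sup>2\<close>.
\<close>

lemma L2_dominated_convergence:
  assumes w: "w \<in> L2 M" and f: "f \<in> borel_measurable M" and u: "\<And>n. u n \<in> borel_measurable M"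
    and le: "\<And>n. AE x in M. cmod (u n x) \<le> cmod (w x)"
    and lim: "AE x in M. (\<lambda>n. u n x) \<longlonglongrightarrow> f x"
  shows "f \<in> L2 M" "\<And>n. u n \<in> L2 M" "(\<lambda>n. L2_norm M (\<lambda>x. u n x - f x)) \<longlonglongrightarrow> 0"
proof -
  note [measurable] = f u L2_measurable[OF w]
  have le': "AE x in M. \<forall>n. cmod (u n x) \<le> cmod (w x)" using le by (simp add: AE_all_countable)
  have fle: "AE x in M. cmod (f x) \<le> cmod (w x)"
    using lim le'
  proof eventually_elim
    case (elim x)
    show ?case by (rule LIMSEQ_le_const2[OF tendsto_norm[OF elim(1)]]) (use elim(2) in auto)
  qed
  show fL: "f \<in> L2 M" by (rule L2_dominated[OF w f, where c=1]) (use fle in simp)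
  show uL: "u n \<in> L2 M" for n by (rule L2_dominated[OF w u, where c=1]) (use le in simp)
  have "(\<lambda>n. \<integral>x. (cmod (u n x - f x))\<^sup>2 \<partial>M) \<longlonglongrightarrow> (\<integral>x. 0 \<partial>M)"
  proof (rule integral_dominated_convergence[where w="\<lambda>x. 4 * (cmod (w x))\<^sup>2"])
    show "integrable M (\<lambda>x. 4 * (cmod (w x))\<^sup>2)" using L2_square_integrable[OF w] by simp
    show "AE x in M. (\<lambda>n. (cmod (u n x - f x))\<^sup>2) \<longlonglongrightarrow> 0"
      using lim
    proof eventually_elim
      case (elim x)
      have "(\<lambda>n. (cmod (u n x - f x))\<^sup>2) \<longlonglongrightarrow> (cmod (f x - f x))\<^sup>2"
        by (intro tendsto_intros elim)
      then show ?case by simp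
    qed
    show "AE x in M. norm ((cmod (u n x - f x))\<^sup>2) \<le> 4 * (cmod (w x))\<^sup>2" for n
      using le[of n] fle
    proof eventually_elim
      case (elim x)
      have "cmod (u n x - f x) \<le> 2 * cmod (w x)" using elim norm_triangle_ineq4[of "u n x" "f x"] by simp
      then have "(cmod (u n x - f x))\<^sup>2 \<le> (2 * cmod (w x))\<^sup>2" by (intro power_mono) auto
      then show ?case by (simp add: power_mult_distrib)
    qed
  qed auto
  then have "(\<lambda>n. sqrt (\<integral>x. (cmod (u n x - f x))\<^sup>2 \<partial>M)) \<longlonglongrightarrow> sqrt 0"
    by (intro tendsto_intros) simp
  then show "(\<lambda>n. L2_norm M (\<lambda>x. u n x - f x)) \<longlonglongrightarrow> 0" by (simp add: L2_norm_def)
qed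

lemma L2_Fatou:
  assumes u: "\<And>n. u n \<in> L2 M" and f: "f \<in> borel_measurable M"
    and le: "\<And>n. L2_norm M (u n) \<le> C"
    and lim: "AE x in M. (\<lambda>n. u n x) \<longlonglongrightarrow> f x"
  shows "f \<in> L2 M" "L2_norm M f \<le> C"
proof -
  have C: "0 \<le> C" using order_trans[OF L2_norm_nonneg le] .
  have um[measurable]: "u n \<in> borel_measurable M" for n using u by (simp add: L2_measurable)
  have "(\<integral>\<^sup>+x. ennreal ((cmod (f x))\<^sup>2) \<partial>M) = (\<integral>\<^sup>+x. liminf (\<lambda>n. ennreal ((cmod (u n x))\<^sup>2)) \<partial>M)"
  proof (rule nn_integral_cong_AE)
    show "AE x in M. ennreal ((cmod (f x))\<^sup>2) = liminf (\<lambda>n. ennreal ((cmod (u n x))\<^sup>2))"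
      using lim
    proof eventually_elim
      case (elim x)
      have "(\<lambda>n. ennreal ((cmod (u n x))\<^sup>2)) \<longlonglongrightarrow> ennreal ((cmod (f x))\<^sup>2)"
        by (rule tendsto_ennrealI) (intro tendsto_intros elim)
      from lim_imp_Liminf[OF trivial_limit_sequentially this] show ?case by simp
    qed
  qed
  also have "\<dots> \<le> liminf (\<lambda>n. \<integral>\<^sup>+x. ennreal ((cmod (u n x))\<^sup>2) \<partial>M)"
    by (rule nn_integral_liminf) measurable
  also have "\<dots> \<le> ennreal (C\<^sup>2)"
  proof (rule Liminf_le)
    show "\<forall>\<^sub>F n in sequentially. (\<integral>\<^sup>+x. ennreal ((cmod (u n x))\<^sup>2) \<partial>M) \<le> ennreal (C\<^sup>2)"
      using nn_integral_L2[OF u] le by (intro always_eventually allI) (simp add: power_mono)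
  qed simp
  finally have *: "(\<integral>\<^sup>+x. ennreal ((cmod (f x))\<^sup>2) \<partial>M) \<le> ennreal (C\<^sup>2)" .
  show "f \<in> L2 M" "L2_norm M f \<le> C" using L2_nn_integral_le[OF f * C] by auto
qed

text \<open>
  With \<open>d = u\<^sub>n - f\<close>, split \<open>|d| |k|\<close> according to whether \<open>|d| \<le> R |k|\<close>. On that set \<open>R |k|\<^sup>2\<close> is an
  integrable majorant; on its complement \<open>|d| |k| \<le> |d|\<^sup>2 / R\<close>, whose integral is at most
  \<open>K\<^sup>2 / R\<close> because the norms are bounded. The cut-off \<open>R\<close> is then chosen large.
\<close>

lemma L2_weak_limit_of_AE_limit:
  assumes u: "\<And>n. u n \<in> L2 M" and f: "f \<in> L2 M" and k: "k \<in> L2 M"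
    and le: "\<And>n. L2_norm M (u n) \<le> C"
    and lim: "AE x in M. (\<lambda>n. u n x) \<longlonglongrightarrow> f x"
  shows "(\<lambda>n. L2_inner M (u n) k) \<longlonglongrightarrow> L2_inner M f k"
proof -
  define d where "d n x = u n x - f x" for n x
  define K where "K = C + L2_norm M f"
  have dL: "d n \<in> L2 M" for n unfolding d_def by (rule L2_diff[OF u f])
  have dK: "L2_norm M (d n) \<le> K" for n
    unfolding d_def K_def using L2_norm_triangle_diff[OF u[of n] f] le[of n] by simp
  note [measurable] = L2_measurable[OF k] L2_measurable[OF dL]
  \<comment> \<open>the minimum is the part with the integrable majorant\<close>
  have split: "(\<integral>x. cmod (d n x) * cmod (k x) \<partial>M)
      \<le> (\<integral>x. min (cmod (d n x) * cmod (k x)) (R * (cmod (k x))\<^sup>2) \<partial>M) + K\<^sup>2 / R" if R: "R > 0" for n R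
  proof -
    have i1: "integrable M (\<lambda>x. min (cmod (d n x) * cmod (k x)) (R * (cmod (k x))\<^sup>2))"
      by (rule Bochner_Integration.integrable_bound[OF L2_mult_integrable_norm[OF dL[of n] k]]) (use R in auto)
    have i2: "integrable M (\<lambda>x. (cmod (d n x))\<^sup>2 / R)" using L2_square_integrable[OF dL] by simp
    have pt: "cmod (d n x) * cmod (k x) \<le> min (cmod (d n x) * cmod (k x)) (R * (cmod (k x))\<^sup>2) + (cmod (d n x))\<^sup>2 / R" for x
    proof (cases "cmod (d n x) \<le> R * cmod (k x)")
      case True
      then have "cmod (d n x) * cmod (k x) \<le> R * (cmod (k x))\<^sup>2"
        by (metis mult.assoc mult_right_mono norm_ge_zero power2_eq_square)
      then show ?thesis using R by simp
    next
      case False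
      then have "cmod (k x) \<le> cmod (d n x) / R" using R by (simp add: field_simps)
      then have "cmod (d n x) * cmod (k x) \<le> (cmod (d n x))\<^sup>2 / R"
        using mult_left_mono[of "cmod (k x)" "cmod (d n x) / R" "cmod (d n x)"] by (simp add: power2_eq_square)
      moreover have "0 \<le> min (cmod (d n x) * cmod (k x)) (R * (cmod (k x))\<^sup>2)" using R by simp
      ultimately show ?thesis by linarith
    qed
    have "(\<integral>x. cmod (d n x) * cmod (k x) \<partial>M) \<le>
       (\<integral>x. min (cmod (d n x) * cmod (k x)) (R * (cmod (k x))\<^sup>2) + (cmod (d n x))\<^sup>2 / R \<partial>M)"
      by (rule integral_mono) (use L2_mult_integrable_norm[OF dL[of n] k] i1 i2 pt in auto)
    also have "\<dots> = (\<integral>x. min (cmod (d n x) * cmod (k x)) (R * (cmod (k x))\<^sup>2) \<partial>M) + (L2_norm M (d n))\<^sup>2 / R"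
      using i1 i2 by (simp add: L2_norm_square)
    also have "(L2_norm M (d n))\<^sup>2 / R \<le> K\<^sup>2 / R"
      using dK[of n] R by (intro divide_right_mono power_mono) auto
    finally show ?thesis by simp
  qed
  have conv0: "(\<lambda>n. \<integral>x. min (cmod (d n x) * cmod (k x)) (R * (cmod (k x))\<^sup>2) \<partial>M) \<longlonglongrightarrow> 0" if R: "R > 0" for R
  proof -
    have "(\<lambda>n. \<integral>x. min (cmod (d n x) * cmod (k x)) (R * (cmod (k x))\<^sup>2) \<partial>M) \<longlonglongrightarrow> (\<integral>x. 0 \<partial>M)"
    proof (rule integral_dominated_convergence[where w="\<lambda>x. R * (cmod (k x))\<^sup>2"])
      show "integrable M (\<lambda>x. R * (cmod (k x))\<^sup>2)" using L2_square_integrable[OF k] by simp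
      show "AE x in M. (\<lambda>n. min (cmod (d n x) * cmod (k x)) (R * (cmod (k x))\<^sup>2)) \<longlonglongrightarrow> 0"
        using lim
      proof eventually_elim
        case (elim x)
        have "(\<lambda>n. min (cmod (d n x) * cmod (k x)) (R * (cmod (k x))\<^sup>2)) \<longlonglongrightarrow> min (cmod (f x - f x) * cmod (k x)) (R * (cmod (k x))\<^sup>2)"
          unfolding d_def by (intro tendsto_intros elim)
        moreover have "min (cmod (f x - f x) * cmod (k x)) (R * (cmod (k x))\<^sup>2) = 0" using R by simp
        ultimately show ?case by simp
      qed
    qed (use R in auto)
    then show ?thesis by simp
  qed
  have "(\<lambda>n. \<integral>x. cmod (d n x) * cmod (k x) \<partial>M) \<longlonglongrightarrow> 0"
  proof (rule LIMSEQ_I)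
    fix r :: real assume r: "0 < r"
    \<comment> \<open>\<open>K\<^sup>2 + 1\<close> instead of \<open>K\<^sup>2\<close> keeps \<open>R\<close> positive\<close>
    define R where "R = 2 * (K\<^sup>2 + 1) / r"
    have R: "R > 0" using r by (simp add: R_def add_nonneg_pos)
    have KR: "K\<^sup>2 / R < r / 2"
      using r unfolding R_def by (simp add: field_simps add_nonneg_pos add_pos_nonneg)
    obtain N where N: "\<And>n. n \<ge> N \<Longrightarrow> \<bar>\<integral>x. min (cmod (d n x) * cmod (k x)) (R * (cmod (k x))\<^sup>2) \<partial>M\<bar> < r / 2"
      using LIMSEQ_D[OF conv0[OF R], of "r/2"] r by auto
    show "\<exists>no. \<forall>n\<ge>no. norm ((\<integral>x. cmod (d n x) * cmod (k x) \<partial>M) - 0) < r"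
    proof (intro exI allI impI)
      fix n assume "n \<ge> N"
      then have "(\<integral>x. cmod (d n x) * cmod (k x) \<partial>M) < r" using N[of n] split[OF R, of n] KR by linarith
      moreover have "0 \<le> (\<integral>x. cmod (d n x) * cmod (k x) \<partial>M)" by simp
      ultimately show "norm ((\<integral>x. cmod (d n x) * cmod (k x) \<partial>M) - 0) < r" by simp
    qed
  qed
  then have "(\<lambda>n. L2_inner M (u n) k - L2_inner M f k) \<longlonglongrightarrow> 0"
  proof (rule Lim_null_comparison[rotated], intro always_eventually allI)
    fix n
    have "norm (L2_inner M (u n) k - L2_inner M f k) = cmod (\<integral>x. d n x * cnj (k x) \<partial>M)"
      using L2_inner_diff_left[OF u[of n] f k] by (simp add: L2_inner_def d_def)
    also have "\<dots> \<le> (\<integral>x. cmod (d n x * cnj (k x)) \<partial>M)" by (rule integral_norm_bound)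
    finally show "norm (L2_inner M (u n) k - L2_inner M f k) \<le> (\<integral>x. cmod (d n x) * cmod (k x) \<partial>M)"
      by (simp add: norm_mult)
  qed
  then show ?thesis by (rule LIM_zero_cancel)
qed

text \<open>
  A norm limit and a pointwise limit of the same sequence agree, by Fatou's lemma applied to the tails.
\<close>

lemma L2_limit_unique_AE:
  assumes u: "\<And>n. u n \<in> L2 M" and g: "g \<in> L2 M" and g': "g' \<in> borel_measurable M"
    and lim: "(\<lambda>n. L2_norm M (\<lambda>x. u n x - g x)) \<longlonglongrightarrow> 0"
    and pt: "AE x in M. (\<lambda>n. u n x) \<longlonglongrightarrow> g' x"
  shows "AE x in M. g' x = g x"
proof -
  note [measurable] = L2_measurable[OF g] g'
  have dm: "(\<lambda>x. g' x - g x) \<in> borel_measurable M" by measurable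
  have pt': "AE x in M. (\<lambda>n. u (n + N) x - g x) \<longlonglongrightarrow> g' x - g x" for N
    using pt
  proof eventually_elim
    case (elim x)
    show ?case by (intro tendsto_intros LIMSEQ_ignore_initial_segment[OF elim])
  qed
  have small: "(\<lambda>x. g' x - g x) \<in> L2 M \<and> L2_norm M (\<lambda>x. g' x - g x) \<le> r" if "0 < r" for r
  proof -
    have "\<forall>\<^sub>F n in sequentially. L2_norm M (\<lambda>x. u n x - g x) < r"
      by (rule order_tendstoD(2)[OF lim that])
    then obtain N where "\<And>n. n \<ge> N \<Longrightarrow> L2_norm M (\<lambda>x. u n x - g x) < r"
      by (auto simp: eventually_sequentially)
    then have "L2_norm M (\<lambda>x. u (n + N) x - g x) \<le> r" for n by (simp add: less_imp_le)
    from L2_Fatou[OF L2_diff[OF u g] dm this pt'] show ?thesis by blast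
  qed
  have "L2_norm M (\<lambda>x. g' x - g x) \<le> 0"
    by (rule field_le_epsilon) (use small in auto)
  then have "L2_norm M (\<lambda>x. g' x - g x) = 0" by (simp add: antisym)
  from L2_norm_0_AE[OF _ this] small[of 1] show ?thesis by simp
qed

section \<open>Density of the compactly supported continuous functions\<close>

lemma L2_indicator:
  assumes "A \<in> sets M" "emeasure M A < \<infinity>"
  shows "(\<lambda>x. complex_of_real (indicator A x)) \<in> L2 M"
proof (rule L2_I)
  show "(\<lambda>x. complex_of_real (indicator A x)) \<in> borel_measurable M" using assms by measurable
  have "integrable M (\<lambda>x. indicator A x :: real)" using assms by simp
  then show "integrable M (\<lambda>x. (cmod (complex_of_real (indicator A x)))\<^sup>2)"
    by (rule Bochner_Integration.integrable_cong[THEN iffD1, rotated 2]) (auto split: split_indicator)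
qed

text \<open>
  Density as an induction rule: a property stable under linear combinations and norm limits holds
  on all of \<open>L\<^sup>2\<close> as soon as it holds for compactly supported continuous real functions. Distance
  functions reach indicators of bounded open sets, the \<open>\<pi>\<close>-\<open>\<lambda>\<close> argument reaches bounded Borel sets, and
  truncated simple functions reach the rest.
\<close>

lemma L2_induct_continuous:
  fixes M :: "real measure" and P :: "(real \<Rightarrow> complex) \<Rightarrow> bool"
  assumes sets: "sets M = sets borel"
    and fin: "\<And>n. emeasure M {-real n<..<real n} < \<infinity>"
    and add: "\<And>f g. f \<in> L2 M \<Longrightarrow> g \<in> L2 M \<Longrightarrow> P f \<Longrightarrow> P g \<Longrightarrow> P (\<lambda>x. f x + g x)"
    and scale: "\<And>f c. f \<in> L2 M \<Longrightarrow> P f \<Longrightarrow> P (\<lambda>x. c * f x)"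
    and lim: "\<And>u f. (\<And>n. u n \<in> L2 M) \<Longrightarrow> (\<And>n. P (u n)) \<Longrightarrow> f \<in> L2 M \<Longrightarrow>
        (\<lambda>n. L2_norm M (\<lambda>x. u n x - f x)) \<longlonglongrightarrow> 0 \<Longrightarrow> P f"
    and cont: "\<And>\<phi> R. continuous_on UNIV \<phi> \<Longrightarrow> (\<And>x. R < \<bar>x\<bar> \<Longrightarrow> \<phi> x = 0) \<Longrightarrow> P (\<lambda>x. complex_of_real (\<phi> x))"
    and f: "f \<in> L2 M"
  shows "P f"
proof -
  have [measurable_cong]: "sets M = sets borel" by (rule sets)
  have sp: "space M = UNIV" using sets_eq_imp_space_eq[OF sets] by simp
  have P0: "P (\<lambda>_. 0)" using cont[of "\<lambda>_. 0"] by simp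
  have dom: "P g" if "w \<in> L2 M" "g \<in> borel_measurable M" "\<And>n. u n \<in> borel_measurable M"
      "\<And>n x. cmod (u n x) \<le> cmod (w x)" "\<And>x. (\<lambda>n. u n x) \<longlonglongrightarrow> g x" "\<And>n. P (u n)" for w g u
  proof -
    have *: "\<And>n. AE x in M. cmod (u n x) \<le> cmod (w x)" "AE x in M. (\<lambda>n. u n x) \<longlonglongrightarrow> g x"
      using that by auto
    note c = L2_dominated_convergence[OF that(1-3) *]
    show ?thesis by (rule lim[OF c(2) that(6) c(1) c(3)])
  qed
  define I where "I n = {-real n<..<real n}" for n :: nat
  have I[measurable]: "I n \<in> sets M" for n unfolding I_def by simp
  have Iind: "(\<lambda>x. complex_of_real (indicator (I n) x)) \<in> L2 M" for n
    by (rule L2_indicator[OF I]) (use fin[of n] in \<open>simp add: I_def\<close>)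
  have ind_open: "P (\<lambda>x. complex_of_real (indicator (U \<inter> I n) x))" if U: "open U" for U n
  proof -
    define C where "C = - (U \<inter> I n)"
    have C: "closed C" unfolding C_def I_def using open_Int[OF U open_greaterThanLessThan] by (simp only: closed_Compl)
    have ne: "C \<noteq> {}" 
    proof -
      have "real n \<in> C" by (simp add: C_def I_def)
      then show ?thesis by auto
    qed
    define \<phi> where "\<phi> k x = min 1 (real k * infdist x C)" for k x
    have \<phi>01: "0 \<le> \<phi> k x" "\<phi> k x \<le> indicator (I n) x" for k x
    proof -
      show "0 \<le> \<phi> k x" by (simp add: \<phi>_def infdist_nonneg)
      show "\<phi> k x \<le> indicator (I n) x"
      proof (cases "x \<in> I n")
        case False
        then have "x \<in> C" by (simp add: C_def)
        then show ?thesis using infdist_zero[of x C] False by (simp add: \<phi>_def)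
      qed (simp add: \<phi>_def)
    qed
    have [measurable]: "\<phi> k \<in> borel_measurable borel" for k
      unfolding \<phi>_def by (intro borel_measurable_continuous_onI continuous_intros)
    have [measurable]: "U \<in> sets borel" using U by simp
    show ?thesis
    proof (rule dom[OF Iind[of n], where u="\<lambda>k x. complex_of_real (\<phi> k x)"])
      show "(\<lambda>x. complex_of_real (indicator (U \<inter> I n) x)) \<in> borel_measurable M" by measurable
      show "(\<lambda>x. complex_of_real (\<phi> k x)) \<in> borel_measurable M" for k by measurable
      show "cmod (complex_of_real (\<phi> k x)) \<le> cmod (complex_of_real (indicator (I n) x))" for k x
        using \<phi>01[of k x] by simp
      show "P (\<lambda>x. complex_of_real (\<phi> k x))" for k
      proof (rule cont[where R="real n"])
        show "continuous_on UNIV (\<phi> k)" unfolding \<phi>_def by (intro continuous_intros)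
        show "\<phi> k x = 0" if "real n < \<bar>x\<bar>" for x
        proof -
          have "x \<notin> I n" using that by (auto simp: I_def)
          then show ?thesis using \<phi>01[of k x] by simp
        qed
      qed
      show "(\<lambda>k. complex_of_real (\<phi> k x)) \<longlonglongrightarrow> complex_of_real (indicator (U \<inter> I n) x)" for x
      proof (cases "x \<in> C")
        case True
        then show ?thesis using infdist_zero[of x C] by (auto simp: \<phi>_def C_def indicator_def)
      next
        case False
        then have pos: "0 < infdist x C" using C ne infdist_pos_not_in_closed by blast
        then obtain N :: nat where N: "1 / infdist x C \<le> real N" using real_arch_simple by blast
        have "eventually (\<lambda>k. \<phi> k x = 1) sequentially"
        proof (rule eventually_sequentiallyI[of N])
          fix k assume "N \<le> k"
          then have "1 / infdist x C \<le> real k" using N by linarith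
          then have "1 \<le> real k * infdist x C" using pos by (simp add: field_simps)
          then show "\<phi> k x = 1" by (simp add: \<phi>_def)
        qed
        then have "(\<lambda>k. \<phi> k x) \<longlonglongrightarrow> 1" by (rule tendsto_eventually)
        then have "(\<lambda>k. complex_of_real (\<phi> k x)) \<longlonglongrightarrow> complex_of_real 1" by (rule tendsto_of_real)
        then show ?thesis using False by (simp add: C_def)
      qed
    qed
  qed
  have ind: "P (\<lambda>x. complex_of_real (indicator (A \<inter> I n) x))" if A: "A \<in> sets borel" for A n
  proof -
    have "A \<in> sigma_sets UNIV {S::real set. open S}" using A by (simp add: borel_def)
    then show ?thesis
    proof (rule sigma_sets_induct_disjoint[rotated 2])
      show "Int_stable {S::real set. open S}" by (auto simp: Int_stable_def)
      show "{S::real set. open S} \<subseteq> Pow UNIV" by simp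
      show "P (\<lambda>x. complex_of_real (indicator (S \<inter> I n) x))" if "S \<in> {S. open S}" for S
        using ind_open that by simp
      show "P (\<lambda>x. complex_of_real (indicator ({} \<inter> I n) x))" using P0 by simp
    next
      fix S assume S: "S \<in> sigma_sets UNIV {S::real set. open S}" and PS: "P (\<lambda>x. complex_of_real (indicator (S \<inter> I n) x))"
      have [measurable]: "S \<in> sets borel" using S by (simp add: borel_def)
      have SL: "(\<lambda>x. complex_of_real (indicator (S \<inter> I n) x)) \<in> L2 M"
        by (rule L2_dominated[OF Iind[of n], where c=1]) (auto split: split_indicator)
      have "P (\<lambda>x. complex_of_real (indicator (UNIV \<inter> I n) x) + (-1) * complex_of_real (indicator (S \<inter> I n) x))"
        by (intro add scale SL PS ind_open L2_scale) (use Iind[of n] in auto)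
      also have "(\<lambda>x. complex_of_real (indicator (UNIV \<inter> I n) x) + (-1) * complex_of_real (indicator (S \<inter> I n) x))
        = (\<lambda>x. complex_of_real (indicator ((UNIV - S) \<inter> I n) x))"
        by (auto split: split_indicator)
      finally show "P (\<lambda>x. complex_of_real (indicator ((UNIV - S) \<inter> I n) x))" .
    next
      fix S :: "nat \<Rightarrow> real set"
      assume dis: "disjoint_family S" and S: "range S \<subseteq> sigma_sets UNIV {S. open S}"
        and PS: "\<And>i. P (\<lambda>x. complex_of_real (indicator (S i \<inter> I n) x))"
      have [measurable]: "S i \<in> sets borel" for i using S by (auto simp: borel_def)
      have SL: "(\<lambda>x. complex_of_real (indicator (S i \<inter> I n) x)) \<in> L2 M" for i
        by (rule L2_dominated[OF Iind[of n], where c=1]) (auto split: split_indicator)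
      have fu: "P (\<lambda>x. complex_of_real (indicator ((\<Union>i<k. S i) \<inter> I n) x)) \<and>
         (\<lambda>x. complex_of_real (indicator ((\<Union>i<k. S i) \<inter> I n) x)) \<in> L2 M" for k
      proof (induction k)
        case 0 then show ?case using P0 by simp
      next
        case (Suc k)
        have eq: "(\<lambda>x. complex_of_real (indicator ((\<Union>i<Suc k. S i) \<inter> I n) x)) =
          (\<lambda>x. complex_of_real (indicator ((\<Union>i<k. S i) \<inter> I n) x) + complex_of_real (indicator (S k \<inter> I n) x))"
        proof
          fix x
          have "\<not> (x \<in> S k \<and> x \<in> (\<Union>i<k. S i))" 
          proof
            assume "x \<in> S k \<and> x \<in> (\<Union>i<k. S i)"
            then obtain i where "x \<in> S k" "x \<in> S i" "i \<noteq> k" by auto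
            then show False using dis unfolding disjoint_family_on_def by blast
          qed
          then show "complex_of_real (indicator ((\<Union>i<Suc k. S i) \<inter> I n) x) =
            complex_of_real (indicator ((\<Union>i<k. S i) \<inter> I n) x) + complex_of_real (indicator (S k \<inter> I n) x)"
            by (auto simp: lessThan_Suc split: split_indicator)
        qed
        show ?case unfolding eq using add[of "\<lambda>x. complex_of_real (indicator ((\<Union>i<k. S i) \<inter> I n) x)", OF _ SL[of k] _ PS[of k]]
          Suc L2_add[OF _ SL[of k]] by blast
      qed
      show "P (\<lambda>x. complex_of_real (indicator (\<Union> (range S) \<inter> I n) x))"
      proof (rule dom[OF Iind[of n], where u="\<lambda>k x. complex_of_real (indicator ((\<Union>i<k. S i) \<inter> I n) x)"])
        show "(\<lambda>k. complex_of_real (indicator ((\<Union>i<k. S i) \<inter> I n) x)) \<longlonglongrightarrow> complex_of_real (indicator (\<Union> (range S) \<inter> I n) x)" for x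
        proof (cases "x \<in> \<Union> (range S) \<inter> I n")
          case True
          then obtain i where i: "x \<in> S i" "x \<in> I n" by auto
          have "eventually (\<lambda>k. complex_of_real (indicator ((\<Union>i<k. S i) \<inter> I n) x) = complex_of_real (indicator (\<Union> (range S) \<inter> I n) x)) sequentially"
            by (rule eventually_sequentiallyI[of "Suc i"]) (use i in \<open>auto simp: indicator_def intro: less_le_trans\<close>)
          then show ?thesis by (rule tendsto_eventually)
        next
          case False
          then have "x \<notin> (\<Union>i<k. S i) \<inter> I n" for k by auto
          then have "indicator ((\<Union>i<k. S i) \<inter> I n) x = (0::real)" for k by (rule indicator_simps(2))
          with False show ?thesis by simp
        qed
        show "(\<lambda>x. complex_of_real (indicator (\<Union> (range S) \<inter> I n) x)) \<in> borel_measurable M" by measurable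
      qed (use fu in \<open>auto simp: L2_measurable split: split_indicator\<close>)
    qed
  qed
  have simp_n: "P (\<lambda>x. complex_of_real (indicator (I n) x) * s x)" if s: "simple_function M s" for s :: "real \<Rightarrow> complex" and n
  proof -
    have [measurable]: "s \<in> borel_measurable M" by (rule borel_measurable_simple_function[OF s])
    have fin_s: "finite (range s)" using s by (simp add: simple_function_def sp)
    have vb: "s -` {y} \<in> sets borel" for y 
      using measurable_sets[of s M borel "{y}"] by (simp add: sp sets)
    have IL: "(\<lambda>x. complex_of_real (indicator (s -` {y} \<inter> I n) x)) \<in> L2 M" for y
      by (rule L2_dominated[OF Iind[of n], where c=1]) (use vb in \<open>auto split: split_indicator\<close>)
    have "P (\<lambda>x. \<Sum>y\<in>Y. y * complex_of_real (indicator (s -` {y} \<inter> I n) x)) \<and> 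
      (\<lambda>x. \<Sum>y\<in>Y. y * complex_of_real (indicator (s -` {y} \<inter> I n) x)) \<in> L2 M" if "finite Y" for Y
      using that
    proof (induction Y rule: finite_induct)
      case empty then show ?case using P0 by simp
    next
      case (insert y Y)
      show ?case
        unfolding sum.insert[OF insert.hyps]
        using insert.IH add[OF L2_scale[OF IL] _ scale[OF IL ind[OF vb]]] L2_add[OF L2_scale[OF IL]] by blast
    qed
    from this[OF fin_s] have "P (\<lambda>x. \<Sum>y\<in>range s. y * complex_of_real (indicator (s -` {y} \<inter> I n) x))" by blast
    also have "(\<lambda>x. \<Sum>y\<in>range s. y * complex_of_real (indicator (s -` {y} \<inter> I n) x)) = (\<lambda>x. complex_of_real (indicator (I n) x) * s x)"
    proof
      fix x
      have "(\<Sum>y\<in>range s. y * complex_of_real (indicator (s -` {y} \<inter> I n) x)) = (\<Sum>y\<in>range s. if y = s x then complex_of_real (indicator (I n) x) * y else 0)"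
        by (intro sum.cong) (auto simp: indicator_def)
      also have "\<dots> = complex_of_real (indicator (I n) x) * s x" using fin_s by simp
      finally show "(\<Sum>y\<in>range s. y * complex_of_real (indicator (s -` {y} \<inter> I n) x)) = complex_of_real (indicator (I n) x) * s x" .
    qed
    finally show ?thesis .
  qed
  obtain s where s: "\<And>i. simple_function M (s i)" and sl: "\<And>x. (\<lambda>i. s i x) \<longlonglongrightarrow> f x"
    and sb: "\<And>i x. dist (s i x) 0 \<le> 2 * dist (f x) 0"
    using borel_measurable_implies_sequence_metric[OF L2_measurable[OF f], of 0] by (auto simp: sp)
  show "P f"
  proof (rule dom[where w="\<lambda>x. 2 * f x" and u="\<lambda>n x. complex_of_real (indicator (I n) x) * s n x"])
    show "(\<lambda>x. 2 * f x) \<in> L2 M" by (rule L2_scale[OF f])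
    show "f \<in> borel_measurable M" using f by (rule L2_measurable)
    show "(\<lambda>x. complex_of_real (indicator (I n) x) * s n x) \<in> borel_measurable M" for n
      using borel_measurable_simple_function[OF s[of n]] by measurable
    show "cmod (complex_of_real (indicator (I n) x) * s n x) \<le> cmod (2 * f x)" for n x
      using sb[of n x] by (auto simp: norm_mult split: split_indicator)
    show "(\<lambda>n. complex_of_real (indicator (I n) x) * s n x) \<longlonglongrightarrow> f x" for x
    proof -
      obtain N :: nat where N: "\<bar>x\<bar> < real N" using reals_Archimedean2 by blast
      have "eventually (\<lambda>n. s n x = complex_of_real (indicator (I n) x) * s n x) sequentially"
        by (rule eventually_sequentiallyI[of N]) (use N in \<open>auto simp: I_def indicator_def\<close>)
      then show ?thesis using sl[of x] by (rule Lim_transform_eventually[rotated])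
    qed
    show "P (\<lambda>x. complex_of_real (indicator (I n) x) * s n x)" for n using simp_n[OF s] .
  qed
qed

section \<open>Operators between two \<open>L\<^sup>2\<close> spaces\<close>

lemma L2_opnorm_le:
  assumes "0 \<le> C" "\<And>f. f \<in> L2 M \<Longrightarrow> L2_norm N (U f) \<le> C * L2_norm M f"
  shows "L2_opnorm M N U \<le> ennreal C"
  unfolding L2_opnorm_def
proof (rule SUP_least)
  fix f assume "f \<in> {f \<in> L2 M. L2_norm M f \<le> 1}"
  then have "L2_norm N (U f) \<le> C * L2_norm M f" "L2_norm M f \<le> 1" using assms(2) by auto
  then have "L2_norm N (U f) \<le> C * 1" using assms(1) mult_left_mono by (metis order_trans)
  then show "ennreal (L2_norm N (U f)) \<le> ennreal C" by (simp add: ennreal_leI)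
qed

lemma L2_bounded_operatorI:
  assumes "L2_linear M N U" "0 \<le> C" "\<And>f. f \<in> L2 M \<Longrightarrow> L2_norm N (U f) \<le> C * L2_norm M f"
  shows "L2_bounded_operator M N U"
  unfolding L2_bounded_operator_def
proof
  have "L2_opnorm M N U \<le> ennreal C" by (rule L2_opnorm_le[OF assms(2,3)])
  then show "L2_opnorm M N U < \<infinity>" by (auto intro: le_less_trans)
qed (rule assms(1))

text \<open>
  The theorem speaks of every weak limit; this reduces it to a single one.
\<close>

lemma L2_weak_operator_limit_unique:
  assumes T: "L2_weak_operator_limit M N U T G" and S: "L2_weak_operator_limit M N U S G"
    and G: "G \<noteq> bot" and f: "f \<in> L2 M"
  shows "AE x in N. T f x = S f x"
proof (rule L2_eq_AE_if_inner_eq)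
  show "T f \<in> L2 N" "S f \<in> L2 N"
    using T S f by (auto simp: L2_weak_operator_limit_def L2_bounded_operator_def L2_linear_def)
  fix k assume "k \<in> L2 N"
  then have "((\<lambda>i. L2_inner N (U i f) k) \<longlongrightarrow> L2_inner N (T f) k) G" "((\<lambda>i. L2_inner N (U i f) k) \<longlongrightarrow> L2_inner N (S f) k) G"
    using T S f by (auto simp: L2_weak_operator_limit_def)
  then show "L2_inner N (T f) k = L2_inner N (S f) k" by (rule tendsto_unique[OF G])
qed

text \<open>
  An adjoint can be assembled vector by vector: linearity and the bound follow from the defining
  identity alone, because an element of \<open>L\<^sup>2\<close> is determined by its inner products.
\<close>

lemma L2_adjoint_exists:
  assumes U: "\<And>f. f \<in> L2 M \<Longrightarrow> U f \<in> L2 N" "\<And>f. f \<in> L2 M \<Longrightarrow> L2_norm N (U f) \<le> C * L2_norm M f" and C: "0 \<le> C"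
    and ex: "\<And>g. g \<in> L2 N \<Longrightarrow> \<exists>w\<in>L2 M. \<forall>f\<in>L2 M. L2_inner N (U f) g = L2_inner M f w"
  shows "\<exists>W. L2_adjoint M N U W"
proof -
  have "\<forall>g\<in>L2 N. \<exists>w. w \<in> L2 M \<and> (\<forall>f\<in>L2 M. L2_inner N (U f) g = L2_inner M f w)" using ex by blast
  from bchoice[OF this] obtain W where W: "\<And>g. g \<in> L2 N \<Longrightarrow> W g \<in> L2 M"
    "\<And>f g. g \<in> L2 N \<Longrightarrow> f \<in> L2 M \<Longrightarrow> L2_inner N (U f) g = L2_inner M f (W g)" by blast
  have eqI: "AE x in M. p x = q x" if "p \<in> L2 M" "q \<in> L2 M" "\<And>f. f \<in> L2 M \<Longrightarrow> L2_inner M f p = L2_inner M f q" for p q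
  proof (rule L2_eq_AE_if_inner_eq[OF that(1,2)])
    fix k assume "k \<in> L2 M"
    then show "L2_inner M p k = L2_inner M q k" using that(3)[of k] by (simp add: L2_inner_commute[of M _ k])
  qed
  have lin: "L2_linear N M W"
    unfolding L2_linear_def
  proof (intro conjI ballI allI impI)
    fix f g assume f: "f \<in> L2 N" and g: "g \<in> L2 N" and eq: "AE x in N. f x = g x"
    show "AE y in M. W f y = W g y"
    proof (rule eqI[OF W(1)[OF f] W(1)[OF g]])
      fix k assume k: "k \<in> L2 M"
      have "L2_inner N (U k) f = L2_inner N (U k) g"
        by (rule L2_inner_cong_AE) (use L2_measurable[OF U(1)[OF k]] L2_measurable[OF f] L2_measurable[OF g] eq in auto)
      then show "L2_inner M k (W f) = L2_inner M k (W g)" using W(2) f g k by simp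
    qed
  next
    fix f g assume f: "f \<in> L2 N" and g: "g \<in> L2 N"
    show "AE y in M. W (\<lambda>x. f x + g x) y = W f y + W g y"
    proof (rule eqI[OF W(1)[OF L2_add[OF f g]] L2_add[OF W(1)[OF f] W(1)[OF g]]])
      fix k assume k: "k \<in> L2 M"
      have radd: "L2_inner Q k (\<lambda>x. a x + b x) = L2_inner Q k a + L2_inner Q k b" if "k \<in> L2 Q" "a \<in> L2 Q" "b \<in> L2 Q" for Q k a b
        using L2_inner_add_left[OF that(2,3,1)] L2_inner_commute[of Q k] by (metis complex_cnj_add L2_inner_commute)
      show "L2_inner M k (W (\<lambda>x. f x + g x)) = L2_inner M k (\<lambda>x. W f x + W g x)"
        using W(2)[OF L2_add[OF f g] k] W(2)[OF f k] W(2)[OF g k] radd[OF U(1)[OF k] f g] radd[OF k W(1)[OF f] W(1)[OF g]] by simp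
    qed
  next
    fix c f assume f: "f \<in> L2 N"
    show "AE y in M. W (\<lambda>x. c * f x) y = c * W f y"
    proof (rule eqI[OF W(1)[OF L2_scale[OF f]] L2_scale[OF W(1)[OF f]]])
      fix k assume k: "k \<in> L2 M"
      show "L2_inner M k (W (\<lambda>x. c * f x)) = L2_inner M k (\<lambda>x. c * W f x)"
        using W(2)[OF L2_scale[OF f] k] W(2)[OF f k] by (simp add: L2_inner_scale_right)
    qed
  qed (use W in auto)
  have "L2_norm M (W g) \<le> C * L2_norm N g" if g: "g \<in> L2 N" for g
  proof (cases "L2_norm M (W g) = 0")
    case False
    then have pos: "0 < L2_norm M (W g)" using L2_norm_nonneg[of M "W g"] by linarith
    have "(L2_norm M (W g))\<^sup>2 = cmod (L2_inner M (W g) (W g))" by (simp add: L2_inner_self norm_power)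
    also have "\<dots> = cmod (L2_inner N (U (W g)) g)" using W(2)[OF g W(1)[OF g]] by simp
    also have "\<dots> \<le> L2_norm N (U (W g)) * L2_norm N g" by (rule L2_Cauchy_Schwarz[OF U(1)[OF W(1)[OF g]] g])
    also have "\<dots> \<le> C * L2_norm M (W g) * L2_norm N g" by (rule mult_right_mono[OF U(2)[OF W(1)[OF g]]]) simp
    finally have "L2_norm M (W g) * L2_norm M (W g) \<le> (C * L2_norm N g) * L2_norm M (W g)"
      by (simp add: power2_eq_square mult_ac)
    then show ?thesis using pos by (simp only: mult_le_cancel_right_pos)
  qed (use C in simp)
  from L2_bounded_operatorI[OF lin C this] have "L2_bounded_operator N M W" .
  then show ?thesis unfolding L2_adjoint_def using W(2) by blast
qed

lemma compactly_supported_iff: "compactly_supported f \<longleftrightarrow> (\<exists>R. \<forall>x. R < \<bar>x\<bar> \<longrightarrow> f x = 0)"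
proof -
  have "compactly_supported f \<longleftrightarrow> bounded {x. f x \<noteq> 0}"
    by (simp add: compactly_supported_def compact_closure)
  also have "\<dots> \<longleftrightarrow> (\<exists>R. \<forall>x. R < \<bar>x\<bar> \<longrightarrow> f x = 0)"
    unfolding bounded_iff by (auto simp: not_le) (metis not_le)+
  finally show ?thesis .
qed

section \<open>A weak-type maximal inequality on the line\<close>

text \<open>
  In a subfamily of least cardinality with the same union no point lies in three intervals: of three
  intervals with a common point, the one that reaches furthest left and the one that reaches furthest
  right cover the third.
\<close>

lemma interval_subcover_overlap_le_2:
  fixes a b :: "'i \<Rightarrow> real"
  assumes fin: "finite J"
  obtains K where "K \<subseteq> J" "(\<Union>i\<in>K. {a i<..<b i}) = (\<Union>i\<in>J. {a i<..<b i})"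
    "\<And>x. card {i \<in> K. x \<in> {a i<..<b i}} \<le> 2"
proof -
  let ?P = "\<lambda>K. K \<subseteq> J \<and> (\<Union>i\<in>K. {a i<..<b i}) = (\<Union>i\<in>J. {a i<..<b i})"
  have "?P J" by simp
  then obtain K where K_least: "?P K \<and> (\<forall>L. ?P L \<longrightarrow> card K \<le> card L)"
    by (rule ex_has_least_nat[of ?P J card, THEN exE])
  then have K: "?P K" and least: "\<And>L. ?P L \<Longrightarrow> card K \<le> card L" by simp_all
  have finK: "finite K" using K fin finite_subset by blast
  show ?thesis
  proof (rule that)
    fix x
    define S where "S = {i \<in> K. x \<in> {a i<..<b i}}"
    have finS: "finite S" using finK by (simp add: S_def)
    show "card {i \<in> K. x \<in> {a i<..<b i}} \<le> 2"
    proof (rule ccontr)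
      assume "\<not> card {i \<in> K. x \<in> {a i<..<b i}} \<le> 2"
      then have c3: "card S > 2" by (simp add: S_def)
      then have ne: "S \<noteq> {}" by auto
      have "Min (a ` S) \<in> a ` S" "Max (b ` S) \<in> b ` S" using finS ne by auto
      then obtain l r where l: "l \<in> S" "a l = Min (a ` S)" and r: "r \<in> S" "b r = Max (b ` S)" by fastforce
      have "card {l, r} \<le> 2" by (simp add: card_insert_if)
      then have "\<not> S \<subseteq> {l, r}" using c3 card_mono[of "{l,r}" S] by fastforce
      then obtain k where k: "k \<in> S" "k \<noteq> l" "k \<noteq> r" by auto
      have "a l \<le> a k" "b k \<le> b r" using l r k finS by auto
      then have sub: "{a k<..<b k} \<subseteq> {a l<..<b l} \<union> {a r<..<b r}"
        using l(1) r(1) by (auto simp: S_def)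
      have lr: "l \<in> K - {k}" "r \<in> K - {k}" using l r k by (auto simp: S_def)
      have "?P (K - {k})"
      proof
        have "(\<Union>i\<in>K - {k}. {a i<..<b i}) = (\<Union>i\<in>K. {a i<..<b i})"
          using sub lr by blast
        then show "(\<Union>i\<in>K - {k}. {a i<..<b i}) = (\<Union>i\<in>J. {a i<..<b i})" using K by simp
      qed (use K in auto)
      have "k \<in> K" using k by (simp add: S_def)
      then have "card (K - {k}) < card K" by (rule card_Diff1_less[OF finK])
      with least[OF \<open>?P (K - {k})\<close>] show False by simp
    qed
  qed (use K in auto)
qed

text \<open>
  The set \<open>W\<close> is the union of the intervals on which \<open>\<nu> < c \<kappa>\<close>. A countable subfamily has the same
  union, and each finite subfamily can be thinned out to overlap at most \<open>2\<close>, which costs the factor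
  \<open>2\<close>. This argument, special to dimension one, replaces a covering theorem.
\<close>

lemma maximal_inequality:
  fixes \<kappa> \<nu> :: "real measure" and c :: ennreal
  assumes sets_\<kappa>[measurable_cong]: "sets \<kappa> = sets borel" and sets_\<nu>[measurable_cong]: "sets \<nu> = sets borel"
  obtains W where "open W" "emeasure \<nu> W \<le> 2 * c * emeasure \<kappa> UNIV"
    "\<And>s r. 0 < r \<Longrightarrow> s \<notin> W \<Longrightarrow> c * emeasure \<kappa> {s-r<..<s+r} \<le> emeasure \<nu> {s-r<..<s+r}"
proof -
  define F where "F = {I. \<exists>s r. 0 < r \<and> I = {s-r<..<s+r} \<and> emeasure \<nu> I < c * emeasure \<kappa> I}"
  have openF: "open I" if "I \<in> F" for I using that by (auto simp: F_def)
  then obtain F' where F': "F' \<subseteq> F" "countable F'" "\<Union>F' = \<Union>F" by (rule Lindelof[of F])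
  have fin_bound: "emeasure \<nu> (\<Union>J) \<le> 2 * c * emeasure \<kappa> UNIV" if J: "finite J" "J \<subseteq> F" for J
  proof -
    have "\<forall>I\<in>J. \<exists>p. I = {fst p<..<snd p}"
    proof
      fix I assume "I \<in> J"
      then obtain s r where "I = {s-r<..<s+r}" using J(2) unfolding F_def by blast
      then show "\<exists>p. I = {fst p<..<snd p}" by (intro exI[of _ "(s-r, s+r)"]) simp
    qed
    from bchoice[OF this] obtain p where p: "\<forall>I\<in>J. I = {fst (p I)<..<snd (p I)}" ..
    define a b where "a I = fst (p I)" and "b I = snd (p I)" for I
    have ab: "I = {a I<..<b I}" "emeasure \<nu> {a I<..<b I} \<le> c * emeasure \<kappa> {a I<..<b I}" if "I \<in> J" for I
    proof -
      show eq: "I = {a I<..<b I}" using p that unfolding a_def b_def by (rule bspec)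
      have "emeasure \<nu> I < c * emeasure \<kappa> I" using J(2) that unfolding F_def by blast
      then show "emeasure \<nu> {a I<..<b I} \<le> c * emeasure \<kappa> {a I<..<b I}" unfolding eq[symmetric] by simp
    qed
    obtain K where K: "K \<subseteq> J" "(\<Union>i\<in>K. {a i<..<b i}) = (\<Union>i\<in>J. {a i<..<b i})"
      and ov: "\<And>x. card {i \<in> K. x \<in> {a i<..<b i}} \<le> 2"
      by (rule interval_subcover_overlap_le_2[OF J(1), of a b]) (rule that; assumption)
    have finK: "finite K" using K(1) J(1) finite_subset by blast
    have "(\<Union>i\<in>J. {a i<..<b i}) = (\<Union>i\<in>J. i)"
      by (rule SUP_cong[OF refl]) (rule ab(1)[symmetric])
    then have UJ: "\<Union>J = (\<Union>i\<in>K. {a i<..<b i})" using K(2) by simp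
    have "emeasure \<nu> (\<Union>J) \<le> (\<Sum>i\<in>K. emeasure \<nu> {a i<..<b i})"
      unfolding UJ by (rule emeasure_subadditive_finite[OF finK]) auto
    also have "\<dots> \<le> (\<Sum>i\<in>K. c * emeasure \<kappa> {a i<..<b i})"
      using ab(2) K(1) by (intro sum_mono) blast
    also have "\<dots> = c * (\<Sum>i\<in>K. \<integral>\<^sup>+x. indicator {a i<..<b i} x \<partial>\<kappa>)"
      by (simp add: sum_distrib_left)
    finally have 1: "emeasure \<nu> (\<Union>J) \<le> c * (\<Sum>i\<in>K. \<integral>\<^sup>+x. indicator {a i<..<b i} x \<partial>\<kappa>)" .
    have "(\<Sum>i\<in>K. \<integral>\<^sup>+x. indicator {a i<..<b i} x \<partial>\<kappa>) = (\<integral>\<^sup>+x. (\<Sum>i\<in>K. indicator {a i<..<b i} x) \<partial>\<kappa>)"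
      by (rule nn_integral_sum[symmetric]) auto
    also have "\<dots> \<le> (\<integral>\<^sup>+x. 2 \<partial>\<kappa>)"
    proof (rule nn_integral_mono)
      fix x
      have "(\<Sum>i\<in>K. indicator {a i<..<b i} x) = (of_nat (card {i \<in> K. x \<in> {a i<..<b i}}) :: ennreal)"
        using finK by (simp add: indicator_def sum_of_bool_eq Int_def)
      also have "\<dots> \<le> of_nat 2" by (rule of_nat_mono[OF ov])
      finally show "(\<Sum>i\<in>K. indicator {a i<..<b i} x) \<le> (2::ennreal)" by simp
    qed
    also have "\<dots> = 2 * emeasure \<kappa> UNIV" using sets_eq_imp_space_eq[OF sets_\<kappa>] by simp
    finally have "c * (\<Sum>i\<in>K. \<integral>\<^sup>+x. indicator {a i<..<b i} x \<partial>\<kappa>) \<le> c * (2 * emeasure \<kappa> UNIV)"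
      by (rule mult_left_mono) simp
    with 1 show ?thesis by (simp add: ac_simps)
  qed
  show ?thesis
  proof (rule that)
    show "open (\<Union>F)" by (auto simp: F_def)
    show "emeasure \<nu> (\<Union>F) \<le> 2 * c * emeasure \<kappa> UNIV"
    proof (cases "F' = {}")
      case True
      then have "\<Union>F = {}" using F'(3) by simp
      then show ?thesis by (simp only: emeasure_empty zero_le)
    next
      case False
      define A where "A n = \<Union>(from_nat_into F' ` {..<n})" for n
      have UA: "\<Union>F = (\<Union>n. A n)"
      proof -
        have "\<Union>F' = \<Union>(range (from_nat_into F'))" using range_from_nat_into[OF False F'(2)] by simp
        also have "\<dots> = (\<Union>n. A n)" unfolding A_def by auto
        finally show ?thesis using F'(3) by simp
      qed
      have mA: "A n \<in> sets \<nu>" for n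
      proof -
        have "open (A n)" unfolding A_def using from_nat_into[OF False] F'(1) openF by blast
        then show ?thesis using sets_\<nu> by simp
      qed
      have "(SUP n. emeasure \<nu> (A n)) = emeasure \<nu> (\<Union>n. A n)"
      proof (rule SUP_emeasure_incseq)
        show "range A \<subseteq> sets \<nu>" using mA by auto
        have "{..<m} \<subseteq> {..<n}" if "m \<le> n" for m n :: nat using that by auto
        then show "incseq A" unfolding incseq_def A_def by (intro allI impI Union_mono image_mono) blast
      qed
      moreover have "emeasure \<nu> (A n) \<le> 2 * c * emeasure \<kappa> UNIV" for n
        unfolding A_def by (rule fin_bound) (use from_nat_into[OF False] F'(1) in auto)
      then have "(SUP n. emeasure \<nu> (A n)) \<le> 2 * c * emeasure \<kappa> UNIV" by (rule SUP_least)
      ultimately show ?thesis unfolding UA by simp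
    qed
    fix s r :: real assume r: "0 < r" and s: "s \<notin> \<Union>F"
    have "s \<in> {s-r<..<s+r}" using r by simp
    then have "{s-r<..<s+r} \<notin> F" using s by blast
    then show "c * emeasure \<kappa> {s-r<..<s+r} \<le> emeasure \<nu> {s-r<..<s+r}"
      using r unfolding F_def by (metis (mono_tags, lifting) mem_Collect_eq not_le)
  qed
qed

section \<open>Poisson integrals of measures\<close>

text \<open>
  The integral is unnormalised: the Poisson kernel proper has an additional factor \<open>1 / \<pi>\<close>, which
  cancels in the quotients considered here. Values are taken in the extended nonnegative reals so that
  finiteness is a separate question.
\<close>

definition poisson_integral :: "real measure \<Rightarrow> real \<Rightarrow> real \<Rightarrow> ennreal" where
  "poisson_integral \<kappa> \<epsilon> s = (\<integral>\<^sup>+t. ennreal (\<epsilon> / ((s - t)\<^sup>2 + \<epsilon>\<^sup>2)) \<partial>\<kappa>)"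

text \<open>
  This is weaker than integrability of \<open>1 / (1 + |t|)\<close>, so that Lebesgue measure is included.
\<close>

definition poisson_finite :: "real measure \<Rightarrow> bool" where
  "poisson_finite \<kappa> \<longleftrightarrow> sets \<kappa> = sets borel \<and> (\<integral>\<^sup>+t. ennreal (1 / (1 + t\<^sup>2)) \<partial>\<kappa>) < \<infinity>"

lemma poisson_finite_interval:
  assumes "poisson_finite \<kappa>"
  shows "emeasure \<kappa> {-real n..real n} < \<infinity>"
proof -
  have [measurable_cong]: "sets \<kappa> = sets borel" using assms by (simp add: poisson_finite_def)
  have "emeasure \<kappa> {-real n..real n} = (\<integral>\<^sup>+t. indicator {-real n..real n} t \<partial>\<kappa>)" by simp
  also have "\<dots> \<le> (\<integral>\<^sup>+t. ennreal (1 + (real n)\<^sup>2) * ennreal (1 / (1 + t\<^sup>2)) \<partial>\<kappa>)"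
  proof (rule nn_integral_mono)
    fix t :: real
    show "indicator {-real n..real n} t \<le> ennreal (1 + (real n)\<^sup>2) * ennreal (1 / (1 + t\<^sup>2))"
    proof (cases "t \<in> {-real n..real n}")
      case True
      then have "t\<^sup>2 \<le> (real n)\<^sup>2" by (auto simp: abs_le_square_iff[symmetric])
      then have "ennreal 1 \<le> ennreal ((1 + (real n)\<^sup>2) * (1 / (1 + t\<^sup>2)))"
        by (intro ennreal_leI) (simp add: field_simps add_pos_nonneg)
      also have "\<dots> = ennreal (1 + (real n)\<^sup>2) * ennreal (1 / (1 + t\<^sup>2))"
        by (rule ennreal_mult) auto
      finally show ?thesis using True by simp
    qed simp
  qed
  also have "\<dots> = ennreal (1 + (real n)\<^sup>2) * (\<integral>\<^sup>+t. ennreal (1 / (1 + t\<^sup>2)) \<partial>\<kappa>)"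
    by (rule nn_integral_cmult) measurable
  also have "\<dots> < \<infinity>" using assms by (simp add: poisson_finite_def ennreal_mult_less_top)
  finally show ?thesis .
qed

lemma poisson_finite_sigma_finite:
  assumes "poisson_finite \<kappa>"
  shows "sigma_finite_measure \<kappa>"
proof
  have s: "sets \<kappa> = sets borel" using assms by (simp add: poisson_finite_def)
  have "(\<Union>n::nat. {-real n..real n}) = UNIV"
  proof -
    have "\<exists>n::nat. -real n \<le> x \<and> x \<le> real n" for x
    proof -
      obtain n :: nat where "\<bar>x\<bar> \<le> real n" using real_arch_simple by blast
      then show ?thesis by (intro exI[of _ n]) linarith
    qed
    then show ?thesis by auto
  qed
  then show "\<exists>A. countable A \<and> A \<subseteq> sets \<kappa> \<and> \<Union> A = space \<kappa> \<and> (\<forall>a\<in>A. emeasure \<kappa> a \<noteq> \<infinity>)"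
    using poisson_finite_interval[OF assms] s sets_eq_imp_space_eq[OF s]
    by (intro exI[of _ "range (\<lambda>n::nat. {-real n..real n})"]) (auto simp: less_top)
qed

text \<open>
  One inequality for two purposes: with \<open>q = (s - t)\<^sup>2 + d\<^sup>2\<close> it bounds the Poisson kernel at height \<open>d\<close>, and
  for \<open>|s - t| \<ge> d\<close> it bounds the kernel at every height.
\<close>

lemma poisson_kernel_comparison:
  fixes s t d :: real
  assumes "0 < d" "d\<^sup>2 \<le> q" "(s - t)\<^sup>2 \<le> q"
  shows "1 + t\<^sup>2 \<le> ((1 + 2 * s\<^sup>2) / d\<^sup>2 + 2) * q"
proof -
  have "t\<^sup>2 \<le> 2 * (s - t)\<^sup>2 + 2 * s\<^sup>2"
    using sum_squares_bound[of "s - t" "-s"] by (simp add: power2_eq_square algebra_simps)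
  moreover have "(1 + 2 * s\<^sup>2) * 1 \<le> (1 + 2 * s\<^sup>2) * (q / d\<^sup>2)"
    using assms by (intro mult_left_mono) (auto simp: field_simps)
  moreover have "(1 + 2 * s\<^sup>2) * 1 = 1 + 2 * s\<^sup>2" by simp
  ultimately have "1 + t\<^sup>2 \<le> 2 * q + (1 + 2 * s\<^sup>2) * (q / d\<^sup>2)" using assms(3) by linarith
  also have "\<dots> = ((1 + 2 * s\<^sup>2) / d\<^sup>2 + 2) * q" by (simp add: distrib_right)
  finally show ?thesis .
qed

lemma poisson_integral_finite:
  assumes "poisson_finite \<kappa>" "0 < \<epsilon>"
  shows "poisson_integral \<kappa> \<epsilon> s < \<infinity>"
proof -
  have [measurable_cong]: "sets \<kappa> = sets borel" using assms by (simp add: poisson_finite_def)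
  define C where "C = \<epsilon> * ((1 + 2 * s\<^sup>2) / \<epsilon>\<^sup>2 + 2)"
  have C: "0 \<le> C" using assms by (simp add: C_def)
  have "poisson_integral \<kappa> \<epsilon> s \<le> (\<integral>\<^sup>+t. ennreal C * ennreal (1 / (1 + t\<^sup>2)) \<partial>\<kappa>)"
    unfolding poisson_integral_def
  proof (rule nn_integral_mono)
    fix t
    have p: "0 < (s - t)\<^sup>2 + \<epsilon>\<^sup>2" "0 < 1 + t\<^sup>2" using assms by (simp_all add: add_nonneg_pos add_pos_nonneg)
    have "\<epsilon> * (1 + t\<^sup>2) \<le> C * ((s - t)\<^sup>2 + \<epsilon>\<^sup>2)"
      unfolding C_def mult.assoc
      using poisson_kernel_comparison[of \<epsilon> "(s - t)\<^sup>2 + \<epsilon>\<^sup>2" s t] assms by (intro mult_left_mono) auto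
    then have "\<epsilon> / ((s - t)\<^sup>2 + \<epsilon>\<^sup>2) \<le> C * (1 / (1 + t\<^sup>2))"
      using p by (simp add: divide_simps mult.commute)
    then show "ennreal (\<epsilon> / ((s - t)\<^sup>2 + \<epsilon>\<^sup>2)) \<le> ennreal C * ennreal (1 / (1 + t\<^sup>2))"
      using C by (simp flip: ennreal_mult' add: ennreal_leI)
  qed
  also have "\<dots> = ennreal C * (\<integral>\<^sup>+t. ennreal (1 / (1 + t\<^sup>2)) \<partial>\<kappa>)"
    by (rule nn_integral_cmult) measurable
  also have "\<dots> < \<infinity>" using assms by (simp add: poisson_finite_def ennreal_mult_less_top)
  finally show ?thesis .
qed

text \<open>
  The superlevel sets of the Poisson kernel are intervals centred at \<open>s\<close>, so a Poisson integral is a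
  superposition of the measures of such intervals.
\<close>

lemma poisson_integral_layer_cake:
  assumes sets[measurable_cong]: "sets \<kappa> = sets borel" and sf: "sigma_finite_measure \<kappa>" and \<epsilon>: "0 < \<epsilon>"
  shows "poisson_integral \<kappa> \<epsilon> s =
    (\<integral>\<^sup>+u. (if 0 < u \<and> u * \<epsilon> < 1 then emeasure \<kappa> {s - sqrt (\<epsilon> / u - \<epsilon>\<^sup>2)<..<s + sqrt (\<epsilon> / u - \<epsilon>\<^sup>2)} else 0) \<partial>lborel)"
proof -
  interpret sigma_finite_measure \<kappa> by (rule sf)
  interpret P: pair_sigma_finite \<kappa> lborel by standard
  define g where "g t = \<epsilon> / ((s - t)\<^sup>2 + \<epsilon>\<^sup>2)" for t
  have g: "0 \<le> g t" for t using \<epsilon> by (simp add: g_def)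
  have [measurable]: "g \<in> borel_measurable borel" unfolding g_def by measurable
  have "poisson_integral \<kappa> \<epsilon> s = (\<integral>\<^sup>+t. (\<integral>\<^sup>+u. indicator {0<..<g t} u \<partial>lborel) \<partial>\<kappa>)"
    unfolding poisson_integral_def using g by (simp add: g_def[symmetric])
  also have "\<dots> = (\<integral>\<^sup>+t. (\<integral>\<^sup>+u. (if 0 < u \<and> u < g t then 1 else 0) \<partial>lborel) \<partial>\<kappa>)"
    by (intro nn_integral_cong) (auto simp: indicator_def)
  also have "\<dots> = (\<integral>\<^sup>+u. (\<integral>\<^sup>+t. (if 0 < u \<and> u < g t then 1 else 0) \<partial>\<kappa>) \<partial>lborel)"
    by (rule P.Fubini'[symmetric]) measurable
  also have "\<dots> = (\<integral>\<^sup>+u. (if 0 < u \<and> u * \<epsilon> < 1 then emeasure \<kappa> {s - sqrt (\<epsilon> / u - \<epsilon>\<^sup>2)<..<s + sqrt (\<epsilon> / u - \<epsilon>\<^sup>2)} else 0) \<partial>lborel)"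
  proof (rule nn_integral_cong)
    fix u :: real
    have lt: "u < g t \<longleftrightarrow> (s - t)\<^sup>2 < \<epsilon> / u - \<epsilon>\<^sup>2" if "0 < u" for t
    proof -
      have "0 < (s - t)\<^sup>2 + \<epsilon>\<^sup>2" using \<epsilon> by (simp add: add_nonneg_pos)
      then show ?thesis using that by (auto simp: g_def field_simps)
    qed
    have iff: "(s - t)\<^sup>2 < q \<longleftrightarrow> t \<in> {s - sqrt q<..<s + sqrt q}" for t q
    proof -
      have "(s - t)\<^sup>2 < q \<longleftrightarrow> \<bar>s - t\<bar> < sqrt q" by (metis real_sqrt_abs real_sqrt_less_iff)
      also have "\<dots> \<longleftrightarrow> t \<in> {s - sqrt q<..<s + sqrt q}" by auto
      finally show ?thesis .
    qed
    show "(\<integral>\<^sup>+t. (if 0 < u \<and> u < g t then 1 else 0) \<partial>\<kappa>) =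
      (if 0 < u \<and> u * \<epsilon> < 1 then emeasure \<kappa> {s - sqrt (\<epsilon> / u - \<epsilon>\<^sup>2)<..<s + sqrt (\<epsilon> / u - \<epsilon>\<^sup>2)} else 0)"
    proof (cases "0 < u")
      case True
      define q where "q = \<epsilon> / u - \<epsilon>\<^sup>2"
      have "(\<integral>\<^sup>+t. (if 0 < u \<and> u < g t then 1 else 0) \<partial>\<kappa>) = (\<integral>\<^sup>+t. indicator {s - sqrt q<..<s + sqrt q} t \<partial>\<kappa>)"
        by (intro nn_integral_cong) (use True lt iff in \<open>auto simp: q_def indicator_def\<close>)
      also have "\<dots> = emeasure \<kappa> {s - sqrt q<..<s + sqrt q}" by simp
      finally have *: "(\<integral>\<^sup>+t. (if 0 < u \<and> u < g t then 1 else 0) \<partial>\<kappa>) = emeasure \<kappa> {s - sqrt q<..<s + sqrt q}" .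
      show ?thesis
      proof (cases "u * \<epsilon> < 1")
        case False
        then have "q \<le> 0" using True \<epsilon> by (simp add: q_def field_simps power2_eq_square)
        then have "{s - sqrt q<..<s + sqrt q} = {}" by auto
        then show ?thesis using * False by simp
      qed (use * True in \<open>simp add: q_def\<close>)
    qed simp
  qed
  finally show ?thesis .
qed

text \<open>
  By the layer cake formula a comparison of two measures on centred intervals passes to their Poisson
  integrals. This links the maximal inequality to harmonic functions.
\<close>

lemma poisson_integral_le:
  assumes "sets \<kappa> = sets borel" "sigma_finite_measure \<kappa>" "sets \<nu> = sets borel" "sigma_finite_measure \<nu>" and \<epsilon>: "0 < \<epsilon>"
    and le: "\<And>r. 0 < r \<Longrightarrow> c * emeasure \<kappa> {s-r<..<s+r} \<le> emeasure \<nu> {s-r<..<s+r}"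
  shows "c * poisson_integral \<kappa> \<epsilon> s \<le> poisson_integral \<nu> \<epsilon> s"
proof -
  note [measurable_cong] = assms(1)
  interpret sigma_finite_measure \<kappa> by (rule assms(2))
  let ?I = "\<lambda>u. {s - sqrt (\<epsilon> / u - \<epsilon>\<^sup>2)<..<s + sqrt (\<epsilon> / u - \<epsilon>\<^sup>2)}"
  have "(\<lambda>u. \<integral>\<^sup>+t. (if s - sqrt (\<epsilon> / u - \<epsilon>\<^sup>2) < t \<and> t < s + sqrt (\<epsilon> / u - \<epsilon>\<^sup>2) then 1 else 0) \<partial>\<kappa>) \<in> borel_measurable borel"
    by measurable
  also have "(\<lambda>u. \<integral>\<^sup>+t. (if s - sqrt (\<epsilon> / u - \<epsilon>\<^sup>2) < t \<and> t < s + sqrt (\<epsilon> / u - \<epsilon>\<^sup>2) then 1 else 0) \<partial>\<kappa>) = (\<lambda>u. emeasure \<kappa> (?I u))"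
  proof
    fix u
    have "(\<integral>\<^sup>+t. (if s - sqrt (\<epsilon> / u - \<epsilon>\<^sup>2) < t \<and> t < s + sqrt (\<epsilon> / u - \<epsilon>\<^sup>2) then 1 else 0) \<partial>\<kappa>) = (\<integral>\<^sup>+t. indicator (?I u) t \<partial>\<kappa>)"
      by (intro nn_integral_cong) (simp add: indicator_def)
    then show "(\<integral>\<^sup>+t. (if s - sqrt (\<epsilon> / u - \<epsilon>\<^sup>2) < t \<and> t < s + sqrt (\<epsilon> / u - \<epsilon>\<^sup>2) then 1 else 0) \<partial>\<kappa>) = emeasure \<kappa> (?I u)" by simp
  qed
  finally have [measurable]: "(\<lambda>u. emeasure \<kappa> (?I u)) \<in> borel_measurable borel" .
  have "c * poisson_integral \<kappa> \<epsilon> s = (\<integral>\<^sup>+u. c * (if 0 < u \<and> u * \<epsilon> < 1 then emeasure \<kappa> (?I u) else 0) \<partial>lborel)"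
    unfolding poisson_integral_layer_cake[OF assms(1,2) \<epsilon>]
    by (rule nn_integral_cmult[symmetric]) measurable
  also have "\<dots> \<le> (\<integral>\<^sup>+u. (if 0 < u \<and> u * \<epsilon> < 1 then emeasure \<nu> (?I u) else 0) \<partial>lborel)"
  proof (rule nn_integral_mono)
    fix u :: real
    have "0 < sqrt (\<epsilon> / u - \<epsilon>\<^sup>2)" if "0 < u" "u * \<epsilon> < 1"
      using that \<epsilon> by (simp add: field_simps power2_eq_square)
    then show "c * (if 0 < u \<and> u * \<epsilon> < 1 then emeasure \<kappa> (?I u) else 0) \<le> (if 0 < u \<and> u * \<epsilon> < 1 then emeasure \<nu> (?I u) else 0)"
      using le by simp
  qed
  also have "\<dots> = poisson_integral \<nu> \<epsilon> s"
    unfolding poisson_integral_layer_cake[OF assms(3,4) \<epsilon>] ..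
  finally show ?thesis .
qed

section \<open>Ratios of Poisson integrals converge to the density\<close>

lemma AE_outside_of_small_sets:
  fixes C :: real
  assumes W: "\<And>k::nat. W k \<in> sets \<nu>" and C: "0 \<le> C"
    and le: "\<And>k. emeasure \<nu> (W k) \<le> ennreal (C / (real k + 1))"
  shows "AE s in \<nu>. \<exists>k. s \<notin> W k"
proof (rule AE_I)
  show "{s \<in> space \<nu>. \<not> (\<exists>k. s \<notin> W k)} \<subseteq> (\<Inter>k. W k)" by auto
  show mI: "(\<Inter>k. W k) \<in> sets \<nu>" using W by auto
  have "(\<lambda>k. C / (real k + 1)) \<longlonglongrightarrow> 0" 
    using tendsto_mult_right_zero[OF LIMSEQ_inverse_real_of_nat, of C] by (simp add: divide_inverse add.commute)
  then have "(\<lambda>k. ennreal (C / (real k + 1))) \<longlonglongrightarrow> ennreal 0" by (rule tendsto_ennrealI)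
  moreover have "emeasure \<nu> (\<Inter>k. W k) \<le> ennreal (C / (real k + 1))" for k
    using emeasure_mono[of "\<Inter>k. W k" "W k" \<nu>] W le[of k] by (meson INT_lower UNIV_I order_trans)
  ultimately have "emeasure \<nu> (\<Inter>k. W k) \<le> ennreal 0"
    by (intro LIMSEQ_le_const) auto
  then show "emeasure \<nu> (\<Inter>k. W k) = 0" by simp
qed

lemma ennreal_2_mult:
  assumes "0 \<le> c" "0 \<le> x"
  shows "2 * ennreal c * ennreal x = ennreal (2 * c * x)"
  using assms by (simp add: ennreal_mult)

text \<open>
  Compare with Lebesgue measure on a bounded interval, whose Poisson integral is at least \<open>1\<close> for small
  heights: outside a \<open>\<nu>\<close>-null set the maximal inequality bounds it by a multiple of that of \<open>\<nu>\<close>.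
\<close>

lemma poisson_integral_bounded_below:
  assumes \<nu>: "poisson_finite \<nu>"
  shows "AE s in \<nu>. \<exists>c>0. \<forall>\<epsilon>. 0 < \<epsilon> \<and> \<epsilon> < 1 \<longrightarrow> ennreal c \<le> poisson_integral \<nu> \<epsilon> s"
proof -
  have sets[measurable_cong]: "sets \<nu> = sets borel" using \<nu> by (simp add: poisson_finite_def)
  have "AE s in \<nu>. \<bar>s\<bar> < real n \<longrightarrow> (\<exists>c>0. \<forall>\<epsilon>. 0 < \<epsilon> \<and> \<epsilon> < 1 \<longrightarrow> ennreal c \<le> poisson_integral \<nu> \<epsilon> s)" for n
  proof -
    define \<kappa> where "\<kappa> = density lborel (indicator {-real n - 1..real n + 1})"
    have s\<kappa>: "sets \<kappa> = sets borel" by (simp add: \<kappa>_def)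
    have e\<kappa>: "emeasure \<kappa> UNIV = ennreal (2 * real n + 2)"
      unfolding \<kappa>_def by (simp add: emeasure_density)
    interpret finite_measure \<kappa>
      by standard (use e\<kappa> in \<open>simp add: sets_eq_imp_space_eq[OF s\<kappa>]\<close>)
    have sf: "sigma_finite_measure \<kappa>" by unfold_locales
    have "\<exists>W. open W \<and> emeasure \<nu> W \<le> 2 * ennreal (1 / (real k + 1)) * emeasure \<kappa> UNIV \<and>
      (\<forall>s r. 0 < r \<longrightarrow> s \<notin> W \<longrightarrow> ennreal (1 / (real k + 1)) * emeasure \<kappa> {s-r<..<s+r} \<le> emeasure \<nu> {s-r<..<s+r})" for k :: nat
      by (rule maximal_inequality[OF s\<kappa> sets, of "ennreal (1 / (real k + 1))"]) blast
    then obtain W where W: "\<And>k::nat. open (W k)" 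
      and Wm: "\<And>k. emeasure \<nu> (W k) \<le> 2 * ennreal (1 / (real k + 1)) * emeasure \<kappa> UNIV"
      and Wl: "\<And>k s r. 0 < r \<Longrightarrow> s \<notin> W k \<Longrightarrow> ennreal (1 / (real k + 1)) * emeasure \<kappa> {s-r<..<s+r} \<le> emeasure \<nu> {s-r<..<s+r}"
      by metis
    have "AE s in \<nu>. \<exists>k. s \<notin> W k"
    proof (rule AE_outside_of_small_sets)
      show "W k \<in> sets \<nu>" for k using W sets by simp
      have "2 * ennreal (1 / (real k + 1)) * emeasure \<kappa> UNIV = ennreal (2 * (2 * real n + 2) / (real k + 1))" for k
        unfolding e\<kappa> by (subst ennreal_2_mult) (auto simp: field_simps)
      then show "emeasure \<nu> (W k) \<le> ennreal (2 * (2 * real n + 2) / (real k + 1))" for k using Wm[of k] by simp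
    qed simp
    then show ?thesis
    proof eventually_elim
      case (elim s)
      then obtain k where k: "s \<notin> W k" by blast
      show ?case
      proof
        assume s: "\<bar>s\<bar> < real n"
        show "\<exists>c>0. \<forall>\<epsilon>. 0 < \<epsilon> \<and> \<epsilon> < 1 \<longrightarrow> ennreal c \<le> poisson_integral \<nu> \<epsilon> s"
        proof (intro exI[of _ "1 / (real k + 1)"] conjI allI impI)
          fix \<epsilon> :: real assume \<epsilon>: "0 < \<epsilon> \<and> \<epsilon> < 1"
          have "ennreal 1 = (\<integral>\<^sup>+t. ennreal (1 / (2 * \<epsilon>)) * indicator {s-\<epsilon>..s+\<epsilon>} t \<partial>lborel)"
            using \<epsilon> by (simp add: nn_integral_cmult flip: ennreal_mult')
          also have "\<dots> \<le> (\<integral>\<^sup>+t. indicator {-real n - 1..real n + 1} t * ennreal (\<epsilon> / ((s - t)\<^sup>2 + \<epsilon>\<^sup>2)) \<partial>lborel)"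
          proof (rule nn_integral_mono)
            fix t :: real
            show "ennreal (1 / (2 * \<epsilon>)) * indicator {s-\<epsilon>..s+\<epsilon>} t \<le> indicator {-real n - 1..real n + 1} t * ennreal (\<epsilon> / ((s - t)\<^sup>2 + \<epsilon>\<^sup>2))"
            proof (cases "t \<in> {s-\<epsilon>..s+\<epsilon>}")
              case True
              then have "(s - t)\<^sup>2 \<le> \<epsilon>\<^sup>2" by (intro abs_le_square_iff[THEN iffD1]) auto
              then have "(s - t)\<^sup>2 + \<epsilon>\<^sup>2 \<le> \<epsilon> * (2 * \<epsilon>)" by (simp add: power2_eq_square)
              moreover have "0 < (s - t)\<^sup>2 + \<epsilon>\<^sup>2" using \<epsilon> by (simp add: add_nonneg_pos)
              ultimately have "1 / (2 * \<epsilon>) \<le> \<epsilon> / ((s - t)\<^sup>2 + \<epsilon>\<^sup>2)" using \<epsilon> by (simp add: divide_simps)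
              moreover have "t \<in> {-real n - 1..real n + 1}" using True s \<epsilon> by auto
              ultimately show ?thesis using True by (simp add: ennreal_leI)
            qed simp
          qed
          also have "\<dots> = poisson_integral \<kappa> \<epsilon> s"
            unfolding poisson_integral_def \<kappa>_def by (rule nn_integral_density[symmetric]) auto
          finally have "ennreal (1 / (real k + 1)) * ennreal 1 \<le> ennreal (1 / (real k + 1)) * poisson_integral \<kappa> \<epsilon> s"
            by (rule mult_left_mono) simp
          also have "\<dots> \<le> poisson_integral \<nu> \<epsilon> s"
            by (rule poisson_integral_le[OF s\<kappa> sf sets poisson_finite_sigma_finite[OF \<nu>]]) (use \<epsilon> Wl k in auto)
          finally show "ennreal (1 / (real k + 1)) \<le> poisson_integral \<nu> \<epsilon> s" by simp
        qed simp
      qed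
    qed
  qed
  then have "AE s in \<nu>. \<forall>n::nat. \<bar>s\<bar> < real n \<longrightarrow> (\<exists>c>0. \<forall>\<epsilon>. 0 < \<epsilon> \<and> \<epsilon> < 1 \<longrightarrow> ennreal c \<le> poisson_integral \<nu> \<epsilon> s)"
    unfolding AE_all_countable by blast
  then show ?thesis
  proof eventually_elim
    case (elim s)
    obtain n :: nat where "\<bar>s\<bar> < real n" using reals_Archimedean2 by blast
    with elim show ?case by blast
  qed
qed

text \<open>
  The part of a measure away from \<open>s\<close> contributes only \<open>O(\<epsilon>)\<close>.
\<close>

lemma poisson_integral_far:
  assumes \<kappa>: "poisson_finite \<kappa>" and U: "open U" "s \<in> U"
  obtains C where "0 \<le> C" "\<And>\<epsilon>. 0 < \<epsilon> \<Longrightarrow> poisson_integral \<kappa> \<epsilon> s \<le> poisson_integral (density \<kappa> (indicator U)) \<epsilon> s + ennreal (\<epsilon> * C)"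
proof -
  have [measurable_cong]: "sets \<kappa> = sets borel" using \<kappa> by (simp add: poisson_finite_def)
  have [measurable]: "U \<in> sets borel" using U by simp
  obtain d where d: "0 < d" "ball s d \<subseteq> U" using U openE by blast
  define K where "K = (1 + 2 * s\<^sup>2) / d\<^sup>2 + 2"
  have K: "0 \<le> K" by (simp add: K_def)
  define I where "I = (\<integral>\<^sup>+t. ennreal (1 / (1 + t\<^sup>2)) \<partial>\<kappa>)"
  have I: "I < \<infinity>" using \<kappa> by (simp add: poisson_finite_def I_def)
  show ?thesis
  proof (rule that)
    show "0 \<le> K * enn2real I" using K by simp
    fix \<epsilon> :: real assume \<epsilon>: "0 < \<epsilon>"
    let ?p = "\<lambda>t. ennreal (\<epsilon> / ((s - t)\<^sup>2 + \<epsilon>\<^sup>2))"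
    have "poisson_integral \<kappa> \<epsilon> s \<le> (\<integral>\<^sup>+t. indicator U t * ?p t + ennreal (\<epsilon> * K) * ennreal (1 / (1 + t\<^sup>2)) \<partial>\<kappa>)"
      unfolding poisson_integral_def
    proof (rule nn_integral_mono)
      fix t
      show "?p t \<le> indicator U t * ?p t + ennreal (\<epsilon> * K) * ennreal (1 / (1 + t\<^sup>2))"
      proof (cases "t \<in> U")
        case False
        then have "t \<notin> ball s d" using d by blast
        then have "d \<le> \<bar>s - t\<bar>" by (simp add: dist_real_def)
        then have d2: "d\<^sup>2 \<le> (s - t)\<^sup>2" using d by (simp add: abs_le_square_iff[symmetric])
        have pos: "0 < (s - t)\<^sup>2 + \<epsilon>\<^sup>2" "0 < 1 + t\<^sup>2" using \<epsilon> by (simp_all add: add_nonneg_pos add_pos_nonneg)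
        have "1 + t\<^sup>2 \<le> K * ((s - t)\<^sup>2 + \<epsilon>\<^sup>2)"
          unfolding K_def by (rule poisson_kernel_comparison) (use d d2 in \<open>auto intro: add_increasing2\<close>)
        then have "\<epsilon> * (1 + t\<^sup>2) \<le> \<epsilon> * K * ((s - t)\<^sup>2 + \<epsilon>\<^sup>2)" using \<epsilon> by simp
        then have "\<epsilon> / ((s - t)\<^sup>2 + \<epsilon>\<^sup>2) \<le> \<epsilon> * K * (1 / (1 + t\<^sup>2))" using pos by (simp add: divide_simps)
        then have "?p t \<le> ennreal (\<epsilon> * K * (1 / (1 + t\<^sup>2)))" by (rule ennreal_leI)
        also have "\<dots> = ennreal (\<epsilon> * K) * ennreal (1 / (1 + t\<^sup>2))" by (rule ennreal_mult) (use \<epsilon> K in auto)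
        finally show ?thesis using False by simp
      qed simp
    qed
    also have "\<dots> = (\<integral>\<^sup>+t. indicator U t * ?p t \<partial>\<kappa>) + ennreal (\<epsilon> * K) * I"
      by (simp add: nn_integral_add nn_integral_cmult I_def)
    also have "(\<integral>\<^sup>+t. indicator U t * ?p t \<partial>\<kappa>) = poisson_integral (density \<kappa> (indicator U)) \<epsilon> s"
      unfolding poisson_integral_def by (rule nn_integral_density[symmetric]) auto
    also have "ennreal (\<epsilon> * K) * I = ennreal (\<epsilon> * (K * enn2real I))"
    proof -
      have "I = ennreal (enn2real I)" using I by simp
      then have "ennreal (\<epsilon> * K) * I = ennreal (\<epsilon> * K) * ennreal (enn2real I)" by simp
      also have "\<dots> = ennreal (\<epsilon> * K * enn2real I)" by (rule ennreal_mult[symmetric]) (use \<epsilon> K in auto)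
      finally show ?thesis by (simp add: mult.assoc)
    qed
    finally show "poisson_integral \<kappa> \<epsilon> s \<le> poisson_integral (density \<kappa> (indicator U)) \<epsilon> s + ennreal (\<epsilon> * (K * enn2real I))" .
  qed
qed

text \<open>
  If \<open>\<kappa>\<close> does not charge \<open>E\<close>, outer regularity puts \<open>E\<close> into an open set \<open>U\<close> of small \<open>\<kappa>\<close>-measure. Near
  points of \<open>E\<close> only \<open>\<kappa>\<close> restricted to \<open>U\<close> matters up to \<open>O(\<epsilon>)\<close>, which is negligible against the
  Poisson integral of \<open>\<nu>\<close>, and the maximal inequality controls this restriction outside a set of
  small \<open>\<nu>\<close>-measure. Convergence of the quotient to \<open>0\<close> is expressed without division.
\<close>

lemma poisson_ratio_null_set:
  assumes \<kappa>: "poisson_finite \<kappa>" and \<nu>: "poisson_finite \<nu>"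
    and E: "E \<in> sets borel" and null: "emeasure \<kappa> E = 0"
  shows "AE s in \<nu>. s \<in> E \<longrightarrow> (\<forall>j::nat. \<forall>\<^sub>F \<epsilon> in at_right 0. ennreal (real j) * poisson_integral \<kappa> \<epsilon> s \<le> poisson_integral \<nu> \<epsilon> s)"
proof -
  have s\<kappa>[measurable_cong]: "sets \<kappa> = sets borel" and s\<nu>[measurable_cong]: "sets \<nu> = sets borel"
    using \<kappa> \<nu> by (simp_all add: poisson_finite_def)
  have "AE s in \<nu>. s \<in> E \<and> \<bar>s\<bar> < real n \<longrightarrow> (\<forall>\<^sub>F \<epsilon> in at_right 0. ennreal (real j) * poisson_integral \<kappa> \<epsilon> s \<le> poisson_integral \<nu> \<epsilon> s)" for n j :: nat
  proof -
    define \<kappa>n where "\<kappa>n = density \<kappa> (indicator {-real n<..<real n})"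
    have s\<kappa>n[measurable_cong]: "sets \<kappa>n = sets borel" by (simp add: \<kappa>n_def s\<kappa>)
    have e\<kappa>n: "emeasure \<kappa>n A = emeasure \<kappa> ({-real n<..<real n} \<inter> A)" if [measurable]: "A \<in> sets borel" for A
      unfolding \<kappa>n_def by (subst emeasure_density) (auto simp: indicator_inter_arith[symmetric] s\<kappa>)
    have "emeasure \<kappa>n (space \<kappa>n) \<noteq> \<infinity>"
    proof -
      have "emeasure \<kappa>n (space \<kappa>n) = emeasure \<kappa> {-real n<..<real n}"
        using e\<kappa>n[of UNIV] sets_eq_imp_space_eq[OF s\<kappa>n] by simp
      also have "\<dots> \<le> emeasure \<kappa> {-real n..real n}" by (rule emeasure_mono) (auto simp: s\<kappa>)
      finally show ?thesis using poisson_finite_interval[OF \<kappa>, of n] by (auto simp: top_unique)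
    qed
    note outer = outer_regular[OF s\<kappa>n this E]
    have "emeasure \<kappa>n E = 0"
    proof -
      have "emeasure \<kappa>n E \<le> emeasure \<kappa> E" unfolding e\<kappa>n[OF E] by (rule emeasure_mono) (use E in \<open>auto simp: s\<kappa>\<close>)
      then show ?thesis using null by simp
    qed
    with outer have INF0: "(INF U\<in>{U. E \<subseteq> U \<and> open U}. emeasure \<kappa>n U) = 0" by simp
    \<comment> \<open>twice the wanted factor: one half for the part in \<open>U\<close>, one half for the part away from \<open>s\<close>\<close>
    define c where "c = 2 * real j"
    have c: "0 \<le> c" by (simp add: c_def)
    have "\<exists>U. E \<subseteq> U \<and> open U \<and> emeasure \<kappa>n U < ennreal (1 / (real k + 1))" for k :: nat
    proof -
      have "(INF U\<in>{U. E \<subseteq> U \<and> open U}. emeasure \<kappa>n U) < ennreal (1 / (real k + 1))"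
        unfolding INF0 by simp
      then show ?thesis unfolding INF_less_iff by blast
    qed
    then obtain U0 where U0: "\<And>k::nat. E \<subseteq> U0 k" "\<And>k. open (U0 k)" "\<And>k. emeasure \<kappa>n (U0 k) < ennreal (1 / (real k + 1))" by metis
    define U where "U k = {-real n<..<real n} \<inter> U0 k" for k
    have Uo: "open (U k)" for k unfolding U_def using U0(2) by (intro open_Int) auto
    define \<kappa>U where "\<kappa>U k = density \<kappa> (indicator (U k))" for k
    have sU: "sets (\<kappa>U k) = sets borel" for k by (simp add: \<kappa>U_def s\<kappa>)
    have eU: "emeasure (\<kappa>U k) UNIV \<le> ennreal (1 / (real k + 1))" for k
    proof -
      have [measurable]: "U k \<in> sets borel" "U0 k \<in> sets borel" using Uo U0 by auto
      have "emeasure (\<kappa>U k) UNIV = emeasure \<kappa> (U k)"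
        unfolding \<kappa>U_def by (subst emeasure_density) (auto simp: s\<kappa>)
      also have "\<dots> = emeasure \<kappa>n (U0 k)" unfolding U_def by (rule e\<kappa>n[symmetric]) simp
      finally show ?thesis using U0(3)[of k] by simp
    qed
    have sfU: "sigma_finite_measure (\<kappa>U k)" for k
    proof -
      interpret finite_measure "\<kappa>U k"
        by standard (use eU[of k] in \<open>auto simp: sets_eq_imp_space_eq[OF sU] top_unique\<close>)
      show ?thesis by unfold_locales
    qed
    have "\<exists>W. open W \<and> emeasure \<nu> W \<le> 2 * ennreal c * emeasure (\<kappa>U k) UNIV \<and>
      (\<forall>s r. 0 < r \<longrightarrow> s \<notin> W \<longrightarrow> ennreal c * emeasure (\<kappa>U k) {s-r<..<s+r} \<le> emeasure \<nu> {s-r<..<s+r})" for k :: nat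
      by (rule maximal_inequality[OF sU s\<nu>, of "ennreal c" k]) blast
    then obtain W where W: "\<And>k::nat. open (W k)" 
      and Wm: "\<And>k. emeasure \<nu> (W k) \<le> 2 * ennreal c * emeasure (\<kappa>U k) UNIV"
      and Wl: "\<And>k s r. 0 < r \<Longrightarrow> s \<notin> W k \<Longrightarrow> ennreal c * emeasure (\<kappa>U k) {s-r<..<s+r} \<le> emeasure \<nu> {s-r<..<s+r}"
      by metis
    have "AE s in \<nu>. \<exists>k. s \<notin> W k"
    proof (rule AE_outside_of_small_sets)
      show "W k \<in> sets \<nu>" for k using W s\<nu> by simp
      have "2 * ennreal c * ennreal (1 / (real k + 1)) = ennreal (2 * c / (real k + 1))" for k :: nat
        by (subst ennreal_2_mult) (use c in auto)
      moreover have "2 * ennreal c * emeasure (\<kappa>U k) UNIV \<le> 2 * ennreal c * ennreal (1 / (real k + 1))" for k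
        by (rule mult_left_mono[OF eU]) simp
      ultimately show "emeasure \<nu> (W k) \<le> ennreal (2 * c / (real k + 1))" for k
        using Wm[of k] by (metis order_trans)
    qed (use c in simp)
    then show ?thesis using poisson_integral_bounded_below[OF \<nu>]
    proof eventually_elim
      case (elim s)
      then obtain k b where k: "s \<notin> W k" and b: "0 < b" "\<And>\<epsilon>. 0 < \<epsilon> \<and> \<epsilon> < 1 \<Longrightarrow> ennreal b \<le> poisson_integral \<nu> \<epsilon> s" by blast
      show ?case
      proof
        assume s: "s \<in> E \<and> \<bar>s\<bar> < real n"
        then have "s \<in> U k" using U0(1) by (auto simp: U_def)
        from poisson_integral_far[OF \<kappa> Uo this] obtain C where C: "0 \<le> C"
          "\<And>\<epsilon>. 0 < \<epsilon> \<Longrightarrow> poisson_integral \<kappa> \<epsilon> s \<le> poisson_integral (\<kappa>U k) \<epsilon> s + ennreal (\<epsilon> * C)"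
          unfolding \<kappa>U_def by blast
        \<comment> \<open>so small that the \<open>O(\<epsilon>)\<close> term stays below the lower bound \<open>b\<close>; the summands \<open>1\<close> avoid division by zero\<close>
        define e where "e = min 1 (b / (2 * (real j + 1) * (C + 1)))"
        have e: "0 < e" using b C by (simp add: e_def)
        show "\<forall>\<^sub>F \<epsilon> in at_right 0. ennreal (real j) * poisson_integral \<kappa> \<epsilon> s \<le> poisson_integral \<nu> \<epsilon> s"
          using eventually_at_right_real[OF e]
        proof eventually_elim
          case (elim \<epsilon>)
          then have \<epsilon>: "0 < \<epsilon>" "\<epsilon> < 1" "\<epsilon> < b / (2 * (real j + 1) * (C + 1))" by (auto simp: e_def)
          have p1: "ennreal c * poisson_integral (\<kappa>U k) \<epsilon> s \<le> poisson_integral \<nu> \<epsilon> s"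
            by (rule poisson_integral_le[OF sU sfU s\<nu> poisson_finite_sigma_finite[OF \<nu>] \<epsilon>(1)]) (use Wl k in auto)
          have "c * (\<epsilon> * C) \<le> (2 * (real j + 1)) * (\<epsilon> * (C + 1))" unfolding c_def
            using \<epsilon> C by (intro mult_mono) auto
          also have "\<dots> = \<epsilon> * (2 * (real j + 1) * (C + 1))" by (simp add: algebra_simps)
          also have "\<dots> \<le> b" using \<epsilon>(3) C by (simp add: pos_less_divide_eq less_imp_le)
          finally have "ennreal (c * (\<epsilon> * C)) \<le> ennreal b" by (rule ennreal_leI)
          also have "\<dots> \<le> poisson_integral \<nu> \<epsilon> s" using b(2) \<epsilon> by simp
          finally have p2: "ennreal c * ennreal (\<epsilon> * C) \<le> poisson_integral \<nu> \<epsilon> s" using c \<epsilon> C by (simp add: ennreal_mult)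
          have "ennreal c * poisson_integral \<kappa> \<epsilon> s \<le> ennreal c * (poisson_integral (\<kappa>U k) \<epsilon> s + ennreal (\<epsilon> * C))"
            by (rule mult_left_mono[OF C(2)[OF \<epsilon>(1)]]) simp
          also have "\<dots> \<le> poisson_integral \<nu> \<epsilon> s + poisson_integral \<nu> \<epsilon> s"
            unfolding distrib_left by (rule add_mono[OF p1 p2])
          finally have "ennreal c * poisson_integral \<kappa> \<epsilon> s \<le> 2 * poisson_integral \<nu> \<epsilon> s"
            unfolding mult_2 .
          moreover have "ennreal c = 2 * ennreal (real j)" unfolding c_def by (subst ennreal_mult) auto
          ultimately have "2 * (ennreal (real j) * poisson_integral \<kappa> \<epsilon> s) \<le> 2 * poisson_integral \<nu> \<epsilon> s"
            by (simp only: mult.assoc)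
          then show ?case by (subst (asm) ennreal_mult_le_mult_iff) auto
        qed
      qed
    qed
  qed
  then have "AE s in \<nu>. \<forall>n j::nat. s \<in> E \<and> \<bar>s\<bar> < real n \<longrightarrow> (\<forall>\<^sub>F \<epsilon> in at_right 0. ennreal (real j) * poisson_integral \<kappa> \<epsilon> s \<le> poisson_integral \<nu> \<epsilon> s)"
    unfolding AE_all_countable by blast
  then show ?thesis
  proof eventually_elim
    case (elim s)
    obtain n :: nat where "\<bar>s\<bar> < real n" using reals_Archimedean2 by blast
    with elim show ?case by blast
  qed
qed

text \<open>
  The dominating measure is the sum \<open>\<mu> + \<nu>\<close>. Densities with respect to it treat the absolutely
  continuous and the singular part of \<open>\<mu>\<close> at once.
\<close>

lemma common_dominating_measure:
  fixes \<mu> \<nu> :: "real measure"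
  assumes \<mu>: "poisson_finite \<mu>" and \<nu>: "poisson_finite \<nu>"
  obtains \<sigma> a b where "sets \<sigma> = sets borel" "a \<in> borel_measurable borel" "b \<in> borel_measurable borel"
    "\<And>x. 0 \<le> a x" "\<And>x. 0 \<le> b x"
    "\<mu> = density \<sigma> (\<lambda>x. ennreal (a x))" "\<nu> = density \<sigma> (\<lambda>x. ennreal (b x))"
proof -
  have s\<mu>: "sets \<mu> = sets borel" and s\<nu>: "sets \<nu> = sets borel"
    using \<mu> \<nu> by (simp_all add: poisson_finite_def)
  define \<sigma> where "\<sigma> = measure_of UNIV (sets borel) (\<lambda>A. emeasure \<mu> A + emeasure \<nu> A)"
  have sa: "sigma_algebra UNIV (sets (borel::real measure))"
    using sets.sigma_algebra_axioms[of "borel::real measure"] by simp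
  have s\<sigma>: "sets \<sigma> = sets borel"
    unfolding \<sigma>_def using sigma_algebra.sets_measure_of_eq[OF sa] by simp
  have e\<sigma>: "emeasure \<sigma> A = emeasure \<mu> A + emeasure \<nu> A" if "A \<in> sets borel" for A
    unfolding \<sigma>_def
  proof (rule emeasure_measure_of_sigma[OF sa _ _ that])
    show "positive (sets borel) (\<lambda>A. emeasure \<mu> A + emeasure \<nu> A)" by (simp add: positive_def)
    show "countably_additive (sets borel) (\<lambda>A. emeasure \<mu> A + emeasure \<nu> A)"
    proof (rule countably_additiveI)
      fix A :: "nat \<Rightarrow> real set" assume A: "range A \<subseteq> sets borel" "disjoint_family A"
      then have "(\<Sum>i. emeasure \<mu> (A i)) = emeasure \<mu> (\<Union>i. A i)" "(\<Sum>i. emeasure \<nu> (A i)) = emeasure \<nu> (\<Union>i. A i)"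
        using s\<mu> s\<nu> by (auto intro!: suminf_emeasure)
      then show "(\<Sum>i. emeasure \<mu> (A i) + emeasure \<nu> (A i)) = emeasure \<mu> (\<Union>i. A i) + emeasure \<nu> (\<Union>i. A i)"
        by (subst suminf_add[symmetric]) auto
    qed
  qed
  interpret \<sigma>: sigma_finite_measure \<sigma>
  proof
    have "(\<Union>n::nat. {-real n..real n}) = UNIV"
    proof -
      have "\<exists>n::nat. -real n \<le> x \<and> x \<le> real n" for x
      proof -
        obtain n :: nat where "\<bar>x\<bar> \<le> real n" using real_arch_simple by blast
        then show ?thesis by (intro exI[of _ n]) linarith
      qed
      then show ?thesis by auto
    qed
    moreover have "emeasure \<sigma> {-real n..real n} \<noteq> \<infinity>" for n
      using poisson_finite_interval[OF \<mu>, of n] poisson_finite_interval[OF \<nu>, of n] by (auto simp: e\<sigma> less_top)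
    ultimately show "\<exists>A. countable A \<and> A \<subseteq> sets \<sigma> \<and> \<Union> A = space \<sigma> \<and> (\<forall>a\<in>A. emeasure \<sigma> a \<noteq> \<infinity>)"
      using s\<sigma> sets_eq_imp_space_eq[OF s\<sigma>]
      by (intro exI[of _ "range (\<lambda>n::nat. {-real n..real n})"]) auto
  qed
  have dens: "\<exists>a. a \<in> borel_measurable borel \<and> (\<forall>x. 0 \<le> a x) \<and> \<kappa> = density \<sigma> (\<lambda>x. ennreal (a x))"
    if \<kappa>: "poisson_finite \<kappa>" and le: "\<And>A. A \<in> sets borel \<Longrightarrow> emeasure \<kappa> A \<le> emeasure \<sigma> A" for \<kappa>
  proof -
    have s\<kappa>: "sets \<kappa> = sets borel" using \<kappa> by (simp add: poisson_finite_def)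
    have ac: "absolutely_continuous \<sigma> \<kappa>"
    proof -
      have "emeasure \<kappa> A = 0" if "A \<in> sets borel" "emeasure \<sigma> A = 0" for A using le[OF that(1)] that(2) by simp
      then show ?thesis unfolding absolutely_continuous_def using s\<kappa> s\<sigma> by (auto simp: null_sets_def)
    qed
    have RNm: "RN_deriv \<sigma> \<kappa> \<in> borel_measurable borel"
      using borel_measurable_RN_deriv[of \<sigma> \<kappa>] unfolding measurable_cong_sets[OF s\<sigma> refl] .
    have "AE x in \<sigma>. RN_deriv \<sigma> \<kappa> x \<noteq> \<infinity>"
      by (rule \<sigma>.RN_deriv_finite) (use ac s\<kappa> s\<sigma> poisson_finite_sigma_finite[OF \<kappa>] in auto)
    then have "density \<sigma> (\<lambda>x. ennreal (enn2real (RN_deriv \<sigma> \<kappa> x))) = density \<sigma> (RN_deriv \<sigma> \<kappa>)"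
      by (intro density_cong) (auto simp: less_top elim!: eventually_mono)
    also have "\<dots> = \<kappa>" by (rule \<sigma>.density_RN_deriv) (use ac s\<kappa> s\<sigma> in auto)
    finally have "\<kappa> = density \<sigma> (\<lambda>x. ennreal (enn2real (RN_deriv \<sigma> \<kappa> x)))" by simp
    moreover have "(\<lambda>x. enn2real (RN_deriv \<sigma> \<kappa> x)) \<in> borel_measurable borel"
      by (rule borel_measurable_enn2real[OF RNm])
    ultimately show ?thesis by (intro exI[of _ "\<lambda>x. enn2real (RN_deriv \<sigma> \<kappa> x)"]) simp
  qed
  obtain a where "a \<in> borel_measurable borel" "\<And>x. 0 \<le> a x" "\<mu> = density \<sigma> (\<lambda>x. ennreal (a x))"
    using dens[OF \<mu>] e\<sigma> by auto
  moreover obtain b where "b \<in> borel_measurable borel" "\<And>x. 0 \<le> b x" "\<nu> = density \<sigma> (\<lambda>x. ennreal (b x))"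
    using dens[OF \<nu>] e\<sigma> by auto
  ultimately show ?thesis using that s\<sigma> by blast
qed

lemma poisson_integral_density:
  assumes [measurable_cong]: "sets \<sigma> = sets borel" and [measurable]: "f \<in> borel_measurable borel"
  shows "poisson_integral (density \<sigma> f) \<epsilon> s = (\<integral>\<^sup>+t. f t * ennreal (\<epsilon> / ((s - t)\<^sup>2 + \<epsilon>\<^sup>2)) \<partial>\<sigma>)"
  unfolding poisson_integral_def by (rule nn_integral_density) measurable

lemma poisson_finite_density_mono:
  assumes [measurable_cong]: "sets \<sigma> = sets borel" and [measurable]: "f \<in> borel_measurable borel" "g \<in> borel_measurable borel"
    and le: "\<And>x. f x \<le> ennreal c * g x" and g: "poisson_finite (density \<sigma> g)"
  shows "poisson_finite (density \<sigma> f)"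
proof -
  have "(\<integral>\<^sup>+t. ennreal (1 / (1 + t\<^sup>2)) \<partial>density \<sigma> f) = (\<integral>\<^sup>+t. f t * ennreal (1 / (1 + t\<^sup>2)) \<partial>\<sigma>)"
    by (rule nn_integral_density) measurable
  also have "\<dots> \<le> (\<integral>\<^sup>+t. ennreal c * (g t * ennreal (1 / (1 + t\<^sup>2))) \<partial>\<sigma>)"
    unfolding mult.assoc[symmetric] by (intro nn_integral_mono mult_right_mono le) simp
  also have "\<dots> = ennreal c * (\<integral>\<^sup>+t. g t * ennreal (1 / (1 + t\<^sup>2)) \<partial>\<sigma>)"
    by (rule nn_integral_cmult) measurable
  also have "(\<integral>\<^sup>+t. g t * ennreal (1 / (1 + t\<^sup>2)) \<partial>\<sigma>) = (\<integral>\<^sup>+t. ennreal (1 / (1 + t\<^sup>2)) \<partial>density \<sigma> g)"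
    by (rule nn_integral_density[symmetric]) measurable
  also have "ennreal c * \<dots> < \<infinity>" using g by (simp add: poisson_finite_def ennreal_mult_less_top)
  finally show ?thesis using assms(1) by (simp add: poisson_finite_def)
qed

lemma tendsto_squeeze_rat:
  fixes p q :: "real \<Rightarrow> real" and m :: real
  assumes q: "\<forall>\<^sub>F \<epsilon> in F. 0 < q \<epsilon>" and p: "\<forall>\<^sub>F \<epsilon> in F. 0 \<le> p \<epsilon>" and m: "0 \<le> m"
    and up: "\<And>c j. c \<in> \<rat> \<Longrightarrow> 0 \<le> c \<Longrightarrow> m \<le> c \<Longrightarrow> \<forall>\<^sub>F \<epsilon> in F. p \<epsilon> \<le> (c + 1 / real (Suc j)) * q \<epsilon>"
    and lo: "\<And>c j. c \<in> \<rat> \<Longrightarrow> 0 \<le> c \<Longrightarrow> c \<le> m \<Longrightarrow> \<forall>\<^sub>F \<epsilon> in F. (c - 1 / real (Suc j)) * q \<epsilon> \<le> p \<epsilon>"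
  shows "((\<lambda>\<epsilon>. p \<epsilon> / q \<epsilon>) \<longlongrightarrow> m) F"
proof (rule order_tendstoI)
  fix y assume y: "y < m"
  show "\<forall>\<^sub>F \<epsilon> in F. y < p \<epsilon> / q \<epsilon>"
  proof (cases "y < 0")
    case True
    show ?thesis using q p
    proof eventually_elim
      case (elim \<epsilon>)
      then have "0 \<le> p \<epsilon> / q \<epsilon>" by simp
      with True show ?case by linarith
    qed
  next
    case False
    obtain c where c: "c \<in> \<rat>" "y < c" "c < m" using Rats_dense_in_real[OF y] by blast
    obtain j where j: "1 / real (Suc j) < c - y" using nat_approx_posE[of "c - y"] c by auto
    have "\<forall>\<^sub>F \<epsilon> in F. (c - 1 / real (Suc j)) * q \<epsilon> \<le> p \<epsilon>" using lo[of c j] c False by simp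
    with q show ?thesis
    proof eventually_elim
      case (elim \<epsilon>)
      then have "c - 1 / real (Suc j) \<le> p \<epsilon> / q \<epsilon>" by (subst pos_le_divide_eq) auto
      with j show ?case by linarith
    qed
  qed
next
  fix y assume y: "m < y"
  obtain c where c: "c \<in> \<rat>" "m < c" "c < y" using Rats_dense_in_real[OF y] by blast
  obtain j where j: "1 / real (Suc j) < y - c" using nat_approx_posE[of "y - c"] c by auto
  have "\<forall>\<^sub>F \<epsilon> in F. p \<epsilon> \<le> (c + 1 / real (Suc j)) * q \<epsilon>" using up[of c j] c m by simp
  with q show "\<forall>\<^sub>F \<epsilon> in F. p \<epsilon> / q \<epsilon> < y"
  proof eventually_elim
    case (elim \<epsilon>)
    then have "p \<epsilon> / q \<epsilon> \<le> c + 1 / real (Suc j)" by (subst pos_divide_le_eq) auto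
    with j show ?case by linarith
  qed
qed

text \<open>
  With densities \<open>a\<close> and \<open>b\<close> of \<open>\<mu>\<close> and \<open>\<nu>\<close>, the limit is \<open>m = a / b\<close>. For rational \<open>c\<close> the measure with density
  \<open>max 0 (a - c b)\<close> does not charge \<open>{m \<le> c}\<close>, so there its Poisson integral is negligible against that
  of \<open>\<nu>\<close>, which gives the upper bound \<open>c\<close> for the quotient; \<open>max 0 (c b - a)\<close> gives the lower bound.
  The set \<open>B = {b > 0}\<close> carries \<open>\<nu>\<close>, and on it \<open>\<mu>\<close> is absolutely continuous with respect to \<open>\<nu>\<close>.
\<close>

theorem poisson_ratio_converges:
  fixes \<mu> \<nu> :: "real measure"
  assumes \<mu>: "poisson_finite \<mu>" and \<nu>: "poisson_finite \<nu>"
  obtains m B where "m \<in> borel_measurable borel" "\<And>s. 0 \<le> m s" "B \<in> sets borel"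
    "AE s in \<nu>. s \<in> B" "density \<nu> (\<lambda>s. ennreal (m s)) = density \<mu> (indicator B)"
    "AE s in \<nu>. ((\<lambda>\<epsilon>. enn2real (poisson_integral \<mu> \<epsilon> s) / enn2real (poisson_integral \<nu> \<epsilon> s)) \<longlongrightarrow> m s) (at_right 0)"
proof -
  obtain \<sigma> a b where s\<sigma>[measurable_cong]: "sets \<sigma> = sets borel" and [measurable]: "a \<in> borel_measurable borel" "b \<in> borel_measurable borel"
    and a: "\<And>x. 0 \<le> a x" and b: "\<And>x. 0 \<le> b x"
    and \<mu>a: "\<mu> = density \<sigma> (\<lambda>x. ennreal (a x))" and \<nu>b: "\<nu> = density \<sigma> (\<lambda>x. ennreal (b x))"
    by (rule common_dominating_measure[OF \<mu> \<nu>]) (rule that; assumption)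
  define m where "m x = a x / b x" for x
  define B where "B = {x. 0 < b x}"
  have Bm[measurable]: "B \<in> sets borel" unfolding B_def by measurable
  have mm[measurable]: "m \<in> borel_measurable borel" unfolding m_def by measurable
  have m0: "0 \<le> m s" for s using a b by (simp add: m_def)
  have AB: "AE s in \<nu>. s \<in> B"
    unfolding \<nu>b by (subst AE_density) (auto simp: B_def)
  have dens: "density \<nu> (\<lambda>s. ennreal (m s)) = density \<mu> (indicator B)"
  proof -
    have "density \<nu> (\<lambda>s. ennreal (m s)) = density \<sigma> (\<lambda>s. ennreal (b s) * ennreal (m s))"
      unfolding \<nu>b by (rule density_density_eq) measurable
    also have "\<dots> = density \<sigma> (\<lambda>s. ennreal (a s) * indicator B s)"
    proof (rule density_cong)
      show "AE s in \<sigma>. ennreal (b s) * ennreal (m s) = ennreal (a s) * indicator B s"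
      proof (rule AE_I2)
        fix s
        show "ennreal (b s) * ennreal (m s) = ennreal (a s) * indicator B s"
        proof (cases "0 < b s")
          case True
          then have "b s * m s = a s" by (simp add: m_def)
          then show ?thesis using True b m0 by (simp add: B_def flip: ennreal_mult)
        next
          case False
          then have "b s = 0" using b[of s] by simp
          then show ?thesis by (simp add: B_def)
        qed
      qed
    qed measurable
    also have "\<dots> = density \<mu> (indicator B)"
      unfolding \<mu>a by (rule density_density_eq[symmetric]) measurable
    finally show ?thesis .
  qed
  define up where "up c x = ennreal (max 0 (a x - c * b x))" for c x
  define lo where "lo c x = ennreal (max 0 (c * b x - a x))" for c x
  have [measurable]: "up c \<in> borel_measurable borel" "lo c \<in> borel_measurable borel" for c
    unfolding up_def lo_def by measurable
  have pf: "poisson_finite (density \<sigma> (up c))" "poisson_finite (density \<sigma> (lo c))" if c: "0 \<le> c" for c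
  proof -
    show "poisson_finite (density \<sigma> (up c))"
      by (rule poisson_finite_density_mono[OF s\<sigma>, of _ "\<lambda>x. ennreal (a x)" 1])
        (use \<mu> a b c in \<open>auto simp: \<mu>a[symmetric] up_def intro!: ennreal_leI\<close>)
    show "poisson_finite (density \<sigma> (lo c))"
    proof (rule poisson_finite_density_mono[OF s\<sigma>, of _ "\<lambda>x. ennreal (b x)" c])
      show "lo c x \<le> ennreal c * ennreal (b x)" for x
        using a[of x] b[of x] c by (simp add: lo_def flip: ennreal_mult)
    qed (use \<nu> in \<open>auto simp: \<nu>b[symmetric]\<close>)
  qed
  have nullup: "AE s in \<nu>. s \<in> {x. a x \<le> c * b x} \<longrightarrow> (\<forall>j::nat. \<forall>\<^sub>F \<epsilon> in at_right 0. ennreal (real j) * poisson_integral (density \<sigma> (up c)) \<epsilon> s \<le> poisson_integral \<nu> \<epsilon> s)" if "0 \<le> c" for c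
  proof (rule poisson_ratio_null_set[OF pf(1)[OF that] \<nu>])
    show "emeasure (density \<sigma> (up c)) {x. a x \<le> c * b x} = 0"
      by (subst emeasure_density) (auto simp: up_def nn_integral_0_iff_AE indicator_def)
  qed measurable
  have nulllo: "AE s in \<nu>. s \<in> {x. c * b x \<le> a x} \<longrightarrow> (\<forall>j::nat. \<forall>\<^sub>F \<epsilon> in at_right 0. ennreal (real j) * poisson_integral (density \<sigma> (lo c)) \<epsilon> s \<le> poisson_integral \<nu> \<epsilon> s)" if "0 \<le> c" for c
  proof (rule poisson_ratio_null_set[OF pf(2)[OF that] \<nu>])
    show "emeasure (density \<sigma> (lo c)) {x. c * b x \<le> a x} = 0"
      by (subst emeasure_density) (auto simp: lo_def nn_integral_0_iff_AE indicator_def)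
  qed measurable
  have AEup: "AE s in \<nu>. \<forall>c\<in>\<rat>. 0 \<le> c \<longrightarrow> s \<in> {x. a x \<le> c * b x} \<longrightarrow> (\<forall>j::nat. \<forall>\<^sub>F \<epsilon> in at_right 0. ennreal (real j) * poisson_integral (density \<sigma> (up c)) \<epsilon> s \<le> poisson_integral \<nu> \<epsilon> s)"
    unfolding AE_ball_countable[OF countable_rat] using nullup by (auto intro: AE_I2)
  have AElo: "AE s in \<nu>. \<forall>c\<in>\<rat>. 0 \<le> c \<longrightarrow> s \<in> {x. c * b x \<le> a x} \<longrightarrow> (\<forall>j::nat. \<forall>\<^sub>F \<epsilon> in at_right 0. ennreal (real j) * poisson_integral (density \<sigma> (lo c)) \<epsilon> s \<le> poisson_integral \<nu> \<epsilon> s)"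
    unfolding AE_ball_countable[OF countable_rat] using nulllo by (auto intro: AE_I2)
  have ineq_up: "poisson_integral \<mu> \<epsilon> s \<le> poisson_integral (density \<sigma> (up c)) \<epsilon> s + ennreal c * poisson_integral \<nu> \<epsilon> s" if c: "0 \<le> c" for c \<epsilon> s
  proof -
    let ?k = "\<lambda>t. ennreal (\<epsilon> / ((s - t)\<^sup>2 + \<epsilon>\<^sup>2))"
    have "poisson_integral \<mu> \<epsilon> s = (\<integral>\<^sup>+t. ennreal (a t) * ?k t \<partial>\<sigma>)" unfolding \<mu>a by (rule poisson_integral_density[OF s\<sigma>]) measurable
    also have "\<dots> \<le> (\<integral>\<^sup>+t. up c t * ?k t + ennreal c * (ennreal (b t) * ?k t) \<partial>\<sigma>)"
    proof (rule nn_integral_mono)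
      fix t
      have "ennreal (a t) \<le> ennreal (max 0 (a t - c * b t) + c * b t)" by (rule ennreal_leI) simp
      also have "\<dots> = up c t + ennreal c * ennreal (b t)" using b[of t] c by (simp add: up_def ennreal_plus ennreal_mult)
      finally have "ennreal (a t) * ?k t \<le> (up c t + ennreal c * ennreal (b t)) * ?k t" by (rule mult_right_mono) simp
      then show "ennreal (a t) * ?k t \<le> up c t * ?k t + ennreal c * (ennreal (b t) * ?k t)" by (simp add: distrib_right mult.assoc)
    qed
    also have "\<dots> = (\<integral>\<^sup>+t. up c t * ?k t \<partial>\<sigma>) + ennreal c * (\<integral>\<^sup>+t. ennreal (b t) * ?k t \<partial>\<sigma>)"
      by (simp add: nn_integral_add nn_integral_cmult)
    finally show ?thesis unfolding \<nu>b by (simp add: poisson_integral_density[OF s\<sigma>])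
  qed
  have ineq_lo: "ennreal c * poisson_integral \<nu> \<epsilon> s \<le> poisson_integral (density \<sigma> (lo c)) \<epsilon> s + poisson_integral \<mu> \<epsilon> s" if c: "0 \<le> c" for c \<epsilon> s
  proof -
    let ?k = "\<lambda>t. ennreal (\<epsilon> / ((s - t)\<^sup>2 + \<epsilon>\<^sup>2))"
    have "ennreal c * poisson_integral \<nu> \<epsilon> s = (\<integral>\<^sup>+t. ennreal c * (ennreal (b t) * ?k t) \<partial>\<sigma>)" unfolding \<nu>b
      by (simp add: poisson_integral_density[OF s\<sigma>] nn_integral_cmult)
    also have "\<dots> \<le> (\<integral>\<^sup>+t. lo c t * ?k t + ennreal (a t) * ?k t \<partial>\<sigma>)"
    proof (rule nn_integral_mono)
      fix t
      have "ennreal c * ennreal (b t) = ennreal (c * b t)" using b[of t] c by (simp add: ennreal_mult)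
      also have "\<dots> \<le> ennreal (max 0 (c * b t - a t) + a t)" by (rule ennreal_leI) simp
      also have "\<dots> = lo c t + ennreal (a t)" using a[of t] by (simp add: lo_def ennreal_plus)
      finally have "ennreal c * ennreal (b t) * ?k t \<le> (lo c t + ennreal (a t)) * ?k t" by (rule mult_right_mono) simp
      then show "ennreal c * (ennreal (b t) * ?k t) \<le> lo c t * ?k t + ennreal (a t) * ?k t" by (simp add: distrib_right mult.assoc)
    qed
    also have "\<dots> = (\<integral>\<^sup>+t. lo c t * ?k t \<partial>\<sigma>) + (\<integral>\<^sup>+t. ennreal (a t) * ?k t \<partial>\<sigma>)"
      by (simp add: nn_integral_add)
    finally show ?thesis unfolding \<mu>a by (simp add: poisson_integral_density[OF s\<sigma>])
  qed
  have conv: "AE s in \<nu>. ((\<lambda>\<epsilon>. enn2real (poisson_integral \<mu> \<epsilon> s) / enn2real (poisson_integral \<nu> \<epsilon> s)) \<longlongrightarrow> m s) (at_right 0)"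
    using AB AEup AElo poisson_integral_bounded_below[OF \<nu>]
  proof eventually_elim
    case (elim s)
    then have bs: "0 < b s" by (simp add: B_def)
    obtain w where w: "0 < w" "\<And>\<epsilon>. 0 < \<epsilon> \<and> \<epsilon> < 1 \<Longrightarrow> ennreal w \<le> poisson_integral \<nu> \<epsilon> s" using elim(4) by blast
    let ?p = "\<lambda>\<epsilon>. enn2real (poisson_integral \<mu> \<epsilon> s)" and ?q = "\<lambda>\<epsilon>. enn2real (poisson_integral \<nu> \<epsilon> s)"
    have fin: "poisson_integral \<mu> \<epsilon> s = ennreal (?p \<epsilon>)" "poisson_integral \<nu> \<epsilon> s = ennreal (?q \<epsilon>)" if "0 < \<epsilon>" for \<epsilon>
      using poisson_integral_finite[OF \<mu> that, of s] poisson_integral_finite[OF \<nu> that, of s] by (simp_all add: less_top)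
    have finc: "poisson_integral (density \<sigma> (up c)) \<epsilon> s = ennreal (enn2real (poisson_integral (density \<sigma> (up c)) \<epsilon> s))"
       "poisson_integral (density \<sigma> (lo c)) \<epsilon> s = ennreal (enn2real (poisson_integral (density \<sigma> (lo c)) \<epsilon> s))" if "0 < \<epsilon>" "0 \<le> c" for \<epsilon> c
      using poisson_integral_finite[OF pf(1)[OF that(2)] that(1), of s] poisson_integral_finite[OF pf(2)[OF that(2)] that(1), of s]
      by (simp_all add: less_top)
    have ev01: "\<forall>\<^sub>F \<epsilon> in at_right 0. \<epsilon> \<in> {0<..<1::real}" by (rule eventually_at_right_real) simp
    show ?case
    proof (rule tendsto_squeeze_rat)
      show "\<forall>\<^sub>F \<epsilon> in at_right 0. 0 < ?q \<epsilon>"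
        using ev01
      proof eventually_elim
        case (elim \<epsilon>)
        then have "ennreal w \<le> ennreal (?q \<epsilon>)" using w(2)[of \<epsilon>] fin(2)[of \<epsilon>] by simp
        then have "w \<le> ?q \<epsilon>" by (subst (asm) ennreal_le_iff) auto
        then show ?case using w(1) by linarith
      qed
      show "\<forall>\<^sub>F \<epsilon> in at_right 0. 0 \<le> ?p \<epsilon>" by simp
      show "0 \<le> m s" by (rule m0)
    next
      fix c :: real and j :: nat assume c: "c \<in> \<rat>" "0 \<le> c" "m s \<le> c"
      then have "s \<in> {x. a x \<le> c * b x}" using bs by (simp add: m_def field_simps)
      then have "\<forall>\<^sub>F \<epsilon> in at_right 0. ennreal (real (Suc j)) * poisson_integral (density \<sigma> (up c)) \<epsilon> s \<le> poisson_integral \<nu> \<epsilon> s"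
        using elim(2) c by blast
      with ev01 show "\<forall>\<^sub>F \<epsilon> in at_right 0. ?p \<epsilon> \<le> (c + 1 / real (Suc j)) * ?q \<epsilon>"
      proof eventually_elim
        case (elim \<epsilon>)
        then have \<epsilon>: "0 < \<epsilon>" by simp
        define k where "k = enn2real (poisson_integral (density \<sigma> (up c)) \<epsilon> s)"
        have k0: "0 \<le> k" by (simp add: k_def)
        have "ennreal (real (Suc j)) * ennreal k \<le> ennreal (?q \<epsilon>)"
          using elim(2) unfolding k_def finc(1)[OF \<epsilon> c(2), symmetric] fin(2)[OF \<epsilon>, symmetric] .
        then have "ennreal (real (Suc j) * k) \<le> ennreal (?q \<epsilon>)" using k0 by (subst ennreal_mult) auto
        then have 1: "real (Suc j) * k \<le> ?q \<epsilon>" by (subst (asm) ennreal_le_iff) auto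
        have "ennreal (?p \<epsilon>) \<le> ennreal k + ennreal c * ennreal (?q \<epsilon>)"
          using ineq_up[OF c(2), of \<epsilon> s] unfolding k_def finc(1)[OF \<epsilon> c(2), symmetric] fin[OF \<epsilon>, symmetric] .
        also have "\<dots> = ennreal (k + c * ?q \<epsilon>)" using k0 c by (simp add: ennreal_plus ennreal_mult)
        finally have 2: "?p \<epsilon> \<le> k + c * ?q \<epsilon>" using k0 c by (subst (asm) ennreal_le_iff) auto
        have "k \<le> ?q \<epsilon> / real (Suc j)" using 1 by (subst pos_le_divide_eq) (auto simp: mult.commute)
        with 2 show ?case by (simp add: distrib_right)
      qed
    next
      fix c :: real and j :: nat assume c: "c \<in> \<rat>" "0 \<le> c" "c \<le> m s"
      then have "s \<in> {x. c * b x \<le> a x}" using bs by (simp add: m_def field_simps)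
      then have "\<forall>\<^sub>F \<epsilon> in at_right 0. ennreal (real (Suc j)) * poisson_integral (density \<sigma> (lo c)) \<epsilon> s \<le> poisson_integral \<nu> \<epsilon> s"
        using elim(3) c by blast
      with ev01 show "\<forall>\<^sub>F \<epsilon> in at_right 0. (c - 1 / real (Suc j)) * ?q \<epsilon> \<le> ?p \<epsilon>"
      proof eventually_elim
        case (elim \<epsilon>)
        then have \<epsilon>: "0 < \<epsilon>" by simp
        define k where "k = enn2real (poisson_integral (density \<sigma> (lo c)) \<epsilon> s)"
        have k0: "0 \<le> k" by (simp add: k_def)
        have "ennreal (real (Suc j)) * ennreal k \<le> ennreal (?q \<epsilon>)"
          using elim(2) unfolding k_def finc(2)[OF \<epsilon> c(2), symmetric] fin(2)[OF \<epsilon>, symmetric] .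
        then have "ennreal (real (Suc j) * k) \<le> ennreal (?q \<epsilon>)" using k0 by (subst ennreal_mult) auto
        then have 1: "real (Suc j) * k \<le> ?q \<epsilon>" by (subst (asm) ennreal_le_iff) auto
        have "ennreal (c * ?q \<epsilon>) = ennreal c * ennreal (?q \<epsilon>)" using c by (simp add: ennreal_mult)
        also have "\<dots> \<le> ennreal k + ennreal (?p \<epsilon>)"
          using ineq_lo[OF c(2), of \<epsilon> s] unfolding k_def finc(2)[OF \<epsilon> c(2), symmetric] fin[OF \<epsilon>, symmetric] .
        also have "\<dots> = ennreal (k + ?p \<epsilon>)" using k0 by (simp add: ennreal_plus)
        finally have 2: "c * ?q \<epsilon> \<le> k + ?p \<epsilon>" using k0 by (subst (asm) ennreal_le_iff) auto
        have "k \<le> ?q \<epsilon> / real (Suc j)" using 1 by (subst pos_le_divide_eq) (auto simp: mult.commute)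
        with 2 show ?case by (simp add: left_diff_distrib)
      qed
    qed
  qed
  show ?thesis by (rule that[OF mm m0 Bm AB dens conv])
qed

section \<open>Borel transforms and their boundary values\<close>

text \<open>
  The hypothesis on \<open>\<mu>\<close> in the form that is used; the spectral measure of the perturbed operator
  satisfies it as well.
\<close>

definition cauchy_finite :: "real measure \<Rightarrow> bool" where
  "cauchy_finite \<kappa> \<longleftrightarrow> sets \<kappa> = sets borel \<and> integrable \<kappa> (\<lambda>t. 1 / (1 + \<bar>t\<bar>))"

lemma cauchy_finite_sets: "cauchy_finite \<kappa> \<Longrightarrow> sets \<kappa> = sets borel"
  by (simp add: cauchy_finite_def)

lemma cauchy_finite_imp_poisson_finite:
  assumes \<kappa>: "cauchy_finite \<kappa>"
  shows "poisson_finite \<kappa>"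
proof -
  note [measurable_cong] = cauchy_finite_sets[OF \<kappa>]
  have "(\<integral>\<^sup>+t. ennreal (1 / (1 + t\<^sup>2)) \<partial>\<kappa>) \<le> (\<integral>\<^sup>+t. ennreal (2 * (1 / (1 + \<bar>t\<bar>))) \<partial>\<kappa>)"
  proof (intro nn_integral_mono ennreal_leI)
    fix t :: real
    have "2 * \<bar>t\<bar> \<le> t\<^sup>2 + 1" using zero_le_power2[of "\<bar>t\<bar> - 1"] by (simp add: power2_diff)
    then have "1 + \<bar>t\<bar> \<le> 2 * (1 + t\<^sup>2)" using zero_le_power2[of t] by (simp only: distrib_left)
    moreover have "0 < 1 + t\<^sup>2" "0 < 1 + \<bar>t\<bar>" by (simp_all add: add_pos_nonneg)
    ultimately show "1 / (1 + t\<^sup>2) \<le> 2 * (1 / (1 + \<bar>t\<bar>))" by (simp add: divide_simps)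
  qed
  also have "\<dots> < \<infinity>"
  proof -
    have "integrable \<kappa> (\<lambda>t. 2 * (1 / (1 + \<bar>t\<bar>)))"
      using \<kappa> by (intro integrable_mult_right) (simp add: cauchy_finite_def)
    then show ?thesis by (subst nn_integral_eq_integral) auto
  qed
  finally show ?thesis using \<kappa> by (simp add: poisson_finite_def cauchy_finite_def)
qed

lemma cauchy_finite_open_interval:
  assumes "cauchy_finite \<kappa>"
  shows "emeasure \<kappa> {-real n<..<real n} < \<infinity>"
proof -
  have "emeasure \<kappa> {-real n<..<real n} \<le> emeasure \<kappa> {-real n..real n}"
    by (rule emeasure_mono) (use assms in \<open>auto simp: cauchy_finite_sets\<close>)
  also have "\<dots> < \<infinity>" by (rule poisson_finite_interval[OF cauchy_finite_imp_poisson_finite[OF assms]])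
  finally show ?thesis .
qed

lemma nonreal_distance_bound:
  assumes z: "z \<notin> \<real>"
  shows "1 + \<bar>t\<bar> \<le> ((1 + cmod z) / \<bar>Im z\<bar> + 1) * cmod (complex_of_real t - z)"
proof -
  have im: "0 < \<bar>Im z\<bar>" using z complex_is_Real_iff by auto
  have "\<bar>Im z\<bar> \<le> cmod (complex_of_real t - z)" using abs_Im_le_cmod[of "complex_of_real t - z"] by simp
  then have "(1 + cmod z) / \<bar>Im z\<bar> * \<bar>Im z\<bar> \<le> (1 + cmod z) / \<bar>Im z\<bar> * cmod (complex_of_real t - z)"
    by (rule mult_left_mono) simp
  then have "1 + cmod z \<le> (1 + cmod z) / \<bar>Im z\<bar> * cmod (complex_of_real t - z)" using im by simp
  moreover have "\<bar>t\<bar> \<le> cmod z + cmod (complex_of_real t - z)"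
    using norm_triangle_sub[of "complex_of_real t" z] by simp
  ultimately show ?thesis by (simp add: distrib_right)
qed

lemma nonreal_ne: "z \<notin> \<real> \<Longrightarrow> complex_of_real t - z \<noteq> 0"
  by auto

lemma cauchy_kernel_bound:
  assumes z: "z \<notin> \<real>"
  shows "cmod (1 / (complex_of_real t - z)) \<le> ((1 + cmod z) / \<bar>Im z\<bar> + 1) * (1 / (1 + \<bar>t\<bar>))"
proof -
  have 0: "0 < cmod (complex_of_real t - z)" using nonreal_ne[OF z] by simp
  have 1: "0 < 1 + \<bar>t\<bar>" by (simp add: add_pos_nonneg)
  have "1 / cmod (complex_of_real t - z) \<le> K / (1 + \<bar>t\<bar>)"
    if "1 + \<bar>t\<bar> \<le> K * cmod (complex_of_real t - z)" for K
    using 0 1 that by (subst frac_le_eq) (auto simp: divide_le_0_iff)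
  from this[OF nonreal_distance_bound[OF z, of t]] show ?thesis by (simp add: norm_divide)
qed

lemma cauchy_kernel_bound_Im:
  assumes z: "z \<notin> \<real>"
  shows "cmod (1 / (complex_of_real t - z)) \<le> 1 / \<bar>Im z\<bar>"
proof -
  have im: "0 < \<bar>Im z\<bar>" using z complex_is_Real_iff by auto
  have "\<bar>Im z\<bar> \<le> cmod (complex_of_real t - z)" using abs_Im_le_cmod[of "complex_of_real t - z"] by simp
  then show ?thesis using im by (simp add: norm_divide frac_le)
qed

lemma cauchy_kernel_integrable:
  assumes \<kappa>: "cauchy_finite \<kappa>" and z: "z \<notin> \<real>"
  shows "integrable \<kappa> (\<lambda>t. 1 / (complex_of_real t - z))"
proof (rule Bochner_Integration.integrable_bound)
  note [measurable_cong] = cauchy_finite_sets[OF \<kappa>]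
  show "integrable \<kappa> (\<lambda>t. ((1 + cmod z) / \<bar>Im z\<bar> + 1) * (1 / (1 + \<bar>t\<bar>)))"
    using \<kappa> by (intro integrable_mult_right) (simp add: cauchy_finite_def)
  show "(\<lambda>t. 1 / (complex_of_real t - z)) \<in> borel_measurable \<kappa>" by measurable
  show "AE t in \<kappa>. norm (1 / (complex_of_real t - z)) \<le> norm (((1 + cmod z) / \<bar>Im z\<bar> + 1) * (1 / (1 + \<bar>t\<bar>)))"
    using cauchy_kernel_bound[OF z] by (intro AE_I2) (metis abs_ge_self order_trans real_norm_def)
qed

lemma cauchy_kernel_L2:
  assumes \<kappa>: "cauchy_finite \<kappa>" and z: "z \<notin> \<real>"
  shows "(\<lambda>t. 1 / (complex_of_real t - z)) \<in> L2 \<kappa>"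
proof (rule L2_I)
  note [measurable_cong] = cauchy_finite_sets[OF \<kappa>]
  show "(\<lambda>t. 1 / (complex_of_real t - z)) \<in> borel_measurable \<kappa>" by measurable
  show "integrable \<kappa> (\<lambda>t. (cmod (1 / (complex_of_real t - z)))\<^sup>2)"
  proof (rule Bochner_Integration.integrable_bound)
    show "integrable \<kappa> (\<lambda>t. (1 / \<bar>Im z\<bar>) * cmod (1 / (complex_of_real t - z)))"
      using cauchy_kernel_integrable[OF \<kappa> z] by (intro integrable_mult_right integrable_norm)
    show "AE t in \<kappa>. norm ((cmod (1 / (complex_of_real t - z)))\<^sup>2) \<le> norm ((1 / \<bar>Im z\<bar>) * cmod (1 / (complex_of_real t - z)))"
    proof (rule AE_I2)
      fix t
      have "cmod (1 / (complex_of_real t - z)) * cmod (1 / (complex_of_real t - z)) \<le> 1 / \<bar>Im z\<bar> * cmod (1 / (complex_of_real t - z))"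
        by (rule mult_right_mono[OF cauchy_kernel_bound_Im[OF z]]) simp
      then show "norm ((cmod (1 / (complex_of_real t - z)))\<^sup>2) \<le> norm ((1 / \<bar>Im z\<bar>) * cmod (1 / (complex_of_real t - z)))"
        by (simp add: power2_eq_square)
    qed
  qed measurable
qed

lemma L2_div_nonreal:
  assumes \<kappa>: "cauchy_finite \<kappa>" and f: "f \<in> L2 \<kappa>" and z: "z \<notin> \<real>"
  shows "(\<lambda>t. f t / (complex_of_real t - z)) \<in> L2 \<kappa>"
proof (rule L2_dominated[OF f])
  note [measurable_cong] = cauchy_finite_sets[OF \<kappa>]
  note [measurable] = L2_measurable[OF f]
  show "(\<lambda>t. f t / (complex_of_real t - z)) \<in> borel_measurable \<kappa>" by measurable
  show "AE t in \<kappa>. cmod (f t / (complex_of_real t - z)) \<le> 1 / \<bar>Im z\<bar> * cmod (f t)"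
    using mult_right_mono[OF cauchy_kernel_bound_Im[OF z]] by (intro AE_I2) (simp add: norm_divide)
qed

lemma L2_div_integrable:
  assumes \<kappa>: "cauchy_finite \<kappa>" and f: "f \<in> L2 \<kappa>" and z: "z \<notin> \<real>"
  shows "integrable \<kappa> (\<lambda>t. f t / (complex_of_real t - z))"
  using L2_mult_integrable[OF f cauchy_kernel_L2[OF \<kappa> z]] by simp

lemma Complex_nonreal: "\<epsilon> \<noteq> 0 \<Longrightarrow> Complex s \<epsilon> \<notin> \<real>"
  by (simp add: complex_is_Real_iff)

lemma Im_cauchy_kernel: "Im (1 / (complex_of_real t - z)) = Im z / (cmod (complex_of_real t - z))\<^sup>2"
  by (simp add: Im_divide cmod_power2)

lemma Im_borel_transform:
  assumes \<kappa>: "cauchy_finite \<kappa>" and \<epsilon>: "0 < \<epsilon>"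
  shows "Im (borel_transform \<kappa> (Complex s \<epsilon>)) = enn2real (poisson_integral \<kappa> \<epsilon> s)"
proof -
  note [measurable_cong] = cauchy_finite_sets[OF \<kappa>]
  have z: "Complex s \<epsilon> \<notin> \<real>" using \<epsilon> by (simp add: Complex_nonreal)
  have "Im (borel_transform \<kappa> (Complex s \<epsilon>)) = (\<integral>t. Im (1 / (complex_of_real t - Complex s \<epsilon>)) \<partial>\<kappa>)"
    unfolding borel_transform_def by (rule integral_Im[symmetric]) (rule cauchy_kernel_integrable[OF \<kappa> z])
  also have "\<dots> = (\<integral>t. \<epsilon> / ((s - t)\<^sup>2 + \<epsilon>\<^sup>2) \<partial>\<kappa>)"
    by (simp add: Im_cauchy_kernel cmod_power2 power2_commute)
  also have "\<dots> = enn2real (poisson_integral \<kappa> \<epsilon> s)"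
    unfolding poisson_integral_def by (rule integral_eq_nn_integral) (use \<epsilon> in auto)
  finally show ?thesis .
qed

text \<open>
  \<open>Im F(z) = Im z \<integral> |t - z|\<^sup>-\<^sup>2 d\<kappa>\<close> vanishes only for the zero measure, and this keeps \<open>1 + \<alpha> F\<close> away from zero.
\<close>

lemma Im_borel_transform_zero:
  assumes \<kappa>: "cauchy_finite \<kappa>" and z: "z \<notin> \<real>" and 0: "Im (borel_transform \<kappa> z) = 0"
  shows "borel_transform \<kappa> z = 0"
proof -
  have im: "Im z \<noteq> 0" using z complex_is_Real_iff by auto
  have L: "(\<lambda>t. 1 / (complex_of_real t - z)) \<in> L2 \<kappa>" by (rule cauchy_kernel_L2[OF \<kappa> z])
  have "Im (borel_transform \<kappa> z) = (\<integral>t. Im (1 / (complex_of_real t - z)) \<partial>\<kappa>)"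
    unfolding borel_transform_def by (rule integral_Im[symmetric]) (rule cauchy_kernel_integrable[OF \<kappa> z])
  also have "\<dots> = (\<integral>t. Im z * (cmod (1 / (complex_of_real t - z)))\<^sup>2 \<partial>\<kappa>)"
    by (intro Bochner_Integration.integral_cong) (simp_all add: Im_cauchy_kernel norm_divide power_divide)
  also have "\<dots> = Im z * (L2_norm \<kappa> (\<lambda>t. 1 / (complex_of_real t - z)))\<^sup>2"
    unfolding L2_norm_square by (rule integral_mult_right_zero)
  finally have "L2_norm \<kappa> (\<lambda>t. 1 / (complex_of_real t - z)) = 0" using 0 im by simp
  from L2_norm_0_AE[OF L this] show ?thesis
    unfolding borel_transform_def by (intro integral_eq_zero_AE)
qed

lemma borel_transform_continuous:
  assumes \<kappa>: "cauchy_finite \<kappa>"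
  shows "continuous_on {0<..} (\<lambda>\<epsilon>. borel_transform \<kappa> (Complex s \<epsilon>))"
  unfolding continuous_on_sequentially
proof (intro allI impI ballI, elim conjE)
  note [measurable_cong] = cauchy_finite_sets[OF \<kappa>]
  fix x :: "nat \<Rightarrow> real" and a assume a: "a \<in> {0<..}" and x: "\<forall>n. x n \<in> {0<..}" and lim: "x \<longlonglongrightarrow> a"
  have "(\<lambda>n. borel_transform \<kappa> (Complex s (x n))) \<longlonglongrightarrow> borel_transform \<kappa> (Complex s a)"
    unfolding borel_transform_def
  proof -
    have "\<forall>\<^sub>F n in sequentially. a / 2 < x n" using order_tendstoD(1)[OF lim, of "a/2"] a by simp
    then obtain N where N: "\<And>n. n \<ge> N \<Longrightarrow> a / 2 < x n" by (auto simp: eventually_sequentially)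
    have "(\<lambda>n. \<integral>t. 1 / (complex_of_real t - Complex s (x (n + N))) \<partial>\<kappa>) \<longlonglongrightarrow> (\<integral>t. 1 / (complex_of_real t - Complex s a) \<partial>\<kappa>)"
    proof (rule integral_dominated_convergence[where w="\<lambda>t. cmod (1 / (complex_of_real t - Complex s (a / 2)))"])
      show "integrable \<kappa> (\<lambda>t. cmod (1 / (complex_of_real t - Complex s (a / 2))))"
        using a by (intro integrable_norm cauchy_kernel_integrable[OF \<kappa>] Complex_nonreal) auto
      show "AE t in \<kappa>. (\<lambda>n. 1 / (complex_of_real t - Complex s (x (n + N)))) \<longlonglongrightarrow> 1 / (complex_of_real t - Complex s a)"
      proof (rule AE_I2)
        fix t
        have "(\<lambda>n. x (n + N)) \<longlonglongrightarrow> a" using lim by (rule LIMSEQ_ignore_initial_segment)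
        then show "(\<lambda>n. 1 / (complex_of_real t - Complex s (x (n + N)))) \<longlonglongrightarrow> 1 / (complex_of_real t - Complex s a)"
          using a by (intro tendsto_intros) (auto simp: complex_eq_iff)
      qed
      show "AE t in \<kappa>. norm (1 / (complex_of_real t - Complex s (x (n + N)))) \<le> cmod (1 / (complex_of_real t - Complex s (a / 2)))" for n
      proof (rule AE_I2)
        fix t
        have "a / 2 < x (n + N)" using N by simp
        then have "(a / 2)\<^sup>2 \<le> (x (n + N))\<^sup>2" using a by (intro power_mono) auto
        then have "cmod (complex_of_real t - Complex s (a / 2)) \<le> cmod (complex_of_real t - Complex s (x (n + N)))"
          by (simp add: cmod_def)
        moreover have "0 < cmod (complex_of_real t - Complex s (a / 2))" using a by (auto simp: complex_eq_iff)
        ultimately show "norm (1 / (complex_of_real t - Complex s (x (n + N)))) \<le> cmod (1 / (complex_of_real t - Complex s (a / 2)))"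
          unfolding norm_divide norm_one by (intro frac_le) auto
      qed
    qed measurable
    then show "(\<lambda>n. \<integral>t. 1 / (complex_of_real t - Complex s (x n)) \<partial>\<kappa>) \<longlonglongrightarrow> (\<integral>t. 1 / (complex_of_real t - Complex s a) \<partial>\<kappa>)"
      by (rule LIMSEQ_offset)
  qed
  then show "((\<lambda>\<epsilon>. borel_transform \<kappa> (Complex s \<epsilon>)) \<circ> x) \<longlonglongrightarrow> borel_transform \<kappa> (Complex s a)"
    by (simp add: o_def)
qed

text \<open>
  If the square has a positive limit, the function has no zeros near \<open>0\<close> and, being continuous, keeps its
  sign.
\<close>

lemma converges_if_square_converges:
  fixes x :: "real \<Rightarrow> real"
  assumes cont: "continuous_on {0<..} x" and lim: "((\<lambda>\<epsilon>. (x \<epsilon>)\<^sup>2) \<longlongrightarrow> q) (at_right 0)"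
  shows "\<exists>r. (x \<longlongrightarrow> r) (at_right 0)"
proof -
  have "((\<lambda>\<epsilon>. sqrt ((x \<epsilon>)\<^sup>2)) \<longlongrightarrow> sqrt q) (at_right 0)" by (intro tendsto_intros lim)
  then have abslim: "((\<lambda>\<epsilon>. \<bar>x \<epsilon>\<bar>) \<longlongrightarrow> sqrt q) (at_right 0)" by simp
  have "0 \<le> q" by (rule tendsto_lowerbound[OF lim]) auto
  show ?thesis
  proof (cases "q = 0")
    case True
    then show ?thesis using abslim by (intro exI[of _ 0]) (simp add: tendsto_rabs_zero_iff)
  next
    case False
    then have "0 < q" using \<open>0 \<le> q\<close> by simp
    from order_tendstoD(1)[OF lim this] obtain d where d: "0 < d" "\<And>\<epsilon>. 0 < \<epsilon> \<Longrightarrow> \<epsilon> < d \<Longrightarrow> 0 < (x \<epsilon>)\<^sup>2"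
      unfolding eventually_at_right_field by auto
    have nz: "x \<epsilon> \<noteq> 0" if "0 < \<epsilon>" "\<epsilon> < d" for \<epsilon> using d(2)[OF that] by auto
    have con: "connected (x ` {0<..<d})"
      by (rule connected_continuous_image[OF continuous_on_subset[OF cont]]) auto
    have sign: "(\<forall>\<epsilon>\<in>{0<..<d}. 0 < x \<epsilon>) \<or> (\<forall>\<epsilon>\<in>{0<..<d}. x \<epsilon> < 0)"
    proof (rule ccontr)
      assume "\<not> ?thesis"
      then obtain e1 e2 where e: "e1 \<in> {0<..<d}" "e2 \<in> {0<..<d}" "x e1 \<le> 0" "0 \<le> x e2" by (auto simp: not_less)
      have "0 \<in> x ` {0<..<d}"
        using connectedD_interval[OF con, of "x e1" "x e2" 0] e by auto
      then show False using nz by auto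
    qed
    have ev: "\<forall>\<^sub>F \<epsilon> in at_right 0. \<epsilon> \<in> {0<..<d}" by (rule eventually_at_right_real[OF d(1)])
    from sign show ?thesis
    proof
      assume p: "\<forall>\<epsilon>\<in>{0<..<d}. 0 < x \<epsilon>"
      have "\<forall>\<^sub>F \<epsilon> in at_right 0. \<bar>x \<epsilon>\<bar> = x \<epsilon>"
        using ev by eventually_elim (use p in \<open>simp add: less_imp_le\<close>)
      then show ?thesis using Lim_transform_eventually[OF abslim] by blast
    next
      assume p: "\<forall>\<epsilon>\<in>{0<..<d}. x \<epsilon> < 0"
      have "\<forall>\<^sub>F \<epsilon> in at_right 0. - \<bar>x \<epsilon>\<bar> = x \<epsilon>"
        using ev by eventually_elim (use p in \<open>simp add: less_imp_le\<close>)
      then show ?thesis using Lim_transform_eventually[OF tendsto_minus[OF abslim]] by blast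
    qed
  qed
qed

text \<open>
  Here \<open>\<Gamma> = \<Phi> / (1 + \<alpha> \<Phi>)\<close>, so \<open>Im \<Phi> / Im \<Gamma> = |1 + \<alpha> \<Phi>|\<^sup>2\<close>. If \<open>Im \<Gamma>\<close> tends to infinity (\<open>l = 0\<close>), then
  \<open>\<Phi> = 1 / (1 / \<Gamma> - \<alpha>)\<close> tends to \<open>-1 / \<alpha>\<close>. Otherwise \<open>Im \<Phi>\<close> converges, hence
  \<open>(1 + \<alpha> Re \<Phi>)\<^sup>2 = |1 + \<alpha> \<Phi>|\<^sup>2 - \<alpha>\<^sup>2 (Im \<Phi>)\<^sup>2\<close> converges, and continuity in \<open>\<epsilon>\<close> settles the sign.
\<close>

lemma boundary_value_from_imaginary_parts:
  fixes \<Phi> \<Gamma> :: "real \<Rightarrow> complex" and \<alpha> c m l :: real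
  assumes cont: "continuous_on {0<..} \<Phi>" and \<alpha>: "\<alpha> \<noteq> 0" and c: "0 < c"
    and nz: "\<forall>\<^sub>F \<epsilon> in at_right 0. 1 + complex_of_real \<alpha> * \<Phi> \<epsilon> \<noteq> 0"
    and \<Gamma>: "\<forall>\<^sub>F \<epsilon> in at_right 0. \<Gamma> \<epsilon> = \<Phi> \<epsilon> / (1 + complex_of_real \<alpha> * \<Phi> \<epsilon>)"
    and pos: "\<forall>\<^sub>F \<epsilon> in at_right 0. 0 < Im (\<Gamma> \<epsilon>)"
    and m: "((\<lambda>\<epsilon>. Im (\<Phi> \<epsilon>) / Im (\<Gamma> \<epsilon>)) \<longlongrightarrow> m) (at_right 0)"
    and l: "((\<lambda>\<epsilon>. c / Im (\<Gamma> \<epsilon>)) \<longlongrightarrow> l) (at_right 0)"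
  shows "\<exists>L. (\<Phi> \<longlongrightarrow> L) (at_right 0) \<and> (cmod (1 + complex_of_real \<alpha> * L))\<^sup>2 = m"
proof -
  let ?D = "\<lambda>\<epsilon>. 1 + complex_of_real \<alpha> * \<Phi> \<epsilon>"
  have ratio: "\<forall>\<^sub>F \<epsilon> in at_right 0. Im (\<Phi> \<epsilon>) / Im (\<Gamma> \<epsilon>) = (cmod (?D \<epsilon>))\<^sup>2"
    using nz \<Gamma> pos
  proof eventually_elim
    case (elim \<epsilon>)
    have "Im (\<Gamma> \<epsilon>) = Im (\<Phi> \<epsilon>) / (cmod (?D \<epsilon>))\<^sup>2"
      unfolding elim(2) Im_divide by (simp add: cmod_power2 algebra_simps)
    moreover have "(cmod (?D \<epsilon>))\<^sup>2 \<noteq> 0" using elim(1) by simp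
    ultimately have "Im (\<Phi> \<epsilon>) = (cmod (?D \<epsilon>))\<^sup>2 * Im (\<Gamma> \<epsilon>)" by simp
    then show ?case using elim(3) by simp
  qed
  have sq: "((\<lambda>\<epsilon>. (cmod (?D \<epsilon>))\<^sup>2) \<longlongrightarrow> m) (at_right 0)"
    by (rule Lim_transform_eventually[OF m ratio])
  have "\<exists>L. (\<Phi> \<longlongrightarrow> L) (at_right 0)"
  proof (cases "l = 0")
    case True
    have inv0: "((\<lambda>\<epsilon>. 1 / \<Gamma> \<epsilon>) \<longlongrightarrow> 0) (at_right 0)"
    proof (rule Lim_null_comparison)
      show "((\<lambda>\<epsilon>. (c / Im (\<Gamma> \<epsilon>)) / c) \<longlongrightarrow> 0) (at_right 0)"
        using tendsto_divide[OF l tendsto_const[of c]] c True by simp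
      show "\<forall>\<^sub>F \<epsilon> in at_right 0. norm (1 / \<Gamma> \<epsilon>) \<le> (c / Im (\<Gamma> \<epsilon>)) / c"
        using pos
      proof eventually_elim
        case (elim \<epsilon>)
        have "Im (\<Gamma> \<epsilon>) \<le> cmod (\<Gamma> \<epsilon>)" using abs_Im_le_cmod[of "\<Gamma> \<epsilon>"] by simp
        then show ?case using elim c by (simp add: norm_divide frac_le)
      qed
    qed
    have eq: "\<forall>\<^sub>F \<epsilon> in at_right 0. 1 / (1 / \<Gamma> \<epsilon> - complex_of_real \<alpha>) = \<Phi> \<epsilon>"
      using nz \<Gamma> pos
    proof eventually_elim
      case (elim \<epsilon>)
      have "\<Phi> \<epsilon> \<noteq> 0" using elim by auto
      then have "1 / \<Gamma> \<epsilon> = 1 / \<Phi> \<epsilon> + complex_of_real \<alpha>" using elim(1) unfolding elim(2) by (simp add: field_simps)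
      then show ?case by simp
    qed
    have "((\<lambda>\<epsilon>. 1 / (1 / \<Gamma> \<epsilon> - complex_of_real \<alpha>)) \<longlongrightarrow> 1 / (0 - complex_of_real \<alpha>)) (at_right 0)"
      using \<alpha> by (intro tendsto_intros inv0) auto
    from Lim_transform_eventually[OF this eq] show ?thesis by blast
  next
    case False
    have imeq: "\<forall>\<^sub>F \<epsilon> in at_right 0. (Im (\<Phi> \<epsilon>) / Im (\<Gamma> \<epsilon>)) * (c / (c / Im (\<Gamma> \<epsilon>))) = Im (\<Phi> \<epsilon>)"
      using pos by eventually_elim (use c in \<open>simp add: field_simps\<close>)
    have "((\<lambda>\<epsilon>. (Im (\<Phi> \<epsilon>) / Im (\<Gamma> \<epsilon>)) * (c / (c / Im (\<Gamma> \<epsilon>)))) \<longlongrightarrow> m * (c / l)) (at_right 0)"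
      using False by (intro tendsto_intros m l)
    from Lim_transform_eventually[OF this imeq] have imlim: "((\<lambda>\<epsilon>. Im (\<Phi> \<epsilon>)) \<longlongrightarrow> m * (c / l)) (at_right 0)" .
    have "((\<lambda>\<epsilon>. (cmod (?D \<epsilon>))\<^sup>2 - \<alpha>\<^sup>2 * (Im (\<Phi> \<epsilon>))\<^sup>2) \<longlongrightarrow> m - \<alpha>\<^sup>2 * (m * (c / l))\<^sup>2) (at_right 0)"
      by (intro tendsto_intros sq imlim)
    moreover have "(cmod (?D \<epsilon>))\<^sup>2 - \<alpha>\<^sup>2 * (Im (\<Phi> \<epsilon>))\<^sup>2 = (1 + \<alpha> * Re (\<Phi> \<epsilon>))\<^sup>2" for \<epsilon>
      by (simp add: cmod_power2 power_mult_distrib)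
    ultimately have "((\<lambda>\<epsilon>. (1 + \<alpha> * Re (\<Phi> \<epsilon>))\<^sup>2) \<longlongrightarrow> m - \<alpha>\<^sup>2 * (m * (c / l))\<^sup>2) (at_right 0)" by simp
    moreover have "continuous_on {0<..} (\<lambda>\<epsilon>. 1 + \<alpha> * Re (\<Phi> \<epsilon>))" by (intro continuous_intros cont)
    ultimately obtain r where r: "((\<lambda>\<epsilon>. 1 + \<alpha> * Re (\<Phi> \<epsilon>)) \<longlongrightarrow> r) (at_right 0)"
      using converges_if_square_converges by blast
    have "((\<lambda>\<epsilon>. (1 + \<alpha> * Re (\<Phi> \<epsilon>) - 1) / \<alpha>) \<longlongrightarrow> (r - 1) / \<alpha>) (at_right 0)"
      using \<alpha> by (intro tendsto_intros r) auto
    then have "((\<lambda>\<epsilon>. Re (\<Phi> \<epsilon>)) \<longlongrightarrow> (r - 1) / \<alpha>) (at_right 0)" using \<alpha> by simp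
    from tendsto_Complex[OF this imlim] show ?thesis by auto
  qed
  then obtain L where L: "(\<Phi> \<longlongrightarrow> L) (at_right 0)" by blast
  have "((\<lambda>\<epsilon>. (cmod (?D \<epsilon>))\<^sup>2) \<longlongrightarrow> (cmod (1 + complex_of_real \<alpha> * L))\<^sup>2) (at_right 0)"
    by (intro tendsto_intros L)
  from tendsto_unique[OF _ this sq] L show ?thesis by auto
qed

text \<open>
  By translation and scaling, the Poisson integral of Lebesgue measure is constant.
\<close>

lemma poisson_integral_lborel:
  assumes "0 < \<epsilon>"
  shows "poisson_integral lborel \<epsilon> s = (\<integral>\<^sup>+t. ennreal (1 / (1 + t\<^sup>2)) \<partial>lborel)"
proof -
  have "poisson_integral lborel \<epsilon> s = ennreal \<bar>\<epsilon>\<bar> * (\<integral>\<^sup>+t. ennreal (\<epsilon> / ((s - (s + \<epsilon> * t))\<^sup>2 + \<epsilon>\<^sup>2)) \<partial>lborel)"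
    unfolding poisson_integral_def by (rule nn_integral_real_affine) (use assms in auto)
  also have "\<dots> = (\<integral>\<^sup>+t. ennreal \<epsilon> * ennreal (\<epsilon> / ((s - (s + \<epsilon> * t))\<^sup>2 + \<epsilon>\<^sup>2)) \<partial>lborel)"
    using assms by (simp add: nn_integral_cmult)
  also have "\<dots> = (\<integral>\<^sup>+t. ennreal (1 / (1 + t\<^sup>2)) \<partial>lborel)"
  proof (rule nn_integral_cong)
    fix t
    have "(s - (s + \<epsilon> * t))\<^sup>2 + \<epsilon>\<^sup>2 = \<epsilon>\<^sup>2 * (1 + t\<^sup>2)" by (simp add: power2_eq_square algebra_simps)
    then have "\<epsilon> * (\<epsilon> / ((s - (s + \<epsilon> * t))\<^sup>2 + \<epsilon>\<^sup>2)) = 1 / (1 + t\<^sup>2)" using assms by (simp add: power2_eq_square)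
    then show "ennreal \<epsilon> * ennreal (\<epsilon> / ((s - (s + \<epsilon> * t))\<^sup>2 + \<epsilon>\<^sup>2)) = ennreal (1 / (1 + t\<^sup>2))"
      using assms by (simp flip: ennreal_mult)
  qed
  finally show ?thesis .
qed

lemma poisson_finite_lborel: "poisson_finite lborel"
proof -
  have ne: "1 + t\<^sup>2 \<noteq> 0" for t :: real
  proof -
    have "0 < 1 + t\<^sup>2" by (intro add_pos_nonneg) auto
    then show ?thesis by simp
  qed
  have half: "(\<integral>\<^sup>+t. ennreal (1 / (1 + t\<^sup>2)) * indicator {0..} t \<partial>lborel) = ennreal (pi / 2 - arctan 0)"
    by (rule nn_integral_FTC_atLeast)
      (auto intro!: derivative_eq_intros tendsto_arctan_at_top simp: inverse_eq_divide ne)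
  have "(\<integral>\<^sup>+t. ennreal (1 / (1 + t\<^sup>2)) * indicator {..0} t \<partial>lborel) =
     ennreal \<bar>-1\<bar> * (\<integral>\<^sup>+t. ennreal (1 / (1 + (0 + (-1) * t)\<^sup>2)) * indicator {..0} (0 + (-1) * t) \<partial>lborel)"
    by (rule nn_integral_real_affine) auto
  also have "\<dots> = (\<integral>\<^sup>+t. ennreal (1 / (1 + t\<^sup>2)) * indicator {0..} t \<partial>lborel)"
    by (simp add: indicator_def)
  finally have half': "(\<integral>\<^sup>+t. ennreal (1 / (1 + t\<^sup>2)) * indicator {..0} t \<partial>lborel) = ennreal (pi / 2 - arctan 0)"
    using half by simp
  have "(\<integral>\<^sup>+t. ennreal (1 / (1 + t\<^sup>2)) \<partial>lborel) \<le>
     (\<integral>\<^sup>+t. ennreal (1 / (1 + t\<^sup>2)) * indicator {0..} t + ennreal (1 / (1 + t\<^sup>2)) * indicator {..0} t \<partial>lborel)"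
    by (rule nn_integral_mono) (auto split: split_indicator)
  also have "\<dots> = ennreal (pi / 2 - arctan 0) + ennreal (pi / 2 - arctan 0)"
    unfolding half[symmetric] by (subst nn_integral_add) (auto simp: half half')
  also have "\<dots> < \<infinity>" by (simp add: less_top)
  finally show ?thesis by (simp add: poisson_finite_def)
qed

lemma poisson_integral_lborel_pos: "0 < enn2real (\<integral>\<^sup>+t. ennreal (1 / (1 + t\<^sup>2)) \<partial>lborel)"
proof -
  have "(\<integral>\<^sup>+t. ennreal (1 / (1 + t\<^sup>2)) \<partial>lborel) \<noteq> 0"
  proof
    assume "(\<integral>\<^sup>+t. ennreal (1 / (1 + t\<^sup>2)) \<partial>lborel) = 0"
    then have "AE t in lborel. ennreal (1 / (1 + t\<^sup>2)) = 0" by (subst (asm) nn_integral_0_iff_AE) auto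
    moreover have "ennreal (1 / (1 + t\<^sup>2)) \<noteq> 0" for t :: real
    proof -
      have "0 < 1 + t\<^sup>2" by (intro add_pos_nonneg) auto
      then have "0 < 1 / (1 + t\<^sup>2)" by simp
      then show ?thesis unfolding ennreal_eq_0_iff by linarith
    qed
    ultimately have "AE t in (lborel::real measure). False" by simp
    then show False using AE_iff_measurable[of UNIV "lborel::real measure" "\<lambda>_. False"] by simp
  qed
  then show ?thesis using poisson_finite_lborel by (simp add: poisson_finite_def enn2real_positive_iff less_top zero_less_iff_neq_zero)
qed

section \<open>Divided differences of powers and of exponentials\<close>

text \<open>
  The quotient \<open>(s\<^sup>n - t\<^sup>n) / (s - t)\<close>, with the value of the derivative on the diagonal; as a sum it obeys
  its recursion in \<open>n\<close> for all \<open>s\<close> and \<open>t\<close>, also at atoms of the measures.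
\<close>

definition quot :: "nat \<Rightarrow> real \<Rightarrow> real \<Rightarrow> complex" where
  "quot n s t = (\<Sum>k<n. complex_of_real s ^ (n - Suc k) * complex_of_real t ^ k)"

lemma quot_Suc: "quot (Suc n) s t = complex_of_real s * quot n s t + complex_of_real t ^ n"
proof -
  have "(\<Sum>k<n. complex_of_real s ^ (n - k) * complex_of_real t ^ k) = complex_of_real s * quot n s t"
    unfolding quot_def sum_distrib_left
  proof (rule sum.cong[OF refl])
    fix k assume "k \<in> {..<n}"
    then have "n - k = Suc (n - Suc k)" by auto
    then show "complex_of_real s ^ (n - k) * complex_of_real t ^ k = complex_of_real s * (complex_of_real s ^ (n - Suc k) * complex_of_real t ^ k)"
      by simp
  qed
  then show ?thesis by (simp add: quot_def)
qed

lemma quot_mult: "(complex_of_real s - complex_of_real t) * quot n s t = complex_of_real s ^ n - complex_of_real t ^ n"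
proof (induction n)
  case (Suc n)
  have "(complex_of_real s - complex_of_real t) * quot (Suc n) s t
     = complex_of_real s * ((complex_of_real s - complex_of_real t) * quot n s t) + (complex_of_real s - complex_of_real t) * complex_of_real t ^ n"
    by (simp add: quot_Suc algebra_simps)
  then show ?case unfolding Suc.IH by (simp add: algebra_simps)
qed (simp add: quot_def)

lemma quot_diag: "quot n s s = of_nat n * complex_of_real s ^ (n - 1)"
proof -
  have "quot n s s = (\<Sum>k<n. complex_of_real s ^ (n - 1))"
    unfolding quot_def by (rule sum.cong) (auto simp flip: power_add)
  then show ?thesis by simp
qed

lemma quot_measurable [measurable]: "quot n s \<in> borel_measurable borel"
  unfolding quot_def by measurable

lemma quot_bound:
  assumes "\<bar>s\<bar> \<le> \<rho>" "\<bar>t\<bar> \<le> \<rho>" "1 \<le> \<rho>"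
  shows "cmod (quot n s t) \<le> (2 * \<rho>) ^ n"
proof -
  have "cmod (quot n s t) \<le> (\<Sum>k<n. \<rho> ^ n)"
    unfolding quot_def
  proof (rule sum_norm_le)
    fix k assume "k \<in> {..<n}"
    have "cmod (complex_of_real s ^ (n - Suc k) * complex_of_real t ^ k) = \<bar>s\<bar> ^ (n - Suc k) * \<bar>t\<bar> ^ k"
      by (simp add: norm_mult norm_power)
    also have "\<dots> \<le> \<rho> ^ (n - Suc k) * \<rho> ^ k" using assms by (intro mult_mono power_mono) auto
    also have "\<dots> = \<rho> ^ (n - Suc k + k)" by (simp add: power_add)
    also have "\<dots> \<le> \<rho> ^ n" using assms(3) \<open>k \<in> {..<n}\<close> by (intro power_increasing) auto
    finally show "cmod (complex_of_real s ^ (n - Suc k) * complex_of_real t ^ k) \<le> \<rho> ^ n" .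
  qed
  also have "\<dots> = real n * \<rho> ^ n" by simp
  also have "\<dots> \<le> 2 ^ n * \<rho> ^ n" using assms(3) by (intro mult_right_mono) (auto simp: less_imp_le)
  finally show ?thesis by (simp add: power_mult_distrib)
qed

text \<open>
  The kernel \<open>(e\<^sup>i\<^sup>a\<^sup>x - 1) / x\<close>, continued by its limit at \<open>x = 0\<close>.
\<close>

definition exp_quot :: "real \<Rightarrow> real \<Rightarrow> complex" where
  "exp_quot a x = (if x = 0 then \<i> * complex_of_real a
     else (exp (\<i> * complex_of_real (a * x)) - 1) / complex_of_real x)"

lemma exp_quot_norm: "cmod (exp_quot a x) \<le> \<bar>a\<bar>"
proof (cases "x = 0")
  case False
  have "cmod (exp (\<i> * complex_of_real (a * x)) - 1) = 2 * \<bar>sin (a * x / 2)\<bar>" by (rule dist_exp_i_1)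
  also have "\<dots> \<le> \<bar>a\<bar> * \<bar>x\<bar>" using abs_sin_x_le_abs_x[of "a * x / 2"] by (simp add: abs_mult)
  finally show ?thesis using False by (simp add: exp_quot_def norm_divide pos_divide_le_eq)
qed (simp add: exp_quot_def norm_mult)

lemma exp_quot_measurable [measurable (raw)]:
  assumes [measurable]: "f \<in> borel_measurable M" "g \<in> borel_measurable M"
  shows "(\<lambda>x. exp_quot (f x) (g x)) \<in> borel_measurable M"
  unfolding exp_quot_def by measurable

lemma exp_quot_0: "exp_quot 0 x = 0"
  by (simp add: exp_quot_def)

lemma exp_of_real_deriv:
  "((\<lambda>a. exp (w * complex_of_real a)) has_vector_derivative w * exp (w * complex_of_real a)) (at a)"
  by (rule has_vector_derivative_real_field) (auto intro!: derivative_eq_intros)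

lemma exp_quot_deriv: "((\<lambda>a. exp_quot a x) has_vector_derivative \<i> * exp (\<i> * complex_of_real (a * x))) (at a)"
proof (cases "x = 0")
  case True
  then show ?thesis unfolding exp_quot_def by (auto intro!: derivative_eq_intros)
next
  case False
  have "((\<lambda>a. (exp (\<i> * complex_of_real (a * x)) - 1) / complex_of_real x) has_vector_derivative
      \<i> * exp (\<i> * complex_of_real (a * x))) (at a)"
  proof -
    have "((\<lambda>a. (exp ((\<i> * complex_of_real x) * complex_of_real a) - 1) * (1 / complex_of_real x)) has_vector_derivative
      (\<i> * complex_of_real x * exp ((\<i> * complex_of_real x) * complex_of_real a) - 0) * (1 / complex_of_real x)) (at a)"
      by (intro has_vector_derivative_mult_left has_vector_derivative_diff exp_of_real_deriv has_vector_derivative_const)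
    then show ?thesis by (simp add: mult_ac False)
  qed
  then show ?thesis using False by (simp add: exp_quot_def)
qed

text \<open>
  The exponential distribution with rate \<open>\<epsilon>\<close>.
\<close>

definition exp_dist :: "real \<Rightarrow> real measure" where
  "exp_dist \<epsilon> = density lborel (\<lambda>a. ennreal (indicator {0<..} a * (\<epsilon> * exp (- \<epsilon> * a))))"

lemma sets_exp_dist [measurable_cong, simp]: "sets (exp_dist \<epsilon>) = sets borel"
  by (simp add: exp_dist_def)

lemma space_exp_dist [simp]: "space (exp_dist \<epsilon>) = UNIV"
  by (simp add: exp_dist_def)

lemma exp_decay_times_linear:
  fixes \<epsilon> :: real
  assumes "0 < \<epsilon>"
  shows "((\<lambda>a. a * exp (- \<epsilon> * a)) \<longlongrightarrow> 0) at_top" "((\<lambda>a. exp (- \<epsilon> * a)) \<longlongrightarrow> 0) at_top"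
proof -
  have top: "filterlim (\<lambda>a. \<epsilon> * a) at_top at_top"
    unfolding filterlim_at_top
  proof
    fix Z
    show "\<forall>\<^sub>F a in at_top. Z \<le> \<epsilon> * a"
      using eventually_ge_at_top[of "Z / \<epsilon>"] by eventually_elim (use assms in \<open>simp add: field_simps\<close>)
  qed
  have "((\<lambda>a. (\<epsilon> * a) ^ 1 / exp (\<epsilon> * a)) \<longlongrightarrow> 0) at_top"
    by (rule filterlim_compose[OF tendsto_power_div_exp_0 top])
  then have "((\<lambda>a. (1 / \<epsilon>) * ((\<epsilon> * a) ^ 1 / exp (\<epsilon> * a))) \<longlongrightarrow> (1 / \<epsilon>) * 0) at_top"
    by (intro tendsto_intros)
  moreover have "(\<lambda>a. (1 / \<epsilon>) * ((\<epsilon> * a) ^ 1 / exp (\<epsilon> * a))) = (\<lambda>a. a * exp (- \<epsilon> * a))"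
    using assms by (auto simp: exp_minus field_simps)
  ultimately show "((\<lambda>a. a * exp (- \<epsilon> * a)) \<longlongrightarrow> 0) at_top" by simp
  have "((\<lambda>a. (\<epsilon> * a) ^ 0 / exp (\<epsilon> * a)) \<longlongrightarrow> 0) at_top"
    by (rule filterlim_compose[OF tendsto_power_div_exp_0 top])
  moreover have "(\<lambda>a. (\<epsilon> * a) ^ 0 / exp (\<epsilon> * a)) = (\<lambda>a. exp (- \<epsilon> * a))"
    by (auto simp: exp_minus field_simps)
  ultimately show "((\<lambda>a. exp (- \<epsilon> * a)) \<longlongrightarrow> 0) at_top" by simp
qed

lemma exp_dist_nn_integral:
  assumes [measurable]: "f \<in> borel_measurable borel" and "0 < \<epsilon>" and f: "\<And>a. 0 \<le> a \<Longrightarrow> 0 \<le> f a"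
  shows "(\<integral>\<^sup>+a. ennreal (f a) \<partial>exp_dist \<epsilon>) = (\<integral>\<^sup>+a. ennreal (f a * (\<epsilon> * exp (- \<epsilon> * a))) * indicator {0..} a \<partial>lborel)"
proof -
  have "(\<integral>\<^sup>+a. ennreal (f a) \<partial>exp_dist \<epsilon>) = (\<integral>\<^sup>+a. ennreal (indicator {0<..} a * (\<epsilon> * exp (- \<epsilon> * a))) * ennreal (f a) \<partial>lborel)"
    unfolding exp_dist_def by (rule nn_integral_density) auto
  also have "\<dots> = (\<integral>\<^sup>+a. ennreal (f a * (\<epsilon> * exp (- \<epsilon> * a))) * indicator {0..} a \<partial>lborel)"
  proof (rule nn_integral_cong_AE)
    have "AE a in lborel. a \<noteq> (0::real)" by (rule AE_lborel_singleton)
    then show "AE a in lborel. ennreal (indicator {0<..} a * (\<epsilon> * exp (- \<epsilon> * a))) * ennreal (f a) = ennreal (f a * (\<epsilon> * exp (- \<epsilon> * a))) * indicator {0..} a"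
    proof eventually_elim
      case (elim a)
      show ?case
      proof (cases "0 < a")
        case True
        then show ?thesis using assms(2) f[of a] by (simp add: ennreal_mult mult.commute)
      qed (use elim in simp)
    qed
  qed
  finally show ?thesis .
qed

lemma exp_dist_total:
  assumes \<epsilon>: "0 < \<epsilon>"
  shows "emeasure (exp_dist \<epsilon>) UNIV = 1"
proof -
  have "emeasure (exp_dist \<epsilon>) UNIV = (\<integral>\<^sup>+a. ennreal 1 \<partial>exp_dist \<epsilon>)" by simp
  also have "\<dots> = (\<integral>\<^sup>+a. ennreal (1 * (\<epsilon> * exp (- \<epsilon> * a))) * indicator {0..} a \<partial>lborel)"
    by (rule exp_dist_nn_integral) (use \<epsilon> in auto)
  also have "\<dots> = (\<integral>\<^sup>+a. ennreal (\<epsilon> * exp (- \<epsilon> * a)) * indicator {0..} a \<partial>lborel)" by simp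
  also have "\<dots> = ennreal (- 0 - (- exp (- \<epsilon> * 0)))"
  proof (rule nn_integral_FTC_atLeast)
    show "((\<lambda>a. - exp (- \<epsilon> * a)) \<longlongrightarrow> - 0) at_top" by (intro tendsto_minus exp_decay_times_linear \<epsilon>)
    show "((\<lambda>a. - exp (- \<epsilon> * a)) has_real_derivative \<epsilon> * exp (- \<epsilon> * a)) (at a)" for a
      by (auto intro!: derivative_eq_intros)
  qed (use \<epsilon> in auto)
  finally show ?thesis by simp
qed

lemma exp_dist_integrable_linear:
  assumes \<epsilon>: "0 < \<epsilon>"
  shows "integrable (exp_dist \<epsilon>) (\<lambda>a. \<bar>a\<bar>)"
proof (rule integrableI_nonneg)
  have "(\<integral>\<^sup>+a. ennreal \<bar>a\<bar> \<partial>exp_dist \<epsilon>) = (\<integral>\<^sup>+a. ennreal (\<bar>a\<bar> * (\<epsilon> * exp (- \<epsilon> * a))) * indicator {0..} a \<partial>lborel)"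
    by (rule exp_dist_nn_integral) (use \<epsilon> in auto)
  also have "\<dots> = ennreal ((- 0 - 0 / \<epsilon>) - (- (0 * exp (- \<epsilon> * 0)) - exp (- \<epsilon> * 0) / \<epsilon>))"
  proof (rule nn_integral_FTC_atLeast)
    show "((\<lambda>a. - (a * exp (- \<epsilon> * a)) - exp (- \<epsilon> * a) / \<epsilon>) \<longlongrightarrow> - 0 - 0 / \<epsilon>) at_top"
      using \<epsilon> by (intro tendsto_intros exp_decay_times_linear) auto
    show "((\<lambda>a. - (a * exp (- \<epsilon> * a)) - exp (- \<epsilon> * a) / \<epsilon>) has_real_derivative \<bar>a\<bar> * (\<epsilon> * exp (- \<epsilon> * a))) (at a)" if "0 \<le> a" for a
      using \<epsilon> that by (auto intro!: derivative_eq_intros simp: field_simps)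
  qed (use \<epsilon> in auto)
  finally show "(\<integral>\<^sup>+a. ennreal \<bar>a\<bar> \<partial>exp_dist \<epsilon>) < \<infinity>" by simp
qed auto

lemma exp_quot_integrable:
  assumes "0 < \<epsilon>"
  shows "integrable (exp_dist \<epsilon>) (\<lambda>a. exp_quot a x)"
  by (rule Bochner_Integration.integrable_bound[OF exp_dist_integrable_linear[OF assms]])
    (auto simp: exp_quot_norm)

text \<open>
  Integration by parts with \<open>\<partial>\<^sub>a exp_quot a x = i e\<^sup>i\<^sup>a\<^sup>x\<close> gives the primitive
  \<open>\<Phi>(a) = - e\<^sup>-\<^sup>\<epsilon>\<^sup>a exp_quot a x + (i / w) e\<^sup>w\<^sup>a\<close> with \<open>w = i x - \<epsilon>\<close>, which needs no distinction between \<open>x = 0\<close>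
  and \<open>x \<noteq> 0\<close>.
\<close>

lemma exp_quot_laplace:
  assumes \<epsilon>: "0 < \<epsilon>"
  shows "(\<integral>a. exp_quot a x \<partial>exp_dist \<epsilon>) = - (1 / (complex_of_real x + \<i> * complex_of_real \<epsilon>))"
proof -
  define w where "w = \<i> * complex_of_real x - complex_of_real \<epsilon>"
  have w: "w \<noteq> 0" using \<epsilon> by (auto simp: w_def complex_eq_iff)
  define f where "f a = complex_of_real (\<epsilon> * exp (- \<epsilon> * a)) * exp_quot a x" for a
  define \<Phi> where "\<Phi> a = - complex_of_real (exp (- \<epsilon> * a)) * exp_quot a x + \<i> / w * exp (w * complex_of_real a)" for a
  have dens: "(\<integral>a. exp_quot a x \<partial>exp_dist \<epsilon>) = (\<integral>a. indicator {0<..} a *\<^sub>R f a \<partial>lborel)"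
    unfolding exp_dist_def
    by (subst integral_density) (use \<epsilon> in \<open>auto simp: f_def scaleR_conv_of_real mult.assoc intro!: Bochner_Integration.integral_cong\<close>)
  have int: "integrable lborel (\<lambda>a. indicator {0<..} a *\<^sub>R f a)"
  proof -
    have "integrable (exp_dist \<epsilon>) (\<lambda>a. exp_quot a x)" by (rule exp_quot_integrable[OF \<epsilon>])
    then have "integrable lborel (\<lambda>a. (indicator {0<..} a * (\<epsilon> * exp (- \<epsilon> * a))) *\<^sub>R exp_quot a x)"
      unfolding exp_dist_def by (subst (asm) integrable_density) (use \<epsilon> in auto)
    then show ?thesis by (simp add: f_def scaleR_conv_of_real mult.assoc)
  qed
  have ei: "einterval 0 \<infinity> = {0::real<..}" by (auto simp: einterval_def)
  have ex: "exp (w * complex_of_real a) = complex_of_real (exp (- \<epsilon> * a)) * exp (\<i> * complex_of_real (a * x))" for a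
  proof -
    have "w * complex_of_real a = complex_of_real (- \<epsilon> * a) + \<i> * complex_of_real (a * x)" by (simp add: w_def algebra_simps)
    then show ?thesis by (simp only: exp_add exp_of_real)
  qed
  have redd: "((\<lambda>a. complex_of_real (exp (- \<epsilon> * a))) has_vector_derivative complex_of_real (- \<epsilon> * exp (- \<epsilon> * a))) (at a)" for a
    using exp_of_real_deriv[of "complex_of_real (- \<epsilon>)" a] by (simp only: of_real_mult[symmetric] exp_of_real)
  have der: "(\<Phi> has_vector_derivative f a) (at a)" for a
  proof -
    have "(\<Phi> has_vector_derivative (- complex_of_real (exp (- \<epsilon> * a))) * (\<i> * exp (\<i> * complex_of_real (a * x)))
       + (- complex_of_real (- \<epsilon> * exp (- \<epsilon> * a))) * exp_quot a x + \<i> / w * (w * exp (w * complex_of_real a))) (at a)"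
      unfolding \<Phi>_def
      by (intro has_vector_derivative_add has_vector_derivative_mult has_vector_derivative_minus redd exp_quot_deriv
          has_vector_derivative_mult_right exp_of_real_deriv)
    then show ?thesis using w by (simp add: f_def ex)
  qed
  have contf: "isCont f a" for a
  proof -
    have "isCont (\<lambda>a. exp_quot a x) a" using exp_quot_deriv[of x a] by (rule has_vector_derivative_continuous)
    then show ?thesis unfolding f_def by (intro continuous_intros)
  qed
  have "(LBINT a=0..\<infinity>. f a) = 0 - \<i> / w"
  proof (rule interval_integral_FTC_integrable[where F=\<Phi>])
    show "set_integrable lborel (einterval 0 \<infinity>) f" unfolding set_integrable_def ei by (rule int)
    have "isCont \<Phi> 0" using der[of 0] by (rule has_vector_derivative_continuous)
    then have "(\<Phi> \<longlongrightarrow> \<Phi> 0) (at_right 0)" by (simp add: continuous_within filterlim_at_split isCont_def)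
    moreover have "\<Phi> 0 = \<i> / w" by (simp add: \<Phi>_def exp_quot_0)
    ultimately show "((\<Phi> \<circ> real_of_ereal) \<longlongrightarrow> \<i> / w) (at_right 0)"
      by (simp add: ereal_tendsto_simps1 zero_ereal_def)
    have "(\<Phi> \<longlongrightarrow> 0) at_top"
    proof (rule Lim_null_comparison)
      show "((\<lambda>a. a * exp (- \<epsilon> * a) + cmod (\<i> / w) * exp (- \<epsilon> * a)) \<longlongrightarrow> 0) at_top"
        using tendsto_add[OF exp_decay_times_linear(1)[OF \<epsilon>] tendsto_mult[OF tendsto_const[of "cmod (\<i> / w)"] exp_decay_times_linear(2)[OF \<epsilon>]]]
        by simp
      show "\<forall>\<^sub>F a in at_top. norm (\<Phi> a) \<le> a * exp (- \<epsilon> * a) + cmod (\<i> / w) * exp (- \<epsilon> * a)"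
        using eventually_ge_at_top[of 0]
      proof eventually_elim
        case (elim a)
        have "norm (\<Phi> a) \<le> cmod (- complex_of_real (exp (- \<epsilon> * a)) * exp_quot a x) + cmod (\<i> / w * exp (w * complex_of_real a))"
          unfolding \<Phi>_def by (rule norm_triangle_ineq)
        also have "cmod (- complex_of_real (exp (- \<epsilon> * a)) * exp_quot a x) \<le> a * exp (- \<epsilon> * a)"
          using exp_quot_norm[of a x] elim by (simp add: norm_mult mult.commute)
        also have "cmod (\<i> / w * exp (w * complex_of_real a)) = cmod (\<i> / w) * exp (- \<epsilon> * a)"
          by (simp add: norm_mult norm_divide w_def)
        finally show ?case by simp
      qed
    qed
    then show "((\<Phi> \<circ> real_of_ereal) \<longlongrightarrow> 0) (at_left \<infinity>)" by (simp add: ereal_tendsto_simps1)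
  qed (use der contf in auto)
  moreover have "(LBINT a=0..\<infinity>. f a) = (\<integral>a. indicator {0<..} a *\<^sub>R f a \<partial>lborel)"
    by (simp add: interval_lebesgue_integral_def set_lebesgue_integral_def ei)
  moreover have "- (\<i> / w) = - (1 / (complex_of_real x + \<i> * complex_of_real \<epsilon>))"
  proof -
    have "w = \<i> * (complex_of_real x + \<i> * complex_of_real \<epsilon>)" by (simp add: w_def algebra_simps)
    then show ?thesis by simp
  qed
  ultimately show ?thesis using dens by simp
qed

text \<open>
  Divided differences of the exponential series, term by term. The factor \<open>e\<^sup>-\<^sup>i\<^sup>a\<^sup>s\<close> appears since
  \<open>(e\<^sup>-\<^sup>i\<^sup>a\<^sup>s - e\<^sup>-\<^sup>i\<^sup>a\<^sup>t) / (s - t) = - e\<^sup>-\<^sup>i\<^sup>a\<^sup>s (e\<^sup>i\<^sup>a\<^sup>(\<^sup>s\<^sup>-\<^sup>t\<^sup>) - 1) / (s - t)\<close>.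
\<close>

lemma quot_exp_series:
  "(\<lambda>n. (- \<i> * complex_of_real a) ^ n / fact n * quot n s t) sums
     (- exp (- \<i> * complex_of_real (a * s)) * exp_quot a (s - t))"
proof -
  define b where "b = - \<i> * complex_of_real a"
  define c where "c n = b ^ n / fact n" for n
  have ser: "(\<lambda>n. c n * complex_of_real t ^ n) sums exp (- \<i> * complex_of_real (a * t))" for t
  proof -
    have "(\<lambda>n. c n * complex_of_real t ^ n) = (\<lambda>n. (- \<i> * complex_of_real (a * t)) ^ n /\<^sub>R fact n)"
    proof -
      have "- \<i> * complex_of_real (a * t) = b * complex_of_real t" by (simp add: b_def)
      then show ?thesis by (simp add: power_mult_distrib c_def scaleR_conv_of_real divide_inverse mult_ac)
    qed
    then show ?thesis using exp_converges[of "- \<i> * complex_of_real (a * t)"] by simp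
  qed
  show ?thesis
  proof (cases "s = t")
    case False
    then have ne: "complex_of_real s - complex_of_real t \<noteq> 0" by simp
    have q: "quot n s t = (complex_of_real s ^ n - complex_of_real t ^ n) / (complex_of_real s - complex_of_real t)" for n
      using quot_mult[of s t n] ne by (simp add: field_simps)
    have "(\<lambda>n. (c n * complex_of_real s ^ n - c n * complex_of_real t ^ n) / (complex_of_real s - complex_of_real t)) sums
      ((exp (- \<i> * complex_of_real (a * s)) - exp (- \<i> * complex_of_real (a * t))) / (complex_of_real s - complex_of_real t))"
      by (intro sums_divide sums_diff ser)
    moreover have "(exp (- \<i> * complex_of_real (a * s)) - exp (- \<i> * complex_of_real (a * t))) / (complex_of_real s - complex_of_real t)
      = - exp (- \<i> * complex_of_real (a * s)) * exp_quot a (s - t)"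
    proof -
      have "exp (- \<i> * complex_of_real (a * s)) * exp (\<i> * complex_of_real (a * (s - t))) = exp (- \<i> * complex_of_real (a * t))"
        by (simp add: exp_add[symmetric] algebra_simps)
      then show ?thesis using False by (simp add: exp_quot_def algebra_simps diff_divide_distrib)
    qed
    ultimately show ?thesis
      unfolding b_def[symmetric] c_def[symmetric] by (simp only: q times_divide_eq_right right_diff_distrib)
  next
    case True
    have "(\<lambda>n. c (Suc n) * quot (Suc n) s s) = (\<lambda>n. - \<i> * complex_of_real a * (c n * complex_of_real s ^ n))"
    proof
      fix n
      have nz: "(of_nat (Suc n) :: complex) \<noteq> 0" by (simp only: of_nat_eq_0_iff)
      have "c (Suc n) * of_nat (Suc n) = - \<i> * complex_of_real a * c n"
        unfolding c_def b_def[symmetric] using nz by (simp only: fact_Suc of_nat_mult power_Suc of_nat_fact) (simp add: divide_simps)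
      then have "c (Suc n) * of_nat (Suc n) * complex_of_real s ^ n = - \<i> * complex_of_real a * c n * complex_of_real s ^ n" by simp
      then show "c (Suc n) * quot (Suc n) s s = - \<i> * complex_of_real a * (c n * complex_of_real s ^ n)"
        by (simp only: quot_diag diff_Suc_1 mult.assoc)
    qed
    then have "(\<lambda>n. c (Suc n) * quot (Suc n) s s) sums (- \<i> * complex_of_real a * exp (- \<i> * complex_of_real (a * s)))"
      using sums_mult[OF ser[of s], of "- \<i> * complex_of_real a"] by simp
    from sums_Suc[OF this] show ?thesis
      unfolding b_def[symmetric] c_def[symmetric] True by (simp add: quot_def exp_quot_def mult.commute b_def)
  qed
qed

text \<open>
  Jensen's inequality for the square, from the Cauchy-Schwarz inequality.
\<close>

lemma nn_integral_square_norm_le: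
  fixes Y :: "'a \<Rightarrow> complex"
  assumes Y: "integrable P Y" and P: "emeasure P (space P) = 1"
  shows "ennreal ((cmod (\<integral>x. Y x \<partial>P))\<^sup>2) \<le> (\<integral>\<^sup>+x. ennreal ((cmod (Y x))\<^sup>2) \<partial>P)"
proof -
  have [measurable]: "Y \<in> borel_measurable P" using Y by auto
  have "ennreal (cmod (\<integral>x. Y x \<partial>P)) \<le> (\<integral>\<^sup>+x. ennreal (cmod (Y x)) \<partial>P)"
    by (rule integral_norm_bound_ennreal[OF Y])
  then have "(ennreal (cmod (\<integral>x. Y x \<partial>P)))\<^sup>2 \<le> (\<integral>\<^sup>+x. ennreal (cmod (Y x)) * 1 \<partial>P)\<^sup>2"
    by (simp add: power_mono)
  also have "\<dots> \<le> (\<integral>\<^sup>+x. (ennreal (cmod (Y x)))\<^sup>2 \<partial>P) * (\<integral>\<^sup>+x. 1\<^sup>2 \<partial>P)"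
    by (rule Cauchy_Schwarz_nn_integral) auto
  also have "\<dots> = (\<integral>\<^sup>+x. ennreal ((cmod (Y x))\<^sup>2) \<partial>P)" using P by (simp add: ennreal_power)
  finally show ?thesis by (simp add: ennreal_power)
qed

section \<open>The perturbed operator and its spectral measure\<close>

locale rank_one_pair =
  fixes \<mu> \<nu> :: "real measure" and \<alpha> :: real and A :: graph
    and V :: "(real \<Rightarrow> complex) \<Rightarrow> (real \<Rightarrow> complex)"
  assumes mu: "cauchy_finite \<mu>" and alpha: "\<alpha> \<noteq> 0"
    and pert: "is_rank_one_perturbation \<mu> \<alpha> A"
    and spec: "is_spectral_measure \<mu> \<alpha> \<nu>"
    and rep: "is_spectral_representation \<mu> \<alpha> A \<nu> V"
begin

abbreviation F :: "complex \<Rightarrow> complex" where "F \<equiv> borel_transform \<mu>"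

abbreviation \<alpha>' :: complex where "\<alpha>' \<equiv> complex_of_real \<alpha>"

lemma sets_mu [measurable_cong]: "sets \<mu> = sets borel"
  using mu by (rule cauchy_finite_sets)

lemma sets_nu [measurable_cong]: "sets \<nu> = sets borel"
  using spec by (simp add: is_spectral_measure_def)

lemma nu: "cauchy_finite \<nu>"
  unfolding cauchy_finite_def
proof
  have i: "integrable \<nu> (\<lambda>s. 1 / (complex_of_real s - \<i>))"
    using spec by (simp add: is_spectral_measure_def complex_is_Real_iff)
  show "integrable \<nu> (\<lambda>t. 1 / (1 + \<bar>t\<bar>))"
  proof (rule Bochner_Integration.integrable_bound[OF i])
    show "AE t in \<nu>. norm (1 / (1 + \<bar>t\<bar>)) \<le> norm (1 / (complex_of_real t - \<i>))"
    proof (rule AE_I2)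
      fix t :: real
      have "complex_of_real t - \<i> \<noteq> 0" by (simp add: complex_eq_iff)
      moreover have "cmod (complex_of_real t - \<i>) \<le> 1 + \<bar>t\<bar>"
        using norm_triangle_ineq4[of "complex_of_real t" \<i>] by simp
      ultimately show "norm (1 / (1 + \<bar>t\<bar>)) \<le> norm (1 / (complex_of_real t - \<i>))"
        by (simp add: norm_divide frac_le)
    qed
  qed measurable
qed (rule sets_nu)

text \<open>
  If \<open>1 + \<alpha> F(z) = 0\<close>, then \<open>F(z)\<close> is real, hence zero, which is absurd.
\<close>

lemma denominator_nonzero:
  assumes z: "z \<notin> \<real>"
  shows "1 + \<alpha>' * F z \<noteq> 0"
proof
  assume 0: "1 + \<alpha>' * F z = 0"
  then have "Im (1 + \<alpha>' * F z) = 0" by simp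
  then have "Im (F z) = 0" using alpha by simp
  then have "F z = 0" by (rule Im_borel_transform_zero[OF mu z])
  with 0 show False by simp
qed

lemma resolvent_of_one:
  assumes z: "z \<notin> \<real>"
  shows "rank_one_resolvent \<mu> \<alpha> z (\<lambda>_. 1) = (\<lambda>t. (1 / (1 + \<alpha>' * F z)) * (1 / (complex_of_real t - z)))"
proof
  fix t
  have "rank_one_resolvent \<mu> \<alpha> z (\<lambda>_. 1) t = (1 - \<alpha>' * F z / (1 + \<alpha>' * F z)) * (1 / (complex_of_real t - z))"
    unfolding rank_one_resolvent_def borel_transform_def[symmetric] by (simp add: diff_divide_distrib)
  also have "1 - \<alpha>' * F z / (1 + \<alpha>' * F z) = 1 / (1 + \<alpha>' * F z)"
    using denominator_nonzero[OF z] by (simp add: field_simps)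
  finally show "rank_one_resolvent \<mu> \<alpha> z (\<lambda>_. 1) t = (1 / (1 + \<alpha>' * F z)) * (1 / (complex_of_real t - z))" .
qed

lemma borel_transform_nu:
  assumes z: "z \<notin> \<real>"
  shows "borel_transform \<nu> z = F z / (1 + \<alpha>' * F z)"
proof -
  have "borel_transform \<nu> z = L2_inner \<mu> (rank_one_resolvent \<mu> \<alpha> z (\<lambda>_. 1)) (\<lambda>_. 1)"
    using spec z unfolding is_spectral_measure_def borel_transform_def by blast
  also have "\<dots> = (\<integral>t. (1 / (1 + \<alpha>' * F z)) * (1 / (complex_of_real t - z)) \<partial>\<mu>)"
    unfolding L2_inner_def resolvent_of_one[OF z] by simp
  also have "\<dots> = (1 / (1 + \<alpha>' * F z)) * F z"
    unfolding borel_transform_def[of \<mu> z] by (rule integral_mult_right_zero)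
  finally show ?thesis by simp
qed

text \<open>
  Here \<open>h\<close> stands for \<open>-F(s + i0\<^sup>+)\<close>, the future \<open>T 1\<close>. The last identity says that \<open>\<mu>\<close> has density
  \<open>|1 - \<alpha> h|\<^sup>2\<close> with respect to \<open>\<nu>\<close> on the set \<open>B\<close>, which carries \<open>\<nu>\<close>.
\<close>

lemma boundary_values:
  obtains h B where "h \<in> borel_measurable borel"
    "AE s in \<nu>. ((\<lambda>\<epsilon>. F (Complex s \<epsilon>)) \<longlongrightarrow> - h s) (at_right 0)"
    "B \<in> sets borel" "AE s in \<nu>. s \<in> B"
    "density \<nu> (\<lambda>s. ennreal ((cmod (1 - \<alpha>' * h s))\<^sup>2)) = density \<mu> (indicator B)"
proof -
  note pmu = cauchy_finite_imp_poisson_finite[OF mu] and pnu = cauchy_finite_imp_poisson_finite[OF nu]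
  obtain m B where m[measurable]: "m \<in> borel_measurable borel" "\<And>s. 0 \<le> m s" and B: "B \<in> sets borel"
    "AE s in \<nu>. s \<in> B" "density \<nu> (\<lambda>s. ennreal (m s)) = density \<mu> (indicator B)"
    and ratio: "AE s in \<nu>. ((\<lambda>\<epsilon>. enn2real (poisson_integral \<mu> \<epsilon> s) / enn2real (poisson_integral \<nu> \<epsilon> s)) \<longlongrightarrow> m s) (at_right 0)"
    by (rule poisson_ratio_converges[OF pmu pnu]) (rule that; assumption)
  obtain l C where l: "AE s in \<nu>. ((\<lambda>\<epsilon>. enn2real (poisson_integral lborel \<epsilon> s) / enn2real (poisson_integral \<nu> \<epsilon> s)) \<longlongrightarrow> l s) (at_right 0)"
    by (rule poisson_ratio_converges[OF poisson_finite_lborel pnu]) (rule that; assumption)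
  \<comment> \<open>the limit along one sequence, which makes measurability evident\<close>
  define h where "h s = - lim (\<lambda>n. F (Complex s (1 / real (Suc n))))" for s
  interpret sigma_finite_measure \<mu> by (rule poisson_finite_sigma_finite[OF pmu])
  have hm[measurable]: "h \<in> borel_measurable borel"
  proof -
    have "(\<lambda>s. F (Complex s (1 / real (Suc n)))) \<in> borel_measurable borel" for n
    proof -
      have "(\<lambda>s. \<integral>t. 1 / (complex_of_real t - (complex_of_real s + \<i> * complex_of_real (1 / real (Suc n)))) \<partial>\<mu>) \<in> borel_measurable borel"
        by measurable
      then show ?thesis unfolding borel_transform_def Complex_eq .
    qed
    then have "(\<lambda>s. lim (\<lambda>n. F (Complex s (1 / real (Suc n))))) \<in> borel_measurable borel"
      by (rule borel_measurable_lim_metric)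
    then show ?thesis unfolding h_def by measurable
  qed
  have lim: "AE s in \<nu>. ((\<lambda>\<epsilon>. F (Complex s \<epsilon>)) \<longlongrightarrow> - h s) (at_right 0) \<and> (cmod (1 - \<alpha>' * h s))\<^sup>2 = m s"
    using ratio l poisson_integral_bounded_below[OF pnu]
  proof eventually_elim
    case (elim s)
    obtain c where c: "0 < c" "\<And>\<epsilon>. 0 < \<epsilon> \<and> \<epsilon> < 1 \<Longrightarrow> ennreal c \<le> poisson_integral \<nu> \<epsilon> s" using elim(3) by blast
    have ev: "\<forall>\<^sub>F \<epsilon> in at_right 0. \<epsilon> \<in> {0<..<1::real}" by (rule eventually_at_right_real) simp
    let ?c = "enn2real (\<integral>\<^sup>+t. ennreal (1 / (1 + t\<^sup>2)) \<partial>lborel)"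
    have "\<exists>L. ((\<lambda>\<epsilon>. F (Complex s \<epsilon>)) \<longlongrightarrow> L) (at_right 0) \<and> (cmod (1 + \<alpha>' * L))\<^sup>2 = m s"
    proof (rule boundary_value_from_imaginary_parts[where \<Gamma>="\<lambda>\<epsilon>. borel_transform \<nu> (Complex s \<epsilon>)" and c="?c" and l="l s"])
      show "continuous_on {0<..} (\<lambda>\<epsilon>. F (Complex s \<epsilon>))" by (rule borel_transform_continuous[OF mu])
      show "\<alpha> \<noteq> 0" by (rule alpha)
      show "0 < ?c" by (rule poisson_integral_lborel_pos)
      show "\<forall>\<^sub>F \<epsilon> in at_right 0. 1 + \<alpha>' * F (Complex s \<epsilon>) \<noteq> 0"
        using ev by eventually_elim (use denominator_nonzero Complex_nonreal in auto)
      show "\<forall>\<^sub>F \<epsilon> in at_right 0. borel_transform \<nu> (Complex s \<epsilon>) = F (Complex s \<epsilon>) / (1 + \<alpha>' * F (Complex s \<epsilon>))"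
        using ev by eventually_elim (use borel_transform_nu Complex_nonreal in auto)
      show "\<forall>\<^sub>F \<epsilon> in at_right 0. 0 < Im (borel_transform \<nu> (Complex s \<epsilon>))"
        using ev
      proof eventually_elim
        case (elim \<epsilon>)
        then have \<epsilon>: "0 < \<epsilon>" by simp
        have "0 < poisson_integral \<nu> \<epsilon> s" using c(2)[of \<epsilon>] c(1) elim by (auto intro: less_le_trans[of 0 "ennreal c"])
        then have "0 < enn2real (poisson_integral \<nu> \<epsilon> s)"
          using poisson_integral_finite[OF pnu \<epsilon>, of s] by (simp add: enn2real_positive_iff)
        then show ?case by (simp add: Im_borel_transform[OF nu \<epsilon>])
      qed
      show "((\<lambda>\<epsilon>. Im (F (Complex s \<epsilon>)) / Im (borel_transform \<nu> (Complex s \<epsilon>))) \<longlongrightarrow> m s) (at_right 0)"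
        by (rule Lim_transform_eventually[OF elim(1)])
          (use ev in eventually_elim, simp add: Im_borel_transform[OF mu] Im_borel_transform[OF nu])
      show "((\<lambda>\<epsilon>. ?c / Im (borel_transform \<nu> (Complex s \<epsilon>))) \<longlongrightarrow> l s) (at_right 0)"
        by (rule Lim_transform_eventually[OF elim(2)])
          (use ev in eventually_elim, simp add: poisson_integral_lborel Im_borel_transform[OF nu])
    qed
    then obtain L where L: "((\<lambda>\<epsilon>. F (Complex s \<epsilon>)) \<longlongrightarrow> L) (at_right 0)" "(cmod (1 + \<alpha>' * L))\<^sup>2 = m s" by blast
    have "filterlim (\<lambda>n. 1 / real (Suc n)) (at_right 0) sequentially"
      unfolding filterlim_at using LIMSEQ_inverse_real_of_nat by (auto simp: inverse_eq_divide)
    from filterlim_compose[OF L(1) this] have "(\<lambda>n. F (Complex s (1 / real (Suc n)))) \<longlonglongrightarrow> L" .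
    then have "h s = - L" unfolding h_def by (simp add: limI)
    with L show ?case by simp
  qed
  have lim1: "AE s in \<nu>. ((\<lambda>\<epsilon>. F (Complex s \<epsilon>)) \<longlongrightarrow> - h s) (at_right 0)" using lim by eventually_elim simp
  have "density \<nu> (\<lambda>s. ennreal ((cmod (1 - \<alpha>' * h s))\<^sup>2)) = density \<nu> (\<lambda>s. ennreal (m s))"
    by (rule density_cong) (use lim in \<open>auto elim: eventually_mono\<close>)
  also note B(3)
  finally show ?thesis using that[OF hm lim1 B(1,2)] by simp
qed

section \<open>The commutator of the spectral representation with multiplication\<close>

lemma V_linear: "L2_linear \<mu> \<nu> V"
  using rep by (simp add: is_spectral_representation_def L2_unitary_def)

lemma V_L2: "f \<in> L2 \<mu> \<Longrightarrow> V f \<in> L2 \<nu>"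
  using V_linear by (simp add: L2_linear_def)

lemma V_add: "f \<in> L2 \<mu> \<Longrightarrow> g \<in> L2 \<mu> \<Longrightarrow> AE s in \<nu>. V (\<lambda>t. f t + g t) s = V f s + V g s"
  using V_linear by (simp add: L2_linear_def)

lemma V_scale: "f \<in> L2 \<mu> \<Longrightarrow> AE s in \<nu>. V (\<lambda>t. c * f t) s = c * V f s"
  using V_linear by (simp add: L2_linear_def)

lemma V_diff:
  assumes "f \<in> L2 \<mu>" "g \<in> L2 \<mu>"
  shows "AE s in \<nu>. V (\<lambda>t. f t - g t) s = V f s - V g s"
  using V_add[OF assms(1) L2_scale[OF assms(2), of "-1"]] V_scale[OF assms(2), of "-1"]
  by eventually_elim simp

lemma V_inner: "f \<in> L2 \<mu> \<Longrightarrow> g \<in> L2 \<mu> \<Longrightarrow> L2_inner \<nu> (V f) (V g) = L2_inner \<mu> f g"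
  using rep by (simp add: is_spectral_representation_def L2_unitary_def)

lemma V_surj: "g \<in> L2 \<nu> \<Longrightarrow> \<exists>f\<in>L2 \<mu>. AE s in \<nu>. V f s = g s"
  using rep by (simp add: is_spectral_representation_def L2_unitary_def)

lemma V_norm:
  assumes "f \<in> L2 \<mu>"
  shows "L2_norm \<nu> (V f) = L2_norm \<mu> f"
proof -
  have "complex_of_real ((L2_norm \<nu> (V f))\<^sup>2) = complex_of_real ((L2_norm \<mu> f)\<^sup>2)"
    using V_inner[OF assms assms] by (simp only: L2_inner_self)
  then have "(L2_norm \<nu> (V f))\<^sup>2 = (L2_norm \<mu> f)\<^sup>2" by (simp only: of_real_eq_iff)
  then show ?thesis by (simp add: power2_eq_iff_nonneg)
qed

lemma V_cauchy_kernel: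
  assumes z: "z \<notin> \<real>"
  shows "AE s in \<nu>. V (\<lambda>t. 1 / (complex_of_real t - z)) s = (1 + \<alpha>' * F z) / (complex_of_real s - z)"
proof -
  let ?k = "\<lambda>t. 1 / (complex_of_real t - z)"
  have "AE s in \<nu>. V (\<lambda>t. (1 / (1 + \<alpha>' * F z)) * ?k t) s = 1 / (complex_of_real s - z)"
    using rep z unfolding is_spectral_representation_def resolvent_of_one[OF z, symmetric] by blast
  moreover have "AE s in \<nu>. V (\<lambda>t. (1 / (1 + \<alpha>' * F z)) * ?k t) s = (1 / (1 + \<alpha>' * F z)) * V ?k s"
    by (rule V_scale[OF cauchy_kernel_L2[OF mu z]])
  ultimately show ?thesis
  proof eventually_elim
    case (elim s)
    then have "V ?k s / (1 + \<alpha>' * F z) = 1 / (complex_of_real s - z)" by simp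
    then show ?case using denominator_nonzero[OF z] by (simp add: divide_eq_eq)
  qed
qed

text \<open>
  For \<open>u = (A\<^sub>\<alpha> - z)\<^sup>-\<^sup>1 f\<close> the intertwining relation reads \<open>V u = V f / (s - z)\<close>; the rank one term of the
  resolvent formula is a multiple of \<open>1 / (t - z)\<close>, whose image is known.
\<close>

lemma V_div:
  assumes f: "f \<in> L2 \<mu>" and z: "z \<notin> \<real>"
  shows "AE s in \<nu>. V (\<lambda>t. f t / (complex_of_real t - z)) s =
    (V f s + \<alpha>' * (\<integral>t. f t / (complex_of_real t - z) \<partial>\<mu>)) / (complex_of_real s - z)"
proof -
  let ?I = "\<integral>t. f t / (complex_of_real t - z) \<partial>\<mu>" and ?k = "\<lambda>t. 1 / (complex_of_real t - z)"
  define c where "c = \<alpha>' * ?I / (1 + \<alpha>' * F z)"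
  \<comment> \<open>\<open>(u, f + z u)\<close> lies in the graph of the perturbed operator\<close>
  define u where "u = rank_one_resolvent \<mu> \<alpha> z f"
  have u_eq: "u = (\<lambda>t. f t / (complex_of_real t - z) - c * ?k t)"
    unfolding u_def rank_one_resolvent_def c_def ..
  have res: "is_resolvent \<mu> A z (rank_one_resolvent \<mu> \<alpha> z)"
    using pert z by (simp add: is_rank_one_perturbation_def)
  have uL: "u \<in> L2 \<mu>"
    unfolding u_eq by (intro L2_diff L2_scale L2_div_nonreal[OF mu f z] cauchy_kernel_L2[OF mu z])
  define v where "v = (\<lambda>t. f t + z * u t)"
  have vL: "v \<in> L2 \<mu>" unfolding v_def by (intro L2_add f L2_scale uL)
  have "(u, v) \<in> A"
  proof -
    have "(u, v) \<in> A \<longleftrightarrow> (AE t in \<mu>. u t = rank_one_resolvent \<mu> \<alpha> z (\<lambda>x. v x - z * u x) t)"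
      using res uL vL unfolding is_resolvent_def by blast
    moreover have "(\<lambda>x. v x - z * u x) = f" by (simp add: v_def)
    ultimately show ?thesis by (simp add: u_def)
  qed
  then have "(V u, V v) \<in> mult_graph \<nu>"
    using rep uL vL unfolding is_spectral_representation_def by blast
  then have "AE s in \<nu>. V v s = complex_of_real s * V u s" by (simp add: mult_graph_def)
  moreover have "AE s in \<nu>. V v s = V f s + V (\<lambda>t. z * u t) s" unfolding v_def by (rule V_add[OF f L2_scale[OF uL]])
  moreover have "AE s in \<nu>. V (\<lambda>t. z * u t) s = z * V u s" by (rule V_scale[OF uL])
  moreover have "AE s in \<nu>. V (\<lambda>t. u t + c * ?k t) s = V u s + V (\<lambda>t. c * ?k t) s"
    by (rule V_add[OF uL L2_scale[OF cauchy_kernel_L2[OF mu z]]])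
  moreover have "AE s in \<nu>. V (\<lambda>t. c * ?k t) s = c * V ?k s" by (rule V_scale[OF cauchy_kernel_L2[OF mu z]])
  ultimately show ?thesis using V_cauchy_kernel[OF z]
  proof eventually_elim
    case (elim s)
    have nz: "complex_of_real s - z \<noteq> 0" by (rule nonreal_ne[OF z])
    have "V f s = (complex_of_real s - z) * V u s" using elim(1-3) by (simp add: left_diff_distrib eq_diff_eq)
    then have 1: "V u s = V f s / (complex_of_real s - z)" using nz by (simp add: field_simps)
    have "(\<lambda>t. f t / (complex_of_real t - z)) = (\<lambda>t. u t + c * ?k t)" unfolding u_eq by simp
    then have "V (\<lambda>t. f t / (complex_of_real t - z)) s = V u s + c * ((1 + \<alpha>' * F z) / (complex_of_real s - z))"
      using elim(4-6) by simp
    also have "c * ((1 + \<alpha>' * F z) / (complex_of_real s - z)) = \<alpha>' * ?I / (complex_of_real s - z)"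
      using denominator_nonzero[OF z] by (simp add: c_def)
    finally show ?case using 1 by (simp add: add_divide_distrib)
  qed
qed

lemma bounded_support_integrable:
  assumes f: "f \<in> L2 \<mu>" and supp: "\<And>t. R < \<bar>t\<bar> \<Longrightarrow> f t = 0"
  shows "integrable \<mu> f"
proof -
  have "integrable \<mu> (\<lambda>t. (complex_of_real t - \<i>) * f t / (complex_of_real t - \<i>))"
  proof (rule L2_div_integrable[OF mu])
    show "(\<lambda>t. (complex_of_real t - \<i>) * f t) \<in> L2 \<mu>"
    proof (rule L2_dominated[OF f, where c="R + 1"])
      note [measurable] = L2_measurable[OF f]
      show "(\<lambda>t. (complex_of_real t - \<i>) * f t) \<in> borel_measurable \<mu>" by measurable
      show "AE t in \<mu>. cmod ((complex_of_real t - \<i>) * f t) \<le> (R + 1) * cmod (f t)"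
      proof (rule AE_I2)
        fix t
        show "cmod ((complex_of_real t - \<i>) * f t) \<le> (R + 1) * cmod (f t)"
        proof (cases "R < \<bar>t\<bar>")
          case False
          have "cmod (complex_of_real t - \<i>) \<le> \<bar>t\<bar> + 1" using norm_triangle_ineq4[of "complex_of_real t" \<i>] by simp
          then show ?thesis unfolding norm_mult using False by (intro mult_right_mono) auto
        qed (simp add: supp)
      qed
    qed
  qed (simp add: complex_is_Real_iff)
  moreover have "complex_of_real t - \<i> \<noteq> 0" for t by (simp add: complex_eq_iff)
  ultimately show ?thesis by simp
qed

lemma L2_bounded_multiplier:
  assumes f: "f \<in> L2 \<mu>" and supp: "\<And>t. R < \<bar>t\<bar> \<Longrightarrow> f t = 0"
    and p: "p \<in> borel_measurable borel" and le: "\<And>t. \<bar>t\<bar> \<le> R \<Longrightarrow> cmod (p t) \<le> C"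
  shows "(\<lambda>t. p t * f t) \<in> L2 \<mu>"
proof (rule L2_dominated[OF f, where c=C])
  note [measurable] = L2_measurable[OF f] p
  show "(\<lambda>t. p t * f t) \<in> borel_measurable \<mu>" by measurable
  show "AE t in \<mu>. cmod (p t * f t) \<le> C * cmod (f t)"
  proof (rule AE_I2)
    fix t
    show "cmod (p t * f t) \<le> C * cmod (f t)"
      by (cases "R < \<bar>t\<bar>") (auto simp: supp norm_mult intro!: mult_right_mono le)
  qed
qed

text \<open>
  The rank one commutator identity. It is obtained from the resolvent at \<open>i\<close> applied to \<open>(t - i) f\<close>, and it is
  meaningful pointwise although the constant \<open>1\<close> need not be square-integrable.
\<close>

lemma V_times_t:
  assumes f: "f \<in> L2 \<mu>" and supp: "\<And>t. R < \<bar>t\<bar> \<Longrightarrow> f t = 0"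
  shows "AE s in \<nu>. V (\<lambda>t. complex_of_real t * f t) s = complex_of_real s * V f s - \<alpha>' * (\<integral>t. f t \<partial>\<mu>)"
proof -
  have nz: "complex_of_real t - \<i> \<noteq> 0" for t by (simp add: complex_eq_iff)
  have iR: "\<i> \<notin> \<real>" by (simp add: complex_is_Real_iff)
  define g where "g t = (complex_of_real t - \<i>) * f t" for t
  have gL: "g \<in> L2 \<mu>" unfolding g_def
  proof (rule L2_bounded_multiplier[OF f supp, where C="R + 1"])
    show "cmod (complex_of_real t - \<i>) \<le> R + 1" if "\<bar>t\<bar> \<le> R" for t
      using norm_triangle_ineq4[of "complex_of_real t" \<i>] that by simp
  qed auto
  have div: "(\<lambda>t. g t / (complex_of_real t - \<i>)) = f" unfolding g_def using nz by simp
  have sum: "(\<lambda>t. g t + \<i> * f t) = (\<lambda>t. complex_of_real t * f t)" unfolding g_def by (simp add: algebra_simps)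
  show ?thesis
    using V_div[OF gL iR, unfolded div] V_add[OF gL L2_scale[OF f, of \<i>], unfolded sum] V_scale[OF f, of \<i>]
  proof eventually_elim
    case (elim s)
    then have "V g s = (complex_of_real s - \<i>) * V f s - \<alpha>' * (\<integral>t. f t \<partial>\<mu>)"
      using nz[of s] by (simp add: field_simps)
    with elim show ?case by (simp add: algebra_simps)
  qed
qed

text \<open>
  Iteration of the commutator identity.
\<close>

lemma V_times_power:
  assumes f: "f \<in> L2 \<mu>" and supp: "\<And>t. R < \<bar>t\<bar> \<Longrightarrow> f t = 0"
  shows "(\<lambda>t. complex_of_real t ^ n * f t) \<in> L2 \<mu>"
    "integrable \<mu> (\<lambda>t. quot n s t * f t)"
    "AE s in \<nu>. V (\<lambda>t. complex_of_real t ^ n * f t) s = complex_of_real s ^ n * V f s - \<alpha>' * (\<integral>t. quot n s t * f t \<partial>\<mu>)"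
proof -
  show L: "(\<lambda>t. complex_of_real t ^ n * f t) \<in> L2 \<mu>" for n
    by (rule L2_bounded_multiplier[OF f supp, where C="R ^ n"]) (auto simp: norm_power power_mono)
  have int: "integrable \<mu> (\<lambda>t. p t * f t)" if "(\<lambda>t. p t * f t) \<in> L2 \<mu>" for p
    by (rule bounded_support_integrable[OF that, where R=R]) (simp add: supp)
  have q: "integrable \<mu> (\<lambda>t. quot n s t * f t)" for n s
  proof (rule int, rule L2_bounded_multiplier[OF f supp, where C="(2 * max 1 (max \<bar>s\<bar> R)) ^ n"])
    show "cmod (quot n s t) \<le> (2 * max 1 (max \<bar>s\<bar> R)) ^ n" if "\<bar>t\<bar> \<le> R" for t
      by (rule quot_bound) (use that in auto)
  qed auto
  then show "integrable \<mu> (\<lambda>t. quot n s t * f t)" .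
  show "AE s in \<nu>. V (\<lambda>t. complex_of_real t ^ n * f t) s = complex_of_real s ^ n * V f s - \<alpha>' * (\<integral>t. quot n s t * f t \<partial>\<mu>)"
  proof (induction n)
    case (Suc n)
    have step: "AE s in \<nu>. V (\<lambda>t. complex_of_real t * (complex_of_real t ^ n * f t)) s = complex_of_real s * V (\<lambda>t. complex_of_real t ^ n * f t) s - \<alpha>' * (\<integral>t. complex_of_real t ^ n * f t \<partial>\<mu>)"
      by (rule V_times_t[OF L, where R=R]) (use supp in simp)
    from step Suc.IH show ?case
    proof eventually_elim
      case (elim s)
      have "(\<integral>t. quot (Suc n) s t * f t \<partial>\<mu>) = (\<integral>t. complex_of_real s * (quot n s t * f t) + complex_of_real t ^ n * f t \<partial>\<mu>)"
        by (simp add: quot_Suc algebra_simps)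
      also have "\<dots> = complex_of_real s * (\<integral>t. quot n s t * f t \<partial>\<mu>) + (\<integral>t. complex_of_real t ^ n * f t \<partial>\<mu>)"
        using q int[OF L] by (subst Bochner_Integration.integral_add) auto
      finally have *: "(\<integral>t. quot (Suc n) s t * f t \<partial>\<mu>) = complex_of_real s * (\<integral>t. quot n s t * f t \<partial>\<mu>) + (\<integral>t. complex_of_real t ^ n * f t \<partial>\<mu>)" .
      have "V (\<lambda>t. complex_of_real t ^ Suc n * f t) s = complex_of_real s * (complex_of_real s ^ n * V f s - \<alpha>' * (\<integral>t. quot n s t * f t \<partial>\<mu>)) - \<alpha>' * (\<integral>t. complex_of_real t ^ n * f t \<partial>\<mu>)"
        using elim by (simp only: power_Suc mult.assoc)
      then show ?case unfolding * by (simp only: power_Suc distrib_left right_diff_distrib mult.assoc mult.left_commute diff_diff_eq)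
    qed
  qed (simp add: quot_def)
qed

section \<open>The uniform bound\<close>

lemma sigma_finite_mu: "sigma_finite_measure \<mu>" and sigma_finite_nu: "sigma_finite_measure \<nu>"
  using poisson_finite_sigma_finite cauchy_finite_imp_poisson_finite mu nu by blast+

text \<open>
  The exponential series is inserted into the formula for powers. The left side converges in norm, because
  \<open>V\<close> is isometric and the support of \<open>f\<close> is bounded, and the right side converges pointwise, so the two limits agree almost
  everywhere.
\<close>

lemma V_exp:
  assumes f: "f \<in> L2 \<mu>" and supp: "\<And>t. R < \<bar>t\<bar> \<Longrightarrow> f t = 0"
  shows "(\<lambda>t. exp (- \<i> * complex_of_real (a * t)) * f t) \<in> L2 \<mu>"
    and "AE s in \<nu>. V (\<lambda>t. exp (- \<i> * complex_of_real (a * t)) * f t) s =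
      exp (- \<i> * complex_of_real (a * s)) * (V f s + \<alpha>' * (\<integral>t. exp_quot a (s - t) * f t \<partial>\<mu>))"
proof -
  note [measurable] = L2_measurable[OF f] L2_measurable[OF V_L2[OF f]]
  define b where "b = - \<i> * complex_of_real a"
  define c where "c n = b ^ n / fact n" for n
  define e where "e t = exp (- \<i> * complex_of_real (a * t))" for t
  define u where "u N t = (\<Sum>n<N. c n * complex_of_real t ^ n)" for N t
  have ser: "(\<lambda>n. c n * complex_of_real t ^ n) sums e t" for t
  proof -
    have eq: "- \<i> * complex_of_real (a * t) = b * complex_of_real t" by (simp add: b_def)
    have "(\<lambda>n. c n * complex_of_real t ^ n) = (\<lambda>n. (- \<i> * complex_of_real (a * t)) ^ n /\<^sub>R fact n)"
      unfolding eq by (simp add: power_mult_distrib c_def scaleR_conv_of_real divide_inverse mult_ac)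
    then show ?thesis using exp_converges[of "- \<i> * complex_of_real (a * t)"] by (simp add: e_def)
  qed
  have cn: "cmod (c n) = \<bar>a\<bar> ^ n / fact n" for n by (simp add: c_def b_def norm_divide norm_power norm_mult)
  have partial: "(\<Sum>n<N. x ^ n / fact n) \<le> exp x" if "0 \<le> x" for x :: real and N
  proof -
    have "(\<lambda>n. x ^ n / fact n) sums exp x" using exp_converges[of x] by (simp add: divide_inverse mult.commute)
    then show ?thesis
      using sum_le_suminf[of "\<lambda>n. x ^ n / fact n" "{..<N}"] that by (auto simp: sums_iff)
  qed
  have Lpow: "(\<lambda>t. complex_of_real t ^ n * f t) \<in> L2 \<mu>" and qint: "integrable \<mu> (\<lambda>t. quot n s t * f t)" for n s
    using V_times_power[OF f supp] by auto
  have em[measurable]: "e \<in> borel_measurable borel" unfolding e_def by measurable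
  have um[measurable]: "u N \<in> borel_measurable borel" for N unfolding u_def by measurable
  have e1: "cmod (e t) = 1" for t by (simp add: e_def)
  have eL: "(\<lambda>t. e t * f t) \<in> L2 \<mu>"
    by (rule L2_dominated[OF f, where c=1]) (auto simp: norm_mult e1)
  then show "(\<lambda>t. exp (- \<i> * complex_of_real (a * t)) * f t) \<in> L2 \<mu>" by (simp add: e_def)
  define K where "K = exp (\<bar>a\<bar> * \<bar>R\<bar>)"
  have ub: "cmod (u N t * f t) \<le> cmod (complex_of_real K * f t)" for N t
  proof (cases "R < \<bar>t\<bar>")
    case False
    have "cmod (u N t) \<le> (\<Sum>n<N. (\<bar>a\<bar> * \<bar>R\<bar>) ^ n / fact n)" unfolding u_def
    proof (rule sum_norm_le)
      fix n
      have "cmod (c n * complex_of_real t ^ n) = \<bar>a\<bar> ^ n / fact n * \<bar>t\<bar> ^ n" by (simp add: norm_mult cn norm_power)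
      also have "\<dots> \<le> \<bar>a\<bar> ^ n / fact n * \<bar>R\<bar> ^ n" using False by (intro mult_left_mono power_mono) auto
      finally show "cmod (c n * complex_of_real t ^ n) \<le> (\<bar>a\<bar> * \<bar>R\<bar>) ^ n / fact n" by (simp add: power_mult_distrib)
    qed
    also have "\<dots> \<le> K" unfolding K_def by (rule partial) simp
    finally show ?thesis by (simp add: norm_mult K_def mult_right_mono)
  qed (simp add: supp)
  have conv: "AE t in \<mu>. (\<lambda>N. u N t * f t) \<longlonglongrightarrow> e t * f t"
    unfolding u_def using ser by (intro AE_I2 tendsto_intros) (simp add: sums_def)
  have efm: "(\<lambda>t. e t * f t) \<in> borel_measurable \<mu>" and ufm: "(\<lambda>t. u N t * f t) \<in> borel_measurable \<mu>" for N by measurable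
  have ub': "AE t in \<mu>. cmod (u N t * f t) \<le> cmod (complex_of_real K * f t)" for N by (rule AE_I2) (rule ub)
  note dc = L2_dominated_convergence[OF L2_scale[OF f, of "complex_of_real K"] efm ufm ub' conv]
  have Vlim: "(\<lambda>N. L2_norm \<nu> (\<lambda>s. V (\<lambda>t. u N t * f t) s - V (\<lambda>t. e t * f t) s)) \<longlonglongrightarrow> 0"
  proof -
    have "L2_norm \<nu> (\<lambda>s. V (\<lambda>t. u N t * f t) s - V (\<lambda>t. e t * f t) s) = L2_norm \<mu> (\<lambda>t. u N t * f t - e t * f t)" for N
    proof -
      have "L2_norm \<nu> (\<lambda>s. V (\<lambda>t. u N t * f t) s - V (\<lambda>t. e t * f t) s) = L2_norm \<nu> (V (\<lambda>t. u N t * f t - e t * f t))"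
      proof (rule L2_norm_cong_AE)
        show "AE s in \<nu>. V (\<lambda>t. u N t * f t) s - V (\<lambda>t. e t * f t) s = V (\<lambda>t. u N t * f t - e t * f t) s"
          using V_diff[OF dc(2)[of N] dc(1)] by eventually_elim simp
      qed (use V_L2[OF dc(2)[of N]] V_L2[OF dc(1)] V_L2[OF L2_diff[OF dc(2)[of N] dc(1)]] in \<open>auto intro!: L2_measurable L2_diff\<close>)
      then show ?thesis by (simp add: V_norm[OF L2_diff[OF dc(2)[of N] dc(1)]])
    qed
    then show ?thesis using dc(3) by simp
  qed
  have Vu: "AE s in \<nu>. V (\<lambda>t. u N t * f t) s = u N s * V f s - \<alpha>' * (\<integral>t. (\<Sum>n<N. c n * quot n s t) * f t \<partial>\<mu>)" for N
  proof (induction N)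
    case 0
    have "AE s in \<nu>. V (\<lambda>t. 0 * f t) s = 0 * V f s" by (rule V_scale[OF f])
    then show ?case by (simp add: u_def)
  next
    case (Suc N)
    have "AE s in \<nu>. V (\<lambda>t. u N t * f t + c N * (complex_of_real t ^ N * f t)) s = V (\<lambda>t. u N t * f t) s + V (\<lambda>t. c N * (complex_of_real t ^ N * f t)) s"
      by (rule V_add[OF dc(2)[of N] L2_scale[OF Lpow]])
    moreover have "AE s in \<nu>. V (\<lambda>t. c N * (complex_of_real t ^ N * f t)) s = c N * V (\<lambda>t. complex_of_real t ^ N * f t) s"
      by (rule V_scale[OF Lpow])
    ultimately show ?case using Suc.IH V_times_power(3)[OF f supp, of R N, simplified]
    proof eventually_elim
      case (elim s)
      have eq: "(\<lambda>t. u (Suc N) t * f t) = (\<lambda>t. u N t * f t + c N * (complex_of_real t ^ N * f t))"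
        by (simp add: u_def distrib_right mult.assoc)
      have "(\<integral>t. (\<Sum>n<Suc N. c n * quot n s t) * f t \<partial>\<mu>) = (\<integral>t. (\<Sum>n<N. c n * quot n s t) * f t + c N * (quot N s t * f t) \<partial>\<mu>)"
        by (simp add: distrib_right mult.assoc)
      also have "\<dots> = (\<integral>t. (\<Sum>n<N. c n * quot n s t) * f t \<partial>\<mu>) + c N * (\<integral>t. quot N s t * f t \<partial>\<mu>)"
      proof (subst Bochner_Integration.integral_add)
        have "integrable \<mu> (\<lambda>t. \<Sum>n<N. c n * (quot n s t * f t))"
          by (intro Bochner_Integration.integrable_sum integrable_mult_right qint)
        then show "integrable \<mu> (\<lambda>t. (\<Sum>n<N. c n * quot n s t) * f t)" by (simp add: sum_distrib_right mult.assoc)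
      qed (use qint in auto)
      finally have q: "(\<integral>t. (\<Sum>n<Suc N. c n * quot n s t) * f t \<partial>\<mu>) = (\<integral>t. (\<Sum>n<N. c n * quot n s t) * f t \<partial>\<mu>) + c N * (\<integral>t. quot N s t * f t \<partial>\<mu>)" .
      have us: "u (Suc N) s = u N s + c N * complex_of_real s ^ N" by (simp add: u_def)
      have "V (\<lambda>t. u (Suc N) t * f t) s = u N s * V f s - \<alpha>' * (\<integral>t. (\<Sum>n<N. c n * quot n s t) * f t \<partial>\<mu>) + c N * (complex_of_real s ^ N * V f s - \<alpha>' * (\<integral>t. quot N s t * f t \<partial>\<mu>))"
        unfolding eq using elim by simp
      then show ?case unfolding q us by (simp add: algebra_simps)
    qed
  qed
  have Vu_all: "AE s in \<nu>. \<forall>N. V (\<lambda>t. u N t * f t) s = u N s * V f s - \<alpha>' * (\<integral>t. (\<Sum>n<N. c n * quot n s t) * f t \<partial>\<mu>)"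
    unfolding AE_all_countable using Vu by blast
  have Vpt: "AE s in \<nu>. (\<lambda>N. V (\<lambda>t. u N t * f t) s) \<longlonglongrightarrow> e s * (V f s + \<alpha>' * (\<integral>t. exp_quot a (s - t) * f t \<partial>\<mu>))"
    using Vu_all
  proof eventually_elim
    case (elim s)
    \<comment> \<open>at least \<open>1\<close> so that the powers of \<open>\<rho>\<close> increase\<close>
    define \<rho> where "\<rho> = max 1 (max \<bar>s\<bar> \<bar>R\<bar>)"
    have \<rho>: "\<bar>s\<bar> \<le> \<rho>" "1 \<le> \<rho>" "0 \<le> \<rho>" "\<bar>R\<bar> \<le> \<rho>" by (auto simp: \<rho>_def)
    have "(\<lambda>N. \<integral>t. (\<Sum>n<N. c n * quot n s t) * f t \<partial>\<mu>) \<longlonglongrightarrow> (\<integral>t. (- e s * exp_quot a (s - t)) * f t \<partial>\<mu>)"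
    proof (rule integral_dominated_convergence[where w="\<lambda>t. exp (\<bar>a\<bar> * (2 * \<rho>)) * cmod (f t)"])
      show "integrable \<mu> (\<lambda>t. exp (\<bar>a\<bar> * (2 * \<rho>)) * cmod (f t))"
        by (intro integrable_mult_right integrable_norm bounded_support_integrable[OF f supp])
      show "AE t in \<mu>. (\<lambda>N. (\<Sum>n<N. c n * quot n s t) * f t) \<longlonglongrightarrow> (- e s * exp_quot a (s - t)) * f t"
        using quot_exp_series[of a s] unfolding c_def b_def e_def sums_def by (intro AE_I2 tendsto_intros) blast
      show "AE t in \<mu>. norm ((\<Sum>n<N. c n * quot n s t) * f t) \<le> exp (\<bar>a\<bar> * (2 * \<rho>)) * cmod (f t)" for N
      proof (rule AE_I2)
        fix t
        show "norm ((\<Sum>n<N. c n * quot n s t) * f t) \<le> exp (\<bar>a\<bar> * (2 * \<rho>)) * cmod (f t)"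
        proof (cases "R < \<bar>t\<bar>")
          case False
          have "cmod (\<Sum>n<N. c n * quot n s t) \<le> (\<Sum>n<N. (\<bar>a\<bar> * (2 * \<rho>)) ^ n / fact n)"
          proof (rule sum_norm_le)
            fix n
            have "cmod (quot n s t) \<le> (2 * \<rho>) ^ n" by (rule quot_bound) (use \<rho> False in auto)
            then have "cmod (c n * quot n s t) \<le> \<bar>a\<bar> ^ n / fact n * (2 * \<rho>) ^ n"
              unfolding norm_mult cn by (intro mult_left_mono) auto
            then show "cmod (c n * quot n s t) \<le> (\<bar>a\<bar> * (2 * \<rho>)) ^ n / fact n" by (simp add: power_mult_distrib)
          qed
          also have "\<dots> \<le> exp (\<bar>a\<bar> * (2 * \<rho>))" by (rule partial) (use \<rho> in auto)
          finally show ?thesis unfolding norm_mult by (rule mult_right_mono) simp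
        qed (simp add: supp)
      qed
    qed measurable
    then have "(\<lambda>N. u N s * V f s - \<alpha>' * (\<integral>t. (\<Sum>n<N. c n * quot n s t) * f t \<partial>\<mu>)) \<longlonglongrightarrow> e s * V f s - \<alpha>' * (\<integral>t. (- e s * exp_quot a (s - t)) * f t \<partial>\<mu>)"
      using ser[of s] unfolding u_def sums_def by (intro tendsto_intros)
    moreover have "(\<integral>t. (- e s * exp_quot a (s - t)) * f t \<partial>\<mu>) = - e s * (\<integral>t. exp_quot a (s - t) * f t \<partial>\<mu>)"
      unfolding mult.assoc by (rule integral_mult_right_zero)
    moreover have "(\<lambda>N. V (\<lambda>t. u N t * f t) s) = (\<lambda>N. u N s * V f s - \<alpha>' * (\<integral>t. (\<Sum>n<N. c n * quot n s t) * f t \<partial>\<mu>))"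
      using elim by (intro ext) blast
    moreover have "e s * V f s - \<alpha>' * (- e s * (\<integral>t. exp_quot a (s - t) * f t \<partial>\<mu>)) = e s * (V f s + \<alpha>' * (\<integral>t. exp_quot a (s - t) * f t \<partial>\<mu>))"
      by (simp add: distrib_left mult.left_commute)
    ultimately show ?case by (simp only:)
  qed
  have "(\<lambda>s. e s * (V f s + \<alpha>' * (\<integral>t. exp_quot a (s - t) * f t \<partial>\<mu>))) \<in> borel_measurable \<nu>"
  proof -
    interpret sigma_finite_measure \<mu> by (rule sigma_finite_mu)
    show ?thesis by measurable
  qed
  from L2_limit_unique_AE[OF V_L2[OF dc(2)] V_L2[OF eL] this Vlim Vpt]
  show "AE s in \<nu>. V (\<lambda>t. exp (- \<i> * complex_of_real (a * t)) * f t) s =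
      exp (- \<i> * complex_of_real (a * s)) * (V f s + \<alpha>' * (\<integral>t. exp_quot a (s - t) * f t \<partial>\<mu>))"
    unfolding e_def by eventually_elim simp
qed

lemma T_eps_integrable:
  assumes f: "f \<in> L2 \<mu>" and \<epsilon>: "0 < \<epsilon>"
  shows "integrable \<mu> (\<lambda>t. f t / (complex_of_real s - complex_of_real t + \<i> * complex_of_real \<epsilon>))"
proof -
  have "integrable \<mu> (\<lambda>t. - (f t / (complex_of_real t - Complex s \<epsilon>)))"
    using L2_div_integrable[OF mu f Complex_nonreal, of \<epsilon> s] \<epsilon> by simp
  moreover have "- (f t / (complex_of_real t - Complex s \<epsilon>)) = f t / (complex_of_real s - complex_of_real t + \<i> * complex_of_real \<epsilon>)" for t
    unfolding minus_divide_right by (simp add: Complex_eq algebra_simps)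
  ultimately show ?thesis by simp
qed

lemma T_eps_measurable:
  assumes f: "f \<in> borel_measurable \<mu>"
  shows "T_eps \<mu> \<epsilon> f \<in> borel_measurable borel"
proof -
  interpret sigma_finite_measure \<mu> by (rule sigma_finite_mu)
  note [measurable] = f
  show ?thesis unfolding T_eps_def by measurable
qed

text \<open>
  For each \<open>a\<close> the function \<open>Y a = V f + \<alpha> \<integral> exp_quot a (s - t) f(t) d\<mu>(t)\<close> has the same modulus as
  \<open>V (e\<^sup>-\<^sup>i\<^sup>a\<^sup>t f)\<close>, hence the norm of \<open>f\<close>. Its average over \<open>a\<close> is \<open>V f - \<alpha> T\<^sub>\<epsilon> f\<close>, and averages do not increase
  the norm.
\<close>

lemma smoothed_contraction:
  assumes f: "f \<in> L2 \<mu>" and supp: "\<And>t. R < \<bar>t\<bar> \<Longrightarrow> f t = 0" and \<epsilon>: "0 < \<epsilon>"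
  shows "(\<lambda>s. V f s - \<alpha>' * T_eps \<mu> \<epsilon> f s) \<in> L2 \<nu>"
    and "L2_norm \<nu> (\<lambda>s. V f s - \<alpha>' * T_eps \<mu> \<epsilon> f s) \<le> L2_norm \<mu> f"
proof -
  interpret M: sigma_finite_measure \<mu> by (rule sigma_finite_mu)
  interpret N: sigma_finite_measure \<nu> by (rule sigma_finite_nu)
  interpret E: finite_measure "exp_dist \<epsilon>" by standard (simp add: exp_dist_total[OF \<epsilon>])
  interpret EM: pair_sigma_finite "exp_dist \<epsilon>" \<mu> by standard
  interpret EN: pair_sigma_finite "exp_dist \<epsilon>" \<nu> by standard
  note [measurable] = L2_measurable[OF f] L2_measurable[OF V_L2[OF f]]
  have fint: "integrable \<mu> f" by (rule bounded_support_integrable[OF f supp])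
  define Y where "Y a s = V f s + \<alpha>' * (\<integral>t. exp_quot a (s - t) * f t \<partial>\<mu>)" for a s
  have Yint: "integrable (exp_dist \<epsilon>) (\<lambda>a. Y a s)" and Yval: "(\<integral>a. Y a s \<partial>exp_dist \<epsilon>) = V f s - \<alpha>' * T_eps \<mu> \<epsilon> f s" for s
  proof -
    let ?k = "\<lambda>a t. exp_quot a (s - t) * f t"
    have kint: "integrable \<mu> (\<lambda>t. ?k a t)" for a
      by (rule Bochner_Integration.integrable_bound[of _ "\<lambda>t. \<bar>a\<bar> * cmod (f t)"])
        (auto simp: norm_mult exp_quot_norm mult_right_mono fint)
    have pint: "integrable (exp_dist \<epsilon> \<Otimes>\<^sub>M \<mu>) (\<lambda>(a, t). ?k a t)"
    proof (rule EM.Fubini_integrable)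
      show "integrable (exp_dist \<epsilon>) (\<lambda>a. \<integral>t. norm (case (a, t) of (a, t) \<Rightarrow> ?k a t) \<partial>\<mu>)"
      proof (rule Bochner_Integration.integrable_bound)
        show "integrable (exp_dist \<epsilon>) (\<lambda>a. \<bar>a\<bar> * (\<integral>t. cmod (f t) \<partial>\<mu>))"
          using exp_dist_integrable_linear[OF \<epsilon>] by simp
        have "(\<integral>t. norm (?k a t) \<partial>\<mu>) \<le> (\<integral>t. \<bar>a\<bar> * cmod (f t) \<partial>\<mu>)" for a
        proof (rule integral_mono)
          show "integrable \<mu> (\<lambda>t. norm (?k a t))" by (rule integrable_norm[OF kint])
          show "integrable \<mu> (\<lambda>t. \<bar>a\<bar> * cmod (f t))" using fint by (intro integrable_mult_right integrable_norm)
          show "norm (?k a t) \<le> \<bar>a\<bar> * cmod (f t)" for t by (simp add: norm_mult exp_quot_norm mult_right_mono)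
        qed
        then show "AE a in exp_dist \<epsilon>. norm (\<integral>t. norm (case (a, t) of (a, t) \<Rightarrow> ?k a t) \<partial>\<mu>) \<le> norm (\<bar>a\<bar> * (\<integral>t. cmod (f t) \<partial>\<mu>))"
          by (intro AE_I2) (simp add: abs_mult)
      qed measurable
      show "AE a in exp_dist \<epsilon>. integrable \<mu> (\<lambda>t. case (a, t) of (a, t) \<Rightarrow> ?k a t)" using kint by simp
    qed measurable
    have i1: "integrable (exp_dist \<epsilon>) (\<lambda>a. \<integral>t. ?k a t \<partial>\<mu>)"
      using EM.integrable_fst'[OF pint] by simp
    show "integrable (exp_dist \<epsilon>) (\<lambda>a. Y a s)"
      unfolding Y_def using i1 by (intro Bochner_Integration.integrable_add integrable_mult_right) auto
    have "(\<integral>a. Y a s \<partial>exp_dist \<epsilon>) = V f s + \<alpha>' * (\<integral>a. (\<integral>t. ?k a t \<partial>\<mu>) \<partial>exp_dist \<epsilon>)"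
      unfolding Y_def using i1 by (simp add: measure_def exp_dist_total[OF \<epsilon>])
    also have "(\<integral>a. (\<integral>t. ?k a t \<partial>\<mu>) \<partial>exp_dist \<epsilon>) = (\<integral>t. (\<integral>a. ?k a t \<partial>exp_dist \<epsilon>) \<partial>\<mu>)"
      by (rule EM.Fubini_integral[symmetric, OF pint])
    also have "\<dots> = (\<integral>t. - (f t / (complex_of_real s - complex_of_real t + \<i> * complex_of_real \<epsilon>)) \<partial>\<mu>)"
      by (intro Bochner_Integration.integral_cong refl) (simp add: exp_quot_laplace[OF \<epsilon>])
    also have "\<dots> = - T_eps \<mu> \<epsilon> f s" by (simp add: T_eps_def)
    finally show "(\<integral>a. Y a s \<partial>exp_dist \<epsilon>) = V f s - \<alpha>' * T_eps \<mu> \<epsilon> f s" by simp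
  qed
  have Ynorm: "(\<integral>\<^sup>+s. ennreal ((cmod (Y a s))\<^sup>2) \<partial>\<nu>) = ennreal ((L2_norm \<mu> f)\<^sup>2)" for a
  proof -
    let ?g = "\<lambda>t. exp (- \<i> * complex_of_real (a * t)) * f t"
    have "(\<integral>\<^sup>+s. ennreal ((cmod (Y a s))\<^sup>2) \<partial>\<nu>) = (\<integral>\<^sup>+s. ennreal ((cmod (V ?g s))\<^sup>2) \<partial>\<nu>)"
    proof (rule nn_integral_cong_AE)
      show "AE s in \<nu>. ennreal ((cmod (Y a s))\<^sup>2) = ennreal ((cmod (V ?g s))\<^sup>2)"
        using V_exp(2)[OF f supp, of R a, simplified] by eventually_elim (simp add: Y_def norm_mult)
    qed
    also have "\<dots> = ennreal ((L2_norm \<nu> (V ?g))\<^sup>2)" by (rule nn_integral_L2[OF V_L2[OF V_exp(1)[OF f supp]]])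
    also have "L2_norm \<nu> (V ?g) = L2_norm \<mu> ?g" by (rule V_norm[OF V_exp(1)[OF f supp]])
    also have "\<dots> = L2_norm \<mu> f" by (simp add: L2_norm_def norm_mult)
    finally show ?thesis .
  qed
  have m: "(\<lambda>s. V f s - \<alpha>' * T_eps \<mu> \<epsilon> f s) \<in> borel_measurable \<nu>"
    using T_eps_measurable[OF L2_measurable[OF f], of \<epsilon>] by measurable
  have "(\<integral>\<^sup>+s. ennreal ((cmod (V f s - \<alpha>' * T_eps \<mu> \<epsilon> f s))\<^sup>2) \<partial>\<nu>) \<le> (\<integral>\<^sup>+s. (\<integral>\<^sup>+a. ennreal ((cmod (Y a s))\<^sup>2) \<partial>exp_dist \<epsilon>) \<partial>\<nu>)"
    unfolding Yval[symmetric] by (intro nn_integral_mono nn_integral_square_norm_le Yint) (simp add: exp_dist_total[OF \<epsilon>])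
  also have "\<dots> = (\<integral>\<^sup>+a. (\<integral>\<^sup>+s. ennreal ((cmod (Y a s))\<^sup>2) \<partial>\<nu>) \<partial>exp_dist \<epsilon>)"
    by (rule EN.Fubini') (unfold Y_def, measurable)
  also have "\<dots> = ennreal ((L2_norm \<mu> f)\<^sup>2)" by (simp add: Ynorm exp_dist_total[OF \<epsilon>])
  finally have le: "(\<integral>\<^sup>+s. ennreal ((cmod (V f s - \<alpha>' * T_eps \<mu> \<epsilon> f s))\<^sup>2) \<partial>\<nu>) \<le> ennreal ((L2_norm \<mu> f)\<^sup>2)" .
  show "(\<lambda>s. V f s - \<alpha>' * T_eps \<mu> \<epsilon> f s) \<in> L2 \<nu>" "L2_norm \<nu> (\<lambda>s. V f s - \<alpha>' * T_eps \<mu> \<epsilon> f s) \<le> L2_norm \<mu> f"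
    using L2_nn_integral_le[OF m le L2_norm_nonneg] by auto
qed

text \<open>
  The triangle inequality gives the bound for functions of bounded support; truncation and Fatou's lemma
  give it in general.
\<close>

lemma T_eps_bound:
  assumes f: "f \<in> L2 \<mu>" and \<epsilon>: "0 < \<epsilon>"
  shows "T_eps \<mu> \<epsilon> f \<in> L2 \<nu>" and "L2_norm \<nu> (T_eps \<mu> \<epsilon> f) \<le> 2 / \<bar>\<alpha>\<bar> * L2_norm \<mu> f"
proof -
  define fn where "fn n t = indicator {-real n..real n} t * f t" for n t
  have fnL: "fn n \<in> L2 \<mu>" for n unfolding fn_def by (rule L2_times_indicator[OF f]) (simp add: sets_mu)
  have fnn: "L2_norm \<mu> (fn n) \<le> L2_norm \<mu> f" for n
    unfolding L2_norm_def
    by (intro real_sqrt_le_mono integral_mono L2_square_integrable fnL f) (auto simp: fn_def split: split_indicator)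
  have supp: "fn n t = 0" if "real n < \<bar>t\<bar>" for n t using that by (auto simp: fn_def indicator_def)
  have Tn: "T_eps \<mu> \<epsilon> (fn n) \<in> L2 \<nu> \<and> L2_norm \<nu> (T_eps \<mu> \<epsilon> (fn n)) \<le> 2 / \<bar>\<alpha>\<bar> * L2_norm \<mu> f" for n
  proof -
    let ?W = "\<lambda>s. V (fn n) s - \<alpha>' * T_eps \<mu> \<epsilon> (fn n) s"
    note W = smoothed_contraction[OF fnL supp \<epsilon>, of n n]
    have eq: "T_eps \<mu> \<epsilon> (fn n) = (\<lambda>s. (1 / \<alpha>') * (V (fn n) s - ?W s))" using alpha by simp
    have VL: "V (fn n) \<in> L2 \<nu>" by (rule V_L2[OF fnL])
    have "L2_norm \<nu> (T_eps \<mu> \<epsilon> (fn n)) = 1 / \<bar>\<alpha>\<bar> * L2_norm \<nu> (\<lambda>s. V (fn n) s - ?W s)"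
      by (subst eq, subst L2_norm_scale) (simp add: norm_divide)
    also have "\<dots> \<le> 1 / \<bar>\<alpha>\<bar> * (L2_norm \<mu> f + L2_norm \<mu> f)"
    proof (rule mult_left_mono)
      have "L2_norm \<nu> (\<lambda>s. V (fn n) s - ?W s) \<le> L2_norm \<nu> (V (fn n)) + L2_norm \<nu> ?W" by (rule L2_norm_triangle_diff[OF VL W(1)])
      also have "\<dots> \<le> L2_norm \<mu> f + L2_norm \<mu> f" using W(2) fnn[of n] V_norm[OF fnL, of n] by linarith
      finally show "L2_norm \<nu> (\<lambda>s. V (fn n) s - ?W s) \<le> L2_norm \<mu> f + L2_norm \<mu> f" .
    qed simp
    also have "\<dots> = 2 / \<bar>\<alpha>\<bar> * L2_norm \<mu> f" unfolding mult_2[symmetric] by simp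
    finally have "L2_norm \<nu> (T_eps \<mu> \<epsilon> (fn n)) \<le> 2 / \<bar>\<alpha>\<bar> * L2_norm \<mu> f" .
    moreover have "T_eps \<mu> \<epsilon> (fn n) \<in> L2 \<nu>" by (subst eq) (rule L2_scale[OF L2_diff[OF VL W(1)]])
    ultimately show ?thesis by blast
  qed
  have Tm: "T_eps \<mu> \<epsilon> f \<in> borel_measurable \<nu>"
    using T_eps_measurable[OF L2_measurable[OF f], of \<epsilon>] by measurable
  have lim: "AE s in \<nu>. (\<lambda>n. T_eps \<mu> \<epsilon> (fn n) s) \<longlonglongrightarrow> T_eps \<mu> \<epsilon> f s"
  proof (rule AE_I2)
    fix s
    let ?d = "\<lambda>t. complex_of_real s - complex_of_real t + \<i> * complex_of_real \<epsilon>"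
    note [measurable] = L2_measurable[OF f] L2_measurable[OF fnL]
    show "(\<lambda>n. T_eps \<mu> \<epsilon> (fn n) s) \<longlonglongrightarrow> T_eps \<mu> \<epsilon> f s"
      unfolding T_eps_def
    proof (rule integral_dominated_convergence[where w="\<lambda>t. cmod (f t / ?d t)"])
      show "integrable \<mu> (\<lambda>t. cmod (f t / ?d t))" by (rule integrable_norm[OF T_eps_integrable[OF f \<epsilon>]])
      show "AE t in \<mu>. (\<lambda>n. fn n t / ?d t) \<longlonglongrightarrow> f t / ?d t"
      proof (rule AE_I2)
        fix t
        obtain N :: nat where N: "\<bar>t\<bar> \<le> real N" using real_arch_simple by blast
        have "\<forall>\<^sub>F n in sequentially. fn n t / ?d t = f t / ?d t"
        proof (rule eventually_sequentiallyI[of N])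
          fix n assume "N \<le> n"
          then have "\<bar>t\<bar> \<le> real n" using N by linarith
          then have "t \<in> {-real n..real n}" by auto
          then show "fn n t / ?d t = f t / ?d t" by (simp add: fn_def)
        qed
        then show "(\<lambda>n. fn n t / ?d t) \<longlonglongrightarrow> f t / ?d t" by (rule tendsto_eventually)
      qed
      show "AE t in \<mu>. norm (fn n t / ?d t) \<le> cmod (f t / ?d t)" for n
        by (intro AE_I2) (simp add: fn_def split: split_indicator)
    qed measurable
  qed
  show "T_eps \<mu> \<epsilon> f \<in> L2 \<nu>" "L2_norm \<nu> (T_eps \<mu> \<epsilon> f) \<le> 2 / \<bar>\<alpha>\<bar> * L2_norm \<mu> f"
    using L2_Fatou[of "\<lambda>n. T_eps \<mu> \<epsilon> (fn n)", OF _ Tm _ lim] Tn by blast+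
qed

end

section \<open>Two approximation lemmas\<close>

text \<open>
  An exchange of limits: convergence at the approximants \<open>u n\<close>, together with errors \<open>d n\<close> uniform in the
  parameter, gives convergence at \<open>f\<close>.
\<close>

lemma tendsto_uniform_approx:
  fixes a :: "'i \<Rightarrow> 'b \<Rightarrow> complex" and d :: "nat \<Rightarrow> real"
  assumes a: "\<And>n. \<forall>\<^sub>F i in G. cmod (a i f - a i (u n)) \<le> d n"
    and b: "\<And>n. cmod (b f - b (u n)) \<le> d n" and d: "d \<longlonglongrightarrow> 0"
    and lim: "\<And>n. ((\<lambda>i. a i (u n)) \<longlongrightarrow> b (u n)) G"
  shows "((\<lambda>i. a i f) \<longlongrightarrow> b f) G"
proof (rule tendstoI)
  fix e :: real assume e: "0 < e"
  have "\<forall>\<^sub>F n in sequentially. d n < e / 3" using order_tendstoD(2)[OF d, of "e/3"] e by simp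
  then obtain n where n: "d n < e / 3" by (auto simp: eventually_sequentially)
  have "\<forall>\<^sub>F i in G. dist (a i (u n)) (b (u n)) < e / 3" by (rule tendstoD[OF lim]) (use e in simp)
  with a[of n] show "\<forall>\<^sub>F i in G. dist (a i f) (b f) < e"
  proof eventually_elim
    case (elim i)
    have "dist (a i f) (b f) \<le> dist (a i f) (a i (u n)) + dist (a i (u n)) (b (u n)) + dist (b (u n)) (b f)"
      using dist_triangle[of "a i f" "b f" "a i (u n)"] dist_triangle[of "a i (u n)" "b f" "b (u n)"] by linarith
    moreover have "dist (a i f) (a i (u n)) \<le> d n" using elim by (simp add: dist_norm)
    moreover have "dist (b (u n)) (b f) \<le> d n" using b[of n] by (simp add: dist_norm norm_minus_commute)
    ultimately show ?case using elim(2) n by linarith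
  qed
qed

text \<open>
  The map \<open>t \<mapsto> (t + i) / (t - i)\<close>, written out in real coordinates, compactifies the line to the unit circle.
  A compactly supported function extends by \<open>0\<close> to a continuous function on the circle, to which
  Stone-Weierstrass applies. The inverse map is \<open>w \<mapsto> Im w / (1 - Re w)\<close>.
\<close>

lemma cauchy_approximation_on_circle:
  fixes \<psi> :: "real \<Rightarrow> real"
  assumes cont: "continuous_on UNIV \<psi>" and supp: "\<And>t. R < \<bar>t\<bar> \<Longrightarrow> \<psi> t = 0" and e: "0 < e"
  obtains p :: "complex \<Rightarrow> real" where "real_polynomial_function p"
    "\<And>t. \<bar>\<psi> t - p (Complex ((t\<^sup>2 - 1) / (t\<^sup>2 + 1)) (2 * t / (t\<^sup>2 + 1)))\<bar> < e"
proof -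
  let ?S = "sphere 0 1 :: complex set"
  define g where "g w = (if Re w = 1 then 0 else \<psi> (Im w / (1 - Re w)))" for w
  define S1 where "S1 = ?S \<inter> {w. Re w < 1}"
  \<comment> \<open>on the circle \<open>t\<^sup>2 = (1 + Re w) / (1 - Re w)\<close>, so away from \<open>w = 1\<close> this means \<open>|t| > R\<close>\<close>
  define S2 where "S2 = ?S \<inter> {w. R\<^sup>2 * (1 - Re w) < 1 + Re w}"
  have circ: "(Re w)\<^sup>2 + (Im w)\<^sup>2 = 1" "Re w \<le> 1" "-1 \<le> Re w" if "w \<in> ?S" for w
    using that abs_Re_le_cmod[of w] by (auto simp: cmod_power2[symmetric])
  have g2: "g w = 0" if "w \<in> S2" for w
  proof (cases "Re w = 1")
    case False
    have w: "w \<in> ?S" "R\<^sup>2 * (1 - Re w) < 1 + Re w" using that by (auto simp: S2_def)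
    then have pos: "0 < 1 - Re w" using circ(2)[of w] False by simp
    have "(Im w)\<^sup>2 = (1 - Re w) * (1 + Re w)" using circ(1)[OF w(1)] by (simp add: algebra_simps power2_eq_square)
    then have "R\<^sup>2 * (1 - Re w) * (1 - Re w) < (Im w)\<^sup>2" using w(2) pos by (simp add: mult.commute)
    then have "R\<^sup>2 < (Im w / (1 - Re w))\<^sup>2" using pos by (simp add: power_divide power2_eq_square[of "1 - Re w"] pos_less_divide_eq)
    then have "R < \<bar>Im w / (1 - Re w)\<bar>" by (metis abs_ge_self abs_le_square_iff not_le order_trans)
    then show ?thesis using False supp by (simp add: g_def)
  qed (simp add: g_def)
  have uS: "S1 \<union> S2 = ?S"
  proof -
    have "w \<in> S1 \<union> S2" if "w \<in> ?S" for w
      using that circ(2)[OF that] by (cases "Re w < 1") (auto simp: S1_def S2_def)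
    then have "?S \<subseteq> S1 \<union> S2" by blast
    moreover have "S1 \<union> S2 \<subseteq> ?S" by (auto simp: S1_def S2_def)
    ultimately show ?thesis by blast
  qed
  have c1: "continuous_on S1 g"
  proof (rule continuous_on_eq)
    show "continuous_on S1 (\<lambda>w. \<psi> (Im w / (1 - Re w)))"
      by (rule continuous_on_compose2[OF cont]) (auto intro!: continuous_intros simp: S1_def)
  qed (auto simp: S1_def g_def)
  have c2: "continuous_on S2 g"
    by (rule continuous_on_eq[of S2 "\<lambda>_. 0"]) (auto simp: g2)
  have o1: "openin (top_of_set (S1 \<union> S2)) S1" unfolding uS unfolding S1_def
    by (intro openin_open_Int open_Collect_less continuous_intros)
  have o2: "openin (top_of_set (S1 \<union> S2)) S2" unfolding uS unfolding S2_def
    by (intro openin_open_Int open_Collect_less continuous_intros)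
  have "continuous_on ?S g"
    using continuous_on_Un_local_open[OF o1 o2 c1 c2] unfolding uS .
  then obtain p where p: "real_polynomial_function p" "\<And>w. w \<in> ?S \<Longrightarrow> \<bar>g w - p w\<bar> < e"
    using Stone_Weierstrass_real_polynomial_function[of ?S g e] e by auto
  show ?thesis
  proof (rule that[OF p(1)])
    fix t :: real
    define w where "w = Complex ((t\<^sup>2 - 1) / (t\<^sup>2 + 1)) (2 * t / (t\<^sup>2 + 1))"
    have pos: "0 < t\<^sup>2 + 1" by (simp add: add_nonneg_pos)
    have "(cmod w)\<^sup>2 = ((t\<^sup>2 - 1)\<^sup>2 + (2 * t)\<^sup>2) / (t\<^sup>2 + 1)\<^sup>2"
      unfolding w_def cmod_power2 by (simp add: power_divide add_divide_distrib)
    also have "(t\<^sup>2 - 1)\<^sup>2 + (2 * t)\<^sup>2 = (t\<^sup>2 + 1)\<^sup>2" by (simp add: power2_eq_square algebra_simps)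
    finally have "(cmod w)\<^sup>2 = 1" using pos by simp
    then have "w \<in> ?S" by (simp add: power2_eq_1_iff) (smt (verit) norm_ge_zero)
    moreover have "g w = \<psi> t"
    proof -
      have re: "1 - Re w = 2 / (t\<^sup>2 + 1)" unfolding w_def using pos by (simp add: field_simps)
      then have "Re w \<noteq> 1" using pos by auto
      moreover have "Im w / (1 - Re w) = t" unfolding re using pos by (simp add: w_def)
      ultimately show ?thesis by (simp add: g_def)
    qed
    ultimately show "\<bar>\<psi> t - p (Complex ((t\<^sup>2 - 1) / (t\<^sup>2 + 1)) (2 * t / (t\<^sup>2 + 1)))\<bar> < e"
      using p(2)[of w] by (simp add: w_def)
  qed
qed

section \<open>The weak limit\<close>

text \<open>
  A choice of boundary values as provided by lemma \<open>boundary_values\<close>.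
\<close>

locale rank_one_boundary = rank_one_pair +
  fixes h :: "real \<Rightarrow> complex" and B :: "real set"
  assumes h_measurable [measurable]: "h \<in> borel_measurable borel"
    and h_limit: "AE s in \<nu>. ((\<lambda>\<epsilon>. F (Complex s \<epsilon>)) \<longlongrightarrow> - h s) (at_right 0)"
    and B_sets [measurable]: "B \<in> sets borel" and B_full: "AE s in \<nu>. s \<in> B"
    and h_density: "density \<nu> (\<lambda>s. ennreal ((cmod (1 - \<alpha>' * h s))\<^sup>2)) = density \<mu> (indicator B)"
begin

lemma T_eps_diff:
  assumes "f \<in> L2 \<mu>" "g \<in> L2 \<mu>" "0 < \<epsilon>"
  shows "T_eps \<mu> \<epsilon> (\<lambda>t. f t - g t) = (\<lambda>s. T_eps \<mu> \<epsilon> f s - T_eps \<mu> \<epsilon> g s)"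
  unfolding T_eps_def using T_eps_integrable[OF assms(1,3)] T_eps_integrable[OF assms(2,3)]
  by (simp add: diff_divide_distrib)

lemma T_eps_add:
  assumes "f \<in> L2 \<mu>" "g \<in> L2 \<mu>" "0 < \<epsilon>"
  shows "T_eps \<mu> \<epsilon> (\<lambda>t. f t + g t) = (\<lambda>s. T_eps \<mu> \<epsilon> f s + T_eps \<mu> \<epsilon> g s)"
  unfolding T_eps_def using T_eps_integrable[OF assms(1,3)] T_eps_integrable[OF assms(2,3)]
  by (simp add: add_divide_distrib)

lemma T_eps_scale: "T_eps \<mu> \<epsilon> (\<lambda>t. c * f t) = (\<lambda>s. c * T_eps \<mu> \<epsilon> f s)"
proof
  fix s
  have "T_eps \<mu> \<epsilon> (\<lambda>t. c * f t) s = (\<integral>t. c * (f t / (complex_of_real s - complex_of_real t + \<i> * complex_of_real \<epsilon>)) \<partial>\<mu>)"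
    unfolding T_eps_def by (simp only: times_divide_eq_right)
  also have "\<dots> = c * T_eps \<mu> \<epsilon> f s" unfolding T_eps_def by (rule integral_mult_right_zero)
  finally show "T_eps \<mu> \<epsilon> (\<lambda>t. c * f t) s = c * T_eps \<mu> \<epsilon> f s" .
qed

lemma T_eps_bounded_operator:
  assumes \<epsilon>: "0 < \<epsilon>"
  shows "L2_bounded_operator \<mu> \<nu> (T_eps \<mu> \<epsilon>)" "L2_opnorm \<mu> \<nu> (T_eps \<mu> \<epsilon>) \<le> ennreal (2 / \<bar>\<alpha>\<bar>)"
proof -
  have lin: "L2_linear \<mu> \<nu> (T_eps \<mu> \<epsilon>)"
    unfolding L2_linear_def
  proof (intro conjI ballI allI impI)
    fix f g assume f: "f \<in> L2 \<mu>" and g: "g \<in> L2 \<mu>" and eq: "AE x in \<mu>. f x = g x"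
    note [measurable] = L2_measurable[OF f] L2_measurable[OF g]
    have "T_eps \<mu> \<epsilon> f = T_eps \<mu> \<epsilon> g" unfolding T_eps_def
      by (intro ext integral_cong_AE) (use eq in auto)
    then show "AE y in \<nu>. T_eps \<mu> \<epsilon> f y = T_eps \<mu> \<epsilon> g y" by simp
  qed (use T_eps_bound \<epsilon> in \<open>auto simp: T_eps_add T_eps_scale\<close>)
  show "L2_bounded_operator \<mu> \<nu> (T_eps \<mu> \<epsilon>)"
    by (rule L2_bounded_operatorI[OF lin _ T_eps_bound(2)[OF _ \<epsilon>]]) auto
  show "L2_opnorm \<mu> \<nu> (T_eps \<mu> \<epsilon>) \<le> ennreal (2 / \<bar>\<alpha>\<bar>)"
    by (rule L2_opnorm_le[OF _ T_eps_bound(2)[OF _ \<epsilon>]]) auto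
qed

text \<open>
  The weak limit of the contractions \<open>V - \<alpha> T\<^sub>\<epsilon>\<close>.
\<close>

definition boundary_mult :: "(real \<Rightarrow> complex) \<Rightarrow> real \<Rightarrow> complex" where
  "boundary_mult f s = f s * (1 - \<alpha>' * h s)"

lemma boundary_mult_nn_integral:
  assumes [measurable]: "k \<in> borel_measurable borel"
  shows "(\<integral>\<^sup>+s. ennreal ((cmod (1 - \<alpha>' * h s))\<^sup>2) * k s \<partial>\<nu>) = (\<integral>\<^sup>+s. indicator B s * k s \<partial>\<mu>)"
proof -
  have "(\<integral>\<^sup>+s. ennreal ((cmod (1 - \<alpha>' * h s))\<^sup>2) * k s \<partial>\<nu>) = (\<integral>\<^sup>+s. k s \<partial>density \<nu> (\<lambda>s. ennreal ((cmod (1 - \<alpha>' * h s))\<^sup>2)))"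
    by (rule nn_integral_density[symmetric]) measurable
  also have "\<dots> = (\<integral>\<^sup>+s. indicator B s * k s \<partial>\<mu>)"
    unfolding h_density by (rule nn_integral_density) measurable
  finally show ?thesis .
qed

text \<open>
  A set that is null for \<open>\<mu>\<close> may be charged by \<open>\<nu>\<close>, but then \<open>1 - \<alpha> h\<close> vanishes almost everywhere on it. This
  is why the product \<open>f (1 - \<alpha> h)\<close> respects equality \<open>\<mu>\<close>-almost everywhere.
\<close>

lemma boundary_mult_AE:
  assumes "AE t in \<mu>. P t"
  shows "AE s in \<nu>. 1 - \<alpha>' * h s \<noteq> 0 \<longrightarrow> P s"
proof -
  have "AE s in density \<mu> (indicator B). P s"
    by (subst AE_density) (use assms in auto)
  then have "AE s in density \<nu> (\<lambda>s. ennreal ((cmod (1 - \<alpha>' * h s))\<^sup>2)). P s" unfolding h_density .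
  then show ?thesis by (subst (asm) AE_density) auto
qed

lemma measurable_nu_mu: "f \<in> borel_measurable \<mu> \<longleftrightarrow> f \<in> borel_measurable borel" "f \<in> borel_measurable \<nu> \<longleftrightarrow> f \<in> borel_measurable borel"
  using measurable_cong_sets[OF sets_mu refl] measurable_cong_sets[OF sets_nu refl] by auto

lemma boundary_mult_L2:
  assumes f: "f \<in> L2 \<mu>"
  shows "boundary_mult f \<in> L2 \<nu>" "L2_norm \<nu> (boundary_mult f) \<le> L2_norm \<mu> f"
proof -
  have [measurable]: "f \<in> borel_measurable borel" using L2_measurable[OF f] by (simp add: measurable_nu_mu)
  have m: "boundary_mult f \<in> borel_measurable \<nu>" unfolding boundary_mult_def by measurable
  have "(\<integral>\<^sup>+s. ennreal ((cmod (boundary_mult f s))\<^sup>2) \<partial>\<nu>) = (\<integral>\<^sup>+s. ennreal ((cmod (1 - \<alpha>' * h s))\<^sup>2) * ennreal ((cmod (f s))\<^sup>2) \<partial>\<nu>)"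
    by (intro nn_integral_cong) (simp add: boundary_mult_def norm_mult power_mult_distrib ennreal_mult mult.commute)
  also have "\<dots> = (\<integral>\<^sup>+s. indicator B s * ennreal ((cmod (f s))\<^sup>2) \<partial>\<mu>)"
    by (rule boundary_mult_nn_integral) measurable
  also have "\<dots> \<le> (\<integral>\<^sup>+s. ennreal ((cmod (f s))\<^sup>2) \<partial>\<mu>)" by (intro nn_integral_mono) (auto split: split_indicator)
  also have "\<dots> = ennreal ((L2_norm \<mu> f)\<^sup>2)" by (rule nn_integral_L2[OF f])
  finally have le: "(\<integral>\<^sup>+s. ennreal ((cmod (boundary_mult f s))\<^sup>2) \<partial>\<nu>) \<le> ennreal ((L2_norm \<mu> f)\<^sup>2)" .
  show "boundary_mult f \<in> L2 \<nu>" "L2_norm \<nu> (boundary_mult f) \<le> L2_norm \<mu> f"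
    using L2_nn_integral_le[OF m le L2_norm_nonneg] by auto
qed

definition T0 :: "(real \<Rightarrow> complex) \<Rightarrow> real \<Rightarrow> complex" where
  "T0 f s = (1 / \<alpha>') * (V f s - boundary_mult f s)"

lemma alpha': "\<alpha>' \<noteq> 0"
  using alpha by simp

lemma T0_L2: "f \<in> L2 \<mu> \<Longrightarrow> T0 f \<in> L2 \<nu>"
  unfolding T0_def by (intro L2_scale L2_diff V_L2 boundary_mult_L2)

lemma T0_norm:
  assumes f: "f \<in> L2 \<mu>"
  shows "L2_norm \<nu> (T0 f) \<le> 2 / \<bar>\<alpha>\<bar> * L2_norm \<mu> f"
proof -
  have "L2_norm \<nu> (T0 f) = 1 / \<bar>\<alpha>\<bar> * L2_norm \<nu> (\<lambda>s. V f s - boundary_mult f s)"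
    unfolding T0_def L2_norm_scale by (simp add: norm_divide)
  also have "\<dots> \<le> 1 / \<bar>\<alpha>\<bar> * (L2_norm \<mu> f + L2_norm \<mu> f)"
  proof (rule mult_left_mono)
    have "L2_norm \<nu> (\<lambda>s. V f s - boundary_mult f s) \<le> L2_norm \<nu> (V f) + L2_norm \<nu> (boundary_mult f)"
      by (rule L2_norm_triangle_diff[OF V_L2[OF f] boundary_mult_L2(1)[OF f]])
    then show "L2_norm \<nu> (\<lambda>s. V f s - boundary_mult f s) \<le> L2_norm \<mu> f + L2_norm \<mu> f"
      using boundary_mult_L2(2)[OF f] V_norm[OF f] by linarith
  qed simp
  also have "\<dots> = 2 / \<bar>\<alpha>\<bar> * L2_norm \<mu> f" unfolding mult_2[symmetric] by simp
  finally show ?thesis .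
qed

lemma T0_add:
  assumes f: "f \<in> L2 \<mu>" and g: "g \<in> L2 \<mu>"
  shows "AE s in \<nu>. T0 (\<lambda>t. f t + g t) s = T0 f s + T0 g s"
  using V_add[OF f g] by eventually_elim (simp add: T0_def boundary_mult_def algebra_simps flip: add_divide_distrib diff_divide_distrib)

lemma T0_scale:
  assumes f: "f \<in> L2 \<mu>"
  shows "AE s in \<nu>. T0 (\<lambda>t. c * f t) s = c * T0 f s"
  using V_scale[OF f, of c] by eventually_elim (simp add: T0_def boundary_mult_def algebra_simps)

lemma T0_diff:
  assumes f: "f \<in> L2 \<mu>" and g: "g \<in> L2 \<mu>"
  shows "AE s in \<nu>. T0 (\<lambda>t. f t - g t) s = T0 f s - T0 g s"
  using T0_add[OF f L2_scale[OF g, of "-1"]] T0_scale[OF g, of "-1"] by eventually_elim simp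

lemma T0_linear: "L2_linear \<mu> \<nu> T0"
  unfolding L2_linear_def
proof (intro conjI ballI allI impI)
  fix f g assume f: "f \<in> L2 \<mu>" and g: "g \<in> L2 \<mu>" and eq: "AE x in \<mu>. f x = g x"
  have "AE y in \<nu>. V f y = V g y" using V_linear f g eq by (simp add: L2_linear_def)
  with boundary_mult_AE[OF eq] show "AE y in \<nu>. T0 f y = T0 g y"
    by eventually_elim (auto simp: T0_def boundary_mult_def)
qed (use T0_L2 T0_add T0_scale in auto)

lemma T0_bounded_operator: "L2_bounded_operator \<mu> \<nu> T0"
  by (rule L2_bounded_operatorI[OF T0_linear _ T0_norm]) auto

definition pointwise :: "(real \<Rightarrow> complex) set" where
  "pointwise = {f \<in> L2 \<mu>. AE s in \<nu>. ((\<lambda>\<epsilon>. T_eps \<mu> \<epsilon> f s) \<longlongrightarrow> T0 f s) (at_right 0)}"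

lemma eventually_at_right_pos: "\<forall>\<^sub>F \<epsilon> in at_right 0. 0 < (\<epsilon>::real)"
  by (rule eventually_at_right_less)

lemma pointwise_add:
  assumes f: "f \<in> pointwise" and g: "g \<in> pointwise"
  shows "(\<lambda>t. f t + g t) \<in> pointwise"
proof -
  have fg: "f \<in> L2 \<mu>" "g \<in> L2 \<mu>" using f g by (auto simp: pointwise_def)
  have "AE s in \<nu>. ((\<lambda>\<epsilon>. T_eps \<mu> \<epsilon> (\<lambda>t. f t + g t) s) \<longlongrightarrow> T0 (\<lambda>t. f t + g t) s) (at_right 0)"
    using f[unfolded pointwise_def, THEN CollectD, THEN conjunct2] g[unfolded pointwise_def, THEN CollectD, THEN conjunct2] T0_add[OF fg]
  proof eventually_elim
    case (elim s)
    have ev: "\<forall>\<^sub>F \<epsilon> in at_right 0. T_eps \<mu> \<epsilon> f s + T_eps \<mu> \<epsilon> g s = T_eps \<mu> \<epsilon> (\<lambda>t. f t + g t) s"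
      using eventually_at_right_pos by eventually_elim (simp add: T_eps_add fg)
    show ?case unfolding elim(3) by (rule Lim_transform_eventually[OF tendsto_add[OF elim(1,2)] ev])
  qed
  then show ?thesis using L2_add[OF fg] by (simp add: pointwise_def)
qed

lemma pointwise_scale:
  assumes f: "f \<in> pointwise"
  shows "(\<lambda>t. c * f t) \<in> pointwise"
proof -
  have fL: "f \<in> L2 \<mu>" using f by (auto simp: pointwise_def)
  have "AE s in \<nu>. ((\<lambda>\<epsilon>. T_eps \<mu> \<epsilon> (\<lambda>t. c * f t) s) \<longlongrightarrow> T0 (\<lambda>t. c * f t) s) (at_right 0)"
    using f[unfolded pointwise_def, THEN CollectD, THEN conjunct2] T0_scale[OF fL, of c]
  proof eventually_elim
    case (elim s)
    show ?case unfolding elim(2) T_eps_scale by (intro tendsto_intros elim(1))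
  qed
  then show ?thesis using L2_scale[OF fL] by (simp add: pointwise_def)
qed

text \<open>
  Partial fractions. The condition on \<open>\<epsilon>\<close> keeps the point \<open>s + i\<epsilon>\<close> away from \<open>z\<close>. The hypotheses on \<open>f\<close>
  are phrased through the two integrals so that they cover \<open>f = 1\<close>.
\<close>

lemma T_eps_div:
  assumes z: "z \<notin> \<real>" and \<epsilon>: "0 < \<epsilon>" "\<epsilon> < \<bar>Im z\<bar>"
    and i1: "integrable \<mu> (\<lambda>t. f t / (complex_of_real t - z))"
    and i2: "integrable \<mu> (\<lambda>t. f t / (complex_of_real s - complex_of_real t + \<i> * complex_of_real \<epsilon>))"
  shows "T_eps \<mu> \<epsilon> (\<lambda>t. f t / (complex_of_real t - z)) s =
    ((\<integral>t. f t / (complex_of_real t - z) \<partial>\<mu>) + T_eps \<mu> \<epsilon> f s) / (complex_of_real s + \<i> * complex_of_real \<epsilon> - z)"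
proof -
  let ?d = "\<lambda>t. complex_of_real s - complex_of_real t + \<i> * complex_of_real \<epsilon>"
  let ?D = "complex_of_real s + \<i> * complex_of_real \<epsilon> - z"
  have D: "?D \<noteq> 0" using \<epsilon> by (auto simp: complex_eq_iff)
  have frac: "x / a / b = (x / a + x / b) / (b + a)" if "a \<noteq> 0" "b \<noteq> 0" "b + a \<noteq> 0" for x a b :: complex
  proof -
    have "x / a + x / b = x * (b + a) / (a * b)" using that by (simp add: field_simps)
    then show ?thesis using that by simp
  qed
  have "f t / (complex_of_real t - z) / ?d t = (f t / (complex_of_real t - z) + f t / ?d t) / ?D" for t
  proof -
    have 1: "complex_of_real t - z \<noteq> 0" by (rule nonreal_ne[OF z])
    have 2: "?d t \<noteq> 0" using \<epsilon> by (auto simp: complex_eq_iff)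
    have "?D = ?d t + (complex_of_real t - z)" by simp
    with frac[OF 1 2, of "f t"] D show ?thesis by simp
  qed
  then have "T_eps \<mu> \<epsilon> (\<lambda>t. f t / (complex_of_real t - z)) s = (\<integral>t. (f t / (complex_of_real t - z) + f t / ?d t) / ?D \<partial>\<mu>)"
    unfolding T_eps_def by simp
  also have "\<dots> = (\<integral>t. f t / (complex_of_real t - z) + f t / ?d t \<partial>\<mu>) / ?D" by (rule integral_divide_zero)
  also have "(\<integral>t. f t / (complex_of_real t - z) + f t / ?d t \<partial>\<mu>) = (\<integral>t. f t / (complex_of_real t - z) \<partial>\<mu>) + T_eps \<mu> \<epsilon> f s"
    unfolding T_eps_def by (rule Bochner_Integration.integral_add[OF i1 i2])
  finally show ?thesis .
qed

lemma T_eps_div_limit: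
  assumes z: "z \<notin> \<real>" and i1: "integrable \<mu> (\<lambda>t. f t / (complex_of_real t - z))"
    and i2: "\<And>\<epsilon>. 0 < \<epsilon> \<Longrightarrow> integrable \<mu> (\<lambda>t. f t / (complex_of_real s - complex_of_real t + \<i> * complex_of_real \<epsilon>))"
    and lim: "((\<lambda>\<epsilon>. T_eps \<mu> \<epsilon> f s) \<longlongrightarrow> L) (at_right 0)"
  shows "((\<lambda>\<epsilon>. T_eps \<mu> \<epsilon> (\<lambda>t. f t / (complex_of_real t - z)) s) \<longlongrightarrow>
     ((\<integral>t. f t / (complex_of_real t - z) \<partial>\<mu>) + L) / (complex_of_real s - z)) (at_right 0)"
proof -
  have im: "0 < \<bar>Im z\<bar>" using z complex_is_Real_iff by auto
  have idl: "((\<lambda>\<epsilon>. \<epsilon>) \<longlongrightarrow> 0) (at_right (0::real))" by (rule tendsto_ident_at)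
  have "((\<lambda>\<epsilon>. ((\<integral>t. f t / (complex_of_real t - z) \<partial>\<mu>) + T_eps \<mu> \<epsilon> f s) / (complex_of_real s + \<i> * complex_of_real \<epsilon> - z)) \<longlongrightarrow>
     ((\<integral>t. f t / (complex_of_real t - z) \<partial>\<mu>) + L) / (complex_of_real s + \<i> * complex_of_real 0 - z)) (at_right 0)"
    using nonreal_ne[OF z, of s] by (intro tendsto_intros lim idl) auto
  moreover have "\<forall>\<^sub>F \<epsilon> in at_right 0. ((\<integral>t. f t / (complex_of_real t - z) \<partial>\<mu>) + T_eps \<mu> \<epsilon> f s) / (complex_of_real s + \<i> * complex_of_real \<epsilon> - z)
      = T_eps \<mu> \<epsilon> (\<lambda>t. f t / (complex_of_real t - z)) s"
    using eventually_at_right_real[OF im] by eventually_elim (simp add: T_eps_div[OF z _ _ i1 i2])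
  ultimately show ?thesis using Lim_transform_eventually by fastforce
qed

lemma T_eps_one: "T_eps \<mu> \<epsilon> (\<lambda>_. 1) s = - F (Complex s \<epsilon>)"
proof -
  have "1 / (complex_of_real s - complex_of_real t + \<i> * complex_of_real \<epsilon>) = - (1 / (complex_of_real t - Complex s \<epsilon>))" for t
    unfolding minus_divide_right by (simp add: Complex_eq algebra_simps)
  then show ?thesis unfolding T_eps_def borel_transform_def by simp
qed

lemma kernel_one_integrable:
  assumes "0 < \<epsilon>"
  shows "integrable \<mu> (\<lambda>t. 1 / (complex_of_real s - complex_of_real t + \<i> * complex_of_real \<epsilon>))"
proof -
  have "integrable \<mu> (\<lambda>t. - (1 / (complex_of_real t - Complex s \<epsilon>)))"
    using cauchy_kernel_integrable[OF mu Complex_nonreal, of \<epsilon> s] assms by simp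
  moreover have "- (1 / (complex_of_real t - Complex s \<epsilon>)) = 1 / (complex_of_real s - complex_of_real t + \<i> * complex_of_real \<epsilon>)" for t
    unfolding minus_divide_right by (simp add: Complex_eq algebra_simps)
  ultimately show ?thesis by simp
qed

text \<open>
  The base case, where pointwise convergence of \<open>T\<^sub>\<epsilon>\<close> is that of \<open>F\<close>.
\<close>

lemma pointwise_cauchy_kernel:
  assumes z: "z \<notin> \<real>"
  shows "(\<lambda>t. 1 / (complex_of_real t - z)) \<in> pointwise"
proof -
  have "AE s in \<nu>. ((\<lambda>\<epsilon>. T_eps \<mu> \<epsilon> (\<lambda>t. 1 / (complex_of_real t - z)) s) \<longlongrightarrow> T0 (\<lambda>t. 1 / (complex_of_real t - z)) s) (at_right 0)"
    using h_limit V_cauchy_kernel[OF z]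
  proof eventually_elim
    case (elim s)
    have "((\<lambda>\<epsilon>. T_eps \<mu> \<epsilon> (\<lambda>_. 1) s) \<longlongrightarrow> h s) (at_right 0)"
      using tendsto_minus[OF elim(1)] by (simp add: T_eps_one)
    note T_eps_div_limit[OF z cauchy_kernel_integrable[OF mu z] kernel_one_integrable this]
    moreover have "T0 (\<lambda>t. 1 / (complex_of_real t - z)) s = ((\<integral>t. 1 / (complex_of_real t - z) \<partial>\<mu>) + h s) / (complex_of_real s - z)"
    proof -
      have "T0 (\<lambda>t. 1 / (complex_of_real t - z)) s = (1 / \<alpha>') * (\<alpha>' * (F z + h s) / (complex_of_real s - z))"
        unfolding T0_def boundary_mult_def elim(2) by (simp add: diff_divide_distrib[symmetric] algebra_simps)
      then show ?thesis using alpha' by (simp add: borel_transform_def)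
    qed
    ultimately show ?case by simp
  qed
  then show ?thesis using cauchy_kernel_L2[OF mu z] by (simp add: pointwise_def)
qed

lemma pointwise_div:
  assumes f: "f \<in> pointwise" and z: "z \<notin> \<real>"
  shows "(\<lambda>t. f t / (complex_of_real t - z)) \<in> pointwise"
proof -
  have fL: "f \<in> L2 \<mu>" using f by (auto simp: pointwise_def)
  have "AE s in \<nu>. ((\<lambda>\<epsilon>. T_eps \<mu> \<epsilon> (\<lambda>t. f t / (complex_of_real t - z)) s) \<longlongrightarrow> T0 (\<lambda>t. f t / (complex_of_real t - z)) s) (at_right 0)"
    using f[unfolded pointwise_def, THEN CollectD, THEN conjunct2] V_div[OF fL z]
  proof eventually_elim
    case (elim s)
    note T_eps_div_limit[OF z L2_div_integrable[OF mu fL z] T_eps_integrable[OF fL] elim(1)]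
    moreover have "T0 (\<lambda>t. f t / (complex_of_real t - z)) s = ((\<integral>t. f t / (complex_of_real t - z) \<partial>\<mu>) + T0 f s) / (complex_of_real s - z)"
    proof -
      have alg: "(1 / a) * ((v + a * i) / d - x / d * k) = (i + (1 / a) * (v - x * k)) / d"
        if "a \<noteq> 0" "d \<noteq> 0" for a v i d x k :: complex
        using that by (simp add: field_simps)
      show ?thesis unfolding T0_def boundary_mult_def elim(2) by (rule alg[OF alpha' nonreal_ne[OF z]])
    qed
    ultimately show ?case by simp
  qed
  then show ?thesis using L2_div_nonreal[OF mu fL z] by (simp add: pointwise_def)
qed

definition circle_point :: "real \<Rightarrow> complex" where
  "circle_point t = Complex ((t\<^sup>2 - 1) / (t\<^sup>2 + 1)) (2 * t / (t\<^sup>2 + 1))"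

text \<open>
  The coordinates of the point on the circle are linear combinations of \<open>1\<close>, \<open>1 / (t - i)\<close>, \<open>1 / (t + i)\<close> and
  \<open>1 / ((t - i) (t + i))\<close>, so multiplication by them stays within the class.
\<close>

lemma pointwise_polynomial:
  assumes p: "real_polynomial_function p" and f: "f \<in> pointwise"
  shows "(\<lambda>t. complex_of_real (p (circle_point t)) * f t) \<in> pointwise"
  using p f
proof (induction arbitrary: f rule: real_polynomial_function.induct)
  case (linear p)
  have i: "\<i> \<notin> \<real>" "- \<i> \<notin> \<real>" by (simp_all add: complex_is_Real_iff)
  have fp: "f \<in> pointwise" by (rule linear.prems)
  interpret bounded_linear p by (rule linear(1))
  have pw: "p w = Re w * p 1 + Im w * p \<i>" for w
  proof -
    have "w = Re w *\<^sub>R 1 + Im w *\<^sub>R \<i>" by (simp add: complex_eq_iff)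
    then have "p w = p (Re w *\<^sub>R 1 + Im w *\<^sub>R \<i>)" by simp
    then show ?thesis by (simp add: add scaleR)
  qed
  have eq: "complex_of_real (p (circle_point t)) * f t =
      complex_of_real (p 1) * f t + (complex_of_real (-2 * p 1) * (f t / (complex_of_real t - \<i>) / (complex_of_real t - - \<i>)) +
       (complex_of_real (p \<i>) * (f t / (complex_of_real t - \<i>)) + complex_of_real (p \<i>) * (f t / (complex_of_real t - - \<i>))))" for t
  proof -
    have n1: "complex_of_real t - \<i> \<noteq> 0" and n2: "complex_of_real t - - \<i> \<noteq> 0" by (auto simp: complex_eq_iff)
    have pos: "t\<^sup>2 + 1 \<noteq> 0" using add_nonneg_pos[of "t\<^sup>2" 1] by simp
    have prod: "(complex_of_real t - \<i>) * (complex_of_real t - - \<i>) = complex_of_real (t\<^sup>2 + 1)"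
      by (simp add: algebra_simps power2_eq_square)
    have a: "complex_of_real ((t\<^sup>2 - 1) / (t\<^sup>2 + 1)) = 1 - 2 * (1 / ((complex_of_real t - \<i>) * (complex_of_real t - - \<i>)))"
    proof -
      have "(t\<^sup>2 - 1) / (t\<^sup>2 + 1) = 1 - 2 * (1 / (t\<^sup>2 + 1))" using pos by (simp add: field_simps)
      then show ?thesis unfolding prod by simp
    qed
    have b: "complex_of_real (2 * t / (t\<^sup>2 + 1)) = 1 / (complex_of_real t - \<i>) + 1 / (complex_of_real t - - \<i>)"
    proof -
      have "1 / (complex_of_real t - \<i>) + 1 / (complex_of_real t - - \<i>) = (2 * complex_of_real t) / ((complex_of_real t - \<i>) * (complex_of_real t - - \<i>))"
        using n1 n2 by (simp add: add_frac_eq)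
      then show ?thesis unfolding prod by simp
    qed
    have "complex_of_real (p (circle_point t)) * f t = (complex_of_real ((t\<^sup>2 - 1) / (t\<^sup>2 + 1)) * complex_of_real (p 1) + complex_of_real (2 * t / (t\<^sup>2 + 1)) * complex_of_real (p \<i>)) * f t"
      unfolding pw[of "circle_point t"] by (simp add: circle_point_def)
    then show ?thesis unfolding a b by (simp add: algebra_simps)
  qed
  show ?case unfolding eq
    by (intro pointwise_add pointwise_scale pointwise_div fp i)
next
  case (const c)
  then show ?case by (rule pointwise_scale)
next
  case (add p q)
  have "(\<lambda>t. complex_of_real (p (circle_point t)) * f t + complex_of_real (q (circle_point t)) * f t) \<in> pointwise"
    by (intro pointwise_add add.IH add.prems)
  then show ?case by (simp add: distrib_right)
next
  case (mult p q)
  have "(\<lambda>t. complex_of_real (p (circle_point t)) * (complex_of_real (q (circle_point t)) * f t)) \<in> pointwise"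
    by (intro mult.IH mult.prems)
  then show ?case by (simp add: mult.assoc)
qed

definition weakly :: "(real \<Rightarrow> complex) \<Rightarrow> bool" where
  "weakly f \<longleftrightarrow> (\<forall>g\<in>L2 \<nu>. ((\<lambda>\<epsilon>. L2_inner \<nu> (T_eps \<mu> \<epsilon> f) g) \<longlongrightarrow> L2_inner \<nu> (T0 f) g) (at_right 0))"

lemma T_eps_weak_of_pointwise:
  assumes f: "f \<in> L2 \<mu>" and q: "q \<in> L2 \<nu>" and g: "g \<in> L2 \<nu>"
    and lim: "AE s in \<nu>. ((\<lambda>\<epsilon>. T_eps \<mu> \<epsilon> f s) \<longlongrightarrow> q s) (at_right 0)"
  shows "((\<lambda>\<epsilon>. L2_inner \<nu> (T_eps \<mu> \<epsilon> f) g) \<longlongrightarrow> L2_inner \<nu> q g) (at_right 0)"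
  unfolding tendsto_at_iff_sequentially
proof (intro allI impI)
  fix X :: "nat \<Rightarrow> real" assume X: "\<forall>i. X i \<in> {0<..} - {0}" "X \<longlonglongrightarrow> 0"
  then have pos: "0 < X n" for n by auto
  have "X n \<noteq> 0" for n using pos[of n] by simp
  then have fl: "filterlim X (at_right 0) sequentially" using X(2) pos by (simp add: filterlim_at)
  have "(\<lambda>n. L2_inner \<nu> (T_eps \<mu> (X n) f) g) \<longlonglongrightarrow> L2_inner \<nu> q g"
  proof (rule L2_weak_limit_of_AE_limit[OF _ q g])
    show "T_eps \<mu> (X n) f \<in> L2 \<nu>" for n by (rule T_eps_bound(1)[OF f pos])
    show "L2_norm \<nu> (T_eps \<mu> (X n) f) \<le> 2 / \<bar>\<alpha>\<bar> * L2_norm \<mu> f" for n by (rule T_eps_bound(2)[OF f pos])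
    show "AE s in \<nu>. (\<lambda>n. T_eps \<mu> (X n) f s) \<longlonglongrightarrow> q s"
      using lim by eventually_elim (rule filterlim_compose[OF _ fl])
  qed
  then show "((\<lambda>\<epsilon>. L2_inner \<nu> (T_eps \<mu> \<epsilon> f) g) \<circ> X) \<longlonglongrightarrow> L2_inner \<nu> q g" by (simp add: o_def)
qed

lemma pointwise_weakly: "f \<in> pointwise \<Longrightarrow> weakly f"
  unfolding weakly_def pointwise_def using T_eps_weak_of_pointwise T0_L2 by blast

lemma weakly_limit:
  assumes u: "\<And>n. u n \<in> L2 \<mu>" and wu: "\<And>n. weakly (u n)" and f: "f \<in> L2 \<mu>"
    and lim: "(\<lambda>n. L2_norm \<mu> (\<lambda>t. u n t - f t)) \<longlonglongrightarrow> 0"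
  shows "weakly f"
  unfolding weakly_def
proof
  fix g assume g: "g \<in> L2 \<nu>"
  define d where "d n = 2 / \<bar>\<alpha>\<bar> * L2_norm \<mu> (\<lambda>t. u n t - f t) * L2_norm \<nu> g" for n
  have sw: "L2_norm \<mu> (\<lambda>t. f t - u n t) = L2_norm \<mu> (\<lambda>t. u n t - f t)" for n
    by (simp add: L2_norm_def norm_minus_commute)
  show "((\<lambda>\<epsilon>. L2_inner \<nu> (T_eps \<mu> \<epsilon> f) g) \<longlongrightarrow> L2_inner \<nu> (T0 f) g) (at_right 0)"
  proof (rule tendsto_uniform_approx[where u=u and d=d and a="\<lambda>\<epsilon> f. L2_inner \<nu> (T_eps \<mu> \<epsilon> f) g" and b="\<lambda>f. L2_inner \<nu> (T0 f) g"])
    show "\<forall>\<^sub>F \<epsilon> in at_right 0. cmod (L2_inner \<nu> (T_eps \<mu> \<epsilon> f) g - L2_inner \<nu> (T_eps \<mu> \<epsilon> (u n)) g) \<le> d n" for n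
      using eventually_at_right_pos
    proof eventually_elim
      case (elim \<epsilon>)
      note fu = L2_diff[OF f u[of n]]
      have "L2_inner \<nu> (T_eps \<mu> \<epsilon> f) g - L2_inner \<nu> (T_eps \<mu> \<epsilon> (u n)) g = L2_inner \<nu> (T_eps \<mu> \<epsilon> (\<lambda>t. f t - u n t)) g"
        unfolding T_eps_diff[OF f u elim] by (rule L2_inner_diff_left[symmetric, OF T_eps_bound(1)[OF f elim] T_eps_bound(1)[OF u elim] g])
      also have "cmod \<dots> \<le> L2_norm \<nu> (T_eps \<mu> \<epsilon> (\<lambda>t. f t - u n t)) * L2_norm \<nu> g"
        by (rule L2_Cauchy_Schwarz[OF T_eps_bound(1)[OF fu elim] g])
      also have "\<dots> \<le> d n" unfolding d_def sw[symmetric]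
        by (rule mult_right_mono[OF T_eps_bound(2)[OF fu elim]]) simp
      finally show ?case .
    qed
    show "cmod (L2_inner \<nu> (T0 f) g - L2_inner \<nu> (T0 (u n)) g) \<le> d n" for n
    proof -
      note fu = L2_diff[OF f u[of n]]
      have "L2_inner \<nu> (T0 f) g - L2_inner \<nu> (T0 (u n)) g = L2_inner \<nu> (\<lambda>s. T0 f s - T0 (u n) s) g"
        by (rule L2_inner_diff_left[symmetric, OF T0_L2[OF f] T0_L2[OF u] g])
      also have "\<dots> = L2_inner \<nu> (T0 (\<lambda>t. f t - u n t)) g"
      proof (rule L2_inner_cong_AE)
        show "AE s in \<nu>. T0 f s - T0 (u n) s = T0 (\<lambda>t. f t - u n t) s"
          using T0_diff[OF f u[of n]] by eventually_elim simp
      qed (use L2_measurable[OF L2_diff[OF T0_L2[OF f] T0_L2[OF u[of n]]]] L2_measurable[OF T0_L2[OF fu]] L2_measurable[OF g] in auto)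
      also have "cmod \<dots> \<le> L2_norm \<nu> (T0 (\<lambda>t. f t - u n t)) * L2_norm \<nu> g"
        by (rule L2_Cauchy_Schwarz[OF T0_L2[OF fu] g])
      also have "\<dots> \<le> d n" unfolding d_def sw[symmetric]
        by (rule mult_right_mono[OF T0_norm[OF fu]]) simp
      finally show ?thesis .
    qed
    show "d \<longlonglongrightarrow> 0"
      unfolding d_def using tendsto_mult[OF tendsto_mult[OF tendsto_const[of "2 / \<bar>\<alpha>\<bar>"] lim] tendsto_const[of "L2_norm \<nu> g"]] by simp
    show "((\<lambda>\<epsilon>. L2_inner \<nu> (T_eps \<mu> \<epsilon> (u n)) g) \<longlongrightarrow> L2_inner \<nu> (T0 (u n)) g) (at_right 0)" for n
      using wu[of n] g by (simp add: weakly_def)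
  qed
qed

lemma weakly_add:
  assumes f: "f \<in> L2 \<mu>" "weakly f" and g: "g \<in> L2 \<mu>" "weakly g"
  shows "weakly (\<lambda>t. f t + g t)"
  unfolding weakly_def
proof
  fix k assume k: "k \<in> L2 \<nu>"
  have "\<forall>\<^sub>F \<epsilon> in at_right 0. L2_inner \<nu> (T_eps \<mu> \<epsilon> f) k + L2_inner \<nu> (T_eps \<mu> \<epsilon> g) k = L2_inner \<nu> (T_eps \<mu> \<epsilon> (\<lambda>t. f t + g t)) k"
    using eventually_at_right_pos
  proof eventually_elim
    case (elim \<epsilon>)
    show ?case unfolding T_eps_add[OF f(1) g(1) elim]
      by (rule L2_inner_add_left[symmetric, OF T_eps_bound(1)[OF f(1) elim] T_eps_bound(1)[OF g(1) elim] k])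
  qed
  moreover have "((\<lambda>\<epsilon>. L2_inner \<nu> (T_eps \<mu> \<epsilon> f) k + L2_inner \<nu> (T_eps \<mu> \<epsilon> g) k) \<longlongrightarrow> L2_inner \<nu> (T0 f) k + L2_inner \<nu> (T0 g) k) (at_right 0)"
    using f(2) g(2) k by (intro tendsto_add) (auto simp: weakly_def)
  moreover have "L2_inner \<nu> (T0 f) k + L2_inner \<nu> (T0 g) k = L2_inner \<nu> (T0 (\<lambda>t. f t + g t)) k"
    unfolding L2_inner_add_left[symmetric, OF T0_L2[OF f(1)] T0_L2[OF g(1)] k]
  proof (rule L2_inner_cong_AE)
    show "AE s in \<nu>. T0 f s + T0 g s = T0 (\<lambda>t. f t + g t) s"
      using T0_add[OF f(1) g(1)] by eventually_elim simp
  qed (use L2_measurable[OF L2_add[OF T0_L2[OF f(1)] T0_L2[OF g(1)]]] L2_measurable[OF T0_L2[OF L2_add[OF f(1) g(1)]]] L2_measurable[OF k] in auto)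
  ultimately show "((\<lambda>\<epsilon>. L2_inner \<nu> (T_eps \<mu> \<epsilon> (\<lambda>t. f t + g t)) k) \<longlongrightarrow> L2_inner \<nu> (T0 (\<lambda>t. f t + g t)) k) (at_right 0)"
    using Lim_transform_eventually by fastforce
qed

lemma weakly_scale:
  assumes f: "f \<in> L2 \<mu>" "weakly f"
  shows "weakly (\<lambda>t. c * f t)"
  unfolding weakly_def
proof
  fix k assume k: "k \<in> L2 \<nu>"
  have "((\<lambda>\<epsilon>. c * L2_inner \<nu> (T_eps \<mu> \<epsilon> f) k) \<longlongrightarrow> c * L2_inner \<nu> (T0 f) k) (at_right 0)"
    using f(2) k by (intro tendsto_mult_left) (auto simp: weakly_def)
  moreover have "L2_inner \<nu> (\<lambda>s. c * T0 f s) k = L2_inner \<nu> (T0 (\<lambda>t. c * f t)) k"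
  proof (rule L2_inner_cong_AE)
    show "AE s in \<nu>. c * T0 f s = T0 (\<lambda>t. c * f t) s"
      using T0_scale[OF f(1), of c] by eventually_elim simp
  qed (use L2_measurable[OF L2_scale[OF T0_L2[OF f(1)]]] L2_measurable[OF T0_L2[OF L2_scale[OF f(1)]]] L2_measurable[OF k] in auto)
  ultimately show "((\<lambda>\<epsilon>. L2_inner \<nu> (T_eps \<mu> \<epsilon> (\<lambda>t. c * f t)) k) \<longlongrightarrow> L2_inner \<nu> (T0 (\<lambda>t. c * f t)) k) (at_right 0)"
    by (simp add: T_eps_scale L2_inner_scale_left)
qed

text \<open>
  The uniform approximation is applied to \<open>\<psi> = (t\<^sup>2 + 1) \<phi>\<close> and then multiplied by the weight
  \<open>w = 1 / (t\<^sup>2 + 1)\<close>. The weight turns a uniform error into an error in \<open>L\<^sup>2(\<mu>)\<close>.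
\<close>

lemma weakly_continuous:
  fixes \<phi> :: "real \<Rightarrow> real"
  assumes cont: "continuous_on UNIV \<phi>" and supp: "\<And>t. R < \<bar>t\<bar> \<Longrightarrow> \<phi> t = 0"
  shows "weakly (\<lambda>t. complex_of_real (\<phi> t))"
proof -
  have i: "\<i> \<notin> \<real>" "- \<i> \<notin> \<real>" by (simp_all add: complex_is_Real_iff)
  define w where "w t = 1 / (complex_of_real t - \<i>) / (complex_of_real t - - \<i>)" for t
  have w_eq: "w t = complex_of_real (1 / (t\<^sup>2 + 1))" for t
  proof -
    have "(complex_of_real t - \<i>) * (complex_of_real t - - \<i>) = complex_of_real (t\<^sup>2 + 1)"
      by (simp add: algebra_simps power2_eq_square)
    then show ?thesis by (simp add: w_def)
  qed
  have wp: "w \<in> pointwise" unfolding w_def by (intro pointwise_div pointwise_cauchy_kernel i)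
  then have wL: "w \<in> L2 \<mu>" by (simp add: pointwise_def)
  define \<psi> where "\<psi> t = (t\<^sup>2 + 1) * \<phi> t" for t
  have \<phi>\<psi>: "complex_of_real (\<phi> t) = complex_of_real (\<psi> t) * w t" for t
  proof -
    have "t\<^sup>2 + 1 \<noteq> 0" using add_nonneg_pos[of "t\<^sup>2" 1] by simp
    then have "\<psi> t * (1 / (t\<^sup>2 + 1)) = \<phi> t" by (simp add: \<psi>_def)
    then show ?thesis unfolding w_eq of_real_mult[symmetric] by simp
  qed
  have "\<exists>p. real_polynomial_function p \<and> (\<forall>t. \<bar>\<psi> t - p (circle_point t)\<bar> < 1 / real (Suc n))" for n
  proof -
    have "continuous_on UNIV \<psi>" unfolding \<psi>_def by (intro continuous_intros cont)
    moreover have "\<psi> t = 0" if "R < \<bar>t\<bar>" for t using supp[OF that] by (simp add: \<psi>_def)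
    ultimately show ?thesis
      unfolding circle_point_def by (rule cauchy_approximation_on_circle[of \<psi> R "1 / real (Suc n)"]) auto
  qed
  then obtain p where p: "\<And>n. real_polynomial_function (p n)" "\<And>n t. \<bar>\<psi> t - p n (circle_point t)\<bar> < 1 / real (Suc n)"
    by metis
  define u where "u n t = complex_of_real (p n (circle_point t)) * w t" for n t
  have up: "u n \<in> pointwise" for n unfolding u_def by (rule pointwise_polynomial[OF p(1) wp])
  then have uL: "u n \<in> L2 \<mu>" for n by (simp add: pointwise_def)
  have dle: "cmod (u n t - complex_of_real (\<phi> t)) \<le> 1 / real (Suc n) * cmod (w t)" for n t
  proof -
    have "u n t - complex_of_real (\<phi> t) = complex_of_real (p n (circle_point t) - \<psi> t) * w t"
      unfolding u_def \<phi>\<psi> by (simp add: left_diff_distrib)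
    then show ?thesis using p(2)[where t=t and n=n]
      by (simp only: norm_mult norm_of_real) (intro mult_right_mono, auto simp: abs_minus_commute less_imp_le)
  qed
  have \<phi>m: "(\<lambda>t. complex_of_real (\<phi> t)) \<in> borel_measurable \<mu>"
    unfolding measurable_nu_mu using borel_measurable_continuous_onI[OF cont] by measurable
  have dm: "(\<lambda>t. u n t - complex_of_real (\<phi> t)) \<in> borel_measurable \<mu>" for n
    using L2_measurable[OF uL[of n]] \<phi>m by measurable
  have dL: "(\<lambda>t. u n t - complex_of_real (\<phi> t)) \<in> L2 \<mu>" for n
    by (rule L2_dominated[OF wL dm, where c="1 / real (Suc n)"]) (rule AE_I2, rule dle)
  have \<phi>L: "(\<lambda>t. complex_of_real (\<phi> t)) \<in> L2 \<mu>"
    using L2_diff[OF uL[of 0] dL[of 0]] by simp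
  have "(\<lambda>n. L2_norm \<mu> (\<lambda>t. u n t - complex_of_real (\<phi> t))) \<longlonglongrightarrow> 0"
  proof (rule Lim_null_comparison)
    show "(\<lambda>n. 1 / real (Suc n) * L2_norm \<mu> w) \<longlonglongrightarrow> 0"
      using tendsto_mult_left_zero[OF LIMSEQ_inverse_real_of_nat, of "L2_norm \<mu> w"] by (simp add: inverse_eq_divide)
    have "L2_norm \<mu> (\<lambda>t. u n t - complex_of_real (\<phi> t)) \<le> 1 / real (Suc n) * L2_norm \<mu> w" for n
    proof -
      have "L2_norm \<mu> (\<lambda>t. u n t - complex_of_real (\<phi> t)) \<le> L2_norm \<mu> (\<lambda>t. complex_of_real (1 / real (Suc n)) * w t)"
        unfolding L2_norm_def
      proof (intro real_sqrt_le_mono integral_mono L2_square_integrable dL L2_scale wL power_mono)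
        fix t
        have "cmod (complex_of_real (1 / real (Suc n)) * w t) = 1 / real (Suc n) * cmod (w t)"
          by (simp only: norm_mult norm_of_real) simp
        then show "cmod (u n t - complex_of_real (\<phi> t)) \<le> cmod (complex_of_real (1 / real (Suc n)) * w t)"
          using dle[of n t] by linarith
      qed simp
      also have "\<dots> = 1 / real (Suc n) * L2_norm \<mu> w" unfolding L2_norm_scale by (simp only: norm_of_real) simp
      finally show ?thesis .
    qed
    then show "\<forall>\<^sub>F n in sequentially. norm (L2_norm \<mu> (\<lambda>t. u n t - complex_of_real (\<phi> t))) \<le> 1 / real (Suc n) * L2_norm \<mu> w"
      by (intro always_eventually allI) simp
  qed
  from weakly_limit[OF uL pointwise_weakly[OF up] \<phi>L this] show ?thesis .
qed

lemma weakly_all: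
  assumes "f \<in> L2 \<mu>"
  shows "weakly f"
proof (rule L2_induct_continuous[where P=weakly, OF sets_mu cauchy_finite_open_interval[OF mu] _ _ _ _ assms])
  show "weakly (\<lambda>t. f t + g t)" if "f \<in> L2 \<mu>" "g \<in> L2 \<mu>" "weakly f" "weakly g" for f g
    using that by (intro weakly_add)
  show "weakly (\<lambda>t. c * f t)" if "f \<in> L2 \<mu>" "weakly f" for f c
    using that by (intro weakly_scale)
  show "weakly f" if "\<And>n. u n \<in> L2 \<mu>" "\<And>n. weakly (u n)" "f \<in> L2 \<mu>" "(\<lambda>n. L2_norm \<mu> (\<lambda>t. u n t - f t)) \<longlonglongrightarrow> 0" for u f
    using that by (rule weakly_limit)
  show "weakly (\<lambda>t. complex_of_real (\<phi> t))" if "continuous_on UNIV \<phi>" "\<And>t. R < \<bar>t\<bar> \<Longrightarrow> \<phi> t = 0" for \<phi> R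
    using that by (rule weakly_continuous)
qed

theorem T0_weak_limit: "L2_weak_operator_limit \<mu> \<nu> (T_eps \<mu>) T0 (at_right 0)"
  unfolding L2_weak_operator_limit_def using T0_bounded_operator weakly_all by (auto simp: weakly_def)

section \<open>Pointwise limits and the image of the constant function\<close>

text \<open>
  The two parts of \<open>T0\<close> are treated separately. As \<open>V\<close> is unitary, its adjoint is its inverse. The adjoint of
  multiplication by \<open>k = 1 - \<alpha> h\<close> is \<open>g \<mapsto> 1\<^sub>B g / k\<close>, because \<open>d\<mu> = |k|\<^sup>2 d\<nu>\<close> on \<open>B\<close>.
\<close>

lemma T0_adjoint_vector:
  assumes g: "g \<in> L2 \<nu>"
  shows "\<exists>w\<in>L2 \<mu>. \<forall>f\<in>L2 \<mu>. L2_inner \<nu> (T0 f) g = L2_inner \<mu> f w"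
proof -
  obtain v where v: "v \<in> L2 \<mu>" "AE s in \<nu>. V v s = g s" using V_surj[OF g] by blast
  let ?k = "\<lambda>s. 1 - \<alpha>' * h s"
  have [measurable]: "g \<in> borel_measurable borel" using L2_measurable[OF g] by (simp add: measurable_nu_mu)
  define w2 where "w2 s = indicator B s * (g s / ?k s)" for s
  have w2m: "w2 \<in> borel_measurable \<mu>" unfolding w2_def by measurable
  have "(\<integral>\<^sup>+s. ennreal ((cmod (w2 s))\<^sup>2) \<partial>\<mu>) = (\<integral>\<^sup>+s. indicator B s * ennreal ((cmod (g s / ?k s))\<^sup>2) \<partial>\<mu>)"
    by (intro nn_integral_cong) (auto simp: w2_def split: split_indicator)
  also have "\<dots> = (\<integral>\<^sup>+s. ennreal ((cmod (?k s))\<^sup>2) * ennreal ((cmod (g s / ?k s))\<^sup>2) \<partial>\<nu>)"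
    by (rule boundary_mult_nn_integral[symmetric]) measurable
  also have "\<dots> \<le> (\<integral>\<^sup>+s. ennreal ((cmod (g s))\<^sup>2) \<partial>\<nu>)"
  proof (rule nn_integral_mono)
    fix s
    have "(cmod (?k s))\<^sup>2 * (cmod (g s / ?k s))\<^sup>2 \<le> (cmod (g s))\<^sup>2" by (cases "?k s = 0") (auto simp: norm_divide power_divide)
    then show "ennreal ((cmod (?k s))\<^sup>2) * ennreal ((cmod (g s / ?k s))\<^sup>2) \<le> ennreal ((cmod (g s))\<^sup>2)"
      by (simp add: ennreal_leI flip: ennreal_mult)
  qed
  also have "\<dots> = ennreal ((L2_norm \<nu> g)\<^sup>2)" by (rule nn_integral_L2[OF g])
  finally have w2L: "w2 \<in> L2 \<mu>" using L2_nn_integral_le(1)[OF w2m _ L2_norm_nonneg] by blast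
  have mult: "L2_inner \<nu> (boundary_mult f) g = L2_inner \<mu> f w2" if f: "f \<in> L2 \<mu>" for f
  proof -
    have [measurable]: "f \<in> borel_measurable borel" using L2_measurable[OF f] by (simp add: measurable_nu_mu)
    let ?\<phi> = "\<lambda>s. f s * cnj (g s / ?k s)"
    have "L2_inner \<mu> f w2 = (\<integral>s. indicator B s *\<^sub>R ?\<phi> s \<partial>\<mu>)"
      unfolding L2_inner_def by (intro Bochner_Integration.integral_cong) (auto simp: w2_def split: split_indicator)
    also have "\<dots> = (\<integral>s. ?\<phi> s \<partial>density \<mu> (\<lambda>s. ennreal (indicator B s)))"
      by (rule integral_density[symmetric]) auto
    also have "density \<mu> (\<lambda>s. ennreal (indicator B s)) = density \<nu> (\<lambda>s. ennreal ((cmod (?k s))\<^sup>2))"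
      unfolding h_density ennreal_indicator ..
    also have "(\<integral>s. ?\<phi> s \<partial>density \<nu> (\<lambda>s. ennreal ((cmod (?k s))\<^sup>2))) = (\<integral>s. (cmod (?k s))\<^sup>2 *\<^sub>R ?\<phi> s \<partial>\<nu>)"
      by (rule integral_density) auto
    also have "\<dots> = L2_inner \<nu> (boundary_mult f) g"
      unfolding L2_inner_def
    proof (intro Bochner_Integration.integral_cong refl)
      fix s
      show "(cmod (?k s))\<^sup>2 *\<^sub>R ?\<phi> s = boundary_mult f s * cnj (g s)"
      proof (cases "?k s = 0")
        case False
        have "complex_of_real ((cmod (?k s))\<^sup>2) = ?k s * cnj (?k s)" by (rule complex_norm_square)
        moreover have "cnj (?k s) \<noteq> 0" using False by (simp only: complex_cnj_zero_iff not_False_eq_True)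
        ultimately show ?thesis
          unfolding boundary_mult_def scaleR_conv_of_real by (simp only: complex_cnj_divide) (simp add: field_simps)
      qed (simp add: boundary_mult_def)
    qed
    finally show ?thesis by simp
  qed
  have Vg: "L2_inner \<nu> (V f) g = L2_inner \<mu> f v" if f: "f \<in> L2 \<mu>" for f
  proof -
    have "L2_inner \<nu> (V f) g = L2_inner \<nu> (V f) (V v)"
      by (rule L2_inner_cong_AE) (use L2_measurable[OF V_L2[OF f]] L2_measurable[OF g] L2_measurable[OF V_L2[OF v(1)]] v(2) in auto)
    then show ?thesis by (simp add: V_inner[OF f v(1)])
  qed
  show ?thesis
  proof (intro bexI ballI)
    show "(\<lambda>t. cnj (1 / \<alpha>') * (v t - w2 t)) \<in> L2 \<mu>" by (rule L2_scale[OF L2_diff[OF v(1) w2L]])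
    fix f assume f: "f \<in> L2 \<mu>"
    have "L2_inner \<nu> (T0 f) g = (1 / \<alpha>') * (L2_inner \<nu> (V f) g - L2_inner \<nu> (boundary_mult f) g)"
      unfolding T0_def L2_inner_scale_left L2_inner_diff_left[OF V_L2[OF f] boundary_mult_L2(1)[OF f] g] ..
    also have "\<dots> = (1 / \<alpha>') * (L2_inner \<mu> f v - L2_inner \<mu> f w2)" by (simp add: Vg[OF f] mult[OF f])
    also have "\<dots> = L2_inner \<mu> f (\<lambda>t. cnj (1 / \<alpha>') * (v t - w2 t))"
      unfolding L2_inner_scale_right L2_inner_diff_right[OF v(1) w2L f] by simp
    finally show "L2_inner \<nu> (T0 f) g = L2_inner \<mu> f (\<lambda>t. cnj (1 / \<alpha>') * (v t - w2 t))" .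
  qed
qed

text \<open>
  If \<open>T\<^sub>\<epsilon> f\<close> converges almost everywhere at all, the limit must be the weak limit.
\<close>

lemma pointwise_if_convergent:
  assumes f: "f \<in> L2 \<mu>" and conv: "AE s in \<nu>. \<exists>L. ((\<lambda>\<epsilon>. T_eps \<mu> \<epsilon> f s) \<longlongrightarrow> L) (at_right 0)"
  shows "AE s in \<nu>. ((\<lambda>\<epsilon>. T_eps \<mu> \<epsilon> f s) \<longlongrightarrow> T0 f s) (at_right 0)"
proof -
  \<comment> \<open>again along one sequence, for measurability\<close>
  define q where "q s = lim (\<lambda>n. T_eps \<mu> (1 / real (Suc n)) f s)" for s
  have fl: "filterlim (\<lambda>n. 1 / real (Suc n)) (at_right 0) sequentially"
    unfolding filterlim_at using LIMSEQ_inverse_real_of_nat by (auto simp: inverse_eq_divide)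
  have qm: "q \<in> borel_measurable \<nu>"
    unfolding q_def measurable_nu_mu by (rule borel_measurable_lim_metric) (rule T_eps_measurable[OF L2_measurable[OF f]])
  have q: "AE s in \<nu>. ((\<lambda>\<epsilon>. T_eps \<mu> \<epsilon> f s) \<longlongrightarrow> q s) (at_right 0)"
    using conv
  proof eventually_elim
    case (elim s)
    then obtain L where L: "((\<lambda>\<epsilon>. T_eps \<mu> \<epsilon> f s) \<longlongrightarrow> L) (at_right 0)" by blast
    have "q s = L" unfolding q_def by (rule limI) (rule filterlim_compose[OF L fl])
    with L show ?case by simp
  qed
  have qL: "q \<in> L2 \<nu>"
  proof (rule L2_Fatou(1)[where u="\<lambda>n. T_eps \<mu> (1 / real (Suc n)) f"])
    show "T_eps \<mu> (1 / real (Suc n)) f \<in> L2 \<nu>" for n by (rule T_eps_bound(1)[OF f]) simp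
    show "L2_norm \<nu> (T_eps \<mu> (1 / real (Suc n)) f) \<le> 2 / \<bar>\<alpha>\<bar> * L2_norm \<mu> f" for n by (rule T_eps_bound(2)[OF f]) simp
    show "AE s in \<nu>. (\<lambda>n. T_eps \<mu> (1 / real (Suc n)) f s) \<longlonglongrightarrow> q s"
      using q by eventually_elim (rule filterlim_compose[OF _ fl])
  qed (rule qm)
  have "AE s in \<nu>. q s = T0 f s"
  proof (rule L2_eq_AE_if_inner_eq[OF qL T0_L2[OF f]])
    fix k assume k: "k \<in> L2 \<nu>"
    have "((\<lambda>\<epsilon>. L2_inner \<nu> (T_eps \<mu> \<epsilon> f) k) \<longlongrightarrow> L2_inner \<nu> q k) (at_right 0)"
      by (rule T_eps_weak_of_pointwise[OF f qL k q])
    moreover have "((\<lambda>\<epsilon>. L2_inner \<nu> (T_eps \<mu> \<epsilon> f) k) \<longlongrightarrow> L2_inner \<nu> (T0 f) k) (at_right 0)"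
      using weakly_all[OF f] k by (simp add: weakly_def)
    ultimately show "L2_inner \<nu> q k = L2_inner \<nu> (T0 f) k" by (rule tendsto_unique[rotated]) simp
  qed
  with q show ?thesis by eventually_elim simp
qed

lemma T_eps_one_limit: "AE s in \<nu>. ((\<lambda>\<epsilon>. T_eps \<mu> \<epsilon> (\<lambda>_. 1) s) \<longlongrightarrow> h s) (at_right 0)"
  using h_limit
proof eventually_elim
  case (elim s)
  show ?case using tendsto_minus[OF elim] by (simp add: T_eps_one)
qed

text \<open>
  The term \<open>f(s) T\<^sub>\<epsilon> 1(s)\<close> converges by the choice of \<open>h\<close>. In the remainder
  \<open>\<integral> (f(s) - f(t)) / (s - t + i\<epsilon>) d\<mu>(t)\<close> the Lipschitz condition near \<open>s\<close> and boundedness away from \<open>s\<close>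
  provide a majorant of the form \<open>C / (1 + |t|)\<close>.
\<close>

lemma pointwise_locally_Lipschitz:
  fixes f :: "real \<Rightarrow> complex"
  assumes f: "f \<in> L2 \<mu>" and bd: "\<And>t. cmod (f t) \<le> K"
    and lip: "\<And>s. \<exists>d>0. \<exists>L. \<forall>t. \<bar>s - t\<bar> < d \<longrightarrow> cmod (f s - f t) \<le> L * \<bar>s - t\<bar>"
  shows "AE s in \<nu>. ((\<lambda>\<epsilon>. T_eps \<mu> \<epsilon> f s) \<longlongrightarrow> T0 f s) (at_right 0)"
proof (rule pointwise_if_convergent[OF f])
  note [measurable] = L2_measurable[OF f]
  have K: "0 \<le> K" using order_trans[OF norm_ge_zero bd] .
  show "AE s in \<nu>. \<exists>L. ((\<lambda>\<epsilon>. T_eps \<mu> \<epsilon> f s) \<longlongrightarrow> L) (at_right 0)"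
    using T_eps_one_limit
  proof eventually_elim
    case (elim s)
    obtain d L where d: "0 < d" and L: "\<And>t. \<bar>s - t\<bar> < d \<Longrightarrow> cmod (f s - f t) \<le> L * \<bar>s - t\<bar>" using lip[of s] by blast
    let ?d = "\<lambda>\<epsilon> t. complex_of_real s - complex_of_real t + \<i> * complex_of_real \<epsilon>"
    define Q where "Q \<epsilon> = (\<integral>t. (f s - f t) / ?d \<epsilon> t \<partial>\<mu>)" for \<epsilon>
    define Q0 where "Q0 = (\<integral>t. (if t = s then 0 else (f s - f t) / (complex_of_real s - complex_of_real t)) \<partial>\<mu>)"
    \<comment> \<open>the first summand serves \<open>|s - t| < d\<close>, the second one \<open>|s - t| \<ge> d\<close>\<close>
    define C where "C = \<bar>L\<bar> * (1 + \<bar>s\<bar> + d) + 2 * K * ((1 + \<bar>s\<bar>) / d + 1)"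
    have dn: "\<bar>s - t\<bar> \<le> cmod (?d \<epsilon> t)" for \<epsilon> t using abs_Re_le_cmod[of "?d \<epsilon> t"] by simp
    have bound: "cmod (f s - f t) \<le> C * (1 / (1 + \<bar>t\<bar>)) * \<bar>s - t\<bar>" for t
    proof -
      have p: "0 < 1 + \<bar>t\<bar>" by (simp add: add_pos_nonneg)
      have "cmod (f s - f t) * (1 + \<bar>t\<bar>) \<le> C * \<bar>s - t\<bar>"
      proof (cases "\<bar>s - t\<bar> < d")
        case True
        have "cmod (f s - f t) * (1 + \<bar>t\<bar>) \<le> (\<bar>L\<bar> * \<bar>s - t\<bar>) * (1 + \<bar>s\<bar> + d)"
        proof (rule mult_mono)
          have "L * \<bar>s - t\<bar> \<le> \<bar>L\<bar> * \<bar>s - t\<bar>" by (rule mult_right_mono) auto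
          then show "cmod (f s - f t) \<le> \<bar>L\<bar> * \<bar>s - t\<bar>" using L[OF True] by linarith
          show "1 + \<bar>t\<bar> \<le> 1 + \<bar>s\<bar> + d" using True by linarith
        qed auto
        also have "\<dots> = \<bar>L\<bar> * (1 + \<bar>s\<bar> + d) * \<bar>s - t\<bar>" by simp
        also have "\<dots> \<le> C * \<bar>s - t\<bar>" unfolding C_def using K d by (intro mult_right_mono) auto
        finally show ?thesis .
      next
        case False
        have "(1 + \<bar>s\<bar>) / d * d \<le> (1 + \<bar>s\<bar>) / d * \<bar>s - t\<bar>" using d False by (intro mult_left_mono) auto
        then have "1 + \<bar>s\<bar> \<le> (1 + \<bar>s\<bar>) / d * \<bar>s - t\<bar>" using d by simp
        moreover have "1 + \<bar>t\<bar> \<le> 1 + \<bar>s\<bar> + \<bar>s - t\<bar>" by linarith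
        ultimately have "1 + \<bar>t\<bar> \<le> (1 + \<bar>s\<bar>) / d * \<bar>s - t\<bar> + 1 * \<bar>s - t\<bar>"
          unfolding mult_1 by (meson add_right_mono order_trans)
        then have t: "1 + \<bar>t\<bar> \<le> ((1 + \<bar>s\<bar>) / d + 1) * \<bar>s - t\<bar>" unfolding distrib_right .
        have "cmod (f s - f t) \<le> 2 * K" using norm_triangle_ineq4[of "f s" "f t"] bd[of s] bd[of t] by linarith
        then have "cmod (f s - f t) * (1 + \<bar>t\<bar>) \<le> (2 * K) * (((1 + \<bar>s\<bar>) / d + 1) * \<bar>s - t\<bar>)"
          using t K p by (intro mult_mono) auto
        also have "\<dots> = 2 * K * ((1 + \<bar>s\<bar>) / d + 1) * \<bar>s - t\<bar>" by simp
        also have "\<dots> \<le> C * \<bar>s - t\<bar>" unfolding C_def using d by (intro mult_right_mono) auto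
        finally show ?thesis .
      qed
      then have "cmod (f s - f t) \<le> C * \<bar>s - t\<bar> / (1 + \<bar>t\<bar>)" using p by (simp add: pos_le_divide_eq)
      then show ?thesis by simp
    qed
    have C0: "0 \<le> C" unfolding C_def using K d by simp
    have qb: "cmod ((f s - f t) / ?d \<epsilon> t) \<le> C * (1 / (1 + \<bar>t\<bar>))" for \<epsilon> t
    proof (cases "cmod (?d \<epsilon> t) = 0")
      case False
      have "C * (1 / (1 + \<bar>t\<bar>)) * \<bar>s - t\<bar> \<le> C * (1 / (1 + \<bar>t\<bar>)) * cmod (?d \<epsilon> t)"
        using C0 dn[of t \<epsilon>] by (intro mult_left_mono) auto
      then have "cmod (f s - f t) \<le> C * (1 / (1 + \<bar>t\<bar>)) * cmod (?d \<epsilon> t)" using bound[of t] by linarith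
      then show ?thesis unfolding norm_divide using False by (subst pos_divide_le_eq) auto
    qed (use C0 in simp)
    have wint: "integrable \<mu> (\<lambda>t. C * (1 / (1 + \<bar>t\<bar>)))"
      using mu by (intro integrable_mult_right) (simp add: cauchy_finite_def)
    have Qlim: "(Q \<longlongrightarrow> Q0) (at_right 0)"
      unfolding tendsto_at_iff_sequentially
    proof (intro allI impI)
      fix X :: "nat \<Rightarrow> real" assume X: "\<forall>i. X i \<in> {0<..} - {0}" "X \<longlonglongrightarrow> 0"
      have "(\<lambda>n. \<integral>t. (f s - f t) / ?d (X n) t \<partial>\<mu>) \<longlonglongrightarrow> Q0"
        unfolding Q0_def
      proof (rule integral_dominated_convergence[OF _ _ wint])
        show "AE t in \<mu>. (\<lambda>n. (f s - f t) / ?d (X n) t) \<longlonglongrightarrow> (if t = s then 0 else (f s - f t) / (complex_of_real s - complex_of_real t))"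
        proof (rule AE_I2)
          fix t
          show "(\<lambda>n. (f s - f t) / ?d (X n) t) \<longlonglongrightarrow> (if t = s then 0 else (f s - f t) / (complex_of_real s - complex_of_real t))"
          proof (cases "t = s")
            case False
            then have "(\<lambda>n. (f s - f t) / ?d (X n) t) \<longlonglongrightarrow> (f s - f t) / (complex_of_real s - complex_of_real t + \<i> * complex_of_real 0)"
              by (intro tendsto_intros X(2)) auto
            then show ?thesis using False by simp
          qed simp
        qed
        show "AE t in \<mu>. norm ((f s - f t) / ?d (X n) t) \<le> C * (1 / (1 + \<bar>t\<bar>))" for n
          using qb by (intro AE_I2)
      qed measurable
      then show "(Q \<circ> X) \<longlonglongrightarrow> Q0" by (simp add: o_def Q_def)
    qed
    have eq: "\<forall>\<^sub>F \<epsilon> in at_right 0. f s * T_eps \<mu> \<epsilon> (\<lambda>_. 1) s - Q \<epsilon> = T_eps \<mu> \<epsilon> f s"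
      using eventually_at_right_pos
    proof eventually_elim
      case (elim \<epsilon>)
      have i1: "integrable \<mu> (\<lambda>t. f s * (1 / ?d \<epsilon> t))" by (intro integrable_mult_right kernel_one_integrable elim)
      have i2: "integrable \<mu> (\<lambda>t. f t / ?d \<epsilon> t)" by (rule T_eps_integrable[OF f elim])
      have "Q \<epsilon> = (\<integral>t. f s * (1 / ?d \<epsilon> t) - f t / ?d \<epsilon> t \<partial>\<mu>)"
        unfolding Q_def by (intro Bochner_Integration.integral_cong) (auto simp: diff_divide_distrib)
      also have "\<dots> = (\<integral>t. f s * (1 / ?d \<epsilon> t) \<partial>\<mu>) - T_eps \<mu> \<epsilon> f s"
        unfolding T_eps_def by (rule Bochner_Integration.integral_diff[OF i1 i2])
      also have "(\<integral>t. f s * (1 / ?d \<epsilon> t) \<partial>\<mu>) = f s * T_eps \<mu> \<epsilon> (\<lambda>_. 1) s"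
        unfolding T_eps_def by (rule integral_mult_right_zero)
      finally show ?case by simp
    qed
    have "((\<lambda>\<epsilon>. f s * T_eps \<mu> \<epsilon> (\<lambda>_. 1) s - Q \<epsilon>) \<longlongrightarrow> f s * h s - Q0) (at_right 0)"
      by (intro tendsto_intros elim Qlim)
    from Lim_transform_eventually[OF this eq] show ?case by blast
  qed
qed

lemma bounded_support_L2:
  assumes "f \<in> borel_measurable borel" "\<And>t. cmod (f t) \<le> K" "\<And>t. R < \<bar>t\<bar> \<Longrightarrow> f t = 0"
  shows "f \<in> L2 \<mu>" "f \<in> L2 \<nu>"
proof -
  have "f \<in> L2 \<kappa>" if \<kappa>: "cauchy_finite \<kappa>" for \<kappa>
  proof -
    obtain n :: nat where n: "\<bar>R\<bar> < real n" using reals_Archimedean2 by blast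
    note s = cauchy_finite_sets[OF \<kappa>]
    have "(\<lambda>x. complex_of_real (indicator {-real n<..<real n} x)) \<in> L2 \<kappa>"
      by (rule L2_indicator) (use s cauchy_finite_open_interval[OF \<kappa>, of n] in auto)
    then show ?thesis
    proof (rule L2_dominated[where c=K])
      show "f \<in> borel_measurable \<kappa>" using assms(1) measurable_cong_sets[OF s refl] by blast
      show "AE t in \<kappa>. cmod (f t) \<le> K * cmod (complex_of_real (indicator {-real n<..<real n} t))"
      proof (rule AE_I2)
        fix t
        show "cmod (f t) \<le> K * cmod (complex_of_real (indicator {-real n<..<real n} t))"
          by (cases "R < \<bar>t\<bar>") (use assms n in \<open>auto simp: indicator_def intro: order_trans[OF norm_ge_zero]\<close>)
      qed
    qed
  qed
  then show "f \<in> L2 \<mu>" "f \<in> L2 \<nu>" using mu nu by auto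
qed

lemma pointwise_C1:
  fixes f :: "real \<Rightarrow> complex"
  assumes C1: "f C1_differentiable_on UNIV" and cs: "compactly_supported f"
  shows "f \<in> L2 \<mu>" "AE s in \<nu>. ((\<lambda>\<epsilon>. T_eps \<mu> \<epsilon> f s) \<longlongrightarrow> T0 f s) (at_right 0)"
proof -
  obtain D where D: "\<And>x. (f has_vector_derivative D x) (at x)" and Dc: "continuous_on UNIV D"
    using C1 by (auto simp: C1_differentiable_on_def)
  obtain R where R: "\<And>x. R < \<bar>x\<bar> \<Longrightarrow> f x = 0" using cs by (auto simp: compactly_supported_iff)
  have fc: "continuous_on S f" for S
    by (rule continuous_at_imp_continuous_on) (use D in \<open>auto intro: has_vector_derivative_continuous\<close>)
  have "bounded (f ` {-\<bar>R\<bar>..\<bar>R\<bar>})" by (intro compact_imp_bounded compact_continuous_image fc) simp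
  from this[unfolded bounded_iff] obtain K where "\<forall>y\<in>f ` {-\<bar>R\<bar>..\<bar>R\<bar>}. cmod y \<le> K" ..
  then have K: "\<And>x. x \<in> {-\<bar>R\<bar>..\<bar>R\<bar>} \<Longrightarrow> cmod (f x) \<le> K" by blast
  have K': "cmod (f x) \<le> max K 0" for x
  proof (cases "R < \<bar>x\<bar>")
    case False
    then have "x \<in> {-\<bar>R\<bar>..\<bar>R\<bar>}" by (simp add: abs_le_iff) linarith
    then show ?thesis using K[of x] by simp
  qed (simp add: R)
  have fm: "f \<in> borel_measurable borel" by (rule borel_measurable_continuous_onI[OF fc])
  show fL: "f \<in> L2 \<mu>" by (rule bounded_support_L2(1)[OF fm K' R])
  show "AE s in \<nu>. ((\<lambda>\<epsilon>. T_eps \<mu> \<epsilon> f s) \<longlongrightarrow> T0 f s) (at_right 0)"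
  proof (rule pointwise_locally_Lipschitz[OF fL K'])
    fix s
    have "bounded (D ` {s - 1..s + 1})"
      by (intro compact_imp_bounded compact_continuous_image continuous_on_subset[OF Dc]) auto
    from this[unfolded bounded_iff] obtain L where "\<forall>y\<in>D ` {s - 1..s + 1}. cmod y \<le> L" ..
    then have L: "\<And>x. x \<in> {s - 1..s + 1} \<Longrightarrow> cmod (D x) \<le> L" by blast
    have "cmod (f s - f t) \<le> L * \<bar>s - t\<bar>" if "\<bar>s - t\<bar> < 1" for t
    proof -
      have "norm (f s - f t) \<le> L * norm (s - t)"
      proof (rule differentiable_bound[where S="{s - 1..s + 1}" and f'="\<lambda>x u. u *\<^sub>R D x"])
        show "(f has_derivative (\<lambda>u. u *\<^sub>R D x)) (at x within {s - 1..s + 1})" for x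
          using D[of x] by (simp add: has_vector_derivative_def has_derivative_at_withinI)
        show "onorm (\<lambda>u. u *\<^sub>R D x) \<le> L" if "x \<in> {s - 1..s + 1}" for x
          by (rule onorm_le) (use L[OF that] in \<open>simp add: mult.commute[of L] mult_left_mono\<close>)
      qed (use that in auto)
      then show ?thesis by simp
    qed
    then show "\<exists>d>0. \<exists>L. \<forall>t. \<bar>s - t\<bar> < d \<longrightarrow> cmod (f s - f t) \<le> L * \<bar>s - t\<bar>" by (intro exI[of _ 1]) auto
  qed
qed

definition tail :: "nat \<Rightarrow> real" where
  "tail n = (\<integral>t. indicator {t. real n < \<bar>t\<bar>} t * (1 / (1 + \<bar>t\<bar>)) \<partial>\<mu>)"

lemma tail_integrable: "integrable \<mu> (\<lambda>t. indicator {t. real n < \<bar>t\<bar>} t * (1 / (1 + \<bar>t\<bar>)))"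
  by (rule Bochner_Integration.integrable_bound[of _ "\<lambda>t. 1 / (1 + \<bar>t\<bar>)"])
    (use mu in \<open>auto simp: cauchy_finite_def split: split_indicator\<close>)

lemma tail_tendsto: "tail \<longlonglongrightarrow> 0"
proof -
  have "(\<lambda>n. tail n) \<longlonglongrightarrow> (\<integral>t. 0 \<partial>\<mu>)"
    unfolding tail_def
  proof (rule integral_dominated_convergence[where w="\<lambda>t. 1 / (1 + \<bar>t\<bar>)"])
    show "integrable \<mu> (\<lambda>t. 1 / (1 + \<bar>t\<bar>))" using mu by (simp add: cauchy_finite_def)
    show "AE t in \<mu>. (\<lambda>n. indicator {t. real n < \<bar>t\<bar>} t * (1 / (1 + \<bar>t\<bar>))) \<longlonglongrightarrow> 0"
    proof (rule AE_I2)
      fix t :: real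
      obtain N :: nat where N: "\<bar>t\<bar> \<le> real N" using real_arch_simple by blast
      have "\<forall>\<^sub>F n in sequentially. indicator {t. real n < \<bar>t\<bar>} t * (1 / (1 + \<bar>t\<bar>)) = 0"
        by (rule eventually_sequentiallyI[of N]) (use N in \<open>auto simp: indicator_def\<close>)
      then show "(\<lambda>n. indicator {t. real n < \<bar>t\<bar>} t * (1 / (1 + \<bar>t\<bar>))) \<longlonglongrightarrow> 0" by (rule tendsto_eventually)
    qed
  qed (auto split: split_indicator)
  then show ?thesis by simp
qed

text \<open>
  For \<open>|s| \<le> R\<close> and \<open>|t| > n \<ge> R + 1\<close> the kernel is at most \<open>(R + 2) / (1 + |t|)\<close>.
\<close>

lemma T_eps_far:
  assumes v: "v \<in> borel_measurable borel" "\<And>t. cmod (v t) \<le> 1" "\<And>t. \<bar>t\<bar> \<le> real n \<Longrightarrow> v t = 0"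
    and R: "0 \<le> R" "R + 1 \<le> real n" and s: "\<bar>s\<bar> \<le> R"
  shows "cmod (T_eps \<mu> \<epsilon> v s) \<le> (R + 2) * tail n"
proof -
  let ?d = "\<lambda>t. complex_of_real s - complex_of_real t + \<i> * complex_of_real \<epsilon>"
  have "cmod (T_eps \<mu> \<epsilon> v s) \<le> (\<integral>t. cmod (v t / ?d t) \<partial>\<mu>)"
    unfolding T_eps_def by (rule integral_norm_bound)
  also have "\<dots> \<le> (\<integral>t. (R + 2) * (indicator {t. real n < \<bar>t\<bar>} t * (1 / (1 + \<bar>t\<bar>))) \<partial>\<mu>)"
  proof (rule integral_mono')
    show "integrable \<mu> (\<lambda>t. (R + 2) * (indicator {t. real n < \<bar>t\<bar>} t * (1 / (1 + \<bar>t\<bar>))))"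
      by (rule integrable_mult_right[OF tail_integrable])
    fix t
    show "cmod (v t / ?d t) \<le> (R + 2) * (indicator {t. real n < \<bar>t\<bar>} t * (1 / (1 + \<bar>t\<bar>)))"
    proof (cases "real n < \<bar>t\<bar>")
      case True
      have "0 \<le> (R + 1) * (\<bar>t\<bar> - (R + 1))" using True R by (intro mult_nonneg_nonneg) auto
      then have "1 + \<bar>t\<bar> \<le> (R + 2) * (\<bar>t\<bar> - R)" by (simp add: algebra_simps)
      also have "\<dots> \<le> (R + 2) * cmod (?d t)"
      proof (rule mult_left_mono)
        have "\<bar>t\<bar> - R \<le> \<bar>s - t\<bar>" using s by linarith
        also have "\<dots> \<le> cmod (?d t)" using abs_Re_le_cmod[of "?d t"] by simp
        finally show "\<bar>t\<bar> - R \<le> cmod (?d t)" .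
      qed (use R in simp)
      finally have le: "1 + \<bar>t\<bar> \<le> (R + 2) * cmod (?d t)" .
      have p: "0 < 1 + \<bar>t\<bar>" by (simp add: add_pos_nonneg)
      have dp: "0 < cmod (?d t)" using le p R by (metis less_le_trans mult_zero_right norm_ge_zero less_le not_le)
      have "cmod (v t / ?d t) \<le> 1 / cmod (?d t)" unfolding norm_divide using v(2)[of t] by (intro divide_right_mono) auto
      also have "\<dots> \<le> (R + 2) / (1 + \<bar>t\<bar>)" using le p dp by (simp add: divide_le_eq le_divide_eq mult.commute)
      finally show ?thesis using True by simp
    qed (simp add: v(3))
  qed (use R in simp)
  also have "\<dots> = (R + 2) * tail n" unfolding tail_def by (rule integral_mult_right_zero)
  finally show ?thesis .
qed

lemma L2_compact_support_integrable_nu: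
  assumes g: "g \<in> L2 \<nu>" and supp: "\<And>s. R < \<bar>s\<bar> \<Longrightarrow> g s = 0"
  shows "integrable \<nu> g"
proof -
  have "(\<lambda>s. complex_of_real (indicator {-\<bar>R\<bar>..\<bar>R\<bar>} s)) \<in> L2 \<nu>"
    by (rule bounded_support_L2(2)[where K=1 and R="\<bar>R\<bar>"]) (auto split: split_indicator)
  from L2_mult_integrable[OF this g] have "integrable \<nu> (\<lambda>s. complex_of_real (indicator {-\<bar>R\<bar>..\<bar>R\<bar>} s) * g s)" .
  moreover have "(\<lambda>s. complex_of_real (indicator {-\<bar>R\<bar>..\<bar>R\<bar>} s) * g s) = g"
  proof
    fix s show "complex_of_real (indicator {-\<bar>R\<bar>..\<bar>R\<bar>} s) * g s = g s"
      by (cases "R < \<bar>s\<bar>") (auto simp: supp indicator_def)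
  qed
  ultimately show ?thesis by simp
qed

lemma T0_inner_far:
  assumes v: "v \<in> L2 \<mu>" "\<And>t. cmod (v t) \<le> 1" "\<And>t. \<bar>t\<bar> \<le> real n \<Longrightarrow> v t = 0"
    and R: "0 \<le> R" "R + 1 \<le> real n" and g: "g \<in> L2 \<nu>" and supp: "\<And>s. R < \<bar>s\<bar> \<Longrightarrow> g s = 0"
  shows "cmod (L2_inner \<nu> (T0 v) g) \<le> (R + 2) * tail n * (\<integral>s. cmod (g s) \<partial>\<nu>)"
proof -
  have lim: "((\<lambda>\<epsilon>. cmod (L2_inner \<nu> (T_eps \<mu> \<epsilon> v) g)) \<longlongrightarrow> cmod (L2_inner \<nu> (T0 v) g)) (at_right 0)"
    using weakly_all[OF v(1)] g by (intro tendsto_norm) (simp add: weakly_def)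
  have vm: "v \<in> borel_measurable borel" using L2_measurable[OF v(1)] by (simp add: measurable_nu_mu)
  have "cmod (L2_inner \<nu> (T_eps \<mu> \<epsilon> v) g) \<le> (R + 2) * tail n * (\<integral>s. cmod (g s) \<partial>\<nu>)" for \<epsilon>
  proof -
    have "cmod (L2_inner \<nu> (T_eps \<mu> \<epsilon> v) g) \<le> (\<integral>s. cmod (T_eps \<mu> \<epsilon> v s * cnj (g s)) \<partial>\<nu>)"
      unfolding L2_inner_def by (rule integral_norm_bound)
    also have "\<dots> \<le> (\<integral>s. (R + 2) * tail n * cmod (g s) \<partial>\<nu>)"
    proof (rule integral_mono')
      show "integrable \<nu> (\<lambda>s. (R + 2) * tail n * cmod (g s))"
        by (intro integrable_mult_right integrable_norm L2_compact_support_integrable_nu[OF g supp])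
      fix s
      show "cmod (T_eps \<mu> \<epsilon> v s * cnj (g s)) \<le> (R + 2) * tail n * cmod (g s)"
      proof (cases "R < \<bar>s\<bar>")
        case False
        then show ?thesis unfolding norm_mult complex_mod_cnj
          by (intro mult_right_mono T_eps_far[OF vm v(2,3) R]) auto
      qed (simp add: supp)
      have "0 \<le> tail n" unfolding tail_def by (intro integral_nonneg_AE AE_I2) (simp split: split_indicator)
      then show "0 \<le> (R + 2) * tail n * cmod (g s)" using R by simp
    qed
    also have "\<dots> = (R + 2) * tail n * (\<integral>s. cmod (g s) \<partial>\<nu>)" by (rule integral_mult_right_zero)
    finally show ?thesis .
  qed
  then show ?thesis by (intro tendsto_upperbound[OF lim]) auto
qed

text \<open>
  On bounded sets square-integrability suffices. Further out, testing the adjoint relation with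
  \<open>w / |w|\<close>, cut off to \<open>N < |t| \<le> m\<close>, bounds the integral of \<open>|w|\<close> over this set independently of \<open>m\<close>.
\<close>

lemma adjoint_vector_integrable:
  assumes g: "g \<in> L2 \<nu>" and supp: "\<And>s. R < \<bar>s\<bar> \<Longrightarrow> g s = 0"
    and w: "w \<in> L2 \<mu>" and adj: "\<And>f. f \<in> L2 \<mu> \<Longrightarrow> L2_inner \<nu> (T0 f) g = L2_inner \<mu> f w"
  shows "integrable \<mu> w"
proof -
  define R' where "R' = \<bar>R\<bar>"
  have R': "0 \<le> R'" "\<And>s. R' < \<bar>s\<bar> \<Longrightarrow> g s = 0" using supp by (auto simp: R'_def)
  obtain N :: nat where N: "R' + 1 \<le> real N" using real_arch_simple by blast
  have [measurable]: "w \<in> borel_measurable borel" using L2_measurable[OF w] by (simp add: measurable_nu_mu)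
  define C where "C = (R' + 2) * tail N * (\<integral>s. cmod (g s) \<partial>\<nu>)"
  define u where "u m t = (if real N < \<bar>t\<bar> \<and> \<bar>t\<bar> \<le> real m then w t / complex_of_real (cmod (w t)) else 0)" for m t
  have um: "u m \<in> borel_measurable borel" for m unfolding u_def by measurable
  have u1: "cmod (u m t) \<le> 1" for m t by (simp add: u_def norm_divide)
  have uL: "u m \<in> L2 \<mu>" for m
    by (rule bounded_support_L2(1)[OF um u1, of "real m"]) (simp add: u_def)
  have uw: "u m t * cnj (w t) = complex_of_real (indicator {t. real N < \<bar>t\<bar> \<and> \<bar>t\<bar> \<le> real m} t * cmod (w t))" for m t
    by (cases "w t = 0") (auto simp: u_def indicator_def complex_norm_square[symmetric] power2_eq_square)
  have int_u: "integrable \<mu> (\<lambda>t. indicator {t. real N < \<bar>t\<bar> \<and> \<bar>t\<bar> \<le> real m} t * cmod (w t))" for m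
  proof -
    have "integrable \<mu> (\<lambda>t. norm (u m t * cnj (w t)))" by (rule integrable_norm[OF L2_inner_integrable[OF uL w]])
    then show ?thesis unfolding uw norm_of_real by (simp add: abs_mult)
  qed
  have bound: "(\<integral>\<^sup>+t. ennreal (indicator {t. real N < \<bar>t\<bar> \<and> \<bar>t\<bar> \<le> real m} t * cmod (w t)) \<partial>\<mu>) \<le> ennreal C" for m
  proof -
    have "(\<integral>\<^sup>+t. ennreal (indicator {t. real N < \<bar>t\<bar> \<and> \<bar>t\<bar> \<le> real m} t * cmod (w t)) \<partial>\<mu>) = ennreal (\<integral>t. indicator {t. real N < \<bar>t\<bar> \<and> \<bar>t\<bar> \<le> real m} t * cmod (w t) \<partial>\<mu>)"
      by (rule nn_integral_eq_integral[OF int_u]) simp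
    also have "(\<integral>t. indicator {t. real N < \<bar>t\<bar> \<and> \<bar>t\<bar> \<le> real m} t * cmod (w t) \<partial>\<mu>) \<le> cmod (L2_inner \<mu> (u m) w)"
    proof -
      have "L2_inner \<mu> (u m) w = complex_of_real (\<integral>t. indicator {t. real N < \<bar>t\<bar> \<and> \<bar>t\<bar> \<le> real m} t * cmod (w t) \<partial>\<mu>)"
        unfolding L2_inner_def uw by (rule integral_complex_of_real)
      then show ?thesis by simp
    qed
    also have "L2_inner \<mu> (u m) w = L2_inner \<nu> (T0 (u m)) g" using adj[OF uL] by simp
    also have "cmod \<dots> \<le> C" unfolding C_def
      by (rule T0_inner_far[OF uL u1 _ R'(1) N g R'(2)]) (auto simp: u_def)
    finally show ?thesis by (simp add: ennreal_leI)
  qed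
  have "(\<integral>\<^sup>+t. ennreal (indicator {t. real N < \<bar>t\<bar>} t * cmod (w t)) \<partial>\<mu>) \<le> ennreal C"
  proof -
    have "(\<integral>\<^sup>+t. ennreal (indicator {t. real N < \<bar>t\<bar>} t * cmod (w t)) \<partial>\<mu>)
      = (\<integral>\<^sup>+t. (SUP m. ennreal (indicator {t. real N < \<bar>t\<bar> \<and> \<bar>t\<bar> \<le> real m} t * cmod (w t))) \<partial>\<mu>)"
    proof (rule nn_integral_cong)
      fix t
      obtain m0 :: nat where m0: "\<bar>t\<bar> \<le> real m0" using real_arch_simple by blast
      show "ennreal (indicator {t. real N < \<bar>t\<bar>} t * cmod (w t)) = (SUP m. ennreal (indicator {t. real N < \<bar>t\<bar> \<and> \<bar>t\<bar> \<le> real m} t * cmod (w t)))"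
      proof (rule antisym)
        show "ennreal (indicator {t. real N < \<bar>t\<bar>} t * cmod (w t)) \<le> (SUP m. ennreal (indicator {t. real N < \<bar>t\<bar> \<and> \<bar>t\<bar> \<le> real m} t * cmod (w t)))"
          by (rule SUP_upper2[of m0]) (use m0 in \<open>auto simp: indicator_def\<close>)
        show "(SUP m. ennreal (indicator {t. real N < \<bar>t\<bar> \<and> \<bar>t\<bar> \<le> real m} t * cmod (w t))) \<le> ennreal (indicator {t. real N < \<bar>t\<bar>} t * cmod (w t))"
          by (rule SUP_least) (auto simp: indicator_def)
      qed
    qed
    also have "\<dots> = (SUP m. \<integral>\<^sup>+t. ennreal (indicator {t. real N < \<bar>t\<bar> \<and> \<bar>t\<bar> \<le> real m} t * cmod (w t)) \<partial>\<mu>)"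
      by (rule nn_integral_monotone_convergence_SUP) (auto simp: incseq_def le_fun_def indicator_def)
    also have "\<dots> \<le> ennreal C" by (rule SUP_least) (rule bound)
    finally show ?thesis .
  qed
  then have far: "integrable \<mu> (\<lambda>t. indicator {t. real N < \<bar>t\<bar>} t * cmod (w t))"
    by (intro integrableI_nonneg) (auto intro: le_less_trans)
  have near: "integrable \<mu> (\<lambda>t. complex_of_real (indicator {t. \<bar>t\<bar> \<le> real N} t) * w t)"
  proof (rule L2_mult_integrable[OF _ w])
    show "(\<lambda>t. complex_of_real (indicator {t. \<bar>t\<bar> \<le> real N} t)) \<in> L2 \<mu>"
      by (rule bounded_support_L2(1)[where K=1 and R="real N"]) (auto split: split_indicator)
  qed
  show ?thesis
  proof (rule Bochner_Integration.integrable_bound)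
    show "integrable \<mu> (\<lambda>t. indicator {t. real N < \<bar>t\<bar>} t * cmod (w t) + cmod (complex_of_real (indicator {t. \<bar>t\<bar> \<le> real N} t) * w t))"
      by (intro Bochner_Integration.integrable_add far integrable_norm near)
    show "AE t in \<mu>. norm (w t) \<le> norm (indicator {t. real N < \<bar>t\<bar>} t * cmod (w t) + cmod (complex_of_real (indicator {t. \<bar>t\<bar> \<le> real N} t) * w t))"
      by (rule AE_I2) (auto simp: indicator_def)
  qed measurable
qed

text \<open>
  Equal to \<open>1\<close> on \<open>[-n, n]\<close>, to \<open>0\<close> outside \<open>[-n-1, n+1]\<close>, and linear in between. Lipschitz
  continuity makes \<open>T\<^sub>\<epsilon>\<close> of it converge pointwise \<open>\<nu>\<close>-almost everywhere.
\<close>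

definition cutoff :: "nat \<Rightarrow> real \<Rightarrow> complex" where
  "cutoff n t = complex_of_real (max 0 (min 1 (real n + 1 - \<bar>t\<bar>)))"

lemma cutoff_measurable [measurable]: "cutoff n \<in> borel_measurable borel"
  unfolding cutoff_def by measurable

lemma cutoff_le_1: "cmod (cutoff n t) \<le> 1" "cmod (1 - cutoff n t) \<le> 1"
proof -
  have "1 - cutoff n t = complex_of_real (1 - max 0 (min 1 (real n + 1 - \<bar>t\<bar>)))" by (simp add: cutoff_def)
  then show "cmod (1 - cutoff n t) \<le> 1" by (simp only: norm_of_real)
qed (simp add: cutoff_def)

lemma cutoff_L2: "cutoff n \<in> L2 \<mu>"
  by (rule bounded_support_L2(1)[OF cutoff_measurable cutoff_le_1(1), where R="real n + 1"]) (simp add: cutoff_def)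

lemma cutoff_pointwise: "AE s in \<nu>. ((\<lambda>\<epsilon>. T_eps \<mu> \<epsilon> (cutoff n) s) \<longlongrightarrow> T0 (cutoff n) s) (at_right 0)"
proof (rule pointwise_locally_Lipschitz[OF cutoff_L2 cutoff_le_1(1)])
  fix s
  have "cmod (cutoff n s - cutoff n t) \<le> 1 * \<bar>s - t\<bar>" for t
  proof -
    have "cutoff n s - cutoff n t = complex_of_real (max 0 (min 1 (real n + 1 - \<bar>s\<bar>)) - max 0 (min 1 (real n + 1 - \<bar>t\<bar>)))"
      by (simp add: cutoff_def)
    moreover have "\<bar>max 0 (min 1 (real n + 1 - \<bar>s\<bar>)) - max 0 (min 1 (real n + 1 - \<bar>t\<bar>))\<bar> \<le> \<bar>s - t\<bar>" by linarith
    ultimately show ?thesis by (simp only: norm_of_real)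
  qed
  then show "\<exists>d>0. \<exists>L. \<forall>t. \<bar>s - t\<bar> < d \<longrightarrow> cmod (cutoff n s - cutoff n t) \<le> L * \<bar>s - t\<bar>"
    by (intro exI[of _ "1::real"] conjI allI impI) auto
qed

lemma T0_cutoff_near_h:
  assumes R: "0 \<le> R" "R + 1 \<le> real n"
  shows "AE s in \<nu>. \<bar>s\<bar> \<le> R \<longrightarrow> cmod (T0 (cutoff n) s - h s) \<le> (R + 2) * tail n"
  using cutoff_pointwise[of n] T_eps_one_limit
proof eventually_elim
  case (elim s)
  show ?case
  proof
    assume s: "\<bar>s\<bar> \<le> R"
    have lim: "((\<lambda>\<epsilon>. cmod (T_eps \<mu> \<epsilon> (cutoff n) s - T_eps \<mu> \<epsilon> (\<lambda>_. 1) s)) \<longlongrightarrow> cmod (T0 (cutoff n) s - h s)) (at_right 0)"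
      by (intro tendsto_intros elim)
    have "\<forall>\<^sub>F \<epsilon> in at_right 0. cmod (T_eps \<mu> \<epsilon> (cutoff n) s - T_eps \<mu> \<epsilon> (\<lambda>_. 1) s) \<le> (R + 2) * tail n"
      using eventually_at_right_pos
    proof eventually_elim
      case (elim \<epsilon>)
      let ?d = "\<lambda>t. complex_of_real s - complex_of_real t + \<i> * complex_of_real \<epsilon>"
      have "T_eps \<mu> \<epsilon> (\<lambda>t. 1 - cutoff n t) s = T_eps \<mu> \<epsilon> (\<lambda>_. 1) s - T_eps \<mu> \<epsilon> (cutoff n) s"
        unfolding T_eps_def diff_divide_distrib
        by (rule Bochner_Integration.integral_diff[OF kernel_one_integrable[OF elim] T_eps_integrable[OF cutoff_L2 elim]])
      moreover have "cmod (T_eps \<mu> \<epsilon> (\<lambda>t. 1 - cutoff n t) s) \<le> (R + 2) * tail n"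
        by (rule T_eps_far[OF _ cutoff_le_1(2) _ R s]) (auto simp: cutoff_def)
      ultimately show ?case by (simp add: norm_minus_commute)
    qed
    then show "cmod (T0 (cutoff n) s - h s) \<le> (R + 2) * tail n"
      by (intro tendsto_upperbound[OF lim]) auto
  qed
qed

text \<open>
  Both sides are limits of \<open>(T0 (cutoff n), g) = (cutoff n, w)\<close>: on the support of \<open>g\<close> the functions
  \<open>T0 (cutoff n)\<close> approach \<open>h\<close> uniformly, and \<open>w\<close> is integrable.
\<close>

lemma duality_for_h:
  assumes g: "g \<in> L2 \<nu>" and supp: "\<And>s. R < \<bar>s\<bar> \<Longrightarrow> g s = 0"
    and w: "w \<in> L2 \<mu>" and adj: "\<And>f. f \<in> L2 \<mu> \<Longrightarrow> L2_inner \<nu> (T0 f) g = L2_inner \<mu> f w"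
  shows "integrable \<nu> (\<lambda>s. h s * cnj (g s))" "integrable \<mu> (\<lambda>t. cnj (w t))"
    "(\<integral>s. h s * cnj (g s) \<partial>\<nu>) = (\<integral>t. cnj (w t) \<partial>\<mu>)"
proof -
  define R' where "R' = \<bar>R\<bar>"
  have R': "0 \<le> R'" "\<And>s. R' < \<bar>s\<bar> \<Longrightarrow> g s = 0" using supp by (auto simp: R'_def)
  obtain N :: nat where N: "R' + 1 \<le> real N" using real_arch_simple by blast
  note [measurable] = L2_measurable[OF g] L2_measurable[OF w]
  have gint: "integrable \<nu> g" by (rule L2_compact_support_integrable_nu[OF g supp])
  have wint: "integrable \<mu> w" by (rule adjoint_vector_integrable[OF g supp w adj])
  then show "integrable \<mu> (\<lambda>t. cnj (w t))" by simp
  define C where "C n = (R' + 2) * tail n" for n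
  have close: "AE s in \<nu>. cmod (T0 (cutoff n) s * cnj (g s) - h s * cnj (g s)) \<le> C n * cmod (g s)" if "N \<le> n" for n
  proof -
    have Rn: "R' + 1 \<le> real n" using N that by linarith
    show ?thesis using T0_cutoff_near_h[OF R'(1) Rn]
    proof eventually_elim
      case (elim s)
      show ?case
      proof (cases "R' < \<bar>s\<bar>")
        case False
        then have "cmod (T0 (cutoff n) s - h s) \<le> C n" using elim by (simp add: C_def)
        then have "cmod (T0 (cutoff n) s - h s) * cmod (g s) \<le> C n * cmod (g s)" by (rule mult_right_mono) simp
        then show ?thesis by (simp add: norm_mult flip: left_diff_distrib)
      qed (simp add: R'(2))
    qed
  qed
  have Tg: "integrable \<nu> (\<lambda>s. T0 (cutoff n) s * cnj (g s))" for n by (rule L2_inner_integrable[OF T0_L2[OF cutoff_L2] g])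
  note [measurable] = L2_measurable[OF T0_L2[OF cutoff_L2]]
  have dint: "integrable \<nu> (\<lambda>s. T0 (cutoff n) s * cnj (g s) - h s * cnj (g s))" if "N \<le> n" for n
  proof (rule Bochner_Integration.integrable_bound)
    show "integrable \<nu> (\<lambda>s. C n * cmod (g s))" by (intro integrable_mult_right integrable_norm gint)
    show "AE s in \<nu>. norm (T0 (cutoff n) s * cnj (g s) - h s * cnj (g s)) \<le> norm (C n * cmod (g s))"
      using close[OF that] by eventually_elim (simp add: order_trans[OF _ abs_ge_self])
  qed measurable
  show hint: "integrable \<nu> (\<lambda>s. h s * cnj (g s))"
    using Bochner_Integration.integrable_diff[OF Tg[of N] dint[of N]] by simp
  have lim1: "(\<lambda>n. L2_inner \<nu> (T0 (cutoff (n + N))) g) \<longlonglongrightarrow> (\<integral>s. h s * cnj (g s) \<partial>\<nu>)"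
  proof (rule LIM_zero_cancel, rule Lim_null_comparison)
    have "(\<lambda>n. (R' + 2) * tail (n + N) * (\<integral>s. cmod (g s) \<partial>\<nu>)) \<longlonglongrightarrow> (R' + 2) * 0 * (\<integral>s. cmod (g s) \<partial>\<nu>)"
      by (intro tendsto_intros LIMSEQ_ignore_initial_segment[OF tail_tendsto])
    then show "(\<lambda>n. C (n + N) * (\<integral>s. cmod (g s) \<partial>\<nu>)) \<longlonglongrightarrow> 0" by (simp add: C_def)
    show "\<forall>\<^sub>F n in sequentially. norm (L2_inner \<nu> (T0 (cutoff (n + N))) g - (\<integral>s. h s * cnj (g s) \<partial>\<nu>)) \<le> C (n + N) * (\<integral>s. cmod (g s) \<partial>\<nu>)"
    proof (intro always_eventually allI)
      fix n
      have "L2_inner \<nu> (T0 (cutoff (n + N))) g - (\<integral>s. h s * cnj (g s) \<partial>\<nu>) = (\<integral>s. T0 (cutoff (n + N)) s * cnj (g s) - h s * cnj (g s) \<partial>\<nu>)"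
        unfolding L2_inner_def by (rule Bochner_Integration.integral_diff[symmetric, OF Tg hint])
      also have "norm \<dots> \<le> (\<integral>s. norm (T0 (cutoff (n + N)) s * cnj (g s) - h s * cnj (g s)) \<partial>\<nu>)" by (rule integral_norm_bound)
      also have "\<dots> \<le> (\<integral>s. C (n + N) * cmod (g s) \<partial>\<nu>)"
        by (rule integral_mono_AE[OF integrable_norm[OF dint] integrable_mult_right[OF integrable_norm[OF gint]] close]) auto
      also have "\<dots> = C (n + N) * (\<integral>s. cmod (g s) \<partial>\<nu>)" by (rule integral_mult_right_zero)
      finally show "norm (L2_inner \<nu> (T0 (cutoff (n + N))) g - (\<integral>s. h s * cnj (g s) \<partial>\<nu>)) \<le> C (n + N) * (\<integral>s. cmod (g s) \<partial>\<nu>)" .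
    qed
  qed
  have lim2: "(\<lambda>n. \<integral>t. cutoff (n + N) t * cnj (w t) \<partial>\<mu>) \<longlonglongrightarrow> (\<integral>t. cnj (w t) \<partial>\<mu>)"
  proof (rule integral_dominated_convergence[where w="\<lambda>t. cmod (w t)"])
    show "integrable \<mu> (\<lambda>t. cmod (w t))" by (rule integrable_norm[OF wint])
    show "AE t in \<mu>. (\<lambda>n. cutoff (n + N) t * cnj (w t)) \<longlonglongrightarrow> cnj (w t)"
    proof (rule AE_I2)
      fix t
      obtain M :: nat where M: "\<bar>t\<bar> \<le> real M" using real_arch_simple by blast
      have "\<forall>\<^sub>F n in sequentially. cutoff (n + N) t * cnj (w t) = cnj (w t)"
        by (rule eventually_sequentiallyI[of M]) (use M in \<open>auto simp: cutoff_def min_def max_def\<close>)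
      then show "(\<lambda>n. cutoff (n + N) t * cnj (w t)) \<longlonglongrightarrow> cnj (w t)" by (rule tendsto_eventually)
    qed
    show "AE t in \<mu>. norm (cutoff (n + N) t * cnj (w t)) \<le> cmod (w t)" for n
      using cutoff_le_1(1) by (intro AE_I2) (simp add: norm_mult mult_left_le_one_le)
  qed measurable
  have "(\<integral>t. cutoff (n + N) t * cnj (w t) \<partial>\<mu>) = L2_inner \<nu> (T0 (cutoff (n + N))) g" for n
    using adj[OF cutoff_L2] by (simp add: L2_inner_def)
  with lim2 have "(\<lambda>n. L2_inner \<nu> (T0 (cutoff (n + N))) g) \<longlonglongrightarrow> (\<integral>t. cnj (w t) \<partial>\<mu>)" by simp
  from LIMSEQ_unique[OF lim1 this] show "(\<integral>s. h s * cnj (g s) \<partial>\<nu>) = (\<integral>t. cnj (w t) \<partial>\<mu>)" .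
qed

lemma weak_limit_eq_T0:
  assumes T: "L2_weak_operator_limit \<mu> \<nu> (T_eps \<mu>) T (at_right 0)" and f: "f \<in> L2 \<mu>"
  shows "T f \<in> L2 \<nu>" "AE s in \<nu>. T f s = T0 f s"
proof -
  show "T f \<in> L2 \<nu>" using T f by (simp add: L2_weak_operator_limit_def L2_bounded_operator_def L2_linear_def)
  show "AE s in \<nu>. T f s = T0 f s"
    by (rule L2_weak_operator_limit_unique[OF T T0_weak_limit _ f]) simp
qed

lemma weak_limit_inner:
  assumes T: "L2_weak_operator_limit \<mu> \<nu> (T_eps \<mu>) T (at_right 0)" and f: "f \<in> L2 \<mu>" and g: "g \<in> L2 \<nu>"
  shows "L2_inner \<nu> (T f) g = L2_inner \<nu> (T0 f) g"
  by (rule L2_inner_cong_AE)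
    (use L2_measurable[OF weak_limit_eq_T0(1)[OF T f]] L2_measurable[OF T0_L2[OF f]] L2_measurable[OF g] weak_limit_eq_T0(2)[OF T f] in auto)

lemma T0_one:
  assumes one: "(\<lambda>_. 1) \<in> L2 \<mu>"
  shows "AE s in \<nu>. T0 (\<lambda>_. 1) s = h s"
proof -
  have "AE s in \<nu>. ((\<lambda>\<epsilon>. T_eps \<mu> \<epsilon> (\<lambda>_. 1) s) \<longlongrightarrow> T0 (\<lambda>_. 1) s) (at_right 0)"
    by (rule pointwise_if_convergent[OF one]) (use T_eps_one_limit in eventually_elim, blast)
  with T_eps_one_limit show ?thesis
    by eventually_elim (rule tendsto_unique[of "at_right (0::real)"], auto)
qed

lemma adjoint_duality:
  assumes T: "L2_weak_operator_limit \<mu> \<nu> (T_eps \<mu>) T (at_right 0)" and W: "L2_adjoint \<mu> \<nu> T W"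
    and g: "g \<in> L2 \<nu>" "compactly_supported g"
  shows "integrable \<nu> (\<lambda>s. h s * cnj (g s))" "integrable \<mu> (\<lambda>t. cnj (W g t))"
    "(\<integral>s. h s * cnj (g s) \<partial>\<nu>) = (\<integral>t. cnj (W g t) \<partial>\<mu>)"
proof -
  obtain R where R: "\<And>s. R < \<bar>s\<bar> \<Longrightarrow> g s = 0" using g(2) by (auto simp: compactly_supported_iff)
  have wL: "W g \<in> L2 \<mu>" using W g(1) by (simp add: L2_adjoint_def L2_bounded_operator_def L2_linear_def)
  have adj: "L2_inner \<nu> (T0 f) g = L2_inner \<mu> f (W g)" if "f \<in> L2 \<mu>" for f
    using W g(1) that weak_limit_inner[OF T that g(1)] by (simp add: L2_adjoint_def)
  show "integrable \<nu> (\<lambda>s. h s * cnj (g s))" "integrable \<mu> (\<lambda>t. cnj (W g t))"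
    "(\<integral>s. h s * cnj (g s) \<partial>\<nu>) = (\<integral>t. cnj (W g t) \<partial>\<mu>)"
    using duality_for_h[OF g(1) R wL adj] by blast+
qed

lemma h_represents_T_one:
  assumes T: "L2_weak_operator_limit \<mu> \<nu> (T_eps \<mu>) T (at_right 0)"
  shows "represents_T_one \<mu> \<nu> T h"
proof -
  have hm: "h \<in> borel_measurable \<nu>" by measurable
  show ?thesis
  proof (cases "(\<lambda>_. 1) \<in> L2 \<mu>")
    case True
    have "AE s in \<nu>. h s = T (\<lambda>_. 1) s"
      using T0_one[OF True] weak_limit_eq_T0(2)[OF T True] by eventually_elim simp
    then show ?thesis using True hm by (simp add: represents_T_one_def)
  next
    case False
    have "\<exists>W. L2_adjoint \<mu> \<nu> T W"
    proof (rule L2_adjoint_exists)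
      show TL: "T f \<in> L2 \<nu>" if "f \<in> L2 \<mu>" for f by (rule weak_limit_eq_T0(1)[OF T that])
      show "L2_norm \<nu> (T f) \<le> 2 / \<bar>\<alpha>\<bar> * L2_norm \<mu> f" if f: "f \<in> L2 \<mu>" for f
        using T0_norm[OF f] L2_norm_cong_AE[OF L2_measurable[OF TL[OF f]] L2_measurable[OF T0_L2[OF f]] weak_limit_eq_T0(2)[OF T f]] by simp
      show "\<exists>w\<in>L2 \<mu>. \<forall>f\<in>L2 \<mu>. L2_inner \<nu> (T f) g = L2_inner \<mu> f w" if g: "g \<in> L2 \<nu>" for g
        using T0_adjoint_vector[OF g] weak_limit_inner[OF T _ g] by simp
    qed simp
    then obtain W where W: "L2_adjoint \<mu> \<nu> T W" ..
    then show ?thesis using False hm adjoint_duality[OF T W] unfolding represents_T_one_def by auto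
  qed
qed

text \<open>
  When \<open>1\<close> is not square-integrable, both \<open>h'\<close> and \<open>h\<close> satisfy the duality with the same adjoint \<open>W\<close>. Testing
  \<open>d = h' - h\<close> with \<open>d / |d|\<close> on a bounded interval shows that \<open>d\<close> vanishes there.
\<close>

lemma represents_T_one_unique:
  assumes T: "L2_weak_operator_limit \<mu> \<nu> (T_eps \<mu>) T (at_right 0)" and h': "represents_T_one \<mu> \<nu> T h'"
  shows "AE s in \<nu>. h' s = h s"
proof (cases "(\<lambda>_. 1) \<in> L2 \<mu>")
  case True
  then have "AE s in \<nu>. h' s = T (\<lambda>_. 1) s" using h' by (simp add: represents_T_one_def)
  with T0_one[OF True] weak_limit_eq_T0(2)[OF T True] show ?thesis by eventually_elim simp
next
  case False
  then obtain W where W: "L2_adjoint \<mu> \<nu> T W"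
    and dual: "\<And>f. f \<in> L2 \<nu> \<Longrightarrow> compactly_supported f \<Longrightarrow> integrable \<nu> (\<lambda>s. h' s * cnj (f s)) \<and>
      (\<integral>s. h' s * cnj (f s) \<partial>\<nu>) = (\<integral>t. cnj (W f t) \<partial>\<mu>)"
    using h' by (auto simp: represents_T_one_def)
  have h'm[measurable]: "h' \<in> borel_measurable borel"
    using h' by (simp add: represents_T_one_def measurable_nu_mu)
  have "AE s in \<nu>. \<bar>s\<bar> \<le> real n \<longrightarrow> h' s = h s" for n
  proof -
    define d where "d s = h' s - h s" for s
    have [measurable]: "d \<in> borel_measurable borel" unfolding d_def by measurable
    define f where "f s = (if \<bar>s\<bar> \<le> real n then d s / complex_of_real (cmod (d s)) else 0)" for s
    have fm: "f \<in> borel_measurable borel" unfolding f_def by measurable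
    have fL: "f \<in> L2 \<nu>"
      by (rule bounded_support_L2(2)[OF fm, where K=1 and R="real n"]) (auto simp: f_def norm_divide)
    have fc: "compactly_supported f" unfolding compactly_supported_iff by (intro exI[of _ "real n"]) (simp add: f_def)
    have df: "h' s * cnj (f s) - h s * cnj (f s) = complex_of_real (indicator {s. \<bar>s\<bar> \<le> real n} s * cmod (d s))" for s
    proof -
      have "d s * cnj (d s / complex_of_real (cmod (d s))) = complex_of_real (cmod (d s))"
        by (cases "d s = 0") (simp_all add: complex_norm_square[symmetric] power2_eq_square)
      then show ?thesis by (simp add: f_def indicator_def left_diff_distrib[symmetric] d_def[symmetric])
    qed
    have i1: "integrable \<nu> (\<lambda>s. h' s * cnj (f s))" and i2: "integrable \<nu> (\<lambda>s. h s * cnj (f s))"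
      using dual[OF fL fc] adjoint_duality(1)[OF T W fL fc] by auto
    have "(\<integral>s. h' s * cnj (f s) - h s * cnj (f s) \<partial>\<nu>) = 0"
      using dual[OF fL fc] adjoint_duality(3)[OF T W fL fc] i1 i2 by simp
    then have int0: "(\<integral>s. indicator {s. \<bar>s\<bar> \<le> real n} s * cmod (d s) \<partial>\<nu>) = 0"
      unfolding df integral_complex_of_real by simp
    have "integrable \<nu> (\<lambda>s. complex_of_real (indicator {s. \<bar>s\<bar> \<le> real n} s * cmod (d s)))"
      using Bochner_Integration.integrable_diff[OF i1 i2] unfolding df .
    then have "integrable \<nu> (\<lambda>s. indicator {s. \<bar>s\<bar> \<le> real n} s * cmod (d s))"
      by (simp only: complex_of_real_integrable_eq)
    from integral_nonneg_eq_0_iff_AE[OF this] int0 have "AE s in \<nu>. indicator {s. \<bar>s\<bar> \<le> real n} s * cmod (d s) = 0" by simp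
    then show ?thesis by eventually_elim (simp add: indicator_def d_def split: if_splits)
  qed
  then have "AE s in \<nu>. \<forall>n. \<bar>s\<bar> \<le> real n \<longrightarrow> h' s = h s" unfolding AE_all_countable by blast
  then show ?thesis
  proof eventually_elim
    case (elim s)
    obtain n :: nat where "\<bar>s\<bar> \<le> real n" using real_arch_simple by blast
    with elim show ?case by blast
  qed
qed

lemma V_representation:
  assumes T: "L2_weak_operator_limit \<mu> \<nu> (T_eps \<mu>) T (at_right 0)" and h': "represents_T_one \<mu> \<nu> T h'" and f: "f \<in> L2 \<mu>"
  shows "AE s in \<nu>. V f s = f s * (1 - \<alpha>' * h' s) + \<alpha>' * T f s"
  using weak_limit_eq_T0(2)[OF T f] represents_T_one_unique[OF T h']
proof eventually_elim
  case (elim s)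
  then show ?case using alpha' by (simp add: T0_def boundary_mult_def)
qed

lemma C1_pointwise_weak_limit:
  assumes T: "L2_weak_operator_limit \<mu> \<nu> (T_eps \<mu>) T (at_right 0)"
    and f: "f C1_differentiable_on UNIV" "compactly_supported f"
  shows "AE s in \<nu>. ((\<lambda>\<epsilon>. T_eps \<mu> \<epsilon> f s) \<longlongrightarrow> T f s) (at_right 0)"
  using pointwise_C1(2)[OF f] weak_limit_eq_T0(2)[OF T pointwise_C1(1)[OF f]]
  by eventually_elim simp

end

section \<open>The theorem\<close>

theorem theorem3p2:
  fixes \<mu> \<mu>\<^sub>\<alpha> :: "real measure" and \<alpha> :: real and A\<^sub>\<alpha> :: graph
    and V\<^sub>\<alpha> :: "(real \<Rightarrow> complex) \<Rightarrow> (real \<Rightarrow> complex)"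
  assumes "sets \<mu> = sets borel"
    and "(\<integral>\<^sup>+ t. ennreal (1 / (1 + \<bar>t\<bar>)) \<partial>\<mu>) < \<infinity>"
    and "\<alpha> \<noteq> 0"
    and "is_rank_one_perturbation \<mu> \<alpha> A\<^sub>\<alpha>"
    and "is_spectral_measure \<mu> \<alpha> \<mu>\<^sub>\<alpha>"
    and "is_spectral_representation \<mu> \<alpha> A\<^sub>\<alpha> \<mu>\<^sub>\<alpha> V\<^sub>\<alpha>"
  shows "(\<forall>\<epsilon>>0. L2_bounded_operator \<mu> \<mu>\<^sub>\<alpha> (T_eps \<mu> \<epsilon>) \<and>
                L2_opnorm \<mu> \<mu>\<^sub>\<alpha> (T_eps \<mu> \<epsilon>) \<le> ennreal (2 / \<bar>\<alpha>\<bar>)) \<and>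
    (\<exists>T. L2_weak_operator_limit \<mu> \<mu>\<^sub>\<alpha> (T_eps \<mu>) T (at_right 0)) \<and>
    (\<forall>T. L2_weak_operator_limit \<mu> \<mu>\<^sub>\<alpha> (T_eps \<mu>) T (at_right 0) \<longrightarrow>
       (\<exists>h. represents_T_one \<mu> \<mu>\<^sub>\<alpha> T h) \<and>
       (\<forall>h. represents_T_one \<mu> \<mu>\<^sub>\<alpha> T h \<longrightarrow>
          (\<forall>f\<in>L2 \<mu>. AE s in \<mu>\<^sub>\<alpha>.
             V\<^sub>\<alpha> f s = f s * (1 - complex_of_real \<alpha> * h s) + complex_of_real \<alpha> * T f s)) \<and>
       (\<forall>f. f C1_differentiable_on UNIV \<and> compactly_supported f \<longrightarrow>
          (AE s in \<mu>\<^sub>\<alpha>. ((\<lambda>\<epsilon>. T_eps \<mu> \<epsilon> f s) \<longlongrightarrow> T f s) (at_right 0))))"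
proof -
  have "integrable \<mu> (\<lambda>t. 1 / (1 + \<bar>t\<bar>))"
  proof (rule integrableI_nonneg)
    show "(\<lambda>t. 1 / (1 + \<bar>t\<bar>)) \<in> borel_measurable \<mu>"
      unfolding measurable_cong_sets[OF assms(1) refl] by measurable
  qed (use assms(2) in auto)
  then interpret rank_one_pair \<mu> \<mu>\<^sub>\<alpha> \<alpha> A\<^sub>\<alpha> V\<^sub>\<alpha>
    by unfold_locales (use assms in \<open>auto simp: cauchy_finite_def\<close>)
  obtain h B where "h \<in> borel_measurable borel"
    "AE s in \<mu>\<^sub>\<alpha>. ((\<lambda>\<epsilon>. borel_transform \<mu> (Complex s \<epsilon>)) \<longlongrightarrow> - h s) (at_right 0)"
    "B \<in> sets borel" "AE s in \<mu>\<^sub>\<alpha>. s \<in> B"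
    "density \<mu>\<^sub>\<alpha> (\<lambda>s. ennreal ((cmod (1 - complex_of_real \<alpha> * h s))\<^sup>2)) = density \<mu> (indicator B)"
    by (rule boundary_values)
  then interpret rank_one_boundary \<mu> \<mu>\<^sub>\<alpha> \<alpha> A\<^sub>\<alpha> V\<^sub>\<alpha> h B by unfold_locales
  show ?thesis
    using T_eps_bounded_operator T0_weak_limit h_represents_T_one V_representation C1_pointwise_weak_limit by blast
qed

end
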